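(* Let $q$ be a prime power. For every integer $r\ge 0$, $$\mathrm{FGL}^-_{r+1}(q,x)=\prod_{0\le j\le r}\bigl(1+(-1)^{r-j}q^{j}x\bigr)^{(-1)^{r-j}\binom{r}{j}}$$ as formal power series in $x$.
   Context: For a prime power $q$ and $n\ge 1$, $\mathrm{GL}^-_n(\mathbf F_q)$ denotes the general unitary group: the group of all $\mathbf F_{q^2}$-linear automorphisms of $V=\mathbf F_{q^2}^n$ preserving the non-degenerate Hermitian form $\langle u,v\rangle=c\sum_{i=1}^n(-1)^{i+1}u_iv_{n+1-i}^q$, where $c\in\mathbf F_{q^2}^\times$ satisfies $c^{q-1}=(-1)^{n+1}$. $\mathrm L^-_n(\mathbf F_q)^*$ is the poset, under inclusion, of nonzero totally isotropic subspaces $U$ of $V$ (i.e. $0\ne U\subseteq U^\perp$), with its natural $\mathrm{GL}^-_n(\mathbf F_q)$-action. The reduced Euler characteristic of a finite poset $P$ is $\widetilde\chi(P)=\sum_{i\ge -1}(-1)^ic_i(P)$, where $c_i(P)$ is the number of chains in $P$ with $i+1$ elements and $c_{-1}(P)=1$ (so $\widetilde\chi(\emptyset)=-1$). For $r\ge1$ the $r$th equivariant reduced Euler characteristic is $$\widetilde\chi_r(\mathrm{GL}^-_n(\mathbf F_q))=\frac1{|\mathrm{GL}^-_n(\mathbf F_q)|}\sum_{X\in\mathrm{Hom}(\mathbf Z^r,\mathrm{GL}^-_n(\mathbf F_q))}\widetilde\chi\bigl(C_{\mathrm L^-_n(\mathbf F_q)^*}(X(\mathbf Z^r))\bigr),$$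 where $C_{\mathrm L^-_n(\mathbf F_q)^*}(X(\mathbf Z^r))$ is the induced subposet of $X(\mathbf Z^r)$-invariant subspaces. The generating function is $\mathrm{FGL}^-_r(q,x)=1-\sum_{n\ge1}\widetilde\chi_r(\mathrm{GL}^-_n(\mathbf F_q))\,x^n$. *)

theory Defs
  imports
    "HOL-Library.Cardinality"
    "HOL-Number_Theory.Prime_Powers"
    "HOL-Algebra.Product_Groups"
    "HOL-Computational_Algebra.Formal_Power_Series"
    "Jordan_Normal_Form.VS_Connect"
begin

text \<open>The field with \<open>q\<^sup>2\<close> elements is a finite field type \<^typ>\<open>'a\<close> with
  \<open>CARD('a) = q\<^sup>2\<close>, its \<open>n\<close>-dimensional coordinate space is \<open>carrier_vec n\<close>, and linear
  automorphisms of that space are given by their matrices in the standard basis.\<close>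

text \<open>Coordinates are numbered from \<open>0\<close>, so that \<open>(-1)\<^sup>i\<^sup>+\<^sup>1\<close> and \<open>v\<close> at \<open>n + 1 - i\<close>,
  for \<open>1 \<le> i \<le> n\<close>, become \<open>(-1)\<^sup>i\<close> and \<open>v\<close> at \<open>n - 1 - i\<close>, for \<open>i < n\<close>.\<close>

definition herm_form :: "nat \<Rightarrow> 'a::field \<Rightarrow> nat \<Rightarrow> 'a vec \<Rightarrow> 'a vec \<Rightarrow> 'a" where
  "herm_form q c n u v = c * (\<Sum>i<n. (-1) ^ i * u $ i * (v $ (n - 1 - i)) ^ q)"

definition GU :: "nat \<Rightarrow> 'a::field \<Rightarrow> nat \<Rightarrow> 'a mat monoid" where
  "GU q c n =
    \<lparr>carrier = {A \<in> carrier_mat n n. invertible_mat A \<and>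
        (\<forall>u\<in>carrier_vec n. \<forall>v\<in>carrier_vec n.
           herm_form q c n (A *\<^sub>v u) (A *\<^sub>v v) = herm_form q c n u v)},
     monoid.mult = (*), one = 1\<^sub>m n\<rparr>"

definition perp :: "nat \<Rightarrow> 'a::field \<Rightarrow> nat \<Rightarrow> 'a vec set \<Rightarrow> 'a vec set" where
  "perp q c n U = {v \<in> carrier_vec n. \<forall>u\<in>U. herm_form q c n u v = 0}"

definition isotropic_subspaces :: "nat \<Rightarrow> 'a::field \<Rightarrow> nat \<Rightarrow> 'a vec set set" where
  "isotropic_subspaces q c n =
    {U. VectorSpace.subspace class_ring U (module_vec TYPE('a) n) \<and>
        U \<noteq> {0\<^sub>v n} \<and> U \<subseteq> perp q c n U}"

text \<open>The summation index \<open>k\<close> is the number of elements of a chain, that is \<open>k = i + 1\<close>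
  for \<open>i \<ge> -1\<close>; hence the sign \<open>(-1)\<^sup>i = (-1)\<^sup>k\<^sup>+\<^sup>1\<close>. The definition is meant for finite \<open>P\<close>.\<close>

definition reduced_euler_char :: "'p::order set \<Rightarrow> int" where
  "reduced_euler_char P =
    (\<Sum>k\<le>card P. (-1) ^ (k + 1) *
       int (card {C. C \<subseteq> P \<and> Complete_Partial_Order.chain (\<le>) C \<and> card C = k}))"

definition invariant_subspaces :: "'a::semiring_0 mat set \<Rightarrow> 'a vec set set \<Rightarrow> 'a vec set set" where
  "invariant_subspaces H P = {U \<in> P. \<forall>A\<in>H. (\<lambda>v. A *\<^sub>v v) ` U = U}"

definition Zpow :: "nat \<Rightarrow> (nat \<Rightarrow> int) monoid" where
  "Zpow r = product_group {..<r} (\<lambda>_. integer_group)"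

text \<open>Members of \<open>hom\<close> are unconstrained outside the carrier of their domain; intersecting
  with \<open>extensional\<close> makes every homomorphism occur exactly once.\<close>

definition Homs :: "('b, 'm) monoid_scheme \<Rightarrow> ('c, 'n) monoid_scheme \<Rightarrow> ('b \<Rightarrow> 'c) set" where
  "Homs G H = hom G H \<inter> extensional (carrier G)"

definition equiv_reduced_euler_char :: "nat \<Rightarrow> nat \<Rightarrow> 'a::field \<Rightarrow> nat \<Rightarrow> rat" where
  "equiv_reduced_euler_char r q c n =
    (1 / of_nat (Coset.order (GU q c n))) *
    (\<Sum>X\<in>Homs (Zpow r) (GU q c n).
       of_int (reduced_euler_char
         (invariant_subspaces (X ` carrier (Zpow r)) (isotropic_subspaces q c n))))"

text \<open>The constant \<open>c\<close> of the Hermitian form depends on the dimension, so a family of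
  such constants is given.\<close>

definition FGL :: "nat \<Rightarrow> nat \<Rightarrow> (nat \<Rightarrow> 'a::field) \<Rightarrow> rat fps" where
  "FGL r q c =
    1 - Abs_fps (\<lambda>n. if n = 0 then 0 else equiv_reduced_euler_char r q (c n) n)"

end

theory Submission
  imports
    Defs
    "HOL-Library.Function_Algebras"
    "HOL-Algebra.Algebraic_Closure_Type"
    "HOL-Combinatorics.Orbits"
    "HOL-Number_Theory.Residues"
begin

text \<open>
  Put \<open>Q = -q\<close> and let \<open>b(n)\<close> be the coefficient of \<open>x\<^sup>n\<close> in the generating function with \<open>R = r + 1\<close>
  commuting elements; up to the factor \<open>1 / |U\<^sub>n|\<close> it is the sum, over the representations of
  \<open>\<int>\<^sup>R\<close> on a Hermitian space \<open>S\<close> of dimension \<open>n\<close>, of the sum of Moebius numbers of invariant isotropic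
  subspaces. By Crapo's complementation formula a representation contributes \<open>0\<close> as soon as some
  element of its image is unipotent and nontrivial, so \<open>\<int>\<^sup>R\<close> may be replaced by \<open>(\<int>/E)\<^sup>R\<close> with
  \<open>E\<close> prime to \<open>q\<close>.

  Let \<open>w\<close> be the average of the nontrivial additive characters of \<open>F\<^sub>q\<close>, so that \<open>w(h(v,v))\<close> sums to
  \<open>Q\<^sup>n\<close> over \<open>v \<in> S\<close>. Sorting the vectors \<open>v\<close> by the function \<open>\<lambda>(k) = h(\<rho>(k)v, v)\<close>, only those which
  generate a nondegenerate submodule matter; that submodule is determined by \<open>\<lambda>\<close> up to isometry, as in the
  GNS construction, and splits off. This gives \<open>Q\<^sup>n b(n) = \<Sum>\<^sub>\<lambda> w(\<lambda>(0)) b(n - rank \<lambda>)\<close>.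

  The Fourier transform turns \<open>\<lambda>\<close> into a function \<open>t\<close> on \<open>\<mu>\<^sub>E\<^sup>R\<close> with \<open>t(z\<^sup>Q) = t(z)\<^sup>q\<close>, and \<open>rank \<lambda>\<close>
  into the size of the support of \<open>t\<close>. Hence \<open>\<Sum>\<^sub>\<lambda> w(\<lambda>(0)) x\<^bsup>rank \<lambda>\<^esup>\<close> is the product of the factors
  \<open>1 - x\<^bsup>|Y|\<^esup>\<close> over the orbits \<open>Y\<close> of \<open>z \<mapsto> z\<^sup>Q\<close>, and the number of fixed points of \<open>z \<mapsto> z\<^bsup>Q^d\<^esup>\<close> is
  \<open>|Q\<^sup>d - 1|\<^sup>R\<close> once \<open>E\<close> is divisible enough. Comparing logarithmic derivatives, this product agrees to
  any prescribed order with \<open>W(Qx)/W(x)\<close> for the product \<open>W\<close> of the theorem; so both \<open>b\<close> and the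
  coefficients of \<open>W\<close> solve the same recursion, which determines them because \<open>Q\<^sup>n \<noteq> 1\<close> for
  \<open>n \<ge> 1\<close>.
\<close>

text \<open>The obstacle is that isotropic subspaces do not split off orthogonally, so the Moebius
  sums have no evident recursion in the dimension. Weighting by \<open>wt\<close> repairs this.
  Crapo's formula is applied to the orthogonal complement of the submodule generated by
  \<open>v\<close> and then summed over \<open>v\<close>; the term of a complement \<open>A\<close>
  depends on \<open>v\<close> only modulo \<open>A\<close>. If \<open>v\<close> is not orthogonal to
  \<open>A\<close>, the form values on the coset v + A are moved by arbitrary traces, over which
  \<open>wt\<close> sums to zero. If \<open>v\<close> is orthogonal to \<open>A\<close>, then
  \<open>A\<close> lies in a radical, which makes the factor \<open>chi\<close> vanish. Only
  \<open>A = {0}\<close> survives, together with a nondegenerate submodule, and that one does split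
  off. The average of the characters is rational and keeps what matters: sum zero over the subfield
  and value 1 at 0. The step from r to r + 1 is one identity: if W has logarithmic derivative
  -(-1)^d |Q^d - 1|^r in degree d, that of W(Qx)/W(x) is Q^d - 1 times as large, which is -|Q^d -
  1|^(r+1).\<close>

definition echar :: "'p::order set \<Rightarrow> int" where
  "echar P = (\<Sum>C | C \<subseteq> P \<and> Complete_Partial_Order.chain (\<le>) C. (-1) ^ card C)"

text \<open>The empty chain has i = -1 and sign -1 in the reduced Euler characteristic. In
  \<open>echar\<close> it has sign +1, which suits recursions over chains.\<close>

lemma reduced_euler_char_eq:
  assumes "finite P"
  shows "reduced_euler_char P = - echar P"
proof -
  define S where "S = {C. C \<subseteq> P \<and> Complete_Partial_Order.chain (\<le>) C}"
  have fS: "finite S" unfolding S_def using assms by simp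
  have "echar P = (\<Sum>k\<le>card P. \<Sum>C | C \<in> S \<and> card C = k. (-1) ^ card C)"
    unfolding echar_def S_def[symmetric]
    by (rule sum.group[symmetric]) (use fS assms in \<open>auto simp: S_def card_mono\<close>)
  also have "\<dots> = (\<Sum>k\<le>card P. (-1) ^ k * int (card {C. C \<subseteq> P \<and> Complete_Partial_Order.chain (\<le>) C \<and> card C = k}))"
    by (rule sum.cong) (auto simp: S_def conj_assoc)
  finally show ?thesis
    by (simp add: reduced_euler_char_def sum_negf[symmetric])
qed

lemma echar_iso:
  fixes f :: "'p::order \<Rightarrow> 'r::order"
  assumes bij: "bij_betw f P P'"
    and le: "\<And>x y. x \<in> P \<Longrightarrow> y \<in> P \<Longrightarrow> f x \<le> f y \<longleftrightarrow> x \<le> y"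
  shows "echar P' = echar P"
proof -
  have inj: "inj_on f P" and im: "f ` P = P'" using bij by (auto simp: bij_betw_def)
  have ch: "Complete_Partial_Order.chain (\<le>) (f ` C) \<longleftrightarrow> Complete_Partial_Order.chain (\<le>) C" if "C \<subseteq> P" for C
    unfolding chain_def using that le by blast
  have "bij_betw (image f) {C. C \<subseteq> P \<and> Complete_Partial_Order.chain (\<le>) C}
      {C. C \<subseteq> P' \<and> Complete_Partial_Order.chain (\<le>) C}"
  proof (rule bij_betw_imageI)
    show "inj_on (image f) {C. C \<subseteq> P \<and> Complete_Partial_Order.chain (\<le>) C}"
      using inj by (auto simp: inj_on_def inj_on_image_eq_iff[OF inj])
    show "image f ` {C. C \<subseteq> P \<and> Complete_Partial_Order.chain (\<le>) C} = {C. C \<subseteq> P' \<and> Complete_Partial_Order.chain (\<le>) C}"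
    proof (intro equalityI subsetI)
      fix D assume D: "D \<in> {C. C \<subseteq> P' \<and> Complete_Partial_Order.chain (\<le>) C}"
      then obtain C where "C \<subseteq> P" "D = f ` C" using im by (auto simp: subset_image_iff)
      then show "D \<in> image f ` {C. C \<subseteq> P \<and> Complete_Partial_Order.chain (\<le>) C}"
        using D ch by auto
    qed (use im ch in auto)
  qed
  from sum.reindex_bij_betw[OF this, of "\<lambda>C. (-1) ^ card C"]
  have "echar P' = (\<Sum>C | C \<subseteq> P \<and> Complete_Partial_Order.chain (\<le>) C. (-1) ^ card (f ` C))"
    unfolding echar_def by (rule sym)
  also have "\<dots> = echar P" unfolding echar_def
    by (rule sum.cong) (auto intro!: arg_cong[where f = "power (-1)"] card_image inj_on_subset[OF inj])
  finally show ?thesis .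
qed

text \<open>A nonempty chain is its largest element together with a chain below that element.\<close>

lemma echar_top_element:
  fixes P :: "'p::order set"
  assumes fin: "finite P"
  shows "echar P = 1 - (\<Sum>x\<in>P. echar {y\<in>P. y < x})"
proof -
  define Ch where "Ch = (\<lambda>P::'p set. {C. C \<subseteq> P \<and> Complete_Partial_Order.chain (\<le>) C})"
  have fCh: "finite (Ch A)" if "A \<subseteq> P" for A
    using finite_subset[OF that fin] by (simp add: Ch_def)
  define g where "g = (\<lambda>(x::'p, C). insert x C)"
  have maxex: "\<exists>x\<in>C. \<forall>y\<in>C. y \<le> x" if C: "C \<in> Ch P" "C \<noteq> {}" for C
  proof -
    have "finite C" using C fin finite_subset by (auto simp: Ch_def)
    then obtain x where "x \<in> C" and m: "\<And>y. y \<in> C \<Longrightarrow> x \<le> y \<Longrightarrow> x = y"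
      using finite_has_maximal[OF _ C(2)] by metis
    moreover have "y \<le> x" if "y \<in> C" for y
      using m[OF that] \<open>C \<in> Ch P\<close> \<open>x \<in> C\<close> that unfolding Ch_def chain_def by auto
    ultimately show ?thesis by auto
  qed
  have bij: "bij_betw g (SIGMA x:P. Ch {y\<in>P. y < x}) (Ch P - {{}})"
  proof (rule bij_betw_imageI)
    show "inj_on g (SIGMA x:P. Ch {y\<in>P. y < x})"
    proof (rule inj_onI, clarsimp simp: g_def)
      fix x C y D
      assume a: "C \<in> Ch {y\<in>P. y < x}" "D \<in> Ch {z\<in>P. z < y}" "insert x C = insert y D"
      then have C: "\<And>c. c \<in> C \<Longrightarrow> c < x" and D: "\<And>c. c \<in> D \<Longrightarrow> c < y" by (auto simp: Ch_def)
      have "x = y" using a(3) C D by (metis insert_iff order.asym)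
      moreover have "x \<notin> C" "y \<notin> D" using C D by auto
      ultimately show "x = y \<and> C = D" using a(3) by auto
    qed
    show "g ` (SIGMA x:P. Ch {y\<in>P. y < x}) = Ch P - {{}}"
    proof (intro equalityI subsetI)
      fix C assume "C \<in> Ch P - {{}}"
      then obtain x where x: "x \<in> C" "\<forall>y\<in>C. y \<le> x" using maxex by auto
      have "C - {x} \<in> Ch {y\<in>P. y < x}" "x \<in> P"
        using x \<open>C \<in> _\<close> by (auto simp: Ch_def chain_def order.strict_iff_order)
      moreover have "C = g (x, C - {x})" using x by (auto simp: g_def)
      ultimately show "C \<in> g ` (SIGMA x:P. Ch {y\<in>P. y < x})" by blast
    next
      fix C assume "C \<in> g ` (SIGMA x:P. Ch {y\<in>P. y < x})"
      then show "C \<in> Ch P - {{}}"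
        by (auto simp: g_def Ch_def chain_def)
    qed
  qed
  have "echar P = (\<Sum>C\<in>insert {} (Ch P - {{}}). (-1) ^ card C)"
    unfolding echar_def by (rule sum.cong) (auto simp: Ch_def chain_def)
  also have "\<dots> = 1 + (\<Sum>C\<in>Ch P - {{}}. (-1) ^ card C)"
    using fCh[of P] by (subst sum.insert) auto
  also have "(\<Sum>C\<in>Ch P - {{}}. (-1) ^ card C) = (\<Sum>(x,C)\<in>(SIGMA x:P. Ch {y\<in>P. y < x}). (-1) ^ card (insert x C) :: int)"
    by (subst sum.reindex_bij_betw[OF bij, symmetric]) (simp add: g_def case_prod_unfold)
  also have "\<dots> = (\<Sum>x\<in>P. \<Sum>C\<in>Ch {y\<in>P. y < x}. (-1) ^ card (insert x C))"
    by (subst sum.Sigma) (use fin fCh in auto)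
  also have "\<dots> = (\<Sum>x\<in>P. \<Sum>C\<in>Ch {y\<in>P. y < x}. - ((-1) ^ card C))"
  proof (intro sum.cong refl)
    fix x C assume "C \<in> Ch {y\<in>P. y < x}"
    then have "finite C" "x \<notin> C" using fin finite_subset[of C P] by (auto simp: Ch_def)
    then show "(-1) ^ card (insert x C) = - ((-1) ^ card C :: int)" by simp
  qed
  also have "\<dots> = - (\<Sum>x\<in>P. echar {y\<in>P. y < x})"
    by (simp add: echar_def Ch_def sum_negf)
  finally show ?thesis by simp
qed

section \<open>Invariant subspaces and their Moebius function\<close>

text \<open>Vectors are functions on an arbitrary index type. This covers coordinate spaces, indexed
  by \<open>nat\<close>, as well as spaces of functions on the acting group, which serve as cyclic
  modules.\<close>

definition smul :: "'a \<Rightarrow> ('i \<Rightarrow> 'a) \<Rightarrow> 'i \<Rightarrow> 'a::field" where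
  "smul a x = (\<lambda>i. a * x i)"

lemma smul_apply [simp]: "smul a x i = a * x i" by (simp add: smul_def)

lemma smul_simps [simp]: "smul a 0 = 0" "smul 0 x = 0" "smul 1 x = x" "smul a (smul b x) = smul (a * b) x"
  "smul (-1) x = - x"
  by (auto simp: smul_def fun_eq_iff zero_fun_def)

lemma smul_add: "smul a (x + y) = smul a x + smul a y" "smul (a + b) x = smul a x + smul b x"
  by (auto simp: fun_eq_iff algebra_simps)

lemma smul_diff: "smul a (x - y) = smul a x - smul a y"
  by (auto simp: fun_eq_iff algebra_simps)

lemma sum_fun_apply: "(\<Sum>i\<in>I. f i) x = (\<Sum>i\<in>I. f i (x :: 'x) :: 'b::comm_monoid_add)"
  by (induction I rule: infinite_finite_induct) auto

lemma smul_sum: "smul a (\<Sum>i\<in>I. f i) = (\<Sum>i\<in>I. smul a (f i))"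
  by (simp add: fun_eq_iff sum_fun_apply sum_distrib_left)

definition subsp :: "('i \<Rightarrow> 'a::field) set \<Rightarrow> bool" where
  "subsp U \<longleftrightarrow> 0 \<in> U \<and> (\<forall>x\<in>U. \<forall>y\<in>U. x + y \<in> U) \<and> (\<forall>a. \<forall>x\<in>U. smul a x \<in> U)"

lemma subsp_0: "subsp U \<Longrightarrow> 0 \<in> U"
  and subsp_add: "subsp U \<Longrightarrow> x \<in> U \<Longrightarrow> y \<in> U \<Longrightarrow> x + y \<in> U"
  and subsp_smul: "subsp U \<Longrightarrow> x \<in> U \<Longrightarrow> smul a x \<in> U"
  by (auto simp: subsp_def)

lemma subsp_uminus: "subsp U \<Longrightarrow> x \<in> U \<Longrightarrow> - x \<in> U"
  using subsp_smul[of U x "-1"] by simp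

lemma subsp_diff: "subsp U \<Longrightarrow> x \<in> U \<Longrightarrow> y \<in> U \<Longrightarrow> x - y \<in> U"
  using subsp_add[of U x "- y"] subsp_uminus[of U y] by simp

lemma subsp_sum: "subsp U \<Longrightarrow> (\<And>i. i \<in> I \<Longrightarrow> f i \<in> U) \<Longrightarrow> (\<Sum>i\<in>I. f i) \<in> U"
  by (induction I rule: infinite_finite_induct) (auto simp: subsp_0 subsp_add)

lemma subsp_Int: "subsp U \<Longrightarrow> subsp W \<Longrightarrow> subsp (U \<inter> W)"
  by (auto simp: subsp_def)

lemma subsp_zero [simp]: "subsp {0}" by (auto simp: subsp_def)

definition ssum :: "('i \<Rightarrow> 'a::field) set \<Rightarrow> ('i \<Rightarrow> 'a) set \<Rightarrow> ('i \<Rightarrow> 'a) set" where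
  "ssum U W = {x + y |x y. x \<in> U \<and> y \<in> W}"

lemma subsp_ssum:
  assumes "subsp U" "subsp W" shows "subsp (ssum U W)"
  unfolding subsp_def
proof (intro conjI ballI allI)
  have "0 + 0 \<in> ssum U W" using assms subsp_0 unfolding ssum_def by blast
  then show "0 \<in> ssum U W" by simp
next
  fix x y assume "x \<in> ssum U W" "y \<in> ssum U W"
  then obtain a b c d where "x = a + b" "y = c + d" "a \<in> U" "b \<in> W" "c \<in> U" "d \<in> W"
    by (auto simp: ssum_def)
  then have "x + y = (a + c) + (b + d)" "a + c \<in> U" "b + d \<in> W" using assms by (auto simp: subsp_add)
  then show "x + y \<in> ssum U W" unfolding ssum_def by blast
next
  fix a x assume "x \<in> ssum U W"
  then obtain y z where "x = y + z" "y \<in> U" "z \<in> W" by (auto simp: ssum_def)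
  then have "smul a x = smul a y + smul a z" "smul a y \<in> U" "smul a z \<in> W"
    using assms by (auto simp: smul_add subsp_smul)
  then show "smul a x \<in> ssum U W" unfolding ssum_def by blast
qed

lemma ssum_ge: "subsp U \<Longrightarrow> subsp W \<Longrightarrow> U \<subseteq> ssum U W" "subsp U \<Longrightarrow> subsp W \<Longrightarrow> W \<subseteq> ssum U W"
proof -
  assume s: "subsp U" "subsp W"
  have "x + 0 \<in> ssum U W" if "x \<in> U" for x using that s subsp_0 unfolding ssum_def by blast
  then show "U \<subseteq> ssum U W" by auto
  have "0 + x \<in> ssum U W" if "x \<in> W" for x using that s subsp_0 unfolding ssum_def by blast
  then show "W \<subseteq> ssum U W" by auto
qed

lemma ssum_least: "subsp T \<Longrightarrow> U \<subseteq> T \<Longrightarrow> W \<subseteq> T \<Longrightarrow> ssum U W \<subseteq> T"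
  by (auto simp: ssum_def subsp_add subset_iff)

definition additive_on :: "('i \<Rightarrow> 'a::field) set \<Rightarrow> (('i \<Rightarrow> 'a) \<Rightarrow> ('j \<Rightarrow> 'a)) \<Rightarrow> bool" where
  "additive_on S f \<longleftrightarrow> (\<forall>x\<in>S. \<forall>y\<in>S. f (x + y) = f x + f y)"

text \<open>Invariance is an inclusion here; for isometries of a finite space it amounts to
  equality, see \<open>act_image_eq\<close>.\<close>

definition Sub :: "(('i \<Rightarrow> 'a::field) \<Rightarrow> ('i \<Rightarrow> 'a)) set \<Rightarrow> ('i \<Rightarrow> 'a) set \<Rightarrow> ('i \<Rightarrow> 'a) set set" where
  "Sub \<Phi> Y = {U. subsp U \<and> U \<subseteq> Y \<and> (\<forall>f\<in>\<Phi>. f ` U \<subseteq> U)}"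

text \<open>By P. Hall's theorem this is the Moebius number of the interval from \<open>{0}\<close> to \<open>U\<close> in \<open>Sub \<Phi> U\<close>.\<close>

definition mob :: "(('i \<Rightarrow> 'a::field) \<Rightarrow> ('i \<Rightarrow> 'a)) set \<Rightarrow> ('i \<Rightarrow> 'a) set \<Rightarrow> int" where
  "mob \<Phi> U = (if U = {0} then 1 else - echar {U' \<in> Sub \<Phi> U. U' \<noteq> {0} \<and> U' \<noteq> U})"

lemma mob_0 [simp]: "mob \<Phi> {0} = 1" by (simp add: mob_def)

lemma SubD: "U \<in> Sub \<Phi> Y \<Longrightarrow> subsp U" "U \<in> Sub \<Phi> Y \<Longrightarrow> U \<subseteq> Y" "U \<in> Sub \<Phi> Y \<Longrightarrow> f \<in> \<Phi> \<Longrightarrow> x \<in> U \<Longrightarrow> f x \<in> U"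
  by (auto simp: Sub_def)

lemma Sub_mono: "U \<in> Sub \<Phi> Y \<Longrightarrow> U \<subseteq> Z \<Longrightarrow> U \<in> Sub \<Phi> Z" by (auto simp: Sub_def)

lemma Sub_self: "U \<in> Sub \<Phi> Y \<Longrightarrow> U \<in> Sub \<Phi> U" by (auto simp: Sub_def)

lemma finite_Sub: "finite Y \<Longrightarrow> finite (Sub \<Phi> Y)"
  by (rule finite_subset[of _ "Pow Y"]) (auto simp: Sub_def)

lemma Sub_Int: "U \<in> Sub \<Phi> Y \<Longrightarrow> M \<in> Sub \<Phi> Z \<Longrightarrow> U \<inter> M \<in> Sub \<Phi> (Y \<inter> Z)"
  by (fastforce simp: Sub_def subsp_Int)

locale inv_lattice =
  fixes S :: "('i \<Rightarrow> 'a::field) set" and \<Phi> :: "(('i \<Rightarrow> 'a) \<Rightarrow> ('i \<Rightarrow> 'a)) set"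
  assumes finS: "finite S" and subS: "subsp S"
    and add\<Phi>: "\<And>f. f \<in> \<Phi> \<Longrightarrow> additive_on S f"
begin

lemma map_add: "f \<in> \<Phi> \<Longrightarrow> x \<in> S \<Longrightarrow> y \<in> S \<Longrightarrow> f (x + y) = f x + f y"
  using add\<Phi> by (auto simp: additive_on_def)

lemma map_0: "f \<in> \<Phi> \<Longrightarrow> f 0 = 0"
  using map_add[of f 0 0] subsp_0[OF subS] by simp

lemma zero_Sub [simp]: "Y \<in> Sub \<Phi> S \<Longrightarrow> {0} \<in> Sub \<Phi> Y"
  by (auto simp: Sub_def map_0 subsp_0)

lemma ssum_Sub:
  assumes "U \<in> Sub \<Phi> S" "W \<in> Sub \<Phi> S" "U \<subseteq> Y" "W \<subseteq> Y" "subsp Y"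
  shows "ssum U W \<in> Sub \<Phi> Y"
proof -
  have "f (x + y) \<in> ssum U W" if "f \<in> \<Phi>" "x \<in> U" "y \<in> W" for f x y
  proof -
    have "f (x + y) = f x + f y" using that assms SubD(2) map_add by blast
    then show ?thesis using that assms SubD(3) unfolding ssum_def by blast
  qed
  then have "f ` ssum U W \<subseteq> ssum U W" if "f \<in> \<Phi>" for f using that by (auto simp: ssum_def[of U W])
  then show ?thesis using assms subsp_ssum[OF SubD(1) SubD(1)] ssum_least[of Y U W] by (simp add: Sub_def)
qed

lemma fin_Sub: "U \<in> Sub \<Phi> S \<Longrightarrow> finite U" by (rule finite_subset[OF SubD(2) finS])

text \<open>Chains of proper nonzero subspaces, sorted by their largest element as in
  \<open>echar_top_element\<close>, give the defining relation of the Moebius function.\<close>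

lemma sum_mob:
  assumes U: "U \<in> Sub \<Phi> S"
  shows "(\<Sum>U'\<in>Sub \<Phi> U. mob \<Phi> U') = (if U = {0} then 1 else 0)"
proof (cases "U = {0}")
  case True
  have "Sub \<Phi> U = {{0}}" using zero_Sub[OF U] subsp_0 True by (auto simp: Sub_def)
  then show ?thesis using True by (simp add: mob_def)
next
  case False
  define P where "P = {U' \<in> Sub \<Phi> U. U' \<noteq> {0} \<and> U' \<noteq> U}"
  have fin: "finite (Sub \<Phi> U)" using fin_Sub[OF U] finite_Sub by blast
  have "Sub \<Phi> U = insert {0} (insert U P)" using zero_Sub[OF U] Sub_self[OF U] by (auto simp: P_def)
  moreover have "{0} \<notin> insert U P" "U \<notin> P" "finite P" using False fin by (auto simp: P_def)
  ultimately have sum: "(\<Sum>U'\<in>Sub \<Phi> U. mob \<Phi> U') = 1 + (mob \<Phi> U + (\<Sum>U'\<in>P. mob \<Phi> U'))"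
    by simp
  have "(\<Sum>U'\<in>P. mob \<Phi> U') = (\<Sum>U'\<in>P. - echar {y\<in>P. y < U'})"
  proof (rule sum.cong[OF refl])
    fix W assume W: "W \<in> P"
    have "{U' \<in> Sub \<Phi> W. U' \<noteq> {0} \<and> U' \<noteq> W} = {y\<in>P. y < W}"
      using W by (auto simp: P_def Sub_def)
    then show "mob \<Phi> W = - echar {y\<in>P. y < W}" using W by (simp add: mob_def P_def)
  qed
  also have "\<dots> = echar P - 1" using echar_top_element[OF \<open>finite P\<close>] by (simp add: sum_negf)
  finally have "(\<Sum>U'\<in>P. mob \<Phi> U') = echar P - 1" .
  moreover have "mob \<Phi> U = - echar P" using False by (simp add: mob_def P_def)
  ultimately show ?thesis using False sum by simp
qed

text \<open>The relation of \<open>sum_mob\<close> can be solved for its top term, so it determines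
  the function by induction on the size of \<open>U\<close>. The complementation formula is obtained
  through this uniqueness.\<close>

lemma mob_unique:
  assumes "\<And>W. W \<in> Sub \<Phi> S \<Longrightarrow> (\<Sum>U'\<in>Sub \<Phi> W. \<nu> U') = (if W = {0} then 1 else 0)"
    and U: "U \<in> Sub \<Phi> S"
  shows "\<nu> U = mob \<Phi> U"
  using U
proof (induction "card U" arbitrary: U rule: less_induct)
  case less
  have fin: "finite (Sub \<Phi> U)" using fin_Sub[OF less.prems] finite_Sub by blast
  have "\<nu> W = mob \<Phi> W" if "W \<in> Sub \<Phi> U - {U}" for W
    using that less.prems fin_Sub[OF less.prems]
    by (intro less.hyps psubset_card_mono) (auto simp: Sub_def)
  then have "(\<Sum>W\<in>Sub \<Phi> U - {U}. \<nu> W) = (\<Sum>W\<in>Sub \<Phi> U - {U}. mob \<Phi> W)" by (rule sum.cong[OF refl])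
  moreover have "(\<Sum>W\<in>Sub \<Phi> U. \<nu> W) = (\<Sum>W\<in>Sub \<Phi> U. mob \<Phi> W)"
    using sum_mob[OF less.prems] assms(1)[OF less.prems] by simp
  ultimately show ?case
    using sum.remove[OF fin Sub_self[OF less.prems], of \<nu>] sum.remove[OF fin Sub_self[OF less.prems], of "mob \<Phi>"] by simp
qed

text \<open>The modular law for \<open>a\<close> inside \<open>M\<close>, in the case where
  \<open>A\<close> meets \<open>M\<close> trivially.\<close>

lemma modular_decomp:
  assumes "A \<inter> M = {0}" "a \<subseteq> M" "subsp A" "subsp a" "subsp M"
  shows "ssum A a \<inter> M = a"
proof
  show "ssum A a \<inter> M \<subseteq> a"
  proof
    fix z assume "z \<in> ssum A a \<inter> M"
    then obtain x y where z: "z = x + y" "x \<in> A" "y \<in> a" "z \<in> M" by (auto simp: ssum_def)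
    then have "x = z - y" by simp
    moreover have "z - y \<in> M" using z assms subsp_diff by blast
    ultimately have "x = 0" using z assms by auto
    then show "z \<in> a" using z by simp
  qed
  show "a \<subseteq> ssum A a \<inter> M" using ssum_ge(2)[OF assms(3,4)] assms by auto
qed

text \<open>Pairs of a complement and a subspace of \<open>M\<close> correspond to pairs of a subspace and a
  complement of its intersection with \<open>M\<close>.\<close>

lemma bij_complements:
  assumes M: "M \<in> Sub \<Phi> S" and Y: "Y \<in> Sub \<Phi> S"
  shows "bij_betw (\<lambda>(A, a). (ssum A a, A))
    (SIGMA A:{A\<in>Sub \<Phi> Y. A \<inter> M = {0}}. Sub \<Phi> (Y \<inter> M))
    (SIGMA U:Sub \<Phi> Y. {A\<in>Sub \<Phi> U. A \<inter> M = {0} \<and> ssum A (U \<inter> M) = U})"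
    (is "bij_betw ?f ?X ?Z")
proof (rule bij_betwI[where g = "\<lambda>(U, A). (A, U \<inter> M)"])
  have YM: "Y \<inter> M \<in> Sub \<Phi> S" using Sub_Int[OF Y M] by simp
  show "?f \<in> ?X \<rightarrow> ?Z"
  proof clarsimp
    fix A a assume A: "A \<in> Sub \<Phi> Y" "A \<inter> M = {0}" and a: "a \<in> Sub \<Phi> (Y \<inter> M)"
    have s: "subsp A" "subsp a" using A a SubD by auto
    have AS: "A \<in> Sub \<Phi> S" "a \<in> Sub \<Phi> S" using A(1) a SubD(2)[OF Y] SubD(2)[OF A(1)] SubD(2)[OF a] by (auto intro: Sub_mono)
    have 1: "ssum A a \<in> Sub \<Phi> Y" using ssum_Sub[OF AS, of Y] SubD(2)[OF A(1)] SubD(2)[OF a] SubD(1)[OF Y] by auto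
    have 2: "ssum A a \<inter> M = a" using modular_decomp[of A M a] A(2) SubD(2)[OF a] s SubD(1)[OF M] by auto
    show "ssum A a \<in> Sub \<Phi> Y \<and> A \<in> Sub \<Phi> (ssum A a) \<and> ssum A (ssum A a \<inter> M) = ssum A a"
      using 1 2 A ssum_ge(1)[OF s] Sub_mono by auto
  qed
  show "(\<lambda>(U, A). (A, U \<inter> M)) \<in> ?Z \<rightarrow> ?X"
  proof clarsimp
    fix U A assume U: "U \<in> Sub \<Phi> Y" and A: "A \<in> Sub \<Phi> U"
    show "A \<in> Sub \<Phi> Y \<and> U \<inter> M \<in> Sub \<Phi> (Y \<inter> M)"
      using Sub_Int[OF U Sub_self[OF M]] Sub_mono[OF A] SubD(2)[OF A] SubD(2)[OF U] by auto
  qed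
  show "(\<lambda>(U, A). (A, U \<inter> M)) (?f x) = x" if X: "x \<in> ?X" for x
  proof -
    obtain A a where x: "x = (A, a)" "A \<in> Sub \<Phi> Y" "A \<inter> M = {0}" "a \<in> Sub \<Phi> (Y \<inter> M)" using X by blast
    have "ssum A a \<inter> M = a"
      using modular_decomp[OF x(3) _ SubD(1)[OF x(2)] SubD(1)[OF x(4)] SubD(1)[OF M]] SubD(2)[OF x(4)] by auto
    then show ?thesis using x by simp
  qed
  show "?f ((\<lambda>(U, A). (A, U \<inter> M)) y) = y" if "y \<in> ?Z" for y
    using that by auto
qed

text \<open>The modular case of Crapo's complementation formula.\<close>

lemma mob_complement:
  assumes M: "M \<in> Sub \<Phi> S" and U: "U \<in> Sub \<Phi> S"
  shows "mob \<Phi> U = (\<Sum>A | A \<in> Sub \<Phi> U \<and> A \<inter> M = {0} \<and> ssum A (U \<inter> M) = U. mob \<Phi> A * mob \<Phi> (U \<inter> M))"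
\<comment> \<open>The right hand side is tested against the relation of \<open>sum_mob\<close>:
  reindexing by \<open>bij_complements\<close> turns its sum over the subspaces of \<open>W\<close>
  into a product of two independent sums.\<close>
proof (rule mob_unique[OF _ U, symmetric, where \<nu> = "\<lambda>U. \<Sum>A | A \<in> Sub \<Phi> U \<and> A \<inter> M = {0} \<and> ssum A (U \<inter> M) = U.
    mob \<Phi> A * mob \<Phi> (U \<inter> M)"])
  fix W assume W: "W \<in> Sub \<Phi> S"
  have WM: "W \<inter> M \<in> Sub \<Phi> S" using Sub_Int[OF W M] by simp
  have fin: "finite (Sub \<Phi> W)" "finite (Sub \<Phi> (W \<inter> M))" using fin_Sub[OF W] fin_Sub[OF WM] finite_Sub by blast+
  have fin': "finite (Sub \<Phi> U)" if "U \<in> Sub \<Phi> W" for U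
    using finite_Sub[OF finite_subset[OF SubD(2)[OF that] fin_Sub[OF W]]] .
  have "(\<Sum>U\<in>Sub \<Phi> W. \<Sum>A | A \<in> Sub \<Phi> U \<and> A \<inter> M = {0} \<and> ssum A (U \<inter> M) = U. mob \<Phi> A * mob \<Phi> (U \<inter> M))
    = (\<Sum>(U,A)\<in>(SIGMA U:Sub \<Phi> W. {A\<in>Sub \<Phi> U. A \<inter> M = {0} \<and> ssum A (U \<inter> M) = U}). mob \<Phi> A * mob \<Phi> (U \<inter> M))"
    by (subst sum.Sigma) (use fin fin' in auto)
  also have "\<dots> = (\<Sum>(A,a)\<in>(SIGMA A:{A\<in>Sub \<Phi> W. A \<inter> M = {0}}. Sub \<Phi> (W \<inter> M)). mob \<Phi> A * mob \<Phi> (ssum A a \<inter> M))"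
    by (subst sum.reindex_bij_betw[OF bij_complements[OF M W], symmetric]) (simp add: split_beta)
  also have "\<dots> = (\<Sum>(A,a)\<in>(SIGMA A:{A\<in>Sub \<Phi> W. A \<inter> M = {0}}. Sub \<Phi> (W \<inter> M)). mob \<Phi> A * mob \<Phi> a)"
  proof (rule sum.cong[OF refl])
    fix x assume "x \<in> (SIGMA A:{A\<in>Sub \<Phi> W. A \<inter> M = {0}}. Sub \<Phi> (W \<inter> M))"
    then obtain A a where x: "x = (A, a)" and A: "A \<in> Sub \<Phi> W" "A \<inter> M = {0}" and a: "a \<in> Sub \<Phi> (W \<inter> M)"
      by blast
    have "ssum A a \<inter> M = a" using modular_decomp[of A M a] A(2) SubD[OF a] SubD(1)[OF A(1)] SubD(1)[OF M] by auto
    then show "(case x of (A, a) \<Rightarrow> mob \<Phi> A * mob \<Phi> (ssum A a \<inter> M)) = (case x of (A, a) \<Rightarrow> mob \<Phi> A * mob \<Phi> a)"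
      using x by simp
  qed
  also have "\<dots> = (\<Sum>A\<in>{A\<in>Sub \<Phi> W. A \<inter> M = {0}}. mob \<Phi> A) * (\<Sum>a\<in>Sub \<Phi> (W \<inter> M). mob \<Phi> a)"
    by (simp add: sum_product sum.cartesian_product)
  \<comment> \<open>If \<open>W\<close> meets \<open>M\<close> trivially, so does every subspace of
    \<open>W\<close>, and the first factor is the full sum over \<open>W\<close>; otherwise the
    second factor is zero.\<close>
  also have "\<dots> = (if W = {0} then 1 else 0)"
  proof (cases "W \<inter> M = {0}")
    case True
    have "{A\<in>Sub \<Phi> W. A \<inter> M = {0}} = Sub \<Phi> W"
      using True subsp_0 SubD(1)[OF M] by (auto simp: Sub_def)
    then show ?thesis using sum_mob[OF W] sum_mob[OF WM] True by simp
  next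
    case False
    then have "W \<noteq> {0}" using subsp_0 SubD(1)[OF M] by auto
    then show ?thesis using sum_mob[OF WM] False by simp
  qed
  finally show "(\<Sum>U\<in>Sub \<Phi> W. \<Sum>A | A \<in> Sub \<Phi> U \<and> A \<inter> M = {0} \<and> ssum A (U \<inter> M) = U. mob \<Phi> A * mob \<Phi> (U \<inter> M))
     = (if W = {0} then 1 else 0)" .
qed

end

section \<open>Norm and trace of a quadratic extension of finite fields\<close>

text \<open>One bound for three uses: \<open>a = -1\<close> for fixed points of the Frobenius map,
  \<open>a = 1\<close> for fibres of the trace, \<open>a = 0\<close> for fibres of a power
  map.\<close>

lemma card_trinomial_roots:
  fixes a c :: "'b::idom"
  assumes "m \<ge> 2"
  shows "finite {x. x ^ m + a * x + c = 0}" "card {x. x ^ m + a * x + c = 0} \<le> m"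
proof -
  define p where "p = Polynomial.monom 1 m + [:c, a:]"
  have deg: "Polynomial.degree [:c, a:] < Polynomial.degree (Polynomial.monom (1::'b) m)" using assms by (simp add: degree_monom_eq)
  have "Polynomial.degree p = m" unfolding p_def using degree_add_eq_left[OF deg] by (simp add: degree_monom_eq)
  moreover from this have "p \<noteq> 0" using assms by auto
  moreover have "{x. x ^ m + a * x + c = 0} = {x. poly p x = 0}" by (auto simp: p_def poly_monom algebra_simps)
  ultimately show "finite {x. x ^ m + a * x + c = 0}" "card {x. x ^ m + a * x + c = 0} \<le> m"
    using poly_roots_finite[of p] card_poly_roots_bound[of p] by auto
qed

lemma card_power_eq_le:
  fixes c :: "'b::idom"
  assumes "m \<ge> 2"
  shows "finite {x. x ^ m = c}" "card {x. x ^ m = c} \<le> m"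
  using card_trinomial_roots[OF assms, of 0 "- c"] by (auto simp: algebra_simps)

text \<open>If at most \<open>l\<close> fibres with at most \<open>k\<close> elements each contain
  \<open>k * l\<close> elements together, all these bounds are attained. Mere root bounds thus yield
  exact fibre sizes for trace and norm.\<close>

lemma fibers_exact:
  assumes f: "f \<in> A \<rightarrow> B" and fin: "finite A" "finite B" and A: "card A = k * l" and B: "card B \<le> l"
    and fib: "\<And>b. b \<in> B \<Longrightarrow> card {a\<in>A. f a = b} \<le> k" and pos: "k * l > 0"
  shows "card B = l" "\<And>b. b \<in> B \<Longrightarrow> card {a\<in>A. f a = b} = k"
proof -
  have "card A = (\<Sum>b\<in>B. card {a\<in>A. f a = b})"
    using sum.group[of A B f "\<lambda>_. 1 :: nat"] fin f by (simp add: image_subset_iff_funcset)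
  then have s: "k * l = (\<Sum>b\<in>B. card {a\<in>A. f a = b})" using A by simp
  also have "\<dots> \<le> (\<Sum>b\<in>B. k)" by (rule sum_mono) (rule fib)
  finally have "k * l \<le> k * card B" by (simp add: mult.commute)
  then show cB: "card B = l" using pos B by simp
  show "card {a\<in>A. f a = b} = k" if "b \<in> B" for b
  proof (rule ccontr)
    assume "card {a\<in>A. f a = b} \<noteq> k"
    then have "(\<Sum>b\<in>B. card {a\<in>A. f a = b}) < (\<Sum>b\<in>B. k)"
      using fib that fin by (intro sum_strict_mono_ex1) (auto simp: order.strict_iff_order)
    then show False using s cB by (simp add: mult.commute)
  qed
qed

locale quadratic_field =
  fixes q :: nat and ty :: "'a::{field,finite} itself"
  assumes primepow_q: "primepow q" and card_field: "CARD('a) = q\<^sup>2"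
begin

lemma q_ge_2: "q \<ge> 2" using primepow_gt_Suc_0[OF primepow_q] by simp

lemma prime_char: "Factorial_Ring.prime CHAR('a)"
proof -
  have "CHAR('a) > 0" by (rule finite_imp_CHAR_pos) simp
  then show ?thesis using prime_CHAR_semidom by blast
qed

lemma q_char: "\<exists>e>0. q = CHAR('a) ^ e"
proof -
  obtain p e where pe: "Factorial_Ring.prime p" "e > 0" "q = p ^ e" using primepow_q by (auto simp: primepow_def)
  have "CHAR('a) dvd q\<^sup>2" using CHAR_dvd_CARD[where ?'a = 'a] card_field by simp
  then have "CHAR('a) dvd p" using prime_char pe by (metis prime_dvd_power)
  then show ?thesis using pe prime_char by (metis primes_dvd_imp_eq)
qed

lemma frob_add: "(x + y :: 'a) ^ q = x ^ q + y ^ q"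
  using q_char freshmans_dream'[OF prime_char] by blast

lemma frob_sum: "(\<Sum>i\<in>I. f i :: 'a) ^ q = (\<Sum>i\<in>I. f i ^ q)"
  using q_char freshmans_dream_sum'[OF prime_char] by blast

lemma frob_0: "(0::'a) ^ q = 0" using q_ge_2 by (simp add: power_0_left)

lemma frob_minus: "(- x :: 'a) ^ q = - (x ^ q)"
  using frob_add[of x "- x"] frob_0 by (simp add: eq_neg_iff_add_eq_0 add.commute)

lemma frob_diff: "(x - y :: 'a) ^ q = x ^ q - y ^ q"
  using frob_add[of x "- y"] frob_minus[of y] by simp

lemma power_card: "(x::'a) ^ (q\<^sup>2) = x"
proof (cases "x = 0")
  case False
  \<comment> \<open>Multiplication by \<open>x\<close> permutes the nonzero elements, whose product
    cancels; the extra factor \<open>x\<close> raises the exponent from the order of the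
    multiplicative group to the size of the field.\<close>
  have "x * (\<Prod>y\<in>UNIV-{0}. x * y) = x * x ^ (CARD('a) - 1) * \<Prod>(UNIV-{0})"
    by (simp add: prod.distrib mult_ac)
  also have "x * x ^ (CARD('a) - 1) = x ^ CARD('a)"
    using zero_less_card_finite[where ?'a = 'a] by (metis Suc_diff_1 power_Suc)
  also have "(\<Prod>y\<in>UNIV-{0}. x * y) = (\<Prod>y\<in>UNIV-{0}. y)"
    by (rule prod.reindex_bij_witness[of _ "\<lambda>y. y / x" "\<lambda>y. x * y"]) (use False in auto)
  finally show ?thesis by (simp add: card_field)
qed (use q_ge_2 in \<open>simp add: power_0_left\<close>)

lemma frob_frob: "((x::'a) ^ q) ^ q = x"
  using power_card by (simp add: power_mult[symmetric] power2_eq_square)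

abbreviation Fq :: "'a set" where "Fq \<equiv> {s. s ^ q = s}"

lemma card_trace_fibers: "card Fq = q" "s \<in> Fq \<Longrightarrow> card {b. b + b ^ q = s} = q"
proof -
  have *: "(\<lambda>b. b + b ^ q) \<in> UNIV \<rightarrow> Fq" by (auto simp: frob_add frob_frob)
  have 1: "card Fq \<le> q" using card_trinomial_roots(2)[OF q_ge_2, of "-1" 0] by simp
  have 2: "card {a\<in>UNIV. a + a ^ q = b} \<le> q" for b :: 'a
    using card_trinomial_roots(2)[OF q_ge_2, of 1 "-b"] by (simp add: algebra_simps)
  have 3: "CARD('a) = q * q" using card_field by (simp add: power2_eq_square)
  show "card Fq = q" using fibers_exact(1)[OF * _ _ 3 1 2] q_ge_2 by simp
  show "card {b. b + b ^ q = s} = q" if "s \<in> Fq"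
    using fibers_exact(2)[OF * _ _ 3 1 2 _ that] q_ge_2 by simp
qed

text \<open>The same count in the multiplicative group, whose order is (q + 1)(q - 1).\<close>

lemma card_norm_fibers: "s \<in> Fq \<Longrightarrow> s \<noteq> 0 \<Longrightarrow> card {b. b ^ (q + 1) = s} = q + 1"
proof -
  assume s: "s \<in> Fq" "s \<noteq> 0"
  have *: "(\<lambda>b. b ^ (q + 1)) \<in> UNIV - {0} \<rightarrow> Fq - {0}"
    by (auto simp: power_mult_distrib frob_frob)
  have 1: "card (Fq - {0}) \<le> q - 1" using card_trace_fibers(1) frob_0 by (subst card_Diff_singleton) auto
  have 2: "card {a\<in>UNIV - {0}. a ^ (q + 1) = b} \<le> q + 1" for b :: 'a
  proof -
    have "card {a\<in>UNIV - {0}. a ^ (q + 1) = b} \<le> card {a. a ^ (q + 1) = b}" by (rule card_mono) auto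
    also have "\<dots> \<le> q + 1" using card_power_eq_le(2)[of "q + 1" b] q_ge_2 by simp
    finally show ?thesis .
  qed
  have 3: "card (UNIV - {0::'a}) = (q + 1) * (q - 1)"
    using card_field by (simp add: power2_eq_square algebra_simps)
  have "card {b\<in>UNIV - {0}. b ^ (q + 1) = s} = q + 1"
    using fibers_exact(2)[OF * _ _ 3 1 2, of s] q_ge_2 s by simp
  moreover have "{b\<in>UNIV - {0}. b ^ (q + 1) = s} = {b. b ^ (q + 1) = s}" using s by auto
  ultimately show ?thesis by simp
qed

lemma norm_surj: "s \<in> Fq \<Longrightarrow> s \<noteq> 0 \<Longrightarrow> \<exists>b. b ^ (q + 1) = s"
proof -
  assume "s \<in> Fq" "s \<noteq> 0"
  then have "card {b. b ^ (q + 1) = s} \<noteq> 0" using card_norm_fibers by simp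
  then show ?thesis by (metis (mono_tags, lifting) card.empty empty_Collect_eq)
qed

lemma trace_nonzero: "\<exists>b::'a. b + b ^ q \<noteq> 0"
proof (rule ccontr)
  assume "\<not> ?thesis"
  then have "card {b::'a. b + b ^ q = 0} = q\<^sup>2" using card_field by simp
  moreover have "card {b::'a. b + b ^ q = 0} = q" using card_trace_fibers(2)[of 0] frob_0 by simp
  ultimately show False using q_ge_2 by (simp add: power2_eq_square)
qed

text \<open>The average of the nontrivial additive characters of \<open>Fq\<close>.\<close>

definition wt :: "'a \<Rightarrow> rat" where
  "wt s = (if s = 0 then 1 else - 1 / of_nat (q - 1))"

text \<open>The value at 0 balances the \<open>q - 1\<close> equal values elsewhere, and translation
  by \<open>s\<close> permutes the subfield.\<close>

lemma sum_wt_Fq: "s \<in> Fq \<Longrightarrow> (\<Sum>t\<in>Fq. wt (s + t)) = 0"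
proof -
  assume s: "s \<in> Fq"
  have "bij_betw (\<lambda>t. s + t) Fq Fq"
    by (rule bij_betwI[where g = "\<lambda>t. t - s"]) (use s in \<open>auto simp: frob_add frob_diff\<close>)
  then have "(\<Sum>t\<in>Fq. wt (s + t)) = (\<Sum>t\<in>Fq. wt t)" by (rule sum.reindex_bij_betw)
  also have "\<dots> = wt 0 + (\<Sum>t\<in>Fq - {0}. wt t)"
    using frob_0 by (subst sum.remove[of _ "0::'a"]) auto
  also have "(\<Sum>t\<in>Fq - {0}. wt t) = (\<Sum>t\<in>Fq - {0}. - 1 / of_nat (q - 1))"
    by (rule sum.cong) (auto simp: wt_def)
  also have "\<dots> = of_nat (card (Fq - {0})) * (- 1 / of_nat (q - 1))" by simp
  also have "card (Fq - {0}) = q - 1" using card_trace_fibers(1) frob_0 by (subst card_Diff_singleton) auto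
  finally show ?thesis using q_ge_2 by (simp add: wt_def)
qed

lemma sum_wt_fibers:
  assumes f: "f \<in> A \<rightarrow> B" and fin: "finite B" and fib: "\<And>b. b \<in> B \<Longrightarrow> card {a\<in>A. f a = b} = k"
  shows "(\<Sum>a\<in>A. g (f a)) = of_nat k * (\<Sum>b\<in>B. (g b :: rat))"
proof (cases "finite A")
  case True
  have "(\<Sum>a\<in>A. g (f a)) = (\<Sum>b\<in>B. \<Sum>a | a \<in> A \<and> f a = b. g (f a))"
    by (rule sum.group[symmetric]) (use True fin f in auto)
  also have "\<dots> = (\<Sum>b\<in>B. of_nat k * g b)"
    by (rule sum.cong) (simp_all add: fib)
  finally show ?thesis by (simp add: sum_distrib_left)
next
  \<comment> \<open>For infinite \<open>A\<close> the left sum is 0 by convention; some fibre is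
    then infinite and has \<open>card\<close> 0, so \<open>k = 0\<close> and both sides
    vanish.\<close>
  case False
  moreover have "(\<Union>b\<in>B. {a\<in>A. f a = b}) = A" using f by auto
  ultimately have "infinite (\<Union>b\<in>B. {a\<in>A. f a = b})" by simp
  then obtain b where "b \<in> B" "infinite {a\<in>A. f a = b}" using fin by auto
  then have "k = 0" using fib by fastforce
  then show ?thesis using False by simp
qed

lemma sum_wt_trace: "s \<in> Fq \<Longrightarrow> (\<Sum>b\<in>UNIV. wt (s + (b + b ^ q))) = 0"
proof -
  assume s: "s \<in> Fq"
  have "(\<Sum>b\<in>UNIV. wt (s + (b + b ^ q))) = of_nat q * (\<Sum>t\<in>Fq. wt (s + t))"
    by (rule sum_wt_fibers[where g = "\<lambda>t. wt (s + t)" and f = "\<lambda>b. b + b ^ q" and A = UNIV and B = Fq])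
       (use card_trace_fibers(2) in \<open>auto simp: frob_add frob_frob\<close>)
  then show ?thesis using sum_wt_Fq[OF s] by simp
qed

text \<open>The source of Q = -q: every nonzero value of the norm is taken \<open>q + 1\<close>
  times, and \<open>wt (s + t)\<close> sums to \<open>- wt s\<close> over nonzero \<open>t\<close>,
  so the factor is \<open>1 - (q + 1)\<close>.\<close>

lemma sum_wt_norm: "s \<in> Fq \<Longrightarrow> (\<Sum>b\<in>UNIV. wt (s + b ^ (q + 1))) = - of_nat q * wt s"
proof -
  assume s: "s \<in> Fq"
  have "(\<Sum>b\<in>UNIV. wt (s + b ^ (q + 1))) = wt s + (\<Sum>b\<in>UNIV - {0}. wt (s + b ^ (q + 1)))"
    by (subst sum.remove[of _ "0::'a"]) auto
  also have "(\<Sum>b\<in>UNIV - {0}. wt (s + b ^ (q + 1))) = of_nat (q + 1) * (\<Sum>t\<in>Fq - {0}. wt (s + t))"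
  proof (rule sum_wt_fibers[where g = "\<lambda>t. wt (s + t)" and f = "\<lambda>b. b ^ (q + 1)" and A = "UNIV - {0}" and B = "Fq - {0}"])
    fix b assume b: "b \<in> Fq - {0}"
    have "{a \<in> UNIV - {0}. a ^ (q + 1) = b} = {a. a ^ (q + 1) = b}" using b by auto
    then show "card {a \<in> UNIV - {0}. a ^ (q + 1) = b} = q + 1" using card_norm_fibers b by simp
  qed (auto simp: power_mult_distrib frob_frob)
  also have "(\<Sum>t\<in>Fq - {0}. wt (s + t)) = - wt s"
    using sum_wt_Fq[OF s] frob_0 by (subst (asm) sum.remove[of _ "0::'a"]) auto
  finally show ?thesis by (simp add: algebra_simps)
qed

end

section \<open>Hermitian spaces\<close>

text \<open>The axioms constrain \<open>h\<close> on \<open>S\<close> only, so a nondegenerate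
  subspace of \<open>S\<close> is again an instance with the same \<open>h\<close>.\<close>

locale hermitian_space = quadratic_field q "TYPE('a::{field,finite})" for q +
  fixes S :: "('i \<Rightarrow> 'a::{field,finite}) set" and h :: "('i \<Rightarrow> 'a) \<Rightarrow> ('i \<Rightarrow> 'a) \<Rightarrow> 'a"
  assumes finS: "finite S" and subS: "subsp S"
    and h_add_left: "x \<in> S \<Longrightarrow> y \<in> S \<Longrightarrow> z \<in> S \<Longrightarrow> h (x + y) z = h x z + h y z"
    and h_smul_left: "x \<in> S \<Longrightarrow> z \<in> S \<Longrightarrow> h (smul a x) z = a * h x z"
    and h_herm: "x \<in> S \<Longrightarrow> y \<in> S \<Longrightarrow> h y x = h x y ^ q"
    and nondeg: "x \<in> S \<Longrightarrow> (\<And>y. y \<in> S \<Longrightarrow> h x y = 0) \<Longrightarrow> x = 0"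
begin

lemmas S_closed [simp] = subsp_0[OF subS] subsp_add[OF subS] subsp_smul[OF subS] subsp_diff[OF subS] subsp_uminus[OF subS]

lemma h_add_right: "x \<in> S \<Longrightarrow> y \<in> S \<Longrightarrow> z \<in> S \<Longrightarrow> h z (x + y) = h z x + h z y"
  by (simp add: h_herm[of "x + y" z] h_herm[of x z] h_herm[of y z] h_add_left frob_add)

lemma h_smul_right: "x \<in> S \<Longrightarrow> z \<in> S \<Longrightarrow> h z (smul a x) = a ^ q * h z x"
  by (simp add: h_herm[of "smul a x" z] h_herm[of x z] h_smul_left power_mult_distrib)

lemma h_0_left [simp]: "z \<in> S \<Longrightarrow> h 0 z = 0"
  using h_smul_left[of 0 z 0] by simp

lemma h_0_right [simp]: "z \<in> S \<Longrightarrow> h z 0 = 0"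
  using h_herm[of 0 z] frob_0 by simp

lemma h_minus_left: "x \<in> S \<Longrightarrow> z \<in> S \<Longrightarrow> h (- x) z = - h x z"
  using h_smul_left[of x z "-1"] by simp

lemma h_diff_left: "x \<in> S \<Longrightarrow> y \<in> S \<Longrightarrow> z \<in> S \<Longrightarrow> h (x - y) z = h x z - h y z"
  using h_add_left[of x "- y" z] h_minus_left[of y z] by simp

lemma h_sum_right: "(\<And>i. i \<in> I \<Longrightarrow> f i \<in> S) \<Longrightarrow> z \<in> S \<Longrightarrow> h z (\<Sum>i\<in>I. f i) = (\<Sum>i\<in>I. h z (f i))"
  by (induction I rule: infinite_finite_induct) (auto simp: h_add_right subsp_sum[OF subS])

lemma h_self_Fq: "x \<in> S \<Longrightarrow> h x x \<in> Fq" using h_herm[of x x] by simp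

lemma h_eq_0_sym: "x \<in> S \<Longrightarrow> y \<in> S \<Longrightarrow> h x y = 0 \<longleftrightarrow> h y x = 0"
  using h_herm[of x y] h_herm[of y x] frob_0 by auto

definition orth :: "('i \<Rightarrow> 'a) set \<Rightarrow> ('i \<Rightarrow> 'a) set" where
  "orth U = {x\<in>S. \<forall>u\<in>U. h x u = 0}"

lemma orth_subset: "orth U \<subseteq> S" by (auto simp: orth_def)

lemma subsp_orth: "U \<subseteq> S \<Longrightarrow> subsp (orth U)"
  by (auto simp: subsp_def orth_def h_add_left h_smul_left subset_iff)

lemma nondeg_subspace:
  assumes "subsp N" "N \<subseteq> S" "N \<inter> orth N = {0}"
  shows "hermitian_space q N h"
proof unfold_locales
  show "finite N" using assms finS finite_subset by blast
  show "x = 0" if "x \<in> N" "\<And>y. y \<in> N \<Longrightarrow> h x y = 0" for x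
    using that assms by (auto simp: orth_def)
qed (use assms in \<open>auto simp: h_add_left h_smul_left subset_iff intro: h_herm\<close>)

text \<open>If \<open>h\<close> vanished on the diagonal, polarization would give every
  \<open>h z y\<close> trace zero, although rescaling gives it any value. A vector with nonzero
  diagonal value is then normalized by surjectivity of the norm.\<close>

lemma exists_unit_vector:
  assumes "S \<noteq> {0}"
  shows "\<exists>e\<in>S. h e e = 1"
proof -
  have "\<exists>x\<in>S. h x x \<noteq> 0"
  proof (rule ccontr)
    assume a: "\<not> ?thesis"
    obtain x where x: "x \<in> S" "x \<noteq> 0" using assms subsp_0[OF subS] by auto
    then obtain y where y: "y \<in> S" "h x y \<noteq> 0" using nondeg by blast
    obtain b where b: "b + b ^ q \<noteq> (0::'a)" using trace_nonzero by blast
    define z where "z = smul (b / h x y) x"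
    have z: "z \<in> S" "h z y = b" using x y by (auto simp: z_def h_smul_left)
    have "0 = h (z + y) (z + y)" using a z y by simp
    also have "\<dots> = h z z + h y y + (h z y + h y z)" using z y by (simp add: h_add_left h_add_right)
    also have "h y z = b ^ q" using h_herm[of z y] z y by simp
    finally show False using a z y b by simp
  qed
  then obtain x where x: "x \<in> S" "h x x \<noteq> 0" by blast
  have "inverse (h x x) \<in> Fq" using h_self_Fq[OF x(1)] by (simp add: power_inverse)
  then obtain b where "b ^ (q + 1) = inverse (h x x)" using norm_surj[of "inverse (h x x)"] x by auto
  then have "b * (b ^ q * h x x) = 1" using x by (simp add: mult.assoc[symmetric])
  then have "h (smul b x) (smul b x) = 1" using x by (simp add: h_smul_left h_smul_right mult_ac)
  then show ?thesis using x by force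
qed

lemma split_unit_vector:
  assumes e: "e \<in> S" "h e e = 1"
  shows "hermitian_space q (orth {e}) h"
    and "bij_betw (\<lambda>(a, x). smul a e + x) (UNIV \<times> orth {e}) S"
proof -
  have proj: "x - smul (h x e) e \<in> orth {e}" if "x \<in> S" for x
    using that e by (simp add: orth_def h_diff_left h_smul_left)
  have sub: "subsp (orth {e})" using subsp_orth e by simp
  have "x = 0" if "x \<in> orth {e}" "x \<in> orth (orth {e})" for x
  proof (rule nondeg)
    show "x \<in> S" using that orth_subset by blast
    fix y assume y: "y \<in> S"
    have "h x y = h x (y - smul (h y e) e) + h x (smul (h y e) e)"
      using \<open>x \<in> S\<close> y e by (subst h_add_right[symmetric]) auto
    also have "\<dots> = 0" using that proj[OF y] e by (auto simp: orth_def h_smul_right)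
    finally show "h x y = 0" .
  qed
  then show "hermitian_space q (orth {e}) h"
    using sub orth_subset subsp_0[OF sub] by (intro nondeg_subspace) (auto simp: orth_def)
  show "bij_betw (\<lambda>(a, x). smul a e + x) (UNIV \<times> orth {e}) S"
  proof (rule bij_betwI[where g = "\<lambda>x. (h x e, x - smul (h x e) e)"])
    show "(\<lambda>(a, x). smul a e + x) \<in> UNIV \<times> orth {e} \<rightarrow> S" using e by (auto simp: orth_def)
    show "(\<lambda>x. (h x e, x - smul (h x e) e)) \<in> S \<rightarrow> UNIV \<times> orth {e}" using proj by auto
  qed (use e in \<open>auto simp: orth_def h_add_left h_smul_left\<close>)
qed

end

text \<open>Unit vectors are split off one after another. The first argument of \<open>P\<close>
  counts the steps, that is the dimension; it is an output of the rule, hence the existential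
  conclusion, and where it matters it is recovered from the cardinality.\<close>

lemma hermitian_induct [consumes 1, case_names zero step]:
  assumes "hermitian_space q S (h :: ('i \<Rightarrow> 'a::{field,finite}) \<Rightarrow> _)"
    and zero: "P 0 {0}"
    and step: "\<And>n S e. hermitian_space q S h \<Longrightarrow> e \<in> S \<Longrightarrow> h e e = 1 \<Longrightarrow>
      hermitian_space q (hermitian_space.orth S h {e}) h \<Longrightarrow> P n (hermitian_space.orth S h {e}) \<Longrightarrow> P (Suc n) S"
  shows "\<exists>n. P n S"
  using assms(1)
proof (induction "card S" arbitrary: S rule: less_induct)
  case less
  interpret hermitian_space q S h by fact
  show ?case
  proof (cases "S = {0}")
    case True then show ?thesis using zero by auto
  next
    case False
    then obtain e where e: "e \<in> S" "h e e = 1" using exists_unit_vector by blast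
    have "e \<notin> orth {e}" using e by (simp add: orth_def)
    then have "card (orth {e}) < card S" using e orth_subset finS by (intro psubset_card_mono) auto
    then obtain n where "P n (orth {e})" using less.hyps split_unit_vector(1)[OF e] by blast
    then show ?thesis using step[OF less.prems e split_unit_vector(1)[OF e]] by blast
  qed
qed

lemma (in hermitian_space) dimension: "\<exists>n. card S = (q\<^sup>2) ^ n"
proof (induction rule: hermitian_induct[OF hermitian_space_axioms])
  case 1 then show ?case by simp
next
  case (2 n S e)
  interpret T: hermitian_space q S h by fact
  show ?case using bij_betw_same_card[OF T.split_unit_vector(2)[OF 2(2,3)]] 2(5) card_field
    by (simp add: card_cartesian_product)
qed

lemma (in hermitian_space) sum_wt_form:
  assumes "card S = (q\<^sup>2) ^ n" "s \<in> Fq"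
  shows "(\<Sum>x\<in>S. wt (s + h x x)) = (- of_nat q) ^ n * wt s"
proof -
  have "\<exists>n. card S = (q\<^sup>2) ^ n \<and> (\<forall>s\<in>Fq. (\<Sum>x\<in>S. wt (s + h x x)) = (- of_nat q) ^ n * wt s)"
  proof (induction rule: hermitian_induct[OF hermitian_space_axioms])
    case 1 
    have "h 0 0 = 0" by simp
    then show ?case by (simp add: zero_fun_def)
  next
    case (2 n T e)
    interpret T: hermitian_space q T h by fact
    note bij = T.split_unit_vector(2)[OF 2(2,3)]
    have "card T = (q\<^sup>2) ^ Suc n" using bij_betw_same_card[OF bij] 2(5) card_field
      by (simp add: card_cartesian_product)
    moreover have "(\<Sum>x\<in>T. wt (s + h x x)) = (- of_nat q) ^ Suc n * wt s" if s: "s \<in> Fq" for s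
    proof -
      have "(\<Sum>x\<in>T. wt (s + h x x)) = (\<Sum>(a, x)\<in>UNIV \<times> T.orth {e}. wt (s + h (smul a e + x) (smul a e + x)))"
        by (subst sum.reindex_bij_betw[OF bij, symmetric]) (simp add: split_beta)
      also have "\<dots> = (\<Sum>(a, x)\<in>UNIV \<times> T.orth {e}. wt ((s + h x x) + a ^ (q + 1)))"
      proof (rule sum.cong[OF refl], clarsimp)
        fix a x assume x: "x \<in> T.orth {e}"
        have "x \<in> T" "h x e = 0" using x by (auto simp: T.orth_def)
        moreover have "h e x = 0" using T.h_eq_0_sym 2(2) calculation by blast
        ultimately have "h (smul a e + x) (smul a e + x) = a * a ^ q + h x x"
          using 2(2,3) by (simp add: T.h_add_left T.h_add_right T.h_smul_left T.h_smul_right)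
        then show "wt (s + h (smul a e + x) (smul a e + x)) = wt (s + h x x + a * a ^ q)" by (simp add: ac_simps)
      qed
      also have "\<dots> = (\<Sum>x\<in>T.orth {e}. \<Sum>a\<in>UNIV. wt ((s + h x x) + a ^ (q + 1)))"
        by (subst sum.swap) (simp add: sum.cartesian_product)
      also have "\<dots> = (\<Sum>x\<in>T.orth {e}. - of_nat q * wt (s + h x x))"
      proof (rule sum.cong[OF refl])
        fix x assume "x \<in> T.orth {e}"
        then have "x \<in> T" using T.orth_subset by blast
        then have "s + h x x \<in> Fq" using s T.h_self_Fq by (auto simp: frob_add)
        then show "(\<Sum>a\<in>UNIV. wt ((s + h x x) + a ^ (q + 1))) = - of_nat q * wt (s + h x x)" by (rule sum_wt_norm)
      qed
      also have "\<dots> = - of_nat q * (\<Sum>x\<in>T.orth {e}. wt (s + h x x))" by (rule sum_distrib_left[symmetric])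
      also have "(\<Sum>x\<in>T.orth {e}. wt (s + h x x)) = (- of_nat q) ^ n * wt s" using 2(5) s by blast
      also have "- of_nat q * ((- of_nat q) ^ n * wt s) = (- of_nat q) ^ Suc n * wt s" by (simp only: power_Suc mult.assoc)
      finally show ?thesis .
    qed
    ultimately show ?case by blast
  qed
  then obtain n' where "card S = (q\<^sup>2) ^ n'" "(\<Sum>x\<in>S. wt (s + h x x)) = (- of_nat q) ^ n' * wt s" using assms by blast
  moreover have "n' = n" using assms calculation(1) q_ge_2 by (simp add: power_mult[symmetric])
  ultimately show ?thesis by simp
qed

section \<open>Euler characteristics of posets of invariant isotropic subspaces\<close>

definition isotropic :: "('v \<Rightarrow> 'v \<Rightarrow> 'a::zero) \<Rightarrow> 'v set \<Rightarrow> bool" where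
  "isotropic h U \<longleftrightarrow> (\<forall>x\<in>U. \<forall>y\<in>U. h x y = 0)"

lemma isotropic_mono: "isotropic h U \<Longrightarrow> W \<subseteq> U \<Longrightarrow> isotropic h W"
  by (auto simp: isotropic_def)

text \<open>By \<open>chi_echar\<close> this is \<open>echar\<close> of the poset of nonzero
  isotropic members, hence minus its reduced Euler characteristic. The form as a sum of Moebius
  numbers opens it to the complementation formula.\<close>

definition chi :: "(('i \<Rightarrow> 'a::field) \<Rightarrow> ('i \<Rightarrow> 'a) \<Rightarrow> 'a) \<Rightarrow> (('i \<Rightarrow> 'a) \<Rightarrow> ('i \<Rightarrow> 'a)) set \<Rightarrow> ('i \<Rightarrow> 'a) set \<Rightarrow> int" where
  "chi h \<Phi> Y = (\<Sum>U | U \<in> Sub \<Phi> Y \<and> isotropic h U. mob \<Phi> U)"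

locale hermitian_action = hermitian_space q S h for q S and h :: "('i \<Rightarrow> 'a::{field,finite}) \<Rightarrow> _" +
  fixes \<Phi> :: "(('i \<Rightarrow> 'a::{field,finite}) \<Rightarrow> ('i \<Rightarrow> 'a)) set"
  assumes act_closed: "f \<in> \<Phi> \<Longrightarrow> x \<in> S \<Longrightarrow> f x \<in> S"
    and act_add: "f \<in> \<Phi> \<Longrightarrow> x \<in> S \<Longrightarrow> y \<in> S \<Longrightarrow> f (x + y) = f x + f y"
    and act_form: "f \<in> \<Phi> \<Longrightarrow> x \<in> S \<Longrightarrow> y \<in> S \<Longrightarrow> h (f x) (f y) = h x y"
begin

sublocale inv_lattice S \<Phi>
  by unfold_locales (auto simp: finS subS additive_on_def act_add)

lemma S_Sub: "S \<in> Sub \<Phi> S"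
  by (auto simp: Sub_def subS act_closed)

lemma act_inj: "f \<in> \<Phi> \<Longrightarrow> inj_on f S"
proof (rule inj_onI)
  fix x y assume f: "f \<in> \<Phi>" and x: "x \<in> S" "y \<in> S" "f x = f y"
  have "x - y = 0"
  proof (rule nondeg)
    fix z assume z: "z \<in> S"
    have "f x = f (x - y) + f y" using act_add[OF f, of "x - y" y] x by simp
    then have "f (x - y) = 0" using x by simp
    then show "h (x - y) z = 0" using act_form[OF f, of "x - y" z] x z act_closed[OF f z] by simp
  qed (use x in simp)
  then show "x = y" by simp
qed

lemma act_image_eq: "U \<in> Sub \<Phi> S \<Longrightarrow> f \<in> \<Phi> \<Longrightarrow> f ` U = U"
proof -
  assume U: "U \<in> Sub \<Phi> S" and f: "f \<in> \<Phi>"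
  have "f ` U \<subseteq> U" using SubD(3)[OF U f] by auto
  then show ?thesis
    using endo_inj_surj[OF fin_Sub[OF U], of f] inj_on_subset[OF act_inj[OF f] SubD(2)[OF U]] by simp
qed

lemma orth_Sub: "U \<in> Sub \<Phi> S \<Longrightarrow> orth U \<in> Sub \<Phi> S"
proof -
  assume U: "U \<in> Sub \<Phi> S"
  have "f x \<in> orth U" if f: "f \<in> \<Phi>" and x: "x \<in> orth U" for f x
  proof -
    have "x \<in> S" using x orth_subset by blast
    have "h (f x) u = 0" if u: "u \<in> U" for u
    proof -
      obtain u' where "u = f u'" "u' \<in> U" using act_image_eq[OF U f] u by blast
      then show ?thesis using act_form[OF f \<open>x \<in> S\<close>, of u'] x SubD(2)[OF U] by (auto simp: orth_def)
    qed
    then show ?thesis using act_closed[OF f \<open>x \<in> S\<close>] by (simp add: orth_def)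
  qed
  then show ?thesis using subsp_orth[OF SubD(2)[OF U]] orth_subset by (auto simp: Sub_def)
qed

lemma chi_echar: "Y \<in> Sub \<Phi> S \<Longrightarrow> chi h \<Phi> Y = echar {U \<in> Sub \<Phi> Y. isotropic h U \<and> U \<noteq> {0}}"
proof -
  assume Y: "Y \<in> Sub \<Phi> S"
  define P where "P = {U \<in> Sub \<Phi> Y. isotropic h U \<and> U \<noteq> {0}}"
  have fin: "finite P" unfolding P_def using finite_Sub[OF fin_Sub[OF Y]] by simp
  have "isotropic h {0}" by (simp add: isotropic_def)
  then have "{U. U \<in> Sub \<Phi> Y \<and> isotropic h U} = insert {0} P" using zero_Sub[OF Y] by (auto simp: P_def)
  moreover have "{0} \<notin> P" by (simp add: P_def)
  ultimately have "chi h \<Phi> Y = 1 + (\<Sum>U\<in>P. mob \<Phi> U)" using fin by (simp add: chi_def)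
  also have "(\<Sum>U\<in>P. mob \<Phi> U) = (\<Sum>U\<in>P. - echar {y\<in>P. y < U})"
  proof (rule sum.cong[OF refl])
    fix W assume W: "W \<in> P"
    have "{U' \<in> Sub \<Phi> W. U' \<noteq> {0} \<and> U' \<noteq> W} = {y\<in>P. y < W}"
      using W isotropic_mono by (auto simp: P_def Sub_def)
    then show "mob \<Phi> W = - echar {y\<in>P. y < W}" using W by (simp add: mob_def P_def)
  qed
  also have "1 + \<dots> = echar P" using echar_top_element[OF fin] by (simp add: sum_negf)
  finally show ?thesis by (simp add: P_def)
qed

lemma isotropic_ssum:
  assumes "subsp A" "subsp B" "A \<subseteq> S" "B \<subseteq> S"
  shows "isotropic h (ssum A B) \<longleftrightarrow> isotropic h A \<and> isotropic h B \<and> B \<subseteq> orth A"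
proof
  assume i: "isotropic h (ssum A B)"
  then show "isotropic h A \<and> isotropic h B \<and> B \<subseteq> orth A"
    using ssum_ge[OF assms(1,2)] assms(3,4) unfolding isotropic_def orth_def by blast
next
  assume a: "isotropic h A \<and> isotropic h B \<and> B \<subseteq> orth A"
  have "h (x + y) (x' + y') = 0" if "x \<in> A" "y \<in> B" "x' \<in> A" "y' \<in> B" for x y x' y'
  proof -
    have S: "x \<in> S" "y \<in> S" "x' \<in> S" "y' \<in> S" using that assms by auto
    have "h x x' = 0" "h y y' = 0" "h y x' = 0" "h y' x = 0" using a that by (auto simp: isotropic_def orth_def)
    moreover have "h x y' = 0" using h_eq_0_sym S calculation by blast
    ultimately show ?thesis using S by (simp add: h_add_left h_add_right)
  qed
  then show "isotropic h (ssum A B)" by (auto simp: isotropic_def ssum_def)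
qed

text \<open>\<open>mob_complement\<close> is summed over isotropic subspaces. Isotropy of
  \<open>ssum A a\<close> splits into isotropy of both summands and their orthogonality, so for
  fixed \<open>A\<close> the inner sum is a \<open>chi\<close> again.\<close>

lemma chi_complement:
  assumes Y: "Y \<in> Sub \<Phi> S" and M: "M \<in> Sub \<Phi> S"
  shows "chi h \<Phi> Y = (\<Sum>A | A \<in> Sub \<Phi> Y \<and> isotropic h A \<and> A \<inter> M = {0}. mob \<Phi> A * chi h \<Phi> (Y \<inter> M \<inter> orth A))"
proof -
  have YM: "Y \<inter> M \<in> Sub \<Phi> S" using Sub_Int[OF Y M] by simp
  have fin: "finite (Sub \<Phi> Y)" "finite (Sub \<Phi> (Y \<inter> M))" using fin_Sub[OF Y] fin_Sub[OF YM] finite_Sub by blast+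
  have fin': "finite (Sub \<Phi> U)" if "U \<in> Sub \<Phi> Y" for U
    using finite_Sub[OF finite_subset[OF SubD(2)[OF that] fin_Sub[OF Y]]] .
  define G where "G = (\<lambda>U A. if isotropic h U then mob \<Phi> A * mob \<Phi> (U \<inter> M) else 0)"
  let ?Z = "SIGMA U:Sub \<Phi> Y. {A\<in>Sub \<Phi> U. A \<inter> M = {0} \<and> ssum A (U \<inter> M) = U}"
  let ?X = "SIGMA A:{A\<in>Sub \<Phi> Y. A \<inter> M = {0}}. Sub \<Phi> (Y \<inter> M)"
  have "chi h \<Phi> Y = (\<Sum>U\<in>Sub \<Phi> Y. if isotropic h U then mob \<Phi> U else 0)"
    unfolding chi_def using fin by (simp add: sum.inter_filter)
  also have "\<dots> = (\<Sum>U\<in>Sub \<Phi> Y. \<Sum>A\<in>{A\<in>Sub \<Phi> U. A \<inter> M = {0} \<and> ssum A (U \<inter> M) = U}. G U A)"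
  proof (rule sum.cong[OF refl])
    fix U assume "U \<in> Sub \<Phi> Y"
    then have "U \<in> Sub \<Phi> S" using Y SubD(2) Sub_mono by (metis subset_trans)
    from mob_complement[OF M this]
    show "(if isotropic h U then mob \<Phi> U else 0) = (\<Sum>A\<in>{A\<in>Sub \<Phi> U. A \<inter> M = {0} \<and> ssum A (U \<inter> M) = U}. G U A)"
      by (simp add: G_def)
  qed
  also have "\<dots> = (\<Sum>(U,A)\<in>?Z. G U A)"
    by (subst sum.Sigma) (use fin fin' in auto)
  also have "\<dots> = (\<Sum>(A,a)\<in>?X. G (ssum A a) A)"
    by (subst sum.reindex_bij_betw[OF bij_complements[OF M Y], symmetric]) (simp add: split_beta)
  also have "\<dots> = (\<Sum>(A,a)\<in>?X. if isotropic h A then (if isotropic h a \<and> a \<subseteq> orth A then mob \<Phi> A * mob \<Phi> a else 0) else 0)"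
  proof (rule sum.cong[OF refl])
    fix x assume "x \<in> ?X"
    then obtain A a where x: "x = (A, a)" and A: "A \<in> Sub \<Phi> Y" "A \<inter> M = {0}" and a: "a \<in> Sub \<Phi> (Y \<inter> M)"
      by blast
    have "ssum A a \<inter> M = a" using modular_decomp[of A M a] A(2) SubD[OF a] SubD(1)[OF A(1)] SubD(1)[OF M] by auto
    moreover have "isotropic h (ssum A a) \<longleftrightarrow> isotropic h A \<and> isotropic h a \<and> a \<subseteq> orth A"
      using isotropic_ssum[OF SubD(1)[OF A(1)] SubD(1)[OF a]] SubD(2)[OF A(1)] SubD(2)[OF a] SubD(2)[OF Y] by auto
    ultimately show "(case x of (A, a) \<Rightarrow> G (ssum A a) A) = (case x of (A, a) \<Rightarrow>
        if isotropic h A then (if isotropic h a \<and> a \<subseteq> orth A then mob \<Phi> A * mob \<Phi> a else 0) else 0)"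
      by (simp add: x G_def)
  qed
  also have "\<dots> = (\<Sum>A\<in>{A\<in>Sub \<Phi> Y. A \<inter> M = {0}}. if isotropic h A then
      (\<Sum>a\<in>Sub \<Phi> (Y \<inter> M). if isotropic h a \<and> a \<subseteq> orth A then mob \<Phi> A * mob \<Phi> a else 0) else 0)"
    by (subst sum.Sigma[symmetric]) (use fin in \<open>auto intro!: sum.cong\<close>)
  also have "\<dots> = (\<Sum>A\<in>{A\<in>Sub \<Phi> Y. A \<inter> M = {0}}. if isotropic h A then mob \<Phi> A * chi h \<Phi> (Y \<inter> M \<inter> orth A) else 0)"
  proof (rule sum.cong[OF refl])
    fix A
    have "(\<Sum>a\<in>Sub \<Phi> (Y \<inter> M). if isotropic h a \<and> a \<subseteq> orth A then mob \<Phi> A * mob \<Phi> a else 0)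
      = (\<Sum>a | a \<in> Sub \<Phi> (Y \<inter> M) \<and> isotropic h a \<and> a \<subseteq> orth A. mob \<Phi> A * mob \<Phi> a)"
      using fin by (simp add: sum.inter_filter)
    also have "{a. a \<in> Sub \<Phi> (Y \<inter> M) \<and> isotropic h a \<and> a \<subseteq> orth A} = {a. a \<in> Sub \<Phi> (Y \<inter> M \<inter> orth A) \<and> isotropic h a}"
      by (auto simp: Sub_def)
    finally show "(if isotropic h A then
      (\<Sum>a\<in>Sub \<Phi> (Y \<inter> M). if isotropic h a \<and> a \<subseteq> orth A then mob \<Phi> A * mob \<Phi> a else 0) else 0)
      = (if isotropic h A then mob \<Phi> A * chi h \<Phi> (Y \<inter> M \<inter> orth A) else 0)"
      by (simp add: chi_def sum_distrib_left)
  qed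
  also have "\<dots> = (\<Sum>A | A \<in> {A\<in>Sub \<Phi> Y. A \<inter> M = {0}} \<and> isotropic h A. mob \<Phi> A * chi h \<Phi> (Y \<inter> M \<inter> orth A))"
    using fin by (subst sum.inter_filter) auto
  also have "{A. A \<in> {A\<in>Sub \<Phi> Y. A \<inter> M = {0}} \<and> isotropic h A} = {A. A \<in> Sub \<Phi> Y \<and> isotropic h A \<and> A \<inter> M = {0}}"
    by auto
  finally show ?thesis .
qed

text \<open>Complementation with respect to \<open>R\<close>, which lies in the radical of
  \<open>M\<close>: every \<open>A\<close> inside \<open>M\<close> is orthogonal to
  \<open>R\<close>, so each term contains \<open>chi\<close> of the totally isotropic space
  \<open>R\<close>, a full sum of Moebius numbers and hence zero.\<close>

lemma chi_radical:
  assumes M: "M \<in> Sub \<Phi> S" and R: "R \<in> Sub \<Phi> S" "R \<noteq> {0}" "R \<subseteq> M" "M \<subseteq> orth R"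
  shows "chi h \<Phi> M = 0"
proof -
  have "chi h \<Phi> (M \<inter> R \<inter> orth A) = 0" if A: "A \<in> Sub \<Phi> M" for A
  proof -
    have "R \<subseteq> orth A"
    proof
      fix r assume r: "r \<in> R"
      have "h r a = 0" if "a \<in> A" for a
      proof -
        have "a \<in> orth R" using that SubD(2)[OF A] R(4) by blast
        then have "a \<in> S" "h a r = 0" using r by (auto simp: orth_def)
        then show ?thesis using h_eq_0_sym r SubD(2)[OF R(1)] by blast
      qed
      then show "r \<in> orth A" using r SubD(2)[OF R(1)] by (auto simp: orth_def)
    qed
    then have "M \<inter> R \<inter> orth A = R" using R by auto
    moreover have "isotropic h U" if "U \<in> Sub \<Phi> R" for U
      using SubD(2)[OF that] R by (auto simp: isotropic_def orth_def)
    then have "{U. U \<in> Sub \<Phi> R \<and> isotropic h U} = Sub \<Phi> R" by auto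
    then have "chi h \<Phi> R = 0" using sum_mob[OF R(1)] R(2) by (simp add: chi_def)
    ultimately show ?thesis by simp
  qed
  then show ?thesis by (subst chi_complement[OF M R(1)]) simp
qed

lemma orth_zero: "orth {0} = S" by (auto simp: orth_def)

text \<open>If \<open>u\<close> is unipotent, then every nonzero member of the poset meets the fixed space of
  \<open>u\<close>, whose radical is nonzero.\<close>

lemma chi_unipotent:
  assumes u: "u \<in> \<Phi>" and comm: "\<And>f x. f \<in> \<Phi> \<Longrightarrow> x \<in> S \<Longrightarrow> f (u x) = u (f x)"
    and lin: "\<And>a x. x \<in> S \<Longrightarrow> u (smul a x) = smul a (u x)"
    and nontriv: "\<exists>x\<in>S. u x \<noteq> x"
    and fixed: "\<And>U. U \<in> Sub \<Phi> S \<Longrightarrow> U \<noteq> {0} \<Longrightarrow> \<exists>x\<in>U. x \<noteq> 0 \<and> u x = x"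
  shows "chi h \<Phi> S = 0"
proof -
  have uS: "u x \<in> S" if "x \<in> S" for x using act_closed[OF u] that by simp
  have fdiff: "f (x - y) = f x - f y" if "f \<in> \<Phi>" "x \<in> S" "y \<in> S" for f x y
    using act_add[of f "x - y" y] that by simp
  define M where "M = {x\<in>S. u x = x}"
  have M: "M \<in> Sub \<Phi> S"
    by (auto simp: M_def Sub_def subsp_def map_0[OF u] act_add[OF u] lin act_closed comm[symmetric])
  \<comment> \<open>The image of \<open>u - 1\<close> is orthogonal to the fixed space
    \<open>M\<close>. Being nonzero and invariant it contains a fixed vector, which then lies in the
    radical of \<open>M\<close>.\<close>
  define I where "I = (\<lambda>x. u x - x) ` S"
  have subI: "subsp I"
    unfolding subsp_def
  proof (intro conjI ballI allI)
    show "0 \<in> I" unfolding I_def by (rule image_eqI[of _ _ 0]) (auto simp: map_0[OF u])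
  next
    fix x y assume "x \<in> I" "y \<in> I"
    then obtain a b where "a \<in> S" "b \<in> S" "x = u a - a" "y = u b - b" by (auto simp: I_def)
    then show "x + y \<in> I" unfolding I_def by (intro image_eqI[of _ _ "a + b"]) (auto simp: act_add[OF u])
  next
    fix a x assume "x \<in> I"
    then obtain b where "b \<in> S" "x = u b - b" by (auto simp: I_def)
    then show "smul a x \<in> I" unfolding I_def by (intro image_eqI[of _ _ "smul a b"]) (auto simp: lin smul_diff)
  qed
  have IS: "I \<subseteq> S" by (auto simp: I_def uS)
  have "f (u x - x) \<in> I" if "f \<in> \<Phi>" "x \<in> S" for f x
    unfolding I_def using that by (intro image_eqI[of _ _ "f x"]) (simp_all only: fdiff uS comm act_closed)
  then have I: "I \<in> Sub \<Phi> S" using subI IS by (auto simp: Sub_def I_def)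
  have "I \<noteq> {0}"
  proof -
    obtain x where "x \<in> S" "u x \<noteq> x" using nontriv by blast
    then have "u x - x \<in> I" "u x - x \<noteq> 0" by (auto simp: I_def)
    then show ?thesis by auto
  qed
  then obtain w where w: "w \<in> I" "w \<noteq> 0" "u w = w" using fixed[OF I] by blast
  have "w \<in> orth M"
  proof -
    obtain x where x: "x \<in> S" "w = u x - x" using w by (auto simp: I_def)
    have "h w m = 0" if "m \<in> M" for m
    proof -
      have m: "m \<in> S" "u m = m" using that by (auto simp: M_def)
      have "h (u x) m = h x m" using act_form[OF u x(1) m(1)] m by simp
      then show ?thesis using x m uS by (simp add: h_diff_left)
    qed
    then show ?thesis using w IS by (auto simp: orth_def)
  qed
  define R where "R = M \<inter> orth M"
  have R: "R \<in> Sub \<Phi> S" unfolding R_def using Sub_Int[OF M orth_Sub[OF M]] by simp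
  have "w \<in> R" using w IS \<open>w \<in> orth M\<close> by (auto simp: R_def M_def)
  then have "R \<noteq> {0}" using w by auto
  moreover have "M \<subseteq> orth R"
  proof
    fix m assume m: "m \<in> M"
    have "h m r = 0" if "r \<in> R" for r
    proof -
      have "r \<in> S" "h r m = 0" "m \<in> S" using that m by (auto simp: R_def orth_def M_def)
      then show ?thesis using h_eq_0_sym by blast
    qed
    then show "m \<in> orth R" using m by (auto simp: orth_def M_def)
  qed
  ultimately have "chi h \<Phi> M = 0" using chi_radical[OF M R] by (auto simp: R_def)
  \<comment> \<open>Every nonzero invariant subspace contains a fixed vector, so the complementation
    formula for \<open>M\<close> reduces to the term of \<open>A = {0}\<close>.\<close>
  moreover have "{A. A \<in> Sub \<Phi> S \<and> isotropic h A \<and> A \<inter> M = {0}} = {{0}}"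
  proof (intro equalityI subsetI)
    fix A assume A: "A \<in> {A. A \<in> Sub \<Phi> S \<and> isotropic h A \<and> A \<inter> M = {0}}"
    then have A': "A \<in> Sub \<Phi> S" "A \<inter> M = {0}" by auto
    then show "A \<in> {{0}}" using fixed[OF A'(1)] SubD(2)[OF A'(1)] by (auto simp: M_def)
  qed (use zero_Sub[OF S_Sub] subsp_0[OF SubD(1)[OF M]] in \<open>auto simp: isotropic_def\<close>)
  ultimately show ?thesis
    by (subst chi_complement[OF S_Sub M]) (simp add: orth_zero Int_absorb1 Int_absorb2 SubD(2)[OF M])
qed

section \<open>Cyclic submodules and the recursion for a single representation\<close>

definition cyc :: "('i \<Rightarrow> 'a) \<Rightarrow> ('i \<Rightarrow> 'a) set" where
  "cyc v = \<Inter>{U \<in> Sub \<Phi> S. v \<in> U}"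

lemma cyc_Sub: "v \<in> S \<Longrightarrow> cyc v \<in> Sub \<Phi> S"
proof -
  assume v: "v \<in> S"
  have "cyc v \<subseteq> S" using S_Sub v by (auto simp: cyc_def)
  moreover have "subsp (cyc v)" unfolding subsp_def cyc_def
    by (auto dest: SubD(1) intro: subsp_0 subsp_add subsp_smul)
  moreover have "f ` cyc v \<subseteq> cyc v" if "f \<in> \<Phi>" for f
    using that by (auto simp: cyc_def dest: SubD(3))
  ultimately show ?thesis by (simp add: Sub_def)
qed

lemma mem_cyc: "v \<in> cyc v" by (auto simp: cyc_def)

lemma cyc_least: "U \<in> Sub \<Phi> S \<Longrightarrow> v \<in> U \<Longrightarrow> cyc v \<subseteq> U" by (auto simp: cyc_def)

text \<open>Both sides are the submodule generated by \<open>v\<close> and \<open>A\<close>, which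
  depends on \<open>v\<close> only modulo \<open>A\<close>.\<close>

lemma ssum_cyc_translate:
  assumes A: "A \<in> Sub \<Phi> S" and v: "v \<in> S" and a: "a \<in> A"
  shows "ssum (cyc (v + a)) A = ssum (cyc v) A"
proof -
  have *: "ssum (cyc (v + a)) A \<subseteq> ssum (cyc v) A" if "v \<in> S" "a \<in> A" for v a
  proof -
    have s: "ssum (cyc v) A \<in> Sub \<Phi> S"
      using ssum_Sub[OF cyc_Sub[OF that(1)] A] SubD(2)[OF cyc_Sub[OF that(1)]] SubD(2)[OF A] subS by auto
    have "v + a \<in> ssum (cyc v) A" using mem_cyc[of v] that by (auto simp: ssum_def)
    then have "cyc (v + a) \<subseteq> ssum (cyc v) A" using cyc_least[OF s] by blast
    then show ?thesis
      using ssum_least[OF SubD(1)[OF s]] ssum_ge(2)[OF SubD(1)[OF cyc_Sub[OF that(1)]] SubD(1)[OF A]] by blast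
  qed
  have "v + a \<in> S" using v a SubD(2)[OF A] by auto
  then show ?thesis using *[OF v a] *[of "v + a" "- a"] subsp_uminus[OF SubD(1)[OF A] a] by auto
qed

text \<open>Moving \<open>a\<close> along a line on which \<open>h v\<close> does not vanish changes
  \<open>h (v + a) (v + a)\<close> by every trace \<open>b + b ^ q\<close>, and \<open>wt\<close>
  sums to zero over these.\<close>

lemma sum_wt_coset:
  assumes A: "subsp A" "A \<subseteq> S" "isotropic h A" and v: "v \<in> S" and a: "a1 \<in> A" "h v a1 \<noteq> 0"
  shows "(\<Sum>a\<in>A. wt (h (v + a) (v + a))) = 0"
proof -
  \<comment> \<open>The exponent \<open>q\<close> undoes the semilinearity of \<open>h\<close> in
    its second argument, so that \<open>h v a0 = 1\<close>.\<close>
  define a0 where "a0 = smul ((1 / h v a1) ^ q) a1"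
  have a0: "a0 \<in> A" "h v a0 = 1"
    using a A v by (auto simp: a0_def subsp_smul h_smul_right subset_iff frob_frob)
  have "(\<Sum>a\<in>A. wt (h (v + a) (v + a))) = (\<Sum>a\<in>A. wt (h (v + (a + smul b a0)) (v + (a + smul b a0))))" for b
  proof (rule sum.reindex_bij_betw[symmetric])
    show "bij_betw (\<lambda>a. a + smul b a0) A A"
      by (rule bij_betwI[where g = "\<lambda>a. a - smul b a0"]) (use A a0 in \<open>auto simp: subsp_add subsp_diff subsp_smul\<close>)
  qed
  then have "of_nat CARD('a) * (\<Sum>a\<in>A. wt (h (v + a) (v + a)))
    = (\<Sum>b\<in>(UNIV::'a set). \<Sum>a\<in>A. wt (h (v + (a + smul b a0)) (v + (a + smul b a0))))"
    by (metis (no_types, lifting) sum.cong sum_constant)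
  also have "\<dots> = (\<Sum>a\<in>A. \<Sum>b\<in>(UNIV::'a set). wt (h (v + (a + smul b a0)) (v + (a + smul b a0))))"
    by (rule sum.swap)
  also have "\<dots> = (\<Sum>a\<in>A. \<Sum>b\<in>(UNIV::'a set). wt (h (v + a) (v + a) + (b + b ^ q)))"
  proof (intro sum.cong refl)
    fix a b assume aA: "a \<in> A"
    have S: "a \<in> S" "a0 \<in> S" "v \<in> S" using aA a0 A v by auto
    have z: "h a a0 = 0" "h a0 a = 0" "h a0 a0 = 0" using A(3) aA a0 by (auto simp: isotropic_def)
    have "h a0 v = 1" using h_herm[of v a0] S a0 by simp
    then have "h ((v + a) + smul b a0) ((v + a) + smul b a0) = h (v + a) (v + a) + (b + b ^ q)"
      using S a0 z by (simp add: h_add_left h_add_right h_smul_left h_smul_right)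
    then show "wt (h (v + (a + smul b a0)) (v + (a + smul b a0))) = wt (h (v + a) (v + a) + (b + b ^ q))"
      by (simp add: add.assoc)
  qed
  also have "\<dots> = 0"
    using A v by (intro sum.neutral ballI sum_wt_trace h_self_Fq) auto
  finally show ?thesis by simp
qed

text \<open>A function that is constant on cosets of \<open>A\<close> sees only the coset sums of
  \<open>wt\<close>, and these are zero by \<open>sum_wt_coset\<close> wherever the function is
  nonzero.\<close>

lemma sum_wt_translation_invariant:
  fixes g :: "('i \<Rightarrow> 'a) \<Rightarrow> rat"
  assumes A: "subsp A" "A \<subseteq> S" "isotropic h A"
    and g: "\<And>v a. v \<in> S \<Longrightarrow> a \<in> A \<Longrightarrow> g (v + a) = g v"
    and nz: "\<And>v. v \<in> S \<Longrightarrow> g v \<noteq> 0 \<Longrightarrow> \<exists>a\<in>A. h v a \<noteq> 0"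
  shows "(\<Sum>v\<in>S. wt (h v v) * g v) = 0"
proof -
  have finA: "finite A" using A finS finite_subset by blast
  have "(\<Sum>v\<in>S. wt (h v v) * g v) = (\<Sum>v\<in>S. wt (h (v + a) (v + a)) * g v)" if a: "a \<in> A" for a
  proof -
    have "bij_betw (\<lambda>v. v + a) S S"
      by (rule bij_betwI[where g = "\<lambda>v. v - a"]) (use A a in \<open>auto simp: subset_iff\<close>)
    from sum.reindex_bij_betw[OF this, of "\<lambda>v. wt (h v v) * g v"]
    have "(\<Sum>v\<in>S. wt (h v v) * g v) = (\<Sum>v\<in>S. wt (h (v + a) (v + a)) * g (v + a))" by simp
    also have "\<dots> = (\<Sum>v\<in>S. wt (h (v + a) (v + a)) * g v)" using g a by (intro sum.cong) auto
    finally show ?thesis .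
  qed
  then have "of_nat (card A) * (\<Sum>v\<in>S. wt (h v v) * g v) = (\<Sum>a\<in>A. \<Sum>v\<in>S. wt (h (v + a) (v + a)) * g v)"
    by (metis (no_types, lifting) sum.cong sum_constant)
  also have "\<dots> = (\<Sum>v\<in>S. (\<Sum>a\<in>A. wt (h (v + a) (v + a))) * g v)"
    by (subst sum.swap) (simp add: sum_distrib_right)
  also have "\<dots> = 0"
  proof (rule sum.neutral, rule ballI)
    fix v assume v: "v \<in> S"
    show "(\<Sum>a\<in>A. wt (h (v + a) (v + a))) * g v = 0"
      using nz[OF v] sum_wt_coset[OF A v] by (cases "g v = 0") auto
  qed
  finally show ?thesis using finA subsp_0[OF A(1)] by auto
qed

text \<open>One identity is averaged over all \<open>v\<close>: the left side does not depend on
  \<open>v\<close>, while Crapo's formula for \<open>orth (cyc v)\<close> writes it as a sum over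
  \<open>A\<close> of terms in \<open>ssum (cyc v) A\<close>. After the sums are exchanged, the
  terms with \<open>A \<noteq> {0}\<close> cancel.\<close>

theorem chi_recursion:
  assumes card: "card S = (q\<^sup>2) ^ n"
  shows "(- of_nat q) ^ n * rat_of_int (chi h \<Phi> S) =
    (\<Sum>v | v \<in> S \<and> cyc v \<inter> orth (cyc v) = {0}. wt (h v v) * rat_of_int (chi h \<Phi> (orth (cyc v))))"
proof -
  define nd where "nd = (\<lambda>N. N \<inter> orth N = {0})"
  define g where "g = (\<lambda>N. if nd N then rat_of_int (chi h \<Phi> (orth N)) else 0)"
  define As where "As = {A. A \<in> Sub \<Phi> S \<and> isotropic h A}"
  have finAs: "finite As" unfolding As_def using finite_Sub[OF finS] by simp
  have orth_ssum: "orth (ssum U W) = orth U \<inter> orth W" if "subsp U" "subsp W" "U \<subseteq> S" "W \<subseteq> S" for U W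
  proof
    show "orth (ssum U W) \<subseteq> orth U \<inter> orth W" using ssum_ge[OF that(1,2)] by (auto simp: orth_def)
    show "orth U \<inter> orth W \<subseteq> orth (ssum U W)"
      using that by (auto simp: orth_def ssum_def h_add_right subset_iff)
  qed
  have expand: "rat_of_int (chi h \<Phi> S) = (\<Sum>A\<in>As. rat_of_int (mob \<Phi> A) * g (ssum (cyc v) A))" if v: "v \<in> S" for v
  proof -
    note C = cyc_Sub[OF v] and D = orth_Sub[OF cyc_Sub[OF v]]
    have "chi h \<Phi> S = (\<Sum>A | A \<in> Sub \<Phi> S \<and> isotropic h A \<and> A \<inter> orth (cyc v) = {0}. mob \<Phi> A * chi h \<Phi> (S \<inter> orth (cyc v) \<inter> orth A))"
      by (rule chi_complement[OF S_Sub D])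
    also have "\<dots> = (\<Sum>A | A \<in> As \<and> A \<inter> orth (cyc v) = {0}. mob \<Phi> A * chi h \<Phi> (S \<inter> orth (cyc v) \<inter> orth A))"
      by (rule sum.cong) (auto simp: As_def)
    also have "\<dots> = (\<Sum>A\<in>As. if A \<inter> orth (cyc v) = {0} then mob \<Phi> A * chi h \<Phi> (S \<inter> orth (cyc v) \<inter> orth A) else 0)"
      using finAs by (simp add: sum.inter_filter)
    also have "rat_of_int \<dots> = (\<Sum>A\<in>As. rat_of_int (mob \<Phi> A) * g (ssum (cyc v) A))"
      unfolding of_int_sum
    proof (rule sum.cong[OF refl])
      fix A assume "A \<in> As"
      then have A: "A \<in> Sub \<Phi> S" "isotropic h A" by (auto simp: As_def)
      define N where "N = ssum (cyc v) A"
      have N: "N \<in> Sub \<Phi> S" unfolding N_def using ssum_Sub[OF C A(1)] SubD(2)[OF C] SubD(2)[OF A(1)] subS by auto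
      have oN: "orth N = orth (cyc v) \<inter> orth A"
        unfolding N_def using orth_ssum[OF SubD(1)[OF C] SubD(1)[OF A(1)]] SubD(2)[OF C] SubD(2)[OF A(1)] by auto
      have AN: "A \<subseteq> N" unfolding N_def using ssum_ge(2)[OF SubD(1)[OF C] SubD(1)[OF A(1)]] .
      have AA: "A \<subseteq> orth A" using A SubD(2)[OF A(1)] by (auto simp: isotropic_def orth_def)
      have inter: "S \<inter> orth (cyc v) \<inter> orth A = orth N" using orth_subset oN by auto
      \<comment> \<open>For nondegenerate \<open>N\<close> the condition on \<open>A\<close> holds
        automatically, and for degenerate \<open>N\<close> the factor \<open>chi\<close> vanishes by
        \<open>chi_radical\<close>; the condition is thereby absorbed into \<open>g\<close>.\<close>
      have "A \<inter> orth (cyc v) = {0}" if "nd N"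
      proof -
        have "A \<inter> orth (cyc v) \<subseteq> N \<inter> orth N" using AN AA oN by auto
        then show ?thesis using that subsp_0[OF SubD(1)[OF A(1)]] subsp_0[OF SubD(1)[OF D]] by (auto simp: nd_def)
      qed
      moreover have "chi h \<Phi> (orth N) = 0" if "\<not> nd N"
      proof (rule chi_radical[OF orth_Sub[OF N]])
        show "N \<inter> orth N \<in> Sub \<Phi> S" using Sub_Int[OF N orth_Sub[OF N]] by simp
        show "N \<inter> orth N \<noteq> {0}" using that by (simp add: nd_def)
        show "orth N \<subseteq> orth (N \<inter> orth N)" by (auto simp: orth_def)
      qed auto
      ultimately show "rat_of_int (if A \<inter> orth (cyc v) = {0} then mob \<Phi> A * chi h \<Phi> (S \<inter> orth (cyc v) \<inter> orth A) else 0)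
        = rat_of_int (mob \<Phi> A) * g (ssum (cyc v) A)"
        by (auto simp: g_def inter N_def[symmetric])
    qed
    finally show ?thesis .
  qed
  have vanish: "(\<Sum>v\<in>S. wt (h v v) * g (ssum (cyc v) A)) = 0" if "A \<in> As" "A \<noteq> {0}" for A
  proof -
    have A: "A \<in> Sub \<Phi> S" "isotropic h A" using that by (auto simp: As_def)
    show ?thesis
    proof (rule sum_wt_translation_invariant[OF SubD(1)[OF A(1)] SubD(2)[OF A(1)] A(2)])
      show "g (ssum (cyc (v + a)) A) = g (ssum (cyc v) A)" if "v \<in> S" "a \<in> A" for v a
        using ssum_cyc_translate[OF A(1) that] by simp
      \<comment> \<open>If \<open>v\<close> were orthogonal to \<open>A\<close>, then
        \<open>A\<close> would lie in the radical of \<open>ssum (cyc v) A\<close>, contrary to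
        \<open>g\<close> being nonzero there.\<close>
      show "\<exists>a\<in>A. h v a \<noteq> 0" if v: "v \<in> S" and nz: "g (ssum (cyc v) A) \<noteq> 0" for v
      proof (rule ccontr)
        assume "\<not> ?thesis"
        then have "v \<in> orth A" using v by (auto simp: orth_def)
        then have "cyc v \<subseteq> orth A" using cyc_least[OF orth_Sub[OF A(1)]] by blast
        moreover have AA: "A \<subseteq> orth A" using A SubD(2)[OF A(1)] by (auto simp: isotropic_def orth_def)
        ultimately have N: "ssum (cyc v) A \<subseteq> orth A"
          using ssum_least[OF SubD(1)[OF orth_Sub[OF A(1)]]] by blast
        note C = cyc_Sub[OF v]
        have AN: "A \<subseteq> ssum (cyc v) A" using ssum_ge(2)[OF SubD(1)[OF C] SubD(1)[OF A(1)]] .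
        have "A \<subseteq> orth (ssum (cyc v) A)"
        proof
          fix a assume a: "a \<in> A"
          have "h a z = 0" if "z \<in> ssum (cyc v) A" for z
          proof -
            have "z \<in> S" "h z a = 0" "a \<in> S" using N that a SubD(2)[OF A(1)] by (auto simp: orth_def)
            then show ?thesis using h_eq_0_sym by blast
          qed
          then show "a \<in> orth (ssum (cyc v) A)" using a SubD(2)[OF A(1)] by (auto simp: orth_def)
        qed
        moreover have "nd (ssum (cyc v) A)" using nz by (auto simp: g_def split: if_splits)
        ultimately have "A \<subseteq> {0}" using AN by (auto simp: nd_def)
        then show False using that(2) \<open>A \<noteq> {0}\<close> subsp_0[OF SubD(1)[OF A(1)]] by auto
      qed
    qed
  qed
  have zAs: "{0} \<in> As" using zero_Sub[OF S_Sub] by (auto simp: As_def isotropic_def)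
  have ss0: "ssum (cyc v) {0} = cyc v" for v by (auto simp: ssum_def)
  have "(- of_nat q) ^ n = (\<Sum>v\<in>S. wt (h v v))"
    using sum_wt_form[OF card, of 0] frob_0 by (simp add: wt_def)
  then have "(- of_nat q) ^ n * rat_of_int (chi h \<Phi> S) = (\<Sum>v\<in>S. wt (h v v) * rat_of_int (chi h \<Phi> S))"
    by (simp add: sum_distrib_right)
  also have "\<dots> = (\<Sum>v\<in>S. \<Sum>A\<in>As. rat_of_int (mob \<Phi> A) * (wt (h v v) * g (ssum (cyc v) A)))"
    by (rule sum.cong) (simp_all add: expand sum_distrib_left mult_ac)
  also have "\<dots> = (\<Sum>A\<in>As. rat_of_int (mob \<Phi> A) * (\<Sum>v\<in>S. wt (h v v) * g (ssum (cyc v) A)))"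
    by (subst sum.swap) (simp add: sum_distrib_left)
  also have "\<dots> = rat_of_int (mob \<Phi> {0}) * (\<Sum>v\<in>S. wt (h v v) * g (ssum (cyc v) {0}))"
    using vanish by (subst sum.remove[OF finAs zAs]) simp
  also have "\<dots> = (\<Sum>v\<in>S. wt (h v v) * g (cyc v))" by (simp only: mob_0 ss0 of_int_1 mult_1_left)
  also have "\<dots> = (\<Sum>v\<in>S. if nd (cyc v) then wt (h v v) * rat_of_int (chi h \<Phi> (orth (cyc v))) else 0)"
    by (rule sum.cong) (auto simp: g_def)
  also have "\<dots> = (\<Sum>v | v \<in> S \<and> nd (cyc v). wt (h v v) * rat_of_int (chi h \<Phi> (orth (cyc v))))"
    using finS by (simp add: sum.inter_filter)
  finally show ?thesis by (simp add: nd_def)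
qed

end

section \<open>Isometries\<close>

declare zero_fun_apply [simp del] plus_fun_apply [simp del] minus_apply [simp del] smul_apply [simp del]

text \<open>Isometric embeddings, extensional outside \<open>S\<close> so that maps agreeing on
  \<open>S\<close> are counted once. For a Hermitian space and \<open>T = S\<close> they form its
  unitary group.\<close>

definition isoms :: "('i \<Rightarrow> 'a::field) set \<Rightarrow> (('i \<Rightarrow> 'a) \<Rightarrow> ('i \<Rightarrow> 'a) \<Rightarrow> 'a) \<Rightarrow> ('j \<Rightarrow> 'a) set \<Rightarrow>
    (('j \<Rightarrow> 'a) \<Rightarrow> ('j \<Rightarrow> 'a) \<Rightarrow> 'a) \<Rightarrow> (('i \<Rightarrow> 'a) \<Rightarrow> ('j \<Rightarrow> 'a)) set" where
  "isoms S h T k = {f \<in> S \<rightarrow>\<^sub>E T. (\<forall>x\<in>S. \<forall>y\<in>S. f (x + y) = f x + f y) \<and>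
     (\<forall>a. \<forall>x\<in>S. f (smul a x) = smul a (f x)) \<and> (\<forall>x\<in>S. \<forall>y\<in>S. k (f x) (f y) = h x y)}"

lemma isomsD:
  assumes "f \<in> isoms S h T k"
  shows "x \<in> S \<Longrightarrow> f x \<in> T" "x \<in> S \<Longrightarrow> y \<in> S \<Longrightarrow> f (x + y) = f x + f y"
    "x \<in> S \<Longrightarrow> f (smul a x) = smul a (f x)" "x \<in> S \<Longrightarrow> y \<in> S \<Longrightarrow> k (f x) (f y) = h x y"
    "f \<in> extensional S" "f \<in> S \<rightarrow>\<^sub>E T"
  using assms by (auto simp: isoms_def PiE_def)

lemma isomsI:
  assumes "f \<in> S \<rightarrow>\<^sub>E T" "\<And>x y. x \<in> S \<Longrightarrow> y \<in> S \<Longrightarrow> f (x + y) = f x + f y"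
    "\<And>a x. x \<in> S \<Longrightarrow> f (smul a x) = smul a (f x)" "\<And>x y. x \<in> S \<Longrightarrow> y \<in> S \<Longrightarrow> k (f x) (f y) = h x y"
  shows "f \<in> isoms S h T k"
  using assms by (auto simp: isoms_def)

lemma isoms_0: "f \<in> isoms S h T k \<Longrightarrow> subsp S \<Longrightarrow> f 0 = 0"
  using isomsD(2)[of f S h T k 0 0] subsp_0[of S] by simp

lemma isoms_sum:
  assumes f: "f \<in> isoms S h T k" and S: "subsp S" and x: "\<And>i. i \<in> I \<Longrightarrow> x i \<in> S"
  shows "f (\<Sum>i\<in>I. x i) = (\<Sum>i\<in>I. f (x i))"
  using x by (induction I rule: infinite_finite_induct)
    (simp_all add: isoms_0[OF f S] isomsD(2)[OF f] subsp_sum[OF S])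

lemma finite_isoms: "finite S \<Longrightarrow> finite T \<Longrightarrow> finite (isoms S h T k)"
  by (rule finite_subset[of _ "S \<rightarrow>\<^sub>E T"]) (auto simp: isoms_def intro: finite_PiE)

lemma isoms_inj:
  assumes "hermitian_space q S h" "hermitian_space q T k" and f: "f \<in> isoms S h T k"
  shows "inj_on f S"
proof -
  interpret S: hermitian_space q S h by fact
  interpret T: hermitian_space q T k by fact
  show ?thesis
  proof (rule inj_onI)
    fix x y assume x: "x \<in> S" "y \<in> S" "f x = f y"
    have "x - y = 0"
    proof (rule S.nondeg)
      fix z assume z: "z \<in> S"
      have "h x z = h y z" using isomsD(4)[OF f x(1) z] isomsD(4)[OF f x(2) z] x(3) by simp
      then show "h (x - y) z = 0" using x z by (simp add: S.h_diff_left)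
    qed (use x in simp)
    then show "x = y" by simp
  qed
qed

lemma isoms_bij:
  assumes "hermitian_space q S h" "hermitian_space q T k" and f: "f \<in> isoms S h T k" and "card S = card T"
  shows "bij_betw f S T"
proof -
  interpret T: hermitian_space q T k by fact
  have inj: "inj_on f S" by (rule isoms_inj) fact+
  have "f ` S = T" using isomsD(1)[OF f] card_image[OF inj] assms(4) T.finS by (intro card_subset_eq) auto
  then show ?thesis using inj by (simp add: bij_betw_def)
qed

lemma isoms_compose:
  "f \<in> isoms S h T k \<Longrightarrow> g \<in> isoms T k U l \<Longrightarrow> subsp S \<Longrightarrow> compose S g f \<in> isoms S h U l"
  by (rule isomsI) (auto simp: compose_def isomsD subsp_add subsp_smul)

lemma isoms_inv:
  assumes f: "f \<in> isoms S h T k" and bij: "bij_betw f S T" and S: "subsp S" and T: "subsp T"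
  shows "restrict (inv_into S f) T \<in> isoms T k S h"
proof (rule isomsI)
  let ?g = "inv_into S f"
  have g: "?g y \<in> S" "f (?g y) = y" if "y \<in> T" for y
    using that bij by (auto simp: bij_betw_def inv_into_into f_inv_into_f)
  have gf: "?g (f x) = x" if "x \<in> S" for x using that bij by (auto simp: bij_betw_def inv_into_f_f)
  show "restrict ?g T \<in> T \<rightarrow>\<^sub>E S" using g by auto
  fix x y a assume x: "x \<in> T" and y: "y \<in> T"
  have "?g (x + y) = ?g (f (?g x + ?g y))" using isomsD(2)[OF f] g x y by simp
  then show "restrict ?g T (x + y) = restrict ?g T x + restrict ?g T y"
    using x y T S g gf by (simp add: subsp_add)
  show "h (restrict ?g T x) (restrict ?g T y) = k x y"
    using isomsD(4)[OF f g(1)[OF x] g(1)[OF y]] x y g by simp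
next
  let ?g = "inv_into S f"
  have g: "?g y \<in> S" "f (?g y) = y" if "y \<in> T" for y
    using that bij by (auto simp: bij_betw_def inv_into_into f_inv_into_f)
  have gf: "?g (f x) = x" if "x \<in> S" for x using that bij by (auto simp: bij_betw_def inv_into_f_f)
  fix x a assume x: "x \<in> T"
  have "?g (smul a x) = ?g (f (smul a (?g x)))" using isomsD(3)[OF f] g x by simp
  then show "restrict ?g T (smul a x) = smul a (restrict ?g T x)"
    using x T S g gf by (simp add: subsp_smul)
qed

lemma isoms_mono: "f \<in> isoms S h T k \<Longrightarrow> T \<subseteq> U \<Longrightarrow> f \<in> isoms S h U k"
  by (auto simp: isoms_def)

lemma isoms_eqI:
  assumes "f \<in> isoms S h T k" "g \<in> isoms S h T' k'" "\<And>x. x \<in> S \<Longrightarrow> f x = g x"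
  shows "f = g"
  using assms isomsD(5) by (metis extensionalityI)

context hermitian_space
begin

lemma form_expand:
  assumes "e \<in> S" "x \<in> S" "y \<in> S"
  shows "h (smul a e + x) (smul b e + y) = a * b ^ q * h e e + a * h e y + b ^ q * h x e + h x y"
  using assms by (simp add: h_add_left h_add_right h_smul_left h_smul_right algebra_simps)

text \<open>Gram-Schmidt: the projection to the part of \<open>N\<close> orthogonal to a unit vector
  \<open>e\<close> is corrected by the component along \<open>e\<close>.\<close>

lemma orth_projection:
  assumes "hermitian_space q N h" "N \<subseteq> S" "x \<in> S"
  shows "\<exists>a\<in>N. x - a \<in> orth N"
proof -
  \<comment> \<open>The number is a dummy; the containment in \<open>S\<close> belongs to the
    predicate because it has to be handed down to the smaller space.\<close>
  have "\<exists>n::nat. (N \<subseteq> S \<longrightarrow> (\<forall>x\<in>S. \<exists>a\<in>N. \<forall>u\<in>N. h (x - a) u = 0))"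
  proof (induction rule: hermitian_induct[OF assms(1)])
    case 1 then show ?case by simp
  next
    case (2 n N e)
    interpret N: hermitian_space q N h by fact
    show ?case
    proof (intro impI ballI)
      fix x assume N: "N \<subseteq> S" and x: "x \<in> S"
      have "N.orth {e} \<subseteq> S" using N N.orth_subset by blast
      then obtain a where a: "a \<in> N.orth {e}" "\<And>u. u \<in> N.orth {e} \<Longrightarrow> h (x - a) u = 0" using 2(5) x by blast
      have aN: "a \<in> N" "h a e = 0" using a by (auto simp: N.orth_def)
      define a' where "a' = a + smul (h x e) e"
      have a': "a' \<in> N" using aN 2(2) by (simp add: a'_def)
      have S: "a \<in> S" "e \<in> S" "a' \<in> S" using aN a' 2(2) N by auto
      have xe: "h (x - a') e = 0" using S x aN 2(3) by (simp add: a'_def h_diff_left h_add_left h_smul_left)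
      have "h (x - a') u = 0" if u: "u \<in> N" for u
      proof -
        have "u \<in> (\<lambda>(a, x). smul a e + x) ` (UNIV \<times> N.orth {e})"
          using N.split_unit_vector(2)[OF 2(2,3)] u by (simp add: bij_betw_def)
        then obtain c u' where u': "u = smul c e + u'" "u' \<in> N.orth {e}" by auto
        have uN: "u' \<in> N" "h u' e = 0" using u' by (auto simp: N.orth_def)
        then have "h e u' = 0" using N.h_eq_0_sym 2(2) by blast
        then have "h (x - a') u' = 0" using a(2)[OF u'(2)] S x uN N by (auto simp: a'_def h_diff_left h_add_left h_smul_left)
        then show ?thesis using xe u' uN S x N by (auto simp: h_add_right h_smul_right)
      qed
      then show "\<exists>a\<in>N. \<forall>u\<in>N. h (x - a) u = 0" using a' by blast
    qed
  qed
  then obtain a where "a \<in> N" "\<forall>u\<in>N. h (x - a) u = 0" using assms by blast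
  then show ?thesis using assms by (intro bexI[of _ a]) (auto simp: orth_def)
qed

lemma orth_Int:
  assumes "hermitian_space q N h" "N \<subseteq> S"
  shows "N \<inter> orth N = {0}"
proof -
  interpret N: hermitian_space q N h by fact
  show ?thesis using N.nondeg subsp_0[OF N.subS] subsp_0[OF subsp_orth[OF assms(2)]] by (auto simp: orth_def)
qed

lemma orth_split:
  assumes N: "hermitian_space q N h" "N \<subseteq> S"
  shows "bij_betw (\<lambda>(a, y). a + y) (N \<times> orth N) S"
proof (rule bij_betw_imageI)
  interpret N: hermitian_space q N h by fact
  note sub = subsp_orth[OF N(2)]
  show "inj_on (\<lambda>(a, y). a + y) (N \<times> orth N)"
  proof (rule inj_onI, clarify)
    fix a y b z assume a: "a \<in> N" "y \<in> orth N" "b \<in> N" "z \<in> orth N" "a + y = b + z"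
    then have "a - b = z - y" by (simp add: algebra_simps)
    moreover have "a - b \<in> N" "z - y \<in> orth N" using a subsp_diff[OF N.subS] subsp_diff[OF sub] by auto
    ultimately have "a - b \<in> N \<inter> orth N" by simp
    then have "a - b = 0" using orth_Int[OF N] by blast
    then have "a = b" by simp
    then show "a = b \<and> y = z" using a(5) by simp
  qed
  show "(\<lambda>(a, y). a + y) ` (N \<times> orth N) = S"
  proof (intro equalityI subsetI)
    fix x assume x: "x \<in> S"
    obtain a where "a \<in> N" "x - a \<in> orth N" using orth_projection[OF N x] by blast
    then show "x \<in> (\<lambda>(a, y). a + y) ` (N \<times> orth N)" by (intro image_eqI[of _ _ "(a, x - a)"]) auto
  qed (use N orth_subset in \<open>auto simp: subset_iff\<close>)
qed

lemma orth_hermitian: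
  assumes N: "hermitian_space q N h" "N \<subseteq> S"
  shows "hermitian_space q (orth N) h"
proof (rule nondeg_subspace[OF subsp_orth[OF N(2)] orth_subset])
  have "x = 0" if x: "x \<in> orth N" "x \<in> orth (orth N)" for x
  proof (rule nondeg)
    show xS: "x \<in> S" using x orth_subset by blast
    fix y assume "y \<in> S"
    then have "y \<in> (\<lambda>(a, y). a + y) ` (N \<times> orth N)" using orth_split[OF N] by (simp add: bij_betw_def)
    then obtain a b where y: "y = a + b" "a \<in> N" "b \<in> orth N" by auto
    then have "a \<in> S" "b \<in> S" using N orth_subset by auto
    then show "h x y = 0" using x xS y by (auto simp: h_add_right orth_def)
  qed
  then show "orth N \<inter> orth (orth N) = {0}"
    using subsp_0[OF subsp_orth[OF N(2)]] subsp_0[OF subsp_orth[OF orth_subset]] by auto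
qed

lemma card_orth:
  assumes N: "hermitian_space q N h" "N \<subseteq> S" and n: "card S = (q\<^sup>2) ^ n" and m: "card N = (q\<^sup>2) ^ m"
  shows "m \<le> n" "card (orth N) = (q\<^sup>2) ^ (n - m)"
proof -
  interpret O: hermitian_space q "orth N" h by (rule orth_hermitian[OF N])
  obtain k where k: "card (orth N) = (q\<^sup>2) ^ k" using O.dimension by blast
  have "(q\<^sup>2) ^ m * (q\<^sup>2) ^ k = (q\<^sup>2) ^ n" 
    using bij_betw_same_card[OF orth_split[OF N]] by (simp add: card_cartesian_product n m k)
  then have "q ^ (2 * (m + k)) = q ^ (2 * n)" by (simp add: power_mult power_add[symmetric] flip: power_mult)
  then have "m + k = n" using q_ge_2 by simp
  then show "m \<le> n" "card (orth N) = (q\<^sup>2) ^ (n - m)" using k by auto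
qed

end

text \<open>Hermitian spaces over a finite field have no invariant besides the dimension: unit
  vectors exist in every nonzero one and are split off on both sides in parallel.\<close>

lemma exists_isom:
  fixes h :: "('i \<Rightarrow> 'a::{field,finite}) \<Rightarrow> ('i \<Rightarrow> 'a) \<Rightarrow> 'a" and k :: "('j \<Rightarrow> 'a) \<Rightarrow> ('j \<Rightarrow> 'a) \<Rightarrow> 'a"
  assumes S: "hermitian_space q S h" and T: "hermitian_space q T k" and card: "card S = card T"
  shows "\<exists>f. f \<in> isoms S h T k"
proof -
  interpret S: hermitian_space q S h by fact
  have "\<exists>n. card S = (q\<^sup>2) ^ n \<and> (\<forall>T. hermitian_space q T k \<longrightarrow> card T = card S \<longrightarrow> (\<exists>f. f \<in> isoms S h T k))"
  proof (induction rule: hermitian_induct[OF S])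
    case 1
    have "(\<lambda>x\<in>{0}. 0) \<in> isoms {0} h T k" if "hermitian_space q T k" for T
    proof -
      interpret T: hermitian_space q T k by fact
      have "h 0 0 = 0" "k 0 0 = 0" using S.h_0_left[of 0] T.h_0_left[of 0] by (auto simp: subsp_0[OF S.subS] subsp_0[OF T.subS])
      then show ?thesis by (intro isomsI) auto
    qed
    then show ?case by auto
  next
    case (2 n U e)
    interpret U: hermitian_space q U h by fact
    note bijU = U.split_unit_vector(2)[OF 2(2,3)]
    have cU: "card U = CARD('a) * card (U.orth {e})" using bij_betw_same_card[OF bijU]
      by (simp add: card_cartesian_product)
    then have "card U = (q\<^sup>2) ^ Suc n" using 2(5) S.card_field by simp
    moreover have "\<exists>f. f \<in> isoms U h T k" if T: "hermitian_space q T k" "card T = card U" for T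
    proof -
      interpret T: hermitian_space q T k by fact
      have "e \<noteq> 0" using 2(2,3) U.h_0_left[of e] by auto
      then have "card {0, e} \<le> card U" using U.finS 2(2) by (intro card_mono) auto
      then have "T \<noteq> {0}" using T(2) \<open>e \<noteq> 0\<close> by auto
      then obtain e' where e': "e' \<in> T" "k e' e' = 1" using T.exists_unit_vector by blast
      have "card T = CARD('a) * card (T.orth {e'})" using bij_betw_same_card[OF T.split_unit_vector(2)[OF e']]
        by (simp add: card_cartesian_product)
      then have "card (T.orth {e'}) = card (U.orth {e})" using cU T(2) by simp
      then obtain f where f: "f \<in> isoms (U.orth {e}) h (T.orth {e'}) k"
        using 2(5) T.split_unit_vector(1)[OF e'] by blast
      have proj: "x - smul (h x e) e \<in> U.orth {e}" if "x \<in> U" for x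
        using that 2(2,3) by (simp add: U.orth_def U.h_diff_left U.h_smul_left)
      define r where "r = (\<lambda>x. x - smul (h x e) e)"
      have r: "r x \<in> U.orth {e}" if "x \<in> U" for x using proj[OF that] by (simp add: r_def)
      have fT: "f y \<in> T" "k (f y) e' = 0" "k e' (f y) = 0" if "y \<in> U.orth {e}" for y
        using isomsD(1)[OF f that] T.h_eq_0_sym[of "f y" e'] e' by (auto simp: T.orth_def)
      define g where "g = (\<lambda>x\<in>U. smul (h x e) e' + f (r x))"
      have "g \<in> isoms U h T k"
      proof (rule isomsI)
        show "g \<in> U \<rightarrow>\<^sub>E T" using fT(1) r e' by (auto simp: g_def)
      next
        fix x y assume x: "x \<in> U" "y \<in> U"
        have "r (x + y) = r x + r y" using x 2(2) by (simp add: r_def U.h_add_left smul_add algebra_simps)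
        then show "g (x + y) = g x + g y"
          using x r 2(2) by (simp add: g_def U.h_add_left smul_add isomsD(2)[OF f] algebra_simps)
        have "x = smul (h x e) e + r x" "y = smul (h y e) e + r y" by (simp_all add: r_def)
        moreover have "r x \<in> U" "r y \<in> U" "h (r x) e = 0" "h (r y) e = 0" using r[OF x(1)] r[OF x(2)] by (auto simp: U.orth_def)
        moreover have "h e (r y) = 0" using U.h_eq_0_sym 2(2) calculation by blast
        ultimately have "h x y = h x e * h y e ^ q + h (r x) (r y)"
          using 2(2,3) U.form_expand[of e "r x" "r y" "h x e" "h y e"] by simp
        moreover have "k (g x) (g y) = h x e * h y e ^ q + k (f (r x)) (f (r y))"
          using x r fT e' by (simp add: g_def T.h_add_left T.h_add_right T.h_smul_left T.h_smul_right)
        ultimately show "k (g x) (g y) = h x y" using isomsD(4)[OF f r[OF x(1)] r[OF x(2)]] by simp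
      next
        fix a x assume x: "x \<in> U"
        have "r (smul a x) = smul a (r x)" using x 2(2) by (simp add: r_def U.h_smul_left smul_diff)
        then show "g (smul a x) = smul a (g x)"
          using x r 2(2) by (simp add: g_def U.h_smul_left smul_add isomsD(3)[OF f])
      qed
      then show ?thesis by blast
    qed
    ultimately show ?case by blast
  qed
  then show ?thesis using T card by metis
qed


section \<open>Gluing isometries along an orthogonal decomposition\<close>

context hermitian_space
begin

definition proj :: "('i \<Rightarrow> 'a) set \<Rightarrow> ('i \<Rightarrow> 'a) \<Rightarrow> ('i \<Rightarrow> 'a)" where
  "proj N x = (SOME a. a \<in> N \<and> x - a \<in> orth N)"

lemma proj:
  assumes N: "hermitian_space q N h" "N \<subseteq> S" and x: "x \<in> S"
  shows "proj N x \<in> N" "x - proj N x \<in> orth N"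
proof -
  have "\<exists>a. a \<in> N \<and> x - a \<in> orth N" using orth_projection[OF N x] by blast
  then have "proj N x \<in> N \<and> x - proj N x \<in> orth N" unfolding proj_def by (rule someI_ex)
  then show "proj N x \<in> N" "x - proj N x \<in> orth N" by auto
qed

lemma proj_eqI:
  assumes N: "hermitian_space q N h" "N \<subseteq> S" and a: "a \<in> N" "y \<in> orth N"
  shows "proj N (a + y) = a"
proof -
  have "a + y \<in> S" using a N orth_subset by (auto simp: subset_iff)
  note p = proj[OF N this]
  have "inj_on (\<lambda>(a, y). a + y) (N \<times> orth N)" using orth_split[OF N] by (simp add: bij_betw_def)
  from inj_onD[OF this, of "(proj N (a + y), a + y - proj N (a + y))" "(a, y)"] p a show ?thesis by simp
qed

definition glue :: "('i \<Rightarrow> 'a) set \<Rightarrow> (('i \<Rightarrow> 'a) \<Rightarrow> ('j \<Rightarrow> 'a)) \<Rightarrow> (('i \<Rightarrow> 'a) \<Rightarrow> ('j \<Rightarrow> 'a)) \<Rightarrow> ('i \<Rightarrow> 'a) \<Rightarrow> ('j \<Rightarrow> 'a)" where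
  "glue N f g = (\<lambda>x\<in>S. f (proj N x) + g (x - proj N x))"

context
  fixes N
  assumes N: "hermitian_space q N h" "N \<subseteq> S"
begin

lemma zero_N: "0 \<in> N" "0 \<in> orth N"
  using hermitian_space.subS[OF N(1)] subsp_orth[OF N(2)] by (auto intro: subsp_0)

lemma glue_apply: "a \<in> N \<Longrightarrow> y \<in> orth N \<Longrightarrow> glue N f g (a + y) = f a + g y"
  using N orth_subset proj_eqI[OF N, of a y] by (auto simp: glue_def subset_iff)

lemma decomp: "x \<in> S \<Longrightarrow> \<exists>a\<in>N. \<exists>y\<in>orth N. x = a + y"
proof -
  assume "x \<in> S"
  then have "x = proj N x + (x - proj N x)" "proj N x \<in> N" "x - proj N x \<in> orth N" using proj[OF N] by auto
  then show ?thesis by blast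
qed

lemma isom_decomp_eqI:
  assumes F: "F \<in> isoms S h T k" and G: "G \<in> isoms S h T' k'"
    and "\<And>x. x \<in> N \<Longrightarrow> F x = G x" "\<And>x. x \<in> orth N \<Longrightarrow> F x = G x"
  shows "F = G"
proof (rule isoms_eqI[OF F G])
  fix x assume "x \<in> S"
  then obtain a y where x: "x = a + y" "a \<in> N" "y \<in> orth N" using decomp by blast
  then have "a \<in> S" "y \<in> S" using N orth_subset by auto
  then show "F x = G x" using x assms by (simp add: isomsD(2)[OF F] isomsD(2)[OF G])
qed

lemma glue_restrict:
  assumes f: "f \<in> isoms N h T k" and g: "g \<in> isoms (orth N) h U k"
  shows "x \<in> N \<Longrightarrow> glue N f g x = f x" "x \<in> orth N \<Longrightarrow> glue N f g x = g x"
proof -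
  have f0: "f 0 = 0" using isoms_0[OF f] hermitian_space.subS[OF N(1)] by blast
  have g0: "g 0 = 0" using isoms_0[OF g] subsp_orth[OF N(2)] by blast
  show "glue N f g x = f x" if "x \<in> N"
    using glue_apply[OF that zero_N(2), of f g] by (simp add: g0)
  show "glue N f g x = g x" if "x \<in> orth N"
    using glue_apply[OF zero_N(1) that, of f g] by (simp add: f0)
qed

lemma glue_isoms:
  assumes T: "hermitian_space q T k"
    and f: "f \<in> isoms N h T k" and g: "g \<in> isoms (orth N) h (hermitian_space.orth T k (f ` N)) k"
  shows "glue N f g \<in> isoms S h T k"
proof -
  interpret T: hermitian_space q T k by fact
  note sN = hermitian_space.subS[OF N(1)] and sO = subsp_orth[OF N(2)]
  have fT: "f x \<in> T" if "x \<in> N" for x using isomsD(1)[OF f that] .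
  have gT: "g x \<in> T" "k (g x) (f y) = 0" "k (f y) (g x) = 0" if "x \<in> orth N" "y \<in> N" for x y
  proof -
    show "g x \<in> T" "k (g x) (f y) = 0" using isomsD(1)[OF g that(1)] that(2) by (auto simp: T.orth_def)
    then show "k (f y) (g x) = 0" using T.h_eq_0_sym fT[OF that(2)] by blast
  qed
  have gT': "g x \<in> T" if "x \<in> orth N" for x using gT(1)[OF that zero_N(1)] .
  have zero: "h a y = 0" "h y a = 0" if "a \<in> N" "y \<in> orth N" for a y
    using that N h_eq_0_sym[of a y] by (auto simp: orth_def)
  show ?thesis
  proof (rule isomsI)
    show "glue N f g \<in> S \<rightarrow>\<^sub>E T"
    proof
      fix x assume "x \<in> S"
      then obtain a y where x: "x = a + y" "a \<in> N" "y \<in> orth N" using decomp by blast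
      then show "glue N f g x \<in> T" using fT gT' by (simp add: glue_apply)
    qed (simp add: glue_def)
  next
    fix x x' assume "x \<in> S" "x' \<in> S"
    then obtain a y a' y' where x: "x = a + y" "a \<in> N" "y \<in> orth N" "x' = a' + y'" "a' \<in> N" "y' \<in> orth N"
      using decomp by meson
    have "x + x' = (a + a') + (y + y')" using x by (simp add: algebra_simps)
    then have "glue N f g (x + x') = f (a + a') + g (y + y')"
      using x by (simp only: glue_apply subsp_add[OF sN] subsp_add[OF sO])
    also have "\<dots> = glue N f g x + glue N f g x'"
      using x by (simp add: glue_apply isomsD(2)[OF f] isomsD(2)[OF g] algebra_simps)
    finally show "glue N f g (x + x') = glue N f g x + glue N f g x'" .
    have S: "a \<in> S" "a' \<in> S" "y \<in> S" "y' \<in> S" using x N orth_subset by auto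
    have "k (glue N f g x) (glue N f g x') = k (f a) (f a') + k (g y) (g y')"
      using x by (simp add: glue_apply T.h_add_left T.h_add_right fT gT gT')
    also have "\<dots> = h a a' + h y y'" using x isomsD(4)[OF f] isomsD(4)[OF g] by simp
    also have "\<dots> = h x x'" using x S zero by (simp add: h_add_left h_add_right)
    finally show "k (glue N f g x) (glue N f g x') = h x x'" .
  next
    fix c x assume "x \<in> S"
    then obtain a y where x: "x = a + y" "a \<in> N" "y \<in> orth N" using decomp by blast
    then have "glue N f g (smul c x) = f (smul c a) + g (smul c y)"
      by (simp only: smul_add glue_apply subsp_smul[OF sN] subsp_smul[OF sO])
    then show "glue N f g (smul c x) = smul c (glue N f g x)"
      using x by (simp add: glue_apply isomsD(3)[OF f] isomsD(3)[OF g] smul_add)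
  qed
qed

lemma restrict_orth_isoms:
  assumes T: "hermitian_space q T k" and F: "F \<in> isoms S h T k"
  shows "restrict F N \<in> isoms N h T k"
    "restrict F (orth N) \<in> isoms (orth N) h (hermitian_space.orth T k (F ` N)) k"
proof -
  interpret T: hermitian_space q T k by fact
  note sN = hermitian_space.subS[OF N(1)] and sO = subsp_orth[OF N(2)]
  have NS: "x \<in> S" if "x \<in> N" for x using that N by auto
  have OS: "x \<in> S" if "x \<in> orth N" for x using that orth_subset by auto
  show "restrict F N \<in> isoms N h T k"
    by (rule isomsI) (auto simp: isomsD[OF F] NS subsp_add[OF sN] subsp_smul[OF sN])
  show "restrict F (orth N) \<in> isoms (orth N) h (hermitian_space.orth T k (F ` N)) k"
  proof (rule isomsI)
    show "restrict F (orth N) \<in> orth N \<rightarrow>\<^sub>E T.orth (F ` N)"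
    proof
      fix x assume x: "x \<in> orth N"
      have "k (F x) (F u) = 0" if "u \<in> N" for u
        using isomsD(4)[OF F OS[OF x] NS[OF that]] x that by (simp add: orth_def)
      then show "restrict F (orth N) x \<in> T.orth (F ` N)" using x isomsD(1)[OF F OS[OF x]] by (auto simp: T.orth_def)
    qed simp
  qed (auto simp: isomsD[OF F] OS subsp_add[OF sO] subsp_smul[OF sO])
qed

text \<open>An isometric embedding of \<open>S\<close> amounts to one of \<open>N\<close> together
  with one of its complement into the complement of the image. With \<open>exists_isom\<close> this
  does the work of Witt's theorem in counting embeddings.\<close>

lemma bij_glue:
  assumes T: "hermitian_space q T k"
  shows "bij_betw (\<lambda>(f, g). glue N f g)
    (SIGMA f:isoms N h T k. isoms (orth N) h (hermitian_space.orth T k (f ` N)) k) (isoms S h T k)"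
proof (rule bij_betw_imageI)
  show "inj_on (\<lambda>(f, g). glue N f g) (SIGMA f:isoms N h T k. isoms (orth N) h (hermitian_space.orth T k (f ` N)) k)"
  proof (rule inj_onI, clarify)
    fix f g f' g'
    assume f: "f \<in> isoms N h T k" and g: "g \<in> isoms (orth N) h (hermitian_space.orth T k (f ` N)) k"
      and f': "f' \<in> isoms N h T k" and g': "g' \<in> isoms (orth N) h (hermitian_space.orth T k (f' ` N)) k"
      and eq: "glue N f g = glue N f' g'"
    have "f = f'" by (rule isoms_eqI[OF f f']) (metis eq glue_restrict(1) f g f' g')
    moreover have "g = g'" by (rule isoms_eqI[OF g g']) (metis eq glue_restrict(2) f g f' g')
    ultimately show "f = f' \<and> g = g'" by simp
  qed
  show "(\<lambda>(f, g). glue N f g) ` (SIGMA f:isoms N h T k. isoms (orth N) h (hermitian_space.orth T k (f ` N)) k) = isoms S h T k"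
  proof (intro equalityI subsetI)
    fix F assume F: "F \<in> isoms S h T k"
    have im: "restrict F N ` N = F ` N" by (simp add: image_restrict_eq)
    note R = restrict_orth_isoms[OF T F]
    have R2: "restrict F (orth N) \<in> isoms (orth N) h (hermitian_space.orth T k (restrict F N ` N)) k"
      using R(2) by (simp only: im)
    have "glue N (restrict F N) (restrict F (orth N)) = F"
      by (rule isom_decomp_eqI[OF glue_isoms[OF T R(1) R2] F]) (simp_all add: glue_restrict[OF R(1) R2])
    then show "F \<in> (\<lambda>(f, g). glue N f g) ` (SIGMA f:isoms N h T k. isoms (orth N) h (hermitian_space.orth T k (f ` N)) k)"
      using R(1) R2 by (intro image_eqI[of _ _ "(restrict F N, restrict F (orth N))"]) auto
  qed (use glue_isoms[OF T] in auto)
qed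

end

end

section \<open>Standard Hermitian spaces and the number of isometric embeddings\<close>

lemma isoms_image_hermitian:
  assumes S: "hermitian_space q S h" and T: "hermitian_space q T k" and f: "f \<in> isoms S h T k"
  shows "hermitian_space q (f ` S) k" "f ` S \<subseteq> T" "card (f ` S) = card S"
proof -
  interpret S: hermitian_space q S h by fact
  interpret T: hermitian_space q T k by fact
  show sub: "f ` S \<subseteq> T" using isomsD(1)[OF f] by auto
  show "card (f ` S) = card S" by (rule card_image[OF isoms_inj[OF S T f]])
  show "hermitian_space q (f ` S) k"
  proof (rule T.nondeg_subspace[OF _ sub])
    show s: "subsp (f ` S)"
      unfolding subsp_def
    proof (intro conjI ballI allI)
      show "0 \<in> f ` S" using isoms_0[OF f S.subS] subsp_0[OF S.subS] by (metis image_eqI)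
      show "x + y \<in> f ` S" if xy: "x \<in> f ` S" "y \<in> f ` S" for x y
      proof -
        obtain u v where "x = f u" "y = f v" "u \<in> S" "v \<in> S" using xy by blast
        then show ?thesis using isomsD(2)[OF f, of u v] by (metis S.S_closed(2) image_eqI)
      qed
      show "smul a x \<in> f ` S" if x: "x \<in> f ` S" for a x
      proof -
        obtain u where "x = f u" "u \<in> S" using x by blast
        then show ?thesis using isomsD(3)[OF f, of u a] by (metis S.S_closed(3) image_eqI)
      qed
    qed
    have "x = 0" if x: "x \<in> S" "f x \<in> T.orth (f ` S)" for x
      by (rule S.nondeg[OF x(1)]) (use x isomsD(4)[OF f] in \<open>auto simp: T.orth_def\<close>)
    then show "f ` S \<inter> T.orth (f ` S) = {0}"
      using subsp_0[OF s] subsp_0[OF T.subsp_orth[OF sub]] isoms_0[OF f S.subS] by auto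
  qed
qed

lemma card_isoms_le:
  fixes S :: "('i \<Rightarrow> 'a::{field,finite}) set" and S' :: "('i' \<Rightarrow> 'a) set"
    and T :: "('j \<Rightarrow> 'a) set" and T' :: "('j' \<Rightarrow> 'a) set"
  assumes S: "hermitian_space q S h" and S': "hermitian_space q S' h'" and c: "card S = card S'"
    and T: "hermitian_space q T k" and T': "hermitian_space q T' k'" and c': "card T = card T'"
  shows "card (isoms S h T k) \<le> card (isoms S' h' T' k')"
proof -
  interpret S: hermitian_space q S h by fact
  interpret S': hermitian_space q S' h' by fact
  interpret T: hermitian_space q T k by fact
  interpret T': hermitian_space q T' k' by fact
  obtain a where a: "a \<in> isoms S' h' S h" using exists_isom[OF S' S] c by auto
  obtain b where b: "b \<in> isoms T k T' k'" using exists_isom[OF T T' c'] by auto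
  have aS: "a ` S' = S" using isoms_bij[OF S' S a] c by (simp add: bij_betw_def)
  have binj: "inj_on b T" by (rule isoms_inj[OF T T' b])
  show ?thesis
  proof (rule card_inj_on_le[where f = "\<lambda>f. compose S' (compose S b f) a"])
    show "inj_on (\<lambda>f. compose S' (compose S b f) a) (isoms S h T k)"
    proof (rule inj_onI)
      fix f g assume f: "f \<in> isoms S h T k" and g: "g \<in> isoms S h T k"
        and eq: "compose S' (compose S b f) a = compose S' (compose S b g) a"
      show "f = g"
      proof (rule isoms_eqI[OF f g])
        fix x assume x: "x \<in> S"
        then obtain y where y: "y \<in> S'" "x = a y" using aS by blast
        then have "b (f x) = b (g x)" using fun_cong[OF eq, of y] x by (simp add: compose_def)
        then show "f x = g x" using inj_onD[OF binj] isomsD(1)[OF f x] isomsD(1)[OF g x] by blast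
      qed
    qed
    show "(\<lambda>f. compose S' (compose S b f) a) ` isoms S h T k \<subseteq> isoms S' h' T' k'"
      using isoms_compose[OF a isoms_compose[OF _ b S.subS] S'.subS] by auto
    show "finite (isoms S' h' T' k')" by (rule finite_isoms[OF S'.finS T'.finS])
  qed
qed

lemma card_isoms_cong:
  fixes S :: "('i \<Rightarrow> 'a::{field,finite}) set" and S' :: "('i' \<Rightarrow> 'a) set"
    and T :: "('j \<Rightarrow> 'a) set" and T' :: "('j' \<Rightarrow> 'a) set"
  assumes S: "hermitian_space q S h" and S': "hermitian_space q S' h'" and c: "card S = card S'"
    and T: "hermitian_space q T k" and T': "hermitian_space q T' k'" and c': "card T = card T'"
  shows "card (isoms S h T k) = card (isoms S' h' T' k')"
  using card_isoms_le[OF assms] card_isoms_le[OF S' S c[symmetric] T' T c'[symmetric]] by simp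

text \<open>Extension by zero puts the coordinate spaces of all dimensions into one type and makes
  them increasing in \<open>n\<close>; \<open>std_form\<close> has the unit vectors as orthonormal
  basis.\<close>

definition std_space :: "nat \<Rightarrow> (nat \<Rightarrow> 'a::field) set" where
  "std_space n = {x. \<forall>i\<ge>n. x i = 0}"

definition std_form :: "nat \<Rightarrow> nat \<Rightarrow> (nat \<Rightarrow> 'a::field) \<Rightarrow> (nat \<Rightarrow> 'a) \<Rightarrow> 'a" where
  "std_form q n x y = (\<Sum>i<n. x i * y i ^ q)"

lemma std_space_bij: "bij_betw (\<lambda>x. restrict x {..<n}) (std_space n) ({..<n} \<rightarrow>\<^sub>E (UNIV :: 'a::field set))"
  by (rule bij_betwI[where g = "\<lambda>x i. if i < n then x i else 0"])
     (auto simp: std_space_def fun_eq_iff PiE_def extensional_def)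

lemma card_std_space: "card (std_space n :: (nat \<Rightarrow> 'a::{field,finite}) set) = CARD('a) ^ n"
  using bij_betw_same_card[OF std_space_bij[of n]] by (simp add: card_PiE)

lemma finite_std_space: "finite (std_space n :: (nat \<Rightarrow> 'a::{field,finite}) set)"
  using bij_betw_finite[OF std_space_bij[where ?'a = 'a, of n]] by (simp add: finite_PiE)

lemma subsp_std_space: "subsp (std_space n)"
  by (auto simp: subsp_def std_space_def zero_fun_apply plus_fun_apply smul_apply)

lemma (in quadratic_field) std_hermitian: "hermitian_space q (std_space n :: (nat \<Rightarrow> 'a) set) (std_form q n)"
proof unfold_locales
  show "finite (std_space n :: (nat \<Rightarrow> 'a) set)" "subsp (std_space n)"
    by (rule finite_std_space subsp_std_space)+
  fix x y z :: "nat \<Rightarrow> 'a" and a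
  show "std_form q n (x + y) z = std_form q n x z + std_form q n y z"
    by (simp add: std_form_def plus_fun_apply distrib_right sum.distrib)
  show "std_form q n (smul a x) z = a * std_form q n x z"
    by (simp add: std_form_def smul_apply sum_distrib_left mult.assoc)
  show "std_form q n y x = std_form q n x y ^ q"
    by (simp add: std_form_def frob_sum power_mult_distrib frob_frob mult.commute)
next
  fix x :: "nat \<Rightarrow> 'a" assume x: "x \<in> std_space n" "\<And>y. y \<in> std_space n \<Longrightarrow> std_form q n x y = 0"
  have "x i = 0" for i
  proof (cases "i < n")
    case True
    have "(\<lambda>j. if j = i then 1 else 0) \<in> (std_space n :: (nat \<Rightarrow> 'a) set)" using True by (auto simp: std_space_def)
    from x(2)[OF this] have "(\<Sum>j<n. x j * (if j = i then 1 else 0)) = 0"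
      unfolding std_form_def using frob_0 by (simp add: if_distrib[of "\<lambda>x. x ^ q"] cong: if_cong)
    then show ?thesis using True by (simp add: if_distrib cong: if_cong)
  qed (use x in \<open>auto simp: std_space_def\<close>)
  then show "x = 0" by (simp add: fun_eq_iff zero_fun_apply)
qed

context quadratic_field
begin

definition order_U :: "nat \<Rightarrow> nat" where
  "order_U n = card (isoms (std_space n :: (nat \<Rightarrow> 'a) set) (std_form q n) (std_space n :: (nat \<Rightarrow> 'a) set) (std_form q n))"

lemma order_U_pos: "order_U n > 0"
proof -
  have "isoms (std_space n :: (nat \<Rightarrow> 'a) set) (std_form q n) (std_space n :: (nat \<Rightarrow> 'a) set) (std_form q n) \<noteq> {}"
    using exists_isom[OF std_hermitian std_hermitian, of n n] by auto
  then show ?thesis by (simp add: order_U_def card_gt_0_iff finite_isoms finite_std_space)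
qed

lemma order_U_eq:
  fixes S :: "('i \<Rightarrow> 'a) set" and T :: "('j \<Rightarrow> 'a) set"
  assumes "hermitian_space q S h" "hermitian_space q T k" "card S = (q\<^sup>2) ^ n" "card T = (q\<^sup>2) ^ n"
  shows "card (isoms S h T k) = order_U n"
  unfolding order_U_def
  by (rule card_isoms_cong[OF assms(1) std_hermitian _ assms(2) std_hermitian])
     (simp_all add: assms card_std_space card_field)

text \<open>Isometries from a standard space are restricted to a standard subspace \<open>M\<close>
  of the size of \<open>N\<close>; by \<open>bij_glue\<close> every embedding of \<open>M\<close>
  extends in \<open>order_U (n - m)\<close> ways.\<close>

lemma card_isoms_embeddings:
  fixes N :: "('i \<Rightarrow> 'a) set" and T :: "('j \<Rightarrow> 'a) set"
  assumes N: "hermitian_space q N h" and T: "hermitian_space q T k"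
    and m: "card N = (q\<^sup>2) ^ m" and n: "card T = (q\<^sup>2) ^ n"
  shows "m > n \<Longrightarrow> card (isoms N h T k) = 0"
    "m \<le> n \<Longrightarrow> card (isoms N h T k) * order_U (n - m) = order_U n"
proof -
  interpret T: hermitian_space q T k by fact
  interpret N: hermitian_space q N h by fact
  show "card (isoms N h T k) = 0" if "m > n"
  proof -
    have "f \<notin> isoms N h T k" for f
    proof
      assume "f \<in> isoms N h T k"
      then have "card N \<le> card T" using isoms_image_hermitian(2,3)[OF N T] T.finS by (metis card_mono)
      moreover have "(q\<^sup>2) ^ n < (q\<^sup>2) ^ m" using that one_less_power[of q 2] q_ge_2 by (intro power_strict_increasing) auto
      ultimately show False using m n by simp
    qed
    then show ?thesis by (metis card.empty ex_in_conv)
  qed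
  show "card (isoms N h T k) * order_U (n - m) = order_U n" if "m \<le> n"
  proof -
    define St where "St = (std_space n :: (nat \<Rightarrow> 'a) set)"
    define hn where "hn = (std_form q n :: (nat \<Rightarrow> 'a) \<Rightarrow> (nat \<Rightarrow> 'a) \<Rightarrow> 'a)"
    define M where "M = (std_space m :: (nat \<Rightarrow> 'a) set)"
    interpret St: hermitian_space q St hn unfolding St_def hn_def by (rule std_hermitian)
    have cSt: "card St = (q\<^sup>2) ^ n" by (simp add: St_def card_std_space card_field)
    have MS: "M \<subseteq> St" using that by (auto simp: M_def St_def std_space_def)
    have agree: "hn x y = std_form q m x y" if "x \<in> M" for x y
      unfolding hn_def std_form_def
      by (rule sum.mono_neutral_right) (use that \<open>m \<le> n\<close> in \<open>auto simp: M_def std_space_def\<close>)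
    interpret M0: hermitian_space q M "std_form q m" unfolding M_def by (rule std_hermitian)
    have M: "hermitian_space q M hn"
    proof (rule St.nondeg_subspace[OF M0.subS MS])
      have "x = 0" if "x \<in> M" "x \<in> St.orth M" for x
        by (rule M0.nondeg[OF that(1)]) (use that agree in \<open>auto simp: St.orth_def\<close>)
      then show "M \<inter> St.orth M = {0}" using subsp_0[OF M0.subS] subsp_0[OF St.subsp_orth[OF MS]] by auto
    qed
    have cM: "card M = (q\<^sup>2) ^ m" by (simp add: M_def card_std_space card_field)
    have "order_U n = card (isoms St hn T k)" by (rule order_U_eq[OF St.hermitian_space_axioms T cSt n, symmetric])
    also have "\<dots> = card (SIGMA f:isoms M hn T k. isoms (St.orth M) hn (T.orth (f ` M)) k)"
      by (rule bij_betw_same_card[OF St.bij_glue[OF M MS T], symmetric])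
    also have "\<dots> = (\<Sum>f\<in>isoms M hn T k. card (isoms (St.orth M) hn (T.orth (f ` M)) k))"
      by (rule card_SigmaI) (auto intro!: finite_isoms M0.finS T.finS finite_subset[OF St.orth_subset] finite_subset[OF T.orth_subset] St.finS)
    also have "\<dots> = (\<Sum>f\<in>isoms M hn T k. order_U (n - m))"
    proof (rule sum.cong[OF refl])
      fix f assume f: "f \<in> isoms M hn T k"
      note I = isoms_image_hermitian[OF M T f]
      show "card (isoms (St.orth M) hn (T.orth (f ` M)) k) = order_U (n - m)"
        by (rule order_U_eq[OF St.orth_hermitian[OF M MS] T.orth_hermitian[OF I(1,2)]])
           (use St.card_orth[OF M MS cSt cM] T.card_orth[OF I(1,2) n] I(3) cM in auto)
    qed
    also have "\<dots> = card (isoms M hn T k) * order_U (n - m)" by simp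
    also have "card (isoms M hn T k) = card (isoms N h T k)"
      by (rule card_isoms_cong[OF M N _ T T]) (simp_all add: m cM)
    finally show ?thesis by simp
  qed
qed

end

section \<open>Unitary representations with given periods\<close>

text \<open>The acting group is a type, and \<open>P\<close> cuts it down to the quotient of
  interest: \<open>period_lattice R E\<close> gives \<open>(\<int>/E)\<^sup>R\<close>, and with
  \<open>E = 0\<close> it gives \<open>\<int>\<^sup>R\<close>.\<close>

definition Reps :: "'k::ab_group_add set \<Rightarrow> ('i \<Rightarrow> 'a::field) set \<Rightarrow> (('i \<Rightarrow> 'a) \<Rightarrow> ('i \<Rightarrow> 'a) \<Rightarrow> 'a) \<Rightarrow>
    ('k \<Rightarrow> ('i \<Rightarrow> 'a) \<Rightarrow> ('i \<Rightarrow> 'a)) set" where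
  "Reps P S h = {\<rho>. (\<forall>k. \<rho> k \<in> isoms S h S h) \<and> (\<forall>k l. \<forall>x\<in>S. \<rho> (k + l) x = \<rho> k (\<rho> l x)) \<and>
     (\<forall>k\<in>P. \<forall>x\<in>S. \<rho> k x = x)}"

definition chi_sum :: "'k::ab_group_add set \<Rightarrow> ('i \<Rightarrow> 'a::field) set \<Rightarrow> (('i \<Rightarrow> 'a) \<Rightarrow> ('i \<Rightarrow> 'a) \<Rightarrow> 'a) \<Rightarrow> int" where
  "chi_sum P S h = (\<Sum>\<rho>\<in>Reps P S h. chi h (range \<rho>) S)"

lemma RepsD:
  assumes "\<rho> \<in> Reps P S h"
  shows "\<rho> k \<in> isoms S h S h" "x \<in> S \<Longrightarrow> \<rho> (k + l) x = \<rho> k (\<rho> l x)" "k \<in> P \<Longrightarrow> x \<in> S \<Longrightarrow> \<rho> k x = x"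
    "x \<in> S \<Longrightarrow> \<rho> k x \<in> S"
  using assms isomsD(1)[of "\<rho> k" S h S h] by (auto simp: Reps_def)

lemma RepsI:
  assumes "\<And>k. \<rho> k \<in> isoms S h S h" "\<And>k l x. x \<in> S \<Longrightarrow> \<rho> (k + l) x = \<rho> k (\<rho> l x)"
    "\<And>k x. k \<in> P \<Longrightarrow> x \<in> S \<Longrightarrow> \<rho> k x = x"
  shows "\<rho> \<in> Reps P S h"
  using assms by (auto simp: Reps_def)

lemma Reps_action:
  assumes "hermitian_space q S h" "\<rho> \<in> Reps P S h"
  shows "hermitian_action q S h (range \<rho>)"
proof -
  interpret hermitian_space q S h by fact
  show ?thesis by unfold_locales (auto simp: isomsD[OF RepsD(1)[OF assms(2)]])
qed

lemma Sub_image_cong: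
  assumes "\<And>f. f \<in> \<Phi> \<Longrightarrow> \<exists>g\<in>\<Psi>. \<forall>x\<in>Y. g x = f x" "\<And>g. g \<in> \<Psi> \<Longrightarrow> \<exists>f\<in>\<Phi>. \<forall>x\<in>Y. g x = f x"
  shows "Sub \<Phi> Y = Sub \<Psi> Y"
proof -
  have *: "(\<forall>f\<in>\<Phi>. f ` U \<subseteq> U) \<longleftrightarrow> (\<forall>f\<in>\<Psi>. f ` U \<subseteq> U)" if "U \<subseteq> Y" for U
  proof safe
    fix f x assume f: "\<forall>f\<in>\<Phi>. f ` U \<subseteq> U" "f \<in> \<Psi>" "x \<in> U"
    then obtain g where "g \<in> \<Phi>" "f x = g x" using assms(2) \<open>U \<subseteq> Y\<close> by blast
    then show "f x \<in> U" using f by auto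
  next
    fix f x assume f: "\<forall>f\<in>\<Psi>. f ` U \<subseteq> U" "f \<in> \<Phi>" "x \<in> U"
    then obtain g where "g \<in> \<Psi>" "g x = f x" using assms(1) \<open>U \<subseteq> Y\<close> by blast
    then show "f x \<in> U" using f by (metis image_subset_iff)
  qed
  show ?thesis unfolding Sub_def by (rule Collect_cong) (metis *)
qed

lemma chi_image_cong:
  assumes "\<And>f. f \<in> \<Phi> \<Longrightarrow> \<exists>g\<in>\<Psi>. \<forall>x\<in>Y. g x = f x" "\<And>g. g \<in> \<Psi> \<Longrightarrow> \<exists>f\<in>\<Phi>. \<forall>x\<in>Y. g x = f x"
  shows "chi h \<Phi> Y = chi h \<Psi> Y"
proof -
  have "mob \<Phi> U = mob \<Psi> U" if "U \<subseteq> Y" for U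
  proof -
    have "Sub \<Phi> U = Sub \<Psi> U" by (rule Sub_image_cong) (use assms that in blast)+
    then show ?thesis by (simp add: mob_def)
  qed
  moreover have "Sub \<Phi> Y = Sub \<Psi> Y" by (rule Sub_image_cong[OF assms])
  ultimately show ?thesis unfolding chi_def by (intro sum.cong) (auto dest: SubD(2))
qed

lemma chi_transport:
  assumes S: "hermitian_action q S h \<Phi>" and T: "hermitian_action q T k \<Psi>"
    and f: "f \<in> isoms S h T k" and bij: "bij_betw f S T"
    and st: "\<And>\<phi>. \<phi> \<in> \<Phi> \<Longrightarrow> \<exists>\<psi>\<in>\<Psi>. \<forall>x\<in>S. \<psi> (f x) = f (\<phi> x)" "\<And>\<psi>. \<psi> \<in> \<Psi> \<Longrightarrow> \<exists>\<phi>\<in>\<Phi>. \<forall>x\<in>S. \<psi> (f x) = f (\<phi> x)"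
  shows "chi h \<Phi> S = chi k \<Psi> T"
proof -
  interpret S: hermitian_action q S h \<Phi> by fact
  interpret T: hermitian_action q T k \<Psi> by fact
  have inj: "inj_on f S" and im: "f ` S = T" using bij by (auto simp: bij_betw_def)
  have f0: "f 0 = 0" by (rule isoms_0[OF f S.subS])
  have im_eq: "f ` U = f ` W \<longleftrightarrow> U = W" if "U \<subseteq> S" "W \<subseteq> S" for U W
    using inj_on_image_eq_iff[OF inj] that by blast
  have Sub: "f ` U \<in> Sub \<Psi> T \<longleftrightarrow> U \<in> Sub \<Phi> S" if U: "U \<subseteq> S" for U
  proof
    assume "U \<in> Sub \<Phi> S"
    note U = SubD[OF this]
    have "subsp (f ` U)" unfolding subsp_def
    proof (intro conjI ballI allI)
      show "0 \<in> f ` U" using f0 subsp_0[OF U(1)] by (metis image_eqI)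
      fix x y a assume "x \<in> f ` U" 
      then obtain u where u: "x = f u" "u \<in> U" by blast
      have "f (smul a u) = smul a x" using isomsD(3)[OF f] u U by auto
      then show "smul a x \<in> f ` U" using subsp_smul[OF U(1) u(2)] by (metis image_eqI)
      assume "y \<in> f ` U"
      then obtain v where v: "y = f v" "v \<in> U" by blast
      have "f (u + v) = x + y" using isomsD(2)[OF f] u v U by auto
      then show "x + y \<in> f ` U" using subsp_add[OF U(1) u(2) v(2)] by (metis image_eqI)
    qed
    moreover have "\<psi> (f x) \<in> f ` U" if \<psi>: "\<psi> \<in> \<Psi>" and x: "x \<in> U" for \<psi> x
    proof -
      obtain \<phi> where "\<phi> \<in> \<Phi>" "\<psi> (f x) = f (\<phi> x)" using st(2)[OF \<psi>] x U(2) by blast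
      then show ?thesis using U(3)[of \<phi> x] x by auto
    qed
    ultimately show "f ` U \<in> Sub \<Psi> T" using im U(2) by (auto simp: Sub_def)
  next
    assume "f ` U \<in> Sub \<Psi> T"
    note fU = SubD[OF this]
    have mem: "x \<in> U" if "x \<in> S" "f x \<in> f ` U" for x
      using that U inj by (auto dest: inj_onD)
    have "subsp U" unfolding subsp_def
    proof (intro conjI ballI allI)
      show "0 \<in> U" using mem[of 0] f0 subsp_0[OF fU(1)] by (simp add: S.subS subsp_0)
      fix x a assume x: "x \<in> U"
      show "smul a x \<in> U" using mem[of "smul a x"] x U subsp_smul[OF fU(1), of "f x" a] isomsD(3)[OF f, of x a] by auto
      fix y assume y: "y \<in> U"
      show "x + y \<in> U" using mem[of "x + y"] x y subsetD[OF U x] subsetD[OF U y] subsp_add[OF fU(1), of "f x" "f y"] isomsD(2)[OF f, of x y]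
          by (simp add: S.subS subsp_add)
    qed
    moreover have "\<phi> x \<in> U" if \<phi>: "\<phi> \<in> \<Phi>" and x: "x \<in> U" for \<phi> x
    proof -
      obtain \<psi> where "\<psi> \<in> \<Psi>" "\<psi> (f x) = f (\<phi> x)" using st(1)[OF \<phi>] x U by blast
      then show ?thesis using mem[of "\<phi> x"] fU(3)[of \<psi> "f x"] \<phi> x U S.act_closed by auto
    qed
    ultimately show "U \<in> Sub \<Phi> S" using U by (auto simp: Sub_def)
  qed
  have iso: "isotropic k (f ` U) \<longleftrightarrow> isotropic h U" if "U \<subseteq> S" for U
    using that isomsD(4)[OF f] by (fastforce simp: isotropic_def)
  have "echar {U \<in> Sub \<Psi> T. isotropic k U \<and> U \<noteq> {0}} = echar {U \<in> Sub \<Phi> S. isotropic h U \<and> U \<noteq> {0}}"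
  proof (rule echar_iso[where f = "image f"])
    show "bij_betw (image f) {U \<in> Sub \<Phi> S. isotropic h U \<and> U \<noteq> {0}} {U \<in> Sub \<Psi> T. isotropic k U \<and> U \<noteq> {0}}"
    proof (rule bij_betw_imageI)
      show "inj_on (image f) {U \<in> Sub \<Phi> S. isotropic h U \<and> U \<noteq> {0}}"
        using im_eq by (auto simp: inj_on_def dest: SubD(2))
      have z: "f ` U = {0} \<longleftrightarrow> U = {0}" if "U \<subseteq> S" for U
        using im_eq[OF that, of "{0}"] f0 subsp_0[OF S.subS] by simp
      show "image f ` {U \<in> Sub \<Phi> S. isotropic h U \<and> U \<noteq> {0}} = {U \<in> Sub \<Psi> T. isotropic k U \<and> U \<noteq> {0}}"
      proof (intro equalityI subsetI)
        fix W assume W: "W \<in> {U \<in> Sub \<Psi> T. isotropic k U \<and> U \<noteq> {0}}"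
        then have "W \<subseteq> f ` S" using im SubD(2) by blast
        then obtain U where U: "U \<subseteq> S" "W = f ` U" by (auto simp: subset_image_iff)
        then show "W \<in> image f ` {U \<in> Sub \<Phi> S. isotropic h U \<and> U \<noteq> {0}}"
          using W Sub iso z by auto
      next
        fix W assume "W \<in> image f ` {U \<in> Sub \<Phi> S. isotropic h U \<and> U \<noteq> {0}}"
        then obtain U where U: "U \<in> Sub \<Phi> S" "isotropic h U" "U \<noteq> {0}" "W = f ` U" by blast
        then show "W \<in> {U \<in> Sub \<Psi> T. isotropic k U \<and> U \<noteq> {0}}"
          using SubD(2)[OF U(1)] Sub iso z by auto
      qed
    qed
    show "f ` U \<le> f ` W \<longleftrightarrow> U \<le> W"
      if "U \<in> {U \<in> Sub \<Phi> S. isotropic h U \<and> U \<noteq> {0}}" "W \<in> {U \<in> Sub \<Phi> S. isotropic h U \<and> U \<noteq> {0}}" for U W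
    proof -
      have "U \<subseteq> S" "W \<subseteq> S" using that by (auto dest: SubD(2))
      then show ?thesis using inj_on_image_mem_iff[OF inj, of _ W] by blast
    qed
  qed
  then show ?thesis using S.chi_echar[OF S.S_Sub] T.chi_echar[OF T.S_Sub] by simp
qed

text \<open>Conjugation by an isometry between the two spaces matches the representations as well as
  the posets.\<close>

lemma chi_sum_cong:
  fixes S :: "('i \<Rightarrow> 'a::{field,finite}) set" and T :: "('j \<Rightarrow> 'a) set" and P :: "'k::ab_group_add set"
  assumes S: "hermitian_space q S h" and T: "hermitian_space q T k" and card: "card S = card T"
  shows "chi_sum P S h = chi_sum P T k"
proof -
  interpret S: hermitian_space q S h by fact
  interpret T: hermitian_space q T k by fact
  obtain f where f: "f \<in> isoms S h T k" using exists_isom[OF S T card] by auto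
  have bij: "bij_betw f S T" by (rule isoms_bij[OF S T f card])
  define g where "g = restrict (inv_into S f) T"
  have g: "g \<in> isoms T k S h" unfolding g_def by (rule isoms_inv[OF f bij S.subS T.subS])
  have gf: "g (f x) = x" if "x \<in> S" for x
    using that bij isomsD(1)[OF f] by (simp add: g_def bij_betw_def inv_into_f_f)
  have fg: "f (g y) = y" if "y \<in> T" for y
    using that bij by (simp add: g_def bij_betw_def f_inv_into_f)
  have conj: "(\<lambda>k. compose T (compose S f (\<rho> k)) g) \<in> Reps P T k"
    if "\<rho> \<in> Reps P S h" "f \<in> isoms S h T k" "g \<in> isoms T k S h" "\<And>x. x \<in> S \<Longrightarrow> g (f x) = x" "subsp S" "subsp T"
      "\<And>y. y \<in> T \<Longrightarrow> f (g y) = y" for \<rho> f g S h T k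
  proof (rule RepsI)
    fix l m y
    show "compose T (compose S f (\<rho> l)) g \<in> isoms T k T k"
      by (rule isoms_compose[OF that(3) isoms_compose[OF RepsD(1)[OF that(1)] that(2,5)] that(6)])
    assume y: "y \<in> T"
    then have "g y \<in> S" using isomsD(1)[OF that(3)] by blast
    then show "compose T (compose S f (\<rho> (l + m))) g y = compose T (compose S f (\<rho> l)) g (compose T (compose S f (\<rho> m)) g y)"
      using y RepsD[OF that(1)] isomsD(1)[OF that(2)] by (simp add: compose_def that(4))
    show "l \<in> P \<Longrightarrow> compose T (compose S f (\<rho> l)) g y = y"
      using y RepsD(3)[OF that(1)] \<open>g y \<in> S\<close> by (simp add: compose_def that(7))
  qed
  have "bij_betw (\<lambda>\<rho> k. compose T (compose S f (\<rho> k)) g) (Reps P S h) (Reps P T k)"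
  proof (rule bij_betwI[where g = "\<lambda>\<rho> k. compose S (compose T g (\<rho> k)) f"])
    show "(\<lambda>\<rho> k. compose T (compose S f (\<rho> k)) g) \<in> Reps P S h \<rightarrow> Reps P T k"
      using conj[OF _ f g gf S.subS T.subS fg] by auto
    show "(\<lambda>\<rho> l. compose S (compose T g (\<rho> l)) f) \<in> Reps P T k \<rightarrow> Reps P S h"
    proof
      fix \<sigma> assume s: "\<sigma> \<in> Reps P T k"
      show "(\<lambda>l. compose S (compose T g (\<sigma> l)) f) \<in> Reps P S h"
      proof (rule RepsI)
        fix l m y
        show "compose S (compose T g (\<sigma> l)) f \<in> isoms S h S h"
          by (rule isoms_compose[OF f isoms_compose[OF RepsD(1)[OF s] g T.subS] S.subS])
        assume y: "y \<in> S"
        then have "f y \<in> T" using isomsD(1)[OF f] by blast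
        then show "compose S (compose T g (\<sigma> (l + m))) f y = compose S (compose T g (\<sigma> l)) f (compose S (compose T g (\<sigma> m)) f y)"
          using y RepsD[OF s] isomsD(1)[OF g] by (simp add: compose_def fg)
        show "l \<in> P \<Longrightarrow> compose S (compose T g (\<sigma> l)) f y = y"
          using y RepsD(3)[OF s] \<open>f y \<in> T\<close> by (simp add: compose_def gf)
      qed
    qed
    show "(\<lambda>l. compose S (compose T g (compose T (compose S f (\<rho> l)) g)) f) = \<rho>" if "\<rho> \<in> Reps P S h" for \<rho>
    proof
      fix l show "compose S (compose T g (compose T (compose S f (\<rho> l)) g)) f = \<rho> l"
        by (rule extensionalityI[OF compose_extensional isomsD(5)[OF RepsD(1)[OF that]]])
           (simp add: compose_def gf isomsD(1)[OF f] RepsD(4)[OF that])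
    qed
    show "(\<lambda>l. compose T (compose S f (compose S (compose T g (\<rho> l)) f)) g) = \<rho>" if "\<rho> \<in> Reps P T k" for \<rho>
    proof
      fix l show "compose T (compose S f (compose S (compose T g (\<rho> l)) f)) g = \<rho> l"
        by (rule extensionalityI[OF compose_extensional isomsD(5)[OF RepsD(1)[OF that]]])
           (simp add: compose_def fg isomsD(1)[OF g] RepsD(4)[OF that])
    qed
  qed
  from sum.reindex_bij_betw[OF this, of "\<lambda>\<rho>. chi k (range \<rho>) T"]
  have "chi_sum P T k = (\<Sum>\<rho>\<in>Reps P S h. chi k (range (\<lambda>l. compose T (compose S f (\<rho> l)) g)) T)"
    by (simp add: chi_sum_def)
  also have "\<dots> = chi_sum P S h"
    unfolding chi_sum_def
  proof (rule sum.cong[OF refl])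
    fix \<rho> assume r: "\<rho> \<in> Reps P S h"
    show "chi k (range (\<lambda>l. compose T (compose S f (\<rho> l)) g)) T = chi h (range \<rho>) S"
    proof (rule chi_transport[OF Reps_action[OF S r] Reps_action[OF T conj[OF r f g gf S.subS T.subS fg]] f bij, symmetric])
      have *: "compose T (compose S f (\<rho> l)) g (f x) = f (\<rho> l x)" if "x \<in> S" for x l
        using that isomsD(1)[OF f] by (simp add: compose_def gf)
      show "\<exists>\<psi>\<in>range (\<lambda>l. compose T (compose S f (\<rho> l)) g). \<forall>x\<in>S. \<psi> (f x) = f (\<phi> x)" if "\<phi> \<in> range \<rho>" for \<phi>
        using that * by blast
      show "\<exists>\<phi>\<in>range \<rho>. \<forall>x\<in>S. \<psi> (f x) = f (\<phi> x)" if "\<psi> \<in> range (\<lambda>l. compose T (compose S f (\<rho> l)) g)" for \<psi>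
        using that * by blast
    qed
  qed
  finally show ?thesis by simp
qed

lemma Reps_period:
  assumes "\<rho> \<in> Reps P S h" "k - l \<in> P"
  shows "\<rho> k = \<rho> l"
proof (rule isoms_eqI[OF RepsD(1)[OF assms(1)] RepsD(1)[OF assms(1)]])
  fix x assume x: "x \<in> S"
  have "\<rho> ((k - l) + l) x = \<rho> (k - l) (\<rho> l x)" by (rule RepsD(2)[OF assms(1) x])
  then show "\<rho> k x = \<rho> l x" using RepsD(3)[OF assms(1) assms(2) RepsD(4)[OF assms(1) x]] by simp
qed

section \<open>Cyclic Hermitian modules and positive type functions\<close>

text \<open>\<open>B\<close> meets every class modulo \<open>P\<close> and stands in for the finite
  quotient group.\<close>

locale periods =
  fixes P B :: "'k::ab_group_add set"
  assumes finB: "finite B" and repB: "\<And>k. \<exists>b\<in>B. k - b \<in> P" and zeroP: "0 \<in> P"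
begin

lemma finite_Reps:
  assumes "finite S"
  shows "finite (Reps P S h)"
proof -
  have "inj_on (\<lambda>\<rho>. restrict \<rho> B) (Reps P S h)"
  proof (rule inj_onI)
    fix \<rho> \<sigma> assume r: "\<rho> \<in> Reps P S h" and s: "\<sigma> \<in> Reps P S h" and eq: "restrict \<rho> B = restrict \<sigma> B"
    show "\<rho> = \<sigma>"
    proof
      fix k obtain b where b: "b \<in> B" "k - b \<in> P" using repB by blast
      then show "\<rho> k = \<sigma> k" using Reps_period[OF r b(2)] Reps_period[OF s b(2)] fun_cong[OF eq, of b] by simp
    qed
  qed
  moreover have "(\<lambda>\<rho>. restrict \<rho> B) ` Reps P S h \<subseteq> B \<rightarrow>\<^sub>E isoms S h S h"
    using RepsD(1) by auto
  moreover have "finite (B \<rightarrow>\<^sub>E isoms S h S h)" using finB finite_isoms[OF assms assms] by (simp add: finite_PiE)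
  ultimately show ?thesis by (metis finite_imageD finite_subset)
qed

end

definition shift :: "'k::ab_group_add \<Rightarrow> ('k \<Rightarrow> 'a) \<Rightarrow> ('k \<Rightarrow> 'a)" where
  "shift k x = (\<lambda>j. x (j + k))"

lemma shift_apply: "shift k x j = x (j + k)" by (simp add: shift_def)

lemma shift_simps [simp]: "shift 0 x = x" "shift k (shift l x) = shift (k + l) x"
  by (auto simp: shift_def algebra_simps)

lemma shift_linear: "shift k (x + y :: 'k::ab_group_add \<Rightarrow> 'a::field) = shift k x + shift k y"
  "shift k (smul a x) = smul a (shift k x :: _ \<Rightarrow> 'a)" "shift k (0 :: 'k \<Rightarrow> 'a) = 0"
  by (simp_all add: shift_def smul_def plus_fun_def zero_fun_def)

lemma shift_sum: "shift k (\<Sum>i\<in>I. f i :: 'k::ab_group_add \<Rightarrow> 'a::field) = (\<Sum>i\<in>I. shift k (f i))"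
  by (induction I rule: infinite_finite_induct) (auto simp: shift_linear)

text \<open>Both conditions hold for every matrix coefficient
  \<open>k \<mapsto> h (\<rho> k v) v\<close> of a representation. Conversely the space
  \<open>V\<close> below, on which the group acts by translation, realizes each such
  \<open>lam\<close>, with \<open>lam\<close> itself as cyclic vector.\<close>

locale hermitian_function = quadratic_field q "TYPE('a::{field,finite})" + periods P B
  for q and P B :: "'k::ab_group_add set" +
  fixes lam :: "'k \<Rightarrow> 'a::{field,finite}"
  assumes lam_minus: "lam (- k) = lam k ^ q" and lam_period: "p \<in> P \<Longrightarrow> lam (k + p) = lam k"
begin

text \<open>\<open>V\<close> is the GNS space of \<open>lam\<close>, on which \<open>form (shift k lam) (shift l lam) = lam (k - l)\<close>; the
  choice made by \<open>coef\<close> does not affect \<open>form\<close>.\<close>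

definition comb :: "('k \<Rightarrow> 'a) \<Rightarrow> 'k \<Rightarrow> 'a" where
  "comb b = (\<Sum>l\<in>B. smul (b l) (shift l lam))"

definition V :: "('k \<Rightarrow> 'a) set" where
  "V = range comb"

lemma comb_apply: "comb b j = (\<Sum>l\<in>B. b l * lam (j + l))"
  by (simp add: comb_def sum_fun_apply smul_apply shift_apply)

lemma subsp_V: "subsp V"
  unfolding subsp_def
proof (intro conjI ballI allI)
  have "comb (\<lambda>_. 0) = 0" by (simp add: comb_def)
  then show "0 \<in> V" unfolding V_def by (metis rangeI)
  fix x a assume "x \<in> V"
  then obtain b where b: "x = comb b" by (auto simp: V_def)
  have "smul a x = comb (\<lambda>l. a * b l)" by (simp add: b comb_def smul_sum)
  then show "smul a x \<in> V" by (simp add: V_def)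
  fix y assume "y \<in> V"
  then obtain c where c: "y = comb c" by (auto simp: V_def)
  have "x + y = comb (\<lambda>l. b l + c l)" by (simp add: b c comb_def smul_add sum.distrib)
  then show "x + y \<in> V" by (simp add: V_def)
qed

lemma finite_V: "finite V"
proof -
  have "comb b = comb (restrict b B)" for b by (auto simp: comb_def intro: sum.cong)
  then have "V \<subseteq> comb ` (B \<rightarrow>\<^sub>E UNIV)" unfolding V_def by (metis (no_types) image_eqI image_subset_iff restrict_PiE_iff UNIV_I)
  then show ?thesis using finB by (meson finite_PiE finite_UNIV finite_imageI finite_subset finite)
qed

lemma shift_period: "k - b \<in> P \<Longrightarrow> shift k lam = shift b lam"
  using lam_period[of "k - b"] by (auto simp: fun_eq_iff shift_apply) (metis add.assoc diff_add_cancel add.commute)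

lemma shift_mem: "shift k lam \<in> V"
proof -
  obtain b where b: "b \<in> B" "k - b \<in> P" using repB by blast
  have "comb (\<lambda>l. if l = b then 1 else 0) = (\<Sum>l\<in>B. if l = b then shift b lam else 0)"
    unfolding comb_def by (rule sum.cong) auto
  also have "\<dots> = shift b lam" using b finB by simp
  finally show ?thesis using shift_period[OF b(2)] by (metis V_def rangeI)
qed

lemma lam_mem: "lam \<in> V" using shift_mem[of 0] by simp

lemma V_least: "subsp U \<Longrightarrow> (\<And>k. shift k lam \<in> U) \<Longrightarrow> V \<subseteq> U"
  by (auto simp: V_def comb_def intro!: subsp_sum subsp_smul)

lemma shift_V: "x \<in> V \<Longrightarrow> shift k x \<in> V"
  by (auto simp: V_def[symmetric] comb_def shift_sum shift_linear shift_mem subsp_V intro!: subsp_sum subsp_smul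
      dest!: image_iff[THEN iffD1, of x comb UNIV, folded V_def])

lemma V_period: "x \<in> V \<Longrightarrow> p \<in> P \<Longrightarrow> x (j + p) = x j"
  by (auto simp: V_def comb_apply intro!: sum.cong)
     (metis add.assoc add.commute lam_period)

definition coef :: "('k \<Rightarrow> 'a) \<Rightarrow> 'k \<Rightarrow> 'a" where
  "coef y = (SOME b. y = comb b)"

lemma coef: "y \<in> V \<Longrightarrow> y = comb (coef y)"
  unfolding coef_def by (rule someI_ex[of "\<lambda>b. y = comb b"]) (auto simp: V_def)

definition form :: "('k \<Rightarrow> 'a) \<Rightarrow> ('k \<Rightarrow> 'a) \<Rightarrow> 'a" where
  "form x y = (\<Sum>l\<in>B. coef y l ^ q * x (- l))"

text \<open>\<open>form\<close> is defined by the chosen coefficients of its second argument; here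
  it is computed from arbitrary coefficients of the first. Independence of the choice and hermitian
  symmetry follow from this.\<close>

lemma form_comb:
  assumes y: "y \<in> V"
  shows "form (comb a) y = (\<Sum>k\<in>B. a k * y (- k) ^ q)"
proof -
  have "y (- k) ^ q = (\<Sum>l\<in>B. coef y l ^ q * lam (k - l))" for k
  proof -
    have "y (- k) ^ q = (\<Sum>l\<in>B. coef y l * lam (- k + l)) ^ q" by (metis coef[OF y] comb_apply)
    also have "\<dots> = (\<Sum>l\<in>B. coef y l ^ q * lam (- k + l) ^ q)" by (simp add: frob_sum power_mult_distrib)
    also have "\<dots> = (\<Sum>l\<in>B. coef y l ^ q * lam (k - l))"
      using lam_minus[of "- k + l" for l] by (simp add: lam_minus[symmetric])
    finally show ?thesis .
  qed
  then have "(\<Sum>k\<in>B. a k * y (- k) ^ q) = (\<Sum>k\<in>B. \<Sum>l\<in>B. a k * (coef y l ^ q * lam (k - l)))"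
    by (simp add: sum_distrib_left)
  also have "\<dots> = (\<Sum>l\<in>B. coef y l ^ q * (\<Sum>k\<in>B. a k * lam (k - l)))"
    by (subst sum.swap) (simp add: sum_distrib_left mult_ac)
  finally show ?thesis by (simp add: form_def comb_apply algebra_simps)
qed

lemma form_herm: "x \<in> V \<Longrightarrow> y \<in> V \<Longrightarrow> form y x = form x y ^ q"
proof -
  assume x: "x \<in> V" and y: "y \<in> V"
  have "form x y = (\<Sum>k\<in>B. coef x k * y (- k) ^ q)" using form_comb[OF y, of "coef x"] coef[OF x] by simp
  then have "form x y ^ q = (\<Sum>k\<in>B. coef x k ^ q * y (- k))"
    by (simp add: frob_sum power_mult_distrib frob_frob)
  then show ?thesis by (simp add: form_def)
qed

text \<open>The reproducing property: pairing with a translate of \<open>lam\<close> is evaluation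
  at a point, which makes nondegeneracy immediate.\<close>

lemma form_shift: "x \<in> V \<Longrightarrow> form x (shift l lam) = x (- l)"
proof -
  assume x: "x \<in> V"
  obtain b where b: "b \<in> B" "l - b \<in> P" using repB by blast
  have "comb (\<lambda>l. if l = b then 1 else 0) = (\<Sum>l\<in>B. if l = b then shift b lam else 0)"
    unfolding comb_def by (rule sum.cong) auto
  also have "\<dots> = shift b lam" using b finB by simp
  finally have "form (shift b lam) x = (\<Sum>k\<in>B. (if k = b then 1 else 0) * x (- k) ^ q)"
    using form_comb[OF x, of "\<lambda>l. if l = b then 1 else 0"] by simp
  also have "\<dots> = (\<Sum>k\<in>B. if k = b then x (- b) ^ q else 0)" by (rule sum.cong) auto
  also have "\<dots> = x (- b) ^ q" using b finB by simp
  finally have "form x (shift b lam) = x (- b)" using form_herm[OF shift_mem x, of b] frob_frob by simp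
  moreover have "x (- b) = x (- l)" using V_period[OF x b(2), of "- l"] by simp
  ultimately show ?thesis using shift_period[OF b(2)] by simp
qed

lemma hermitian_V: "hermitian_space q V form"
proof unfold_locales
  show "finite V" "subsp V" by (rule finite_V subsp_V)+
  fix x y z a assume "x \<in> V" "z \<in> V"
  show "form (x + y) z = form x z + form y z"
    by (simp add: form_def plus_fun_apply distrib_left sum.distrib)
  show "form (smul a x) z = a * form x z"
    by (simp add: form_def smul_apply sum_distrib_left mult_ac)
next
  fix x assume x: "x \<in> V" "\<And>y. y \<in> V \<Longrightarrow> form x y = 0"
  have "x j = 0" for j using x(2)[OF shift_mem, of "- j"] form_shift[OF x(1), of "- j"] by simp
  then show "x = 0" by (simp add: fun_eq_iff zero_fun_apply)
qed (rule form_herm)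

sublocale V: hermitian_space q V form by (rule hermitian_V)

lemma form_expand_right: "x \<in> V \<Longrightarrow> form x (comb b) = (\<Sum>l\<in>B. b l ^ q * x (- l))"
  by (simp add: comb_def V.h_sum_right V.h_smul_right shift_mem form_shift)

lemma shift_isom: "restrict (shift k) V \<in> isoms V form V form"
proof (rule isomsI)
  fix x y assume x: "x \<in> V" and "y \<in> V"
  then obtain b where y: "y = comb b" by (auto simp: V_def)
  have sy: "shift k y = (\<Sum>l\<in>B. smul (b l) (shift (k + l) lam))"
    by (simp add: y comb_def shift_sum shift_linear)
  have "form (shift k x) (shift k y) = (\<Sum>l\<in>B. b l ^ q * shift k x (- (k + l)))"
    unfolding sy using shift_V[OF x, of k] by (simp add: V.h_sum_right V.h_smul_right shift_mem form_shift)
  also have "\<dots> = form x y" by (simp add: y form_expand_right[OF x] shift_apply)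
  finally show "form (restrict (shift k) V x) (restrict (shift k) V y) = form x y"
    using x \<open>y \<in> V\<close> by simp
qed (auto simp: shift_V shift_linear)

definition cyc_pairs :: "('i \<Rightarrow> 'a) set \<Rightarrow> (('i \<Rightarrow> 'a) \<Rightarrow> ('i \<Rightarrow> 'a) \<Rightarrow> 'a) \<Rightarrow> (('k \<Rightarrow> ('i \<Rightarrow> 'a) \<Rightarrow> ('i \<Rightarrow> 'a)) \<times> ('i \<Rightarrow> 'a)) set" where
  "cyc_pairs S h = {(\<rho>, v). \<rho> \<in> Reps P S h \<and> v \<in> S \<and>
     hermitian_action.cyc S (range \<rho>) v \<inter> hermitian_space.orth S h (hermitian_action.cyc S (range \<rho>) v) = {0} \<and>
     (\<forall>k. h (\<rho> k v) v = lam k)}"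

text \<open>The cyclic module generated by \<open>v\<close> is identified with \<open>V\<close> by means of
  \<open>x \<mapsto> (k \<mapsto> h (\<rho> k x) v)\<close>.\<close>

lemma cyc_pairs_embedding:
  fixes S :: "('i \<Rightarrow> 'a) set"
  assumes S: "hermitian_space q S h" and rv: "(\<rho>, v) \<in> cyc_pairs S h"
  shows "\<exists>\<iota>\<in>isoms V form S h. \<iota> lam = v \<and> \<iota> ` V = hermitian_action.cyc S (range \<rho>) v \<and>
    (\<forall>k. \<forall>x\<in>V. \<rho> k (\<iota> x) = \<iota> (shift k x))"
proof -
  have r: "\<rho> \<in> Reps P S h" and v: "v \<in> S" and lam: "\<And>k. h (\<rho> k v) v = lam k" using rv by (auto simp: cyc_pairs_def)
  interpret A: hermitian_action q S h "range \<rho>" by (rule Reps_action[OF S r])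
  define N where "N = A.cyc v"
  have NSub: "N \<in> Sub (range \<rho>) S" unfolding N_def by (rule A.cyc_Sub[OF v])
  have NS: "N \<subseteq> S" using SubD(2)[OF NSub] .
  have sN: "subsp N" using SubD(1)[OF NSub] .
  have N: "hermitian_space q N h"
    using rv by (intro A.nondeg_subspace[OF sN NS]) (auto simp: cyc_pairs_def N_def)
  interpret N: hermitian_space q N h by (rule N)
  have rN: "\<rho> k x \<in> N" if "x \<in> N" for k x using SubD(3)[OF NSub _ that] by blast
  have vN: "v \<in> N" unfolding N_def by (rule A.mem_cyc)
  have \<rho>_add: "\<rho> (k + l) x = \<rho> k (\<rho> l x)" if "x \<in> S" for k l x using RepsD(2)[OF r that] .
  have \<rho>_0: "\<rho> 0 x = x" if "x \<in> S" for x using RepsD(3)[OF r zeroP that] .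
  have adj: "h (\<rho> (- l) x) y = h x (\<rho> l y)" if "x \<in> S" "y \<in> S" for l x y
    using isomsD(4)[OF RepsD(1)[OF r] RepsD(4)[OF r that(1)] that(2), of l "- l"] \<rho>_add[OF that(1), of l "- l"] \<rho>_0[OF that(1)]
    by simp
  define cmb where "cmb = (\<lambda>b. \<Sum>l\<in>B. smul (b l) (\<rho> l v))"
  have gen: "\<rho> k v \<in> range cmb" for k
  proof -
    obtain b where b: "b \<in> B" "k - b \<in> P" using repB by blast
    have "cmb (\<lambda>l. if l = b then 1 else 0) = (\<Sum>l\<in>B. if l = b then \<rho> b v else 0)"
      unfolding cmb_def by (rule sum.cong) auto
    also have "\<dots> = \<rho> b v" using b finB by simp
    finally show ?thesis using Reps_period[OF r b(2)] by (metis rangeI)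
  qed
  have scmb: "subsp (range cmb)"
    unfolding subsp_def
  proof (intro conjI ballI allI)
    have "cmb (\<lambda>_. 0) = 0" by (simp add: cmb_def)
    then show "0 \<in> range cmb" by (metis rangeI)
    fix x a assume "x \<in> range cmb"
    then obtain b where b: "x = cmb b" by auto
    have "smul a x = cmb (\<lambda>l. a * b l)" by (simp add: b cmb_def smul_sum)
    then show "smul a x \<in> range cmb" by simp
    fix y assume "y \<in> range cmb"
    then obtain c where c: "y = cmb c" by auto
    have "x + y = cmb (\<lambda>l. b l + c l)" by (simp add: b c cmb_def smul_add sum.distrib)
    then show "x + y \<in> range cmb" by simp
  qed
  \<comment> \<open>The combinations of translates of \<open>v\<close> form an invariant subspace
    containing \<open>v\<close>; by periodicity the translates by \<open>B\<close> are
    enough.\<close>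
  have "N \<subseteq> range cmb"
    unfolding N_def
  proof (rule A.cyc_least)
    have "cmb b \<in> S" for b unfolding cmb_def using RepsD(4)[OF r v] A.subS by (auto intro!: subsp_sum)
    moreover have "\<rho> k (cmb b) \<in> range cmb" for k b
    proof -
      have "\<rho> k (cmb b) = (\<Sum>l\<in>B. smul (b l) (\<rho> (k + l) v))"
        unfolding cmb_def using RepsD(4)[OF r v]
        by (simp add: isoms_sum[OF RepsD(1)[OF r] A.subS] isomsD(3)[OF RepsD(1)[OF r]] \<rho>_add[OF v])
      then show ?thesis using gen scmb by (auto intro!: subsp_sum subsp_smul)
    qed
    ultimately show "range cmb \<in> Sub (range \<rho>) S" using scmb by (auto simp: Sub_def)
    show "v \<in> range cmb" using gen[of 0] \<rho>_0[OF v] by simp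
  qed
  \<comment> \<open>\<open>j\<close> takes translates of \<open>v\<close> to translates of
    \<open>lam\<close> and so maps \<open>N\<close> isometrically onto \<open>V\<close>; the
    embedding sought is its inverse.\<close>
  define j where "j = (\<lambda>x\<in>N. (\<lambda>k. h (\<rho> k x) v))"
  have j_lam: "j (\<rho> l v) = shift l lam" for l
    using rN[OF vN, of l] by (auto simp: j_def fun_eq_iff shift_apply lam[symmetric] \<rho>_add[OF v])
  have j_add: "j (x + y) = j x + j y" if "x \<in> N" "y \<in> N" for x y
    using that NS v RepsD(4)[OF r] by (auto simp: j_def fun_eq_iff plus_fun_apply isomsD(2)[OF RepsD(1)[OF r]] A.h_add_left subset_iff)
  have j_smul: "j (smul a x) = smul a (j x)" if "x \<in> N" for a x
    using that NS v RepsD(4)[OF r] by (auto simp: j_def fun_eq_iff smul_apply isomsD(3)[OF RepsD(1)[OF r]] A.h_smul_left subset_iff)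
  have j_0: "j 0 = 0" using j_add[of 0 0] by simp
  have j_sum: "j (\<Sum>l\<in>I. smul (b l) (\<rho> (f l) v)) = (\<Sum>l\<in>I. smul (b l) (shift (f l) lam))" for I b and f :: "'k \<Rightarrow> 'k"
    by (induction I rule: infinite_finite_induct)
       (simp_all add: j_0 j_add j_smul j_lam rN[OF vN] subsp_sum[OF sN] subsp_smul[OF sN])
  have j_cmb: "j (cmb b) = comb b" for b unfolding cmb_def comb_def using j_sum[of b "\<lambda>l. l" B] by simp
  have jV: "j x \<in> V" if "x \<in> N" for x using that \<open>N \<subseteq> range cmb\<close> j_cmb by (auto simp: V_def)
  have j: "j \<in> isoms N h V form"
  proof (rule isomsI)
    show "j \<in> N \<rightarrow>\<^sub>E V" using jV by (auto simp: j_def)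
    fix x y assume x: "x \<in> N" and y: "y \<in> N"
    obtain b where b: "y = cmb b" using y \<open>N \<subseteq> range cmb\<close> by blast
    have "form (j x) (j y) = (\<Sum>l\<in>B. b l ^ q * j x (- l))" by (simp add: b j_cmb form_expand_right[OF jV[OF x]])
    also have "\<dots> = (\<Sum>l\<in>B. b l ^ q * h x (\<rho> l v))" using x NS v by (auto simp: j_def adj subset_iff)
    also have "\<dots> = h x y" unfolding b cmb_def
      using x rN[OF vN] by (simp add: N.h_sum_right N.h_smul_right)
    finally show "form (j x) (j y) = h x y" .
  qed (simp_all add: j_add j_smul)
  have jsurj: "j ` N = V"
  proof
    show "V \<subseteq> j ` N"
    proof (rule V_least)
      show "subsp (j ` N)" using isoms_image_hermitian(1)[OF N hermitian_V j] hermitian_space.subS by blast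
      show "shift k lam \<in> j ` N" for k using j_lam[of k] rN[OF vN, of k] by (metis image_eqI)
    qed
  qed (use jV in auto)
  have bij: "bij_betw j N V" using jsurj isoms_inj[OF N hermitian_V j] by (simp add: bij_betw_def)
  define i where "i = restrict (inv_into N j) V"
  have i: "i \<in> isoms V form N h" unfolding i_def by (rule isoms_inv[OF j bij sN subsp_V])
  have ij: "i (j x) = x" if "x \<in> N" for x using that bij jV by (simp add: i_def bij_betw_def inv_into_f_f)
  have iV: "i ` V = N" using jsurj ij by force
  show ?thesis
  proof (intro bexI[OF _ isoms_mono[OF i NS]] conjI allI ballI)
    have "j v = lam" using j_lam[of 0] \<rho>_0[OF v] by simp
    then show "i lam = v" using ij[OF vN] by simp
    show "i ` V = A.cyc v" using iV N_def by simp
    fix k x assume "x \<in> V"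
    then obtain y where y: "y \<in> N" "x = j y" using jsurj by blast
    have "y \<in> S" using y NS by blast
    have "j (\<rho> k y) = shift k (j y)"
      using y(1) rN[OF y(1), of k] by (simp add: j_def fun_eq_iff shift_apply \<rho>_add[OF \<open>y \<in> S\<close>, symmetric])
    then show "\<rho> k (i x) = i (shift k x)" using ij[OF rN[OF y(1), of k]] ij[OF y(1)] y(2) by simp
  qed
qed

text \<open>The group acts on the image of \<open>V\<close> by translation of functions, transported
  along \<open>\<iota>\<close>, and on the complement by \<open>\<sigma>\<close>.\<close>

definition glue_rep :: "('i \<Rightarrow> 'a) set \<Rightarrow> (('i \<Rightarrow> 'a) \<Rightarrow> ('i \<Rightarrow> 'a) \<Rightarrow> 'a) \<Rightarrow> (('k \<Rightarrow> 'a) \<Rightarrow> ('i \<Rightarrow> 'a)) \<Rightarrow>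
    ('k \<Rightarrow> ('i \<Rightarrow> 'a) \<Rightarrow> ('i \<Rightarrow> 'a)) \<Rightarrow> 'k \<Rightarrow> ('i \<Rightarrow> 'a) \<Rightarrow> ('i \<Rightarrow> 'a)" where
  "glue_rep S h \<iota> \<sigma> k = hermitian_space.glue S h (\<iota> ` V) (\<lambda>x\<in>\<iota> ` V. \<iota> (shift k (inv_into V \<iota> x))) (\<sigma> k)"

context
  fixes S :: "('i \<Rightarrow> 'a) set" and h
  assumes S: "hermitian_space q S h"
begin

interpretation S: hermitian_space q S h by (rule S)

lemma glue_rep_simps:
  assumes \<iota>: "\<iota> \<in> isoms V form S h" and \<sigma>: "\<sigma> \<in> Reps P (S.orth (\<iota> ` V)) h"
  shows "glue_rep S h \<iota> \<sigma> k \<in> isoms S h S h"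
    "x \<in> V \<Longrightarrow> glue_rep S h \<iota> \<sigma> k (\<iota> x) = \<iota> (shift k x)"
    "y \<in> S.orth (\<iota> ` V) \<Longrightarrow> glue_rep S h \<iota> \<sigma> k y = \<sigma> k y"
proof -
  note I = isoms_image_hermitian[OF hermitian_V S \<iota>]
  have inj: "inj_on \<iota> V" by (rule isoms_inj[OF hermitian_V S \<iota>])
  have inv: "inv_into V \<iota> (\<iota> x) = x" if "x \<in> V" for x using inv_into_f_f[OF inj that] .
  define F where "F = (\<lambda>x\<in>\<iota> ` V. \<iota> (shift k (inv_into V \<iota> x)))"
  have F: "F (\<iota> x) = \<iota> (shift k x)" if "x \<in> V" for x using that by (simp add: F_def inv)
  have sN: "subsp (\<iota> ` V)" using hermitian_space.subS[OF I(1)] .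
  have Fi: "F \<in> isoms (\<iota> ` V) h (\<iota> ` V) h"
  proof (rule isomsI)
    show "F \<in> \<iota> ` V \<rightarrow>\<^sub>E \<iota> ` V" by (auto simp: F_def inv shift_V)
  next
    fix x y assume "x \<in> \<iota> ` V" "y \<in> \<iota> ` V"
    then obtain u w where u: "x = \<iota> u" "u \<in> V" "y = \<iota> w" "w \<in> V" by blast
    then have "x + y = \<iota> (u + w)" using isomsD(2)[OF \<iota>] by simp
    then have "F (x + y) = \<iota> (shift k (u + w))" using F[of "u + w"] u by simp
    then show "F (x + y) = F x + F y"
      using u by (simp add: F shift_V shift_linear isomsD(2)[OF \<iota>])
    have "form (shift k u) (shift k w) = form u w" using isomsD(4)[OF shift_isom u(2,4), of k] u by simp
    then show "h (F x) (F y) = h x y" using u by (simp add: F isomsD(4)[OF \<iota>] shift_V)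
  next
    fix a x assume "x \<in> \<iota> ` V"
    then obtain u where u: "x = \<iota> u" "u \<in> V" by blast
    then have "smul a x = \<iota> (smul a u)" using isomsD(3)[OF \<iota>] by simp
    then have "F (smul a x) = \<iota> (shift k (smul a u))" using F[of "smul a u"] u by simp
    then show "F (smul a x) = smul a (F x)" using u by (simp add: F shift_V shift_linear isomsD(3)[OF \<iota>])
  qed
  have "F ` \<iota> ` V = \<iota> ` V"
    using isoms_bij[OF I(1) I(1) Fi] by (simp add: bij_betw_def)
  then have \<sigma>k: "\<sigma> k \<in> isoms (S.orth (\<iota> ` V)) h (S.orth (F ` \<iota> ` V)) h" using RepsD(1)[OF \<sigma>] by simp
  have FS: "F \<in> isoms (\<iota> ` V) h S h" by (rule isoms_mono[OF Fi I(2)])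
  have g: "glue_rep S h \<iota> \<sigma> k = S.glue (\<iota> ` V) F (\<sigma> k)" by (simp add: glue_rep_def F_def)
  show "glue_rep S h \<iota> \<sigma> k \<in> isoms S h S h" unfolding g by (rule S.glue_isoms[OF I(1,2) S FS \<sigma>k])
  show "glue_rep S h \<iota> \<sigma> k (\<iota> x) = \<iota> (shift k x)" if "x \<in> V"
    unfolding g using S.glue_restrict(1)[OF I(1,2) FS \<sigma>k, of "\<iota> x"] that F by auto
  show "glue_rep S h \<iota> \<sigma> k y = \<sigma> k y" if "y \<in> S.orth (\<iota> ` V)"
    unfolding g using S.glue_restrict(2)[OF I(1,2) FS \<sigma>k that] .
qed

lemma glue_rep_cyc_pairs:
  assumes \<iota>: "\<iota> \<in> isoms V form S h" and \<sigma>: "\<sigma> \<in> Reps P (S.orth (\<iota> ` V)) h"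
  shows "(glue_rep S h \<iota> \<sigma>, \<iota> lam) \<in> cyc_pairs S h"
    "hermitian_action.cyc S (range (glue_rep S h \<iota> \<sigma>)) (\<iota> lam) = \<iota> ` V"
    "chi h (range (glue_rep S h \<iota> \<sigma>)) (S.orth (\<iota> ` V)) = chi h (range \<sigma>) (S.orth (\<iota> ` V))"
proof -
  note I = isoms_image_hermitian[OF hermitian_V S \<iota>] and g = glue_rep_simps[OF \<iota> \<sigma>]
  have sO: "subsp (S.orth (\<iota> ` V))" by (rule S.subsp_orth[OF I(2)])
  have r: "glue_rep S h \<iota> \<sigma> \<in> Reps P S h"
  proof (rule RepsI[OF g(1)])
    fix k l x assume "x \<in> S"
    then obtain u y where x: "x = \<iota> u + y" "u \<in> V" "y \<in> S.orth (\<iota> ` V)" using S.decomp[OF I(1,2)] by blast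
    have yS: "y \<in> S" using x S.orth_subset by blast
    have \<sigma>y: "\<sigma> m y \<in> S.orth (\<iota> ` V)" "\<sigma> m y \<in> S" for m using RepsD(4)[OF \<sigma> x(3)] S.orth_subset by auto
    have gx: "glue_rep S h \<iota> \<sigma> m x = \<iota> (shift m u) + \<sigma> m y" for m
      using x yS isomsD(1)[OF \<iota>] by (simp add: isomsD(2)[OF g(1)] g)
    show "glue_rep S h \<iota> \<sigma> (k + l) x = glue_rep S h \<iota> \<sigma> k (glue_rep S h \<iota> \<sigma> l x)"
      unfolding gx using x \<sigma>y isomsD(1)[OF \<iota>] shift_V
      by (simp add: isomsD(2)[OF g(1)] g RepsD(2)[OF \<sigma>])
    assume k: "k \<in> P"
    have "shift k u = u" using V_period[OF x(2) k] by (auto simp: fun_eq_iff shift_apply)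
    then show "glue_rep S h \<iota> \<sigma> k x = x" unfolding gx using RepsD(3)[OF \<sigma> k x(3)] x by simp
  qed
  interpret A: hermitian_action q S h "range (glue_rep S h \<iota> \<sigma>)" by (rule Reps_action[OF S r])
  have lamS: "\<iota> lam \<in> S" using isomsD(1)[OF \<iota> lam_mem] .
  show cyc: "A.cyc (\<iota> lam) = \<iota> ` V"
  proof
    show "A.cyc (\<iota> lam) \<subseteq> \<iota> ` V"
    proof (rule A.cyc_least)
      show "\<iota> ` V \<in> Sub (range (glue_rep S h \<iota> \<sigma>)) S"
        using hermitian_space.subS[OF I(1)] I(2) by (auto simp: Sub_def g shift_V)
    qed (simp add: lam_mem)
    note C = A.cyc_Sub[OF lamS]
    \<comment> \<open>\<open>V\<close> is spanned by the translates of \<open>lam\<close>, so it is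
      enough that \<open>U\<close> is a subspace containing them.\<close>
    define U where "U = {x\<in>V. \<iota> x \<in> A.cyc (\<iota> lam)}"
    have "subsp U"
      using subsp_V SubD(1)[OF C] isoms_0[OF \<iota> subsp_V]
      by (auto simp: subsp_def U_def isomsD(2,3)[OF \<iota>])
    moreover have "shift k lam \<in> U" for k
      using SubD(3)[OF C rangeI A.mem_cyc, of k] g(2)[OF lam_mem, of k] shift_mem by (simp add: U_def)
    ultimately have "V \<subseteq> U" by (rule V_least)
    then show "\<iota> ` V \<subseteq> A.cyc (\<iota> lam)" by (auto simp: U_def)
  qed
  have "h (glue_rep S h \<iota> \<sigma> k (\<iota> lam)) (\<iota> lam) = lam k" for k
  proof -
    have "h (glue_rep S h \<iota> \<sigma> k (\<iota> lam)) (\<iota> lam) = form (shift k lam) lam"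
      by (simp add: g lam_mem isomsD(4)[OF \<iota>] shift_mem)
    also have "\<dots> = lam k" using form_shift[OF shift_mem, of k 0] by (simp add: shift_apply)
    finally show ?thesis .
  qed
  then show "(glue_rep S h \<iota> \<sigma>, \<iota> lam) \<in> cyc_pairs S h"
    unfolding cyc_pairs_def using r lamS S.orth_Int[OF I(1,2)] by (simp add: cyc)
  show "chi h (range (glue_rep S h \<iota> \<sigma>)) (S.orth (\<iota> ` V)) = chi h (range \<sigma>) (S.orth (\<iota> ` V))"
  proof (rule chi_image_cong)
    show "\<exists>g\<in>range \<sigma>. \<forall>x\<in>S.orth (\<iota> ` V). g x = f x" if "f \<in> range (glue_rep S h \<iota> \<sigma>)" for f
      using that g(3) by fastforce
    show "\<exists>f\<in>range (glue_rep S h \<iota> \<sigma>). \<forall>x\<in>S.orth (\<iota> ` V). g x = f x" if "g \<in> range \<sigma>" for g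
      using that g(3) by fastforce
  qed
qed

text \<open>A representation with a vector in \<open>cyc_pairs\<close> is the same as an embedding
  of \<open>V\<close> and a representation on the complement of the image: the embedding is unique
  because it is equivariant and sends \<open>lam\<close> to the vector.\<close>

lemma bij_glue_rep:
  "bij_betw (\<lambda>(\<iota>, \<sigma>). (glue_rep S h \<iota> \<sigma>, \<iota> lam)) (SIGMA \<iota>:isoms V form S h. Reps P (S.orth (\<iota> ` V)) h) (cyc_pairs S h)"
proof (rule bij_betw_imageI)
  show "inj_on (\<lambda>(\<iota>, \<sigma>). (glue_rep S h \<iota> \<sigma>, \<iota> lam)) (SIGMA \<iota>:isoms V form S h. Reps P (S.orth (\<iota> ` V)) h)"
  proof (rule inj_onI, clarify)
    fix i s i' s'
    assume i: "i \<in> isoms V form S h" and s: "s \<in> Reps P (S.orth (i ` V)) h"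
      and i': "i' \<in> isoms V form S h" and s': "s' \<in> Reps P (S.orth (i' ` V)) h"
      and eq: "glue_rep S h i s = glue_rep S h i' s'" "i lam = i' lam"
    define U where "U = {x\<in>V. i x = i' x}"
    have "subsp U"
      using subsp_V isoms_0[OF i subsp_V] isoms_0[OF i' subsp_V]
      by (auto simp: subsp_def U_def isomsD(2,3)[OF i] isomsD(2,3)[OF i'])
    moreover have "shift k lam \<in> U" for k
      using glue_rep_simps(2)[OF i s lam_mem, of k] glue_rep_simps(2)[OF i' s' lam_mem, of k] eq shift_mem by (simp add: U_def)
    ultimately have "V \<subseteq> U" by (rule V_least)
    then have ii: "i = i'" by (intro isoms_eqI[OF i i']) (auto simp: U_def)
    moreover have "s = s'"
    proof
      have s'': "s' \<in> Reps P (S.orth (i ` V)) h" using s' ii by simp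
      fix k show "s k = s' k"
      proof (rule isoms_eqI[OF RepsD(1)[OF s] RepsD(1)[OF s'']])
        fix x assume x: "x \<in> S.orth (i ` V)"
        then show "s k x = s' k x" using glue_rep_simps(3)[OF i s x, of k] glue_rep_simps(3)[OF i' s', of x k] eq ii by simp
      qed
    qed
    ultimately show "i = i' \<and> s = s'" by simp
  qed
  show "(\<lambda>(\<iota>, \<sigma>). (glue_rep S h \<iota> \<sigma>, \<iota> lam)) ` (SIGMA \<iota>:isoms V form S h. Reps P (S.orth (\<iota> ` V)) h) = cyc_pairs S h"
  proof (intro equalityI subsetI)
    fix z assume z: "z \<in> cyc_pairs S h"
    obtain \<rho> v where rv: "z = (\<rho>, v)" "(\<rho>, v) \<in> cyc_pairs S h" using z by (cases z) auto
    have r: "\<rho> \<in> Reps P S h" using rv by (auto simp: cyc_pairs_def)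
    obtain i where i: "i \<in> isoms V form S h" "i lam = v" "\<And>k x. x \<in> V \<Longrightarrow> \<rho> k (i x) = i (shift k x)"
      using cyc_pairs_embedding[OF S rv(2)] by blast
    note I = isoms_image_hermitian[OF hermitian_V S i(1)]
    have imk: "\<rho> k ` i ` V = i ` V" for k
    proof
      show "\<rho> k ` i ` V \<subseteq> i ` V" using i(3) shift_V by auto
      have "i x = \<rho> k (i (shift (- k) x))" if "x \<in> V" for x
        using i(3)[OF shift_V[OF that], of k "- k"] by simp
      then show "i ` V \<subseteq> \<rho> k ` i ` V" using shift_V by blast
    qed
    define s where "s = (\<lambda>k. restrict (\<rho> k) (S.orth (i ` V)))"
    have sk: "s k \<in> isoms (S.orth (i ` V)) h (S.orth (i ` V)) h" for k
      using S.restrict_orth_isoms(2)[OF I(1,2) S RepsD(1)[OF r], of k] by (simp add: s_def imk)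
    have s: "s \<in> Reps P (S.orth (i ` V)) h"
    proof (rule RepsI[OF sk])
      fix k l x assume x: "x \<in> S.orth (i ` V)"
      then have xS: "x \<in> S" using S.orth_subset by blast
      have "\<rho> l x \<in> S.orth (i ` V)" using isomsD(1)[OF sk x, of l] x by (simp add: s_def)
      then show "s (k + l) x = s k (s l x)" using x RepsD(2)[OF r xS] by (simp add: s_def)
      show "k \<in> P \<Longrightarrow> s k x = x" using x RepsD(3)[OF r _ xS] by (simp add: s_def)
    qed
    have "glue_rep S h i s = \<rho>"
    proof
      fix k show "glue_rep S h i s k = \<rho> k"
        by (rule S.isom_decomp_eqI[OF I(1,2) glue_rep_simps(1)[OF i(1) s] RepsD(1)[OF r]])
           (auto simp: glue_rep_simps[OF i(1) s] i(3), simp add: s_def)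
    qed
    then show "z \<in> (\<lambda>(\<iota>, \<sigma>). (glue_rep S h \<iota> \<sigma>, \<iota> lam)) ` (SIGMA \<iota>:isoms V form S h. Reps P (S.orth (\<iota> ` V)) h)"
      using i(1,2) s rv by (intro image_eqI[of _ _ "(i, s)"]) auto
  qed (use glue_rep_cyc_pairs(1) in auto)
qed

lemma sum_cyc_pairs:
  "(\<Sum>(\<rho>, v)\<in>cyc_pairs S h. chi h (range \<rho>) (S.orth (hermitian_action.cyc S (range \<rho>) v)))
    = (\<Sum>\<iota>\<in>isoms V form S h. chi_sum P (S.orth (\<iota> ` V)) h)"
proof -
  have "(\<Sum>(\<rho>, v)\<in>cyc_pairs S h. chi h (range \<rho>) (S.orth (hermitian_action.cyc S (range \<rho>) v)))
    = (\<Sum>(\<iota>, \<sigma>)\<in>(SIGMA \<iota>:isoms V form S h. Reps P (S.orth (\<iota> ` V)) h).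
        chi h (range (glue_rep S h \<iota> \<sigma>)) (S.orth (hermitian_action.cyc S (range (glue_rep S h \<iota> \<sigma>)) (\<iota> lam))))"
    by (subst sum.reindex_bij_betw[OF bij_glue_rep, symmetric]) (simp add: split_beta)
  also have "\<dots> = (\<Sum>(\<iota>, \<sigma>)\<in>(SIGMA \<iota>:isoms V form S h. Reps P (S.orth (\<iota> ` V)) h). chi h (range \<sigma>) (S.orth (\<iota> ` V)))"
    by (rule sum.cong[OF refl]) (auto simp: glue_rep_cyc_pairs)
  also have "\<dots> = (\<Sum>\<iota>\<in>isoms V form S h. chi_sum P (S.orth (\<iota> ` V)) h)"
    unfolding chi_sum_def
    by (subst sum.Sigma) (auto intro!: finite_isoms finite_V S.finS finite_Reps finite_subset[OF S.orth_subset])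
  finally show ?thesis .
qed

end

end

section \<open>The recursion for sums over representations\<close>

context quadratic_field
begin

definition Lam :: "'k::ab_group_add set \<Rightarrow> ('k \<Rightarrow> 'a) set" where
  "Lam P = {lam. (\<forall>k. lam (- k) = lam k ^ q) \<and> (\<forall>k. \<forall>p\<in>P. lam (k + p) = lam k)}"

lemma Lam_hermitian_function:
  "periods P B \<Longrightarrow> lam \<in> Lam P \<Longrightarrow> hermitian_function q P B (lam :: 'k::ab_group_add \<Rightarrow> 'a)"
  unfolding hermitian_function_def hermitian_function_axioms_def
  using quadratic_field_axioms by (auto simp: Lam_def)

lemma finite_Lam:
  assumes "periods P B"
  shows "finite (Lam (P :: 'k::ab_group_add set))"
proof -
  interpret periods P B by fact
  have "inj_on (\<lambda>lam. restrict lam B) (Lam P)"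
  proof (rule inj_onI)
    fix x y assume x: "x \<in> Lam P" and y: "y \<in> Lam P" and eq: "restrict x B = restrict y B"
    show "x = y"
    proof
      fix k obtain b where b: "b \<in> B" "k - b \<in> P" using repB by blast
      have "x (b + (k - b)) = x b" "y (b + (k - b)) = y b" using x y b unfolding Lam_def by blast+
      then show "x k = y k" using fun_cong[OF eq, of b] b by simp
    qed
  qed
  moreover have "(\<lambda>lam. restrict lam B) ` Lam P \<subseteq> B \<rightarrow>\<^sub>E UNIV" by auto
  ultimately show ?thesis using finB by (meson finite_PiE finite finite_imageD finite_subset)
qed

definition rank :: "'k::ab_group_add set \<Rightarrow> ('k \<Rightarrow> 'a) \<Rightarrow> nat" where
  "rank B lam = (THE m. card (hermitian_function.V B lam) = (q\<^sup>2) ^ m)"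

lemma power_q2_inj: "(q\<^sup>2) ^ m = (q\<^sup>2) ^ n \<longleftrightarrow> m = n"
  using q_ge_2 by (simp add: power_mult[symmetric])

lemma rank_eqI: "card (hermitian_function.V B lam) = (q\<^sup>2) ^ m \<Longrightarrow> rank B lam = m"
  unfolding rank_def by (rule the_equality) (auto simp: power_q2_inj)

lemma card_V_rank:
  assumes "periods P B" "lam \<in> Lam P"
  shows "card (hermitian_function.V B lam) = (q\<^sup>2) ^ rank B lam"
proof -
  interpret H: hermitian_function q P B lam by (rule Lam_hermitian_function[OF assms])
  obtain m where "card H.V = (q\<^sup>2) ^ m" using H.V.dimension by blast
  then show ?thesis using rank_eqI by metis
qed

text \<open>This is b(n) for the quotient group given by \<open>P\<close>. The standard form may be
  used because \<open>chi_sum\<close> depends only on the dimension.\<close>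

definition mass :: "'k::ab_group_add set \<Rightarrow> nat \<Rightarrow> rat" where
  "mass P n = of_int (chi_sum P (std_space n :: (nat \<Rightarrow> 'a) set) (std_form q n)) / of_nat (order_U n)"

text \<open>\<open>chi_recursion\<close> is summed over all representations, and the pairs of a
  representation and a vector are sorted by \<open>lam\<close>. A cyclic module of dimension m has
  |U_n| / |U_(n-m)| embeddings, which is exactly the change of normalization from
  \<open>mass P n\<close> to \<open>mass P (n - m)\<close>.\<close>

theorem mass_recursion:
  assumes PB: "periods P (B :: 'k::ab_group_add set)"
  shows "(- of_nat q) ^ n * mass P n =
    (\<Sum>lam | lam \<in> Lam P \<and> rank B lam \<le> n. wt (lam 0) * mass P (n - rank B lam))"
proof -
  interpret periods P B by fact
  define S where "S = (std_space n :: (nat \<Rightarrow> 'a) set)"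
  define h where "h = (std_form q n :: (nat \<Rightarrow> 'a) \<Rightarrow> (nat \<Rightarrow> 'a) \<Rightarrow> 'a)"
  interpret S: hermitian_space q S h unfolding S_def h_def by (rule std_hermitian)
  have cS: "card S = (q\<^sup>2) ^ n" by (simp add: S_def card_std_space card_field)
  let ?cyc = "\<lambda>\<rho>. hermitian_action.cyc S (range (\<rho> :: 'k \<Rightarrow> (nat \<Rightarrow> 'a) \<Rightarrow> (nat \<Rightarrow> 'a)))"
  define A where "A = (SIGMA \<rho>:Reps P S h. {v. v \<in> S \<and> ?cyc \<rho> v \<inter> S.orth (?cyc \<rho> v) = {0}})"
  define L where "L = (\<lambda>(\<rho> :: 'k \<Rightarrow> (nat \<Rightarrow> 'a) \<Rightarrow> (nat \<Rightarrow> 'a), v). (\<lambda>k. h (\<rho> k v) v))"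
  define F where "F = (\<lambda>(\<rho>, v). rat_of_int (chi h (range \<rho>) (S.orth (?cyc \<rho> v))))"
  have finR: "finite (Reps P S h)" by (rule finite_Reps[OF S.finS])
  have finA: "finite A" unfolding A_def using finR S.finS by auto
  have "(- of_nat q) ^ n * rat_of_int (chi_sum P S h)
      = (\<Sum>\<rho>\<in>Reps P S h. (- of_nat q) ^ n * rat_of_int (chi h (range \<rho>) S))"
    by (simp add: chi_sum_def sum_distrib_left)
  also have "\<dots> = (\<Sum>\<rho>\<in>Reps P S h. \<Sum>v | v \<in> S \<and> ?cyc \<rho> v \<inter> S.orth (?cyc \<rho> v) = {0}.
      wt (h v v) * rat_of_int (chi h (range \<rho>) (S.orth (?cyc \<rho> v))))"
    by (rule sum.cong[OF refl]) (rule hermitian_action.chi_recursion[OF Reps_action[OF S.hermitian_space_axioms] cS])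
  also have "\<dots> = (\<Sum>(\<rho>, v)\<in>A. wt (h v v) * rat_of_int (chi h (range \<rho>) (S.orth (?cyc \<rho> v))))"
    unfolding A_def by (subst sum.Sigma) (use finR S.finS in auto)
  also have "\<dots> = (\<Sum>z\<in>A. wt (L z 0) * F z)"
    by (rule sum.cong[OF refl]) (auto simp: A_def L_def F_def RepsD(3)[OF _ zeroP])
  also have "\<dots> = (\<Sum>lam\<in>Lam P. \<Sum>z | z \<in> A \<and> L z = lam. wt (L z 0) * F z)"
  proof (rule sum.group[symmetric, OF finA finite_Lam[OF PB]])
    show "L ` A \<subseteq> Lam P"
    proof
      fix lam assume "lam \<in> L ` A"
      then obtain \<rho> v where r: "\<rho> \<in> Reps P S h" and v: "v \<in> S" and lam: "lam = (\<lambda>k. h (\<rho> k v) v)"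
        by (auto simp: A_def L_def)
      have "h (\<rho> (- k) v) v = h (\<rho> k v) v ^ q" for k
      proof -
        have "h (\<rho> k (\<rho> (- k) v)) (\<rho> k v) = h (\<rho> (- k) v) v"
          by (rule isomsD(4)[OF RepsD(1)[OF r] RepsD(4)[OF r v] v])
        moreover have "\<rho> k (\<rho> (- k) v) = v"
          using RepsD(2)[OF r v, of k "- k"] RepsD(3)[OF r zeroP v] by simp
        ultimately show ?thesis using S.h_herm[OF RepsD(4)[OF r v] v, of k] by simp
      qed
      moreover have "\<rho> (k + p) = \<rho> k" if "p \<in> P" for k p by (rule Reps_period[OF r]) (simp add: that)
      ultimately show "lam \<in> Lam P" by (simp add: Lam_def lam)
    qed
  qed
  also have "\<dots> = (\<Sum>lam\<in>Lam P. wt (lam 0) * (\<Sum>z | z \<in> A \<and> L z = lam. F z))"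
    by (rule sum.cong[OF refl]) (simp add: sum_distrib_left)
  also have "\<dots> = (\<Sum>lam\<in>Lam P. if rank B lam \<le> n then wt (lam 0) * (of_nat (order_U n) * mass P (n - rank B lam)) else 0)"
  proof (rule sum.cong[OF refl])
    fix lam :: "'k \<Rightarrow> 'a" assume lam: "lam \<in> Lam P"
    interpret H: hermitian_function q P B lam by (rule Lam_hermitian_function[OF PB lam])
    define m where "m = rank B lam"
    have cV: "card H.V = (q\<^sup>2) ^ m" unfolding m_def by (rule card_V_rank[OF PB lam])
    have "{z. z \<in> A \<and> L z = lam} = H.cyc_pairs S h"
      by (auto simp: A_def L_def H.cyc_pairs_def)
    then have "(\<Sum>z | z \<in> A \<and> L z = lam. F z) = rat_of_int (\<Sum>(\<rho>, v)\<in>H.cyc_pairs S h. chi h (range \<rho>) (S.orth (?cyc \<rho> v)))"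
      by (simp add: F_def split_beta)
    also have "\<dots> = (\<Sum>\<iota>\<in>isoms H.V H.form S h. rat_of_int (chi_sum P (S.orth (\<iota> ` H.V)) h))"
      by (simp add: H.sum_cyc_pairs[OF S.hermitian_space_axioms])
    also have "\<dots> = (\<Sum>\<iota>\<in>isoms H.V H.form S h. rat_of_int (chi_sum P (std_space (n - m) :: (nat \<Rightarrow> 'a) set) (std_form q (n - m))))"
    proof (rule sum.cong[OF refl])
      fix \<iota> assume i: "\<iota> \<in> isoms H.V H.form S h"
      note I = isoms_image_hermitian[OF H.hermitian_V S.hermitian_space_axioms i]
      have "chi_sum P (S.orth (\<iota> ` H.V)) h = chi_sum P (std_space (n - m) :: (nat \<Rightarrow> 'a) set) (std_form q (n - m))"
        by (rule chi_sum_cong[OF S.orth_hermitian[OF I(1,2)] std_hermitian])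
           (use S.card_orth(2)[OF I(1,2) cS] I(3) cV in \<open>simp add: card_std_space card_field\<close>)
      then show "rat_of_int (chi_sum P (S.orth (\<iota> ` H.V)) h) = rat_of_int (chi_sum P (std_space (n - m) :: (nat \<Rightarrow> 'a) set) (std_form q (n - m)))"
        by simp
    qed
    finally have *: "(\<Sum>z | z \<in> A \<and> L z = lam. F z) = of_nat (card (isoms H.V H.form S h)) *
        rat_of_int (chi_sum P (std_space (n - m) :: (nat \<Rightarrow> 'a) set) (std_form q (n - m)))" by simp
    show "wt (lam 0) * (\<Sum>z | z \<in> A \<and> L z = lam. F z) =
      (if rank B lam \<le> n then wt (lam 0) * (of_nat (order_U n) * mass P (n - rank B lam)) else 0)"
    proof (cases "m \<le> n")
      case True
      have "order_U n = card (isoms H.V H.form S h) * order_U (n - m)"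
        using card_isoms_embeddings(2)[OF H.hermitian_V S.hermitian_space_axioms cV cS True] by simp
      then have "of_nat (order_U n) * mass P (n - m) = of_nat (card (isoms H.V H.form S h)) *
        rat_of_int (chi_sum P (std_space (n - m) :: (nat \<Rightarrow> 'a) set) (std_form q (n - m)))"
        using order_U_pos[of "n - m"] by (simp add: mass_def)
      then show ?thesis using True by (simp add: * m_def)
    next
      case False
      then show ?thesis using card_isoms_embeddings(1)[OF H.hermitian_V S.hermitian_space_axioms cV cS]
        by (simp add: * m_def)
    qed
  qed
  also have "\<dots> = (\<Sum>lam | lam \<in> Lam P \<and> rank B lam \<le> n. wt (lam 0) * (of_nat (order_U n) * mass P (n - rank B lam)))"
    by (rule sum.inter_filter[OF finite_Lam[OF PB], symmetric])
  also have "\<dots> = of_nat (order_U n) * (\<Sum>lam | lam \<in> Lam P \<and> rank B lam \<le> n. wt (lam 0) * mass P (n - rank B lam))"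
    by (simp add: sum_distrib_left mult_ac)
  finally show ?thesis using order_U_pos[of n] by (simp add: mass_def S_def h_def field_simps)
qed

end

section \<open>Representations with nontrivial unipotent part\<close>

text \<open>The binomial theorem for \<open>u = 1 + T\<close>, stated pointwise because
  \<open>u\<close> is linear only on \<open>S\<close>.\<close>

lemma funpow_binomial:
  fixes u :: "('i \<Rightarrow> 'a::field) \<Rightarrow> ('i \<Rightarrow> 'a)"
  assumes S: "subsp S" and u: "\<And>x. x \<in> S \<Longrightarrow> u x \<in> S" "\<And>x y. x \<in> S \<Longrightarrow> y \<in> S \<Longrightarrow> u (x + y) = u x + u y"
    "\<And>a x. x \<in> S \<Longrightarrow> u (smul a x) = smul a (u x)" and x: "x \<in> S"
  defines "T \<equiv> \<lambda>x. u x - x"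
  shows "(u ^^ n) x = (\<Sum>j\<le>n. smul (of_nat (n choose j)) ((T ^^ j) x))"
proof -
  have T: "(T ^^ j) x \<in> S" for j
    by (induction j) (auto simp: T_def x u(1) subsp_diff[OF S])
  have u0: "u 0 = 0" using u(2)[of 0 0] subsp_0[OF S] by simp
  have u_sum: "u (\<Sum>j\<in>J. smul (c j) ((T ^^ j) x)) = (\<Sum>j\<in>J. smul (c j) (u ((T ^^ j) x)))" for c :: "nat \<Rightarrow> 'a" and J
  proof (induction J rule: infinite_finite_induct)
    case (insert j J)
    have "(\<Sum>j\<in>J. smul (c j) ((T ^^ j) x)) \<in> S" by (intro subsp_sum subsp_smul T S)
    then show ?case using insert by (simp add: u(2,3) T subsp_smul[OF S])
  qed (simp_all add: u0)
  have uT: "u ((T ^^ j) x) = (T ^^ j) x + (T ^^ Suc j) x" for j by (simp add: T_def)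
  show ?thesis
  proof (induction n)
    case 0 then show ?case by simp
  next
    case (Suc n)
    have "(u ^^ Suc n) x = (\<Sum>j\<le>n. smul (of_nat (n choose j)) (u ((T ^^ j) x)))"
      by (simp add: Suc u_sum)
    also have "\<dots> = (\<Sum>j\<le>n. smul (of_nat (n choose j)) ((T ^^ j) x)) + (\<Sum>j\<le>n. smul (of_nat (n choose j)) ((T ^^ Suc j) x))"
      by (simp only: uT smul_add sum.distrib)
    also have "(\<Sum>j\<le>n. smul (of_nat (n choose j)) ((T ^^ j) x)) = x + (\<Sum>j\<le>n. smul (of_nat (n choose Suc j)) ((T ^^ Suc j) x))"
    proof -
      have "(\<Sum>j\<le>n. smul (of_nat (n choose j)) ((T ^^ j) x)) = (\<Sum>j\<le>Suc n. smul (of_nat (n choose j)) ((T ^^ j) x))"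
        by (simp add: binomial_eq_0)
      also have "\<dots> = x + (\<Sum>j\<le>n. smul (of_nat (n choose Suc j)) ((T ^^ Suc j) x))"
        by (subst sum.atMost_Suc_shift) simp
      finally show ?thesis .
    qed
    also have "x + (\<Sum>j\<le>n. smul (of_nat (n choose Suc j)) ((T ^^ Suc j) x)) + (\<Sum>j\<le>n. smul (of_nat (n choose j)) ((T ^^ Suc j) x))
      = x + (\<Sum>j\<le>n. smul (of_nat (Suc n choose Suc j)) ((T ^^ Suc j) x))"
      by (simp add: smul_add sum.distrib add_ac)
    also have "\<dots> = (\<Sum>j\<le>Suc n. smul (of_nat (Suc n choose j)) ((T ^^ j) x))"
      by (subst sum.atMost_Suc_shift) simp
    finally show ?case .
  qed
qed

lemma funpow_char:
  fixes u :: "('i \<Rightarrow> 'a::field) \<Rightarrow> ('i \<Rightarrow> 'a)"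
  assumes p: "Factorial_Ring.prime CHAR('a)" and S: "subsp S"
    and u: "\<And>x. x \<in> S \<Longrightarrow> u x \<in> S" "\<And>x y. x \<in> S \<Longrightarrow> y \<in> S \<Longrightarrow> u (x + y) = u x + u y"
    "\<And>a x. x \<in> S \<Longrightarrow> u (smul a x) = smul a (u x)" and x: "x \<in> S"
  shows "(u ^^ CHAR('a)) x = x + ((\<lambda>x. u x - x) ^^ CHAR('a)) x"
proof -
  let ?p = "CHAR('a)"
  let ?T = "\<lambda>x. u x - x"
  have "(u ^^ ?p) x = (\<Sum>j\<le>?p. smul (of_nat (?p choose j)) ((?T ^^ j) x))"
    by (rule funpow_binomial[OF S u x])
  also have "\<dots> = (\<Sum>j\<in>{0, ?p}. smul (of_nat (?p choose j)) ((?T ^^ j) x))"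
  proof (intro sum.mono_neutral_right ballI)
    fix j assume "j \<in> {..?p} - {0, ?p}"
    then have "?p dvd (?p choose j)" by (intro dvd_choose_prime) (auto intro: p)
    then have "of_nat (?p choose j) = (0 :: 'a)" using of_nat_eq_0_iff_char_dvd by blast
    then show "smul (of_nat (?p choose j)) ((?T ^^ j) x) = 0" by simp
  qed auto
  also have "\<dots> = x + (?T ^^ ?p) x" using prime_gt_0_nat[OF p] by simp
  finally show ?thesis .
qed

text \<open>This iterates \<open>(1 + T)\<^sup>p = 1 + T\<^sup>p\<close>. Thus a map whose order is
  a power of the characteristic differs from the identity by a nilpotent map.\<close>

lemma funpow_char_power:
  fixes u :: "('i \<Rightarrow> 'a::field) \<Rightarrow> ('i \<Rightarrow> 'a)"
  assumes p: "Factorial_Ring.prime CHAR('a)" and S: "subsp S"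
    and u: "\<And>x. x \<in> S \<Longrightarrow> u x \<in> S" "\<And>x y. x \<in> S \<Longrightarrow> y \<in> S \<Longrightarrow> u (x + y) = u x + u y"
    "\<And>a x. x \<in> S \<Longrightarrow> u (smul a x) = smul a (u x)" and x: "x \<in> S"
  shows "(u ^^ (CHAR('a) ^ a)) x = x + ((\<lambda>x. u x - x) ^^ (CHAR('a) ^ a)) x"
proof -
  let ?p = "CHAR('a)"
  let ?T = "\<lambda>x. u x - x"
  have "\<forall>x\<in>S. (u ^^ (?p ^ a)) x = x + (?T ^^ (?p ^ a)) x"
  proof (induction a)
    case 0 then show ?case by simp
  next
    case (Suc a)
    note IH = Suc
    define v where "v = u ^^ (?p ^ a)"
    have uS: "(u ^^ n) x \<in> S" if "x \<in> S" for n x by (induction n) (auto simp: that u(1))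
    have TS: "?T x \<in> S" if "x \<in> S" for x using that u(1) subsp_diff[OF S] by blast
    have TSn: "(?T ^^ n) x \<in> S" if "x \<in> S" for n x by (induction n) (auto simp: that TS)
    have v: "v x \<in> S" "v (x + y) = v x + v y" "v (smul b x) = smul b (v x)" if "x \<in> S" "y \<in> S" for x y b
    proof -
      show "v x \<in> S" using uS that by (simp add: v_def)
      have "(u ^^ n) (x + y) = (u ^^ n) x + (u ^^ n) y" for n by (induction n) (auto simp: that u(2) uS)
      then show "v (x + y) = v x + v y" by (simp add: v_def)
      have "(u ^^ n) (smul b x) = smul b ((u ^^ n) x)" for n by (induction n) (auto simp: that u(3) uS)
      then show "v (smul b x) = smul b (v x)" by (simp add: v_def)
    qed
    show ?case
    proof
      fix x assume x: "x \<in> S"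
      have T: "((\<lambda>x. v x - x) ^^ n) x = ((?T ^^ (?p ^ a)) ^^ n) x \<and> ((?T ^^ (?p ^ a)) ^^ n) x \<in> S" for n
      proof (induction n)
        case (Suc n)
        define y where "y = ((?T ^^ (?p ^ a)) ^^ n) x"
        have y: "y \<in> S" "((\<lambda>x. v x - x) ^^ n) x = y" using Suc by (simp_all add: y_def)
        have "v y - y = (?T ^^ (?p ^ a)) y" using IH y(1) by (simp add: v_def)
        then have "((\<lambda>x. v x - x) ^^ Suc n) x = (?T ^^ (?p ^ a)) y" using y(2) by simp
        moreover have "((?T ^^ (?p ^ a)) ^^ Suc n) x = (?T ^^ (?p ^ a)) y" by (simp add: y_def)
        ultimately show ?case using TSn[OF y(1)] by simp
      qed (simp add: x)
      have "(u ^^ (?p ^ Suc a)) x = (v ^^ ?p) x" by (simp add: v_def funpow_mult mult.commute)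
      also have "\<dots> = x + ((\<lambda>x. v x - x) ^^ ?p) x" by (rule funpow_char[OF p S v x])
      also have "\<dots> = x + (?T ^^ (?p ^ Suc a)) x" using T by (simp add: funpow_mult mult.commute)
      finally show "(u ^^ (?p ^ Suc a)) x = x + (?T ^^ (?p ^ Suc a)) x" .
    qed
  qed
  then show ?thesis using x by blast
qed

text \<open>With \<open>T\<close> the nilpotent difference of \<open>\<rho> k\<close> from the
  identity, the last nonzero iterate \<open>(T ^^ m) x\<close> is a fixed vector, and it stays in
  the invariant subspace that contains \<open>x\<close>.\<close>

lemma chi_eq_0_of_unipotent:
  fixes S :: "('i \<Rightarrow> 'a::{field,finite}) set"
  assumes S: "hermitian_space q S h" and r: "\<rho> \<in> Reps P S h"
    and p: "\<And>x. x \<in> S \<Longrightarrow> (\<rho> k ^^ (CHAR('a) ^ a)) x = x" and nontriv: "\<exists>x\<in>S. \<rho> k x \<noteq> x"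
  shows "chi h (range \<rho>) S = 0"
proof -
  interpret A: hermitian_action q S h "range \<rho>" by (rule Reps_action[OF S r])
  show ?thesis
  proof (rule A.chi_unipotent[of "\<rho> k"])
    show "f (\<rho> k x) = \<rho> k (f x)" if "f \<in> range \<rho>" "x \<in> S" for f x
      using that RepsD(2)[OF r that(2)] by (metis add.commute rangeE)
    show "\<rho> k (smul a x) = smul a (\<rho> k x)" if "x \<in> S" for a x by (rule isomsD(3)[OF RepsD(1)[OF r] that])
    show "\<exists>x\<in>S. \<rho> k x \<noteq> x" by (rule nontriv)
    fix U assume U: "U \<in> Sub (range \<rho>) S" "U \<noteq> {0}"
    define T where "T = (\<lambda>x. \<rho> k x - x)"
    obtain x where x: "x \<in> U" "x \<noteq> 0" using U subsp_0[OF SubD(1)[OF U(1)]] by blast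
    then have xS: "x \<in> S" using SubD(2)[OF U(1)] by blast
    have "T y \<in> U" if "y \<in> U" for y
      unfolding T_def using subsp_diff[OF SubD(1)[OF U(1)] SubD(3)[OF U(1) rangeI that] that] .
    then have TU: "(T ^^ n) x \<in> U" for n by (induction n) (simp_all add: x)
    have "(\<rho> k ^^ (CHAR('a) ^ a)) x = x + (T ^^ (CHAR('a) ^ a)) x"
      unfolding T_def
      by (rule funpow_char_power[OF A.prime_char A.subS]) (auto simp: RepsD(4)[OF r] isomsD[OF RepsD(1)[OF r]] xS)
    then have "(T ^^ (CHAR('a) ^ a)) x = 0" using p[OF xS] by simp
    then have ex: "\<exists>n. (T ^^ n) x = 0" by blast
    define n where "n = (LEAST n. (T ^^ n) x = 0)"
    have n0: "(T ^^ n) x = 0" unfolding n_def by (rule LeastI_ex[OF ex])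
    have "n \<noteq> 0"
    proof
      assume "n = 0" then show False using n0 x by simp
    qed
    then obtain m where m: "n = Suc m" by (cases n) auto
    have "(T ^^ m) x \<noteq> 0" using not_less_Least[of m "\<lambda>n. (T ^^ n) x = 0"] m by (auto simp: n_def)
    moreover have "\<rho> k ((T ^^ m) x) = (T ^^ m) x" using n0 m by (simp add: T_def)
    ultimately show "\<exists>x\<in>U. x \<noteq> 0 \<and> \<rho> k x = x" using TU by blast
  qed simp
qed

section \<open>Fourier transform over the algebraic closure\<close>

text \<open>Dividing out a root keeps all roots simple, so the count goes by induction on the
  degree.\<close>

lemma card_roots_separable:
  fixes p :: "'b::alg_closed_field poly"
  assumes "p \<noteq> 0" "\<And>x. poly p x = 0 \<Longrightarrow> poly (pderiv p) x \<noteq> 0"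
  shows "card {x. poly p x = 0} = Polynomial.degree p"
  using assms
proof (induction "Polynomial.degree p" arbitrary: p rule: less_induct)
  case (less p)
  show ?case
  proof (cases "Polynomial.degree p = 0")
    case True
    then obtain c where "p = [:c:]" by (rule degree_eq_zeroE)
    then show ?thesis using less.prems(1) by simp
  next
    case False
    then obtain x where x: "poly p x = 0" using alg_closed_imp_poly_has_root by blast
    then obtain r where r: "p = [:-x, 1:] * r" using poly_eq_0_iff_dvd by (metis dvdE)
    have r0: "r \<noteq> 0" using less.prems(1) r by auto
    have deg: "Polynomial.degree p = Suc (Polynomial.degree r)" unfolding r using r0 by (subst degree_mult_eq) auto
    have pd: "poly (pderiv p) y = poly r y + (y - x) * poly (pderiv r) y" for y
      unfolding r pderiv_mult by (simp add: pderiv_pCons algebra_simps)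
    have rx: "poly r x \<noteq> 0" using less.prems(2)[OF x] pd[of x] by simp
    have "card {y. poly r y = 0} = Polynomial.degree r"
    proof (rule less.hyps[OF _ r0])
      show "Polynomial.degree r < Polynomial.degree p" using deg by simp
      fix y assume y: "poly r y = 0"
      then have "poly p y = 0" by (simp add: r)
      then show "poly (pderiv r) y \<noteq> 0" using less.prems(2) pd[of y] y by auto
    qed
    moreover have "{y. poly p y = 0} = insert x {y. poly r y = 0}" by (auto simp: r)
    ultimately show ?thesis using rx deg poly_roots_finite[OF r0] by simp
  qed
qed

lemma card_nth_roots_unity:
  assumes "of_nat m \<noteq> (0 :: 'b::alg_closed_field)"
  shows "card {x :: 'b. x ^ m = 1} = m"
proof -
  have m: "m > 0" using assms by (cases m) auto
  define p where "p = Polynomial.monom (1 :: 'b) m + [:-1:]"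
  have deg: "Polynomial.degree p = m"
    unfolding p_def using m by (subst degree_add_eq_left) (auto simp: degree_monom_eq)
  have p: "poly p x = x ^ m - 1" "poly (pderiv p) x = of_nat m * x ^ (m - 1)" for x
    by (auto simp: p_def poly_monom pderiv_add pderiv_monom pderiv_pCons)
  have "card {x. poly p x = 0} = m"
    unfolding deg[symmetric]
  proof (rule card_roots_separable)
    show "p \<noteq> 0" using deg m by auto
    fix x assume "poly p x = 0"
    then have "x \<noteq> 0" using m p(1)[of x] by (auto simp: power_0_left)
    then show "poly (pderiv p) x \<noteq> 0" using assms p(2) by auto
  qed
  then show ?thesis using p(1) by simp
qed

text \<open>The derivative of \<open>x\<^sup>m - x\<close> is the constant -1.\<close>

lemma card_frobenius_fixed:
  assumes "of_nat m = (0 :: 'b::alg_closed_field)" "m \<ge> 2"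
  shows "card {x :: 'b. x ^ m = x} = m"
proof -
  define p where "p = Polynomial.monom (1 :: 'b) m + [:0, -1:]"
  have deg: "Polynomial.degree p = m"
    unfolding p_def using assms by (subst degree_add_eq_left) (auto simp: degree_monom_eq)
  have p: "poly p x = x ^ m - x" "poly (pderiv p) x = -1" for x
    using assms by (auto simp: p_def poly_monom pderiv_add pderiv_monom pderiv_pCons)
  have "card {x. poly p x = 0} = m"
    unfolding deg[symmetric] by (rule card_roots_separable) (use p deg assms in auto)
  then show ?thesis using p(1) by simp
qed

lemma card_roots_unity_le:
  assumes "m > 0"
  shows "finite {x :: 'b::idom. x ^ m = 1}" "card {x :: 'b. x ^ m = 1} \<le> m"
proof -
  have "finite {x :: 'b. x ^ m = 1} \<and> card {x :: 'b. x ^ m = 1} \<le> m"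
  proof (cases "m = 1")
    case True then show ?thesis by simp
  next
    case False
    then show ?thesis using card_power_eq_le[of m "1 :: 'b"] assms by simp
  qed
  then show "finite {x :: 'b. x ^ m = 1}" "card {x :: 'b. x ^ m = 1} \<le> m" by auto
qed

text \<open>Group elements are integer sequences of which only the first \<open>R\<close> entries
  count, so that one type serves every \<open>R\<close>. For \<open>E = 0\<close> divisibility means
  vanishing, and the quotient is \<open>\<int>\<^sup>R\<close> itself.\<close>

definition period_lattice :: "nat \<Rightarrow> nat \<Rightarrow> (nat \<Rightarrow> int) set" where
  "period_lattice R E = {k. \<forall>i<R. int E dvd k i}"

definition box :: "nat \<Rightarrow> nat \<Rightarrow> (nat \<Rightarrow> int) set" where
  "box R E = {k. (\<forall>i<R. k i \<in> {0..<int E}) \<and> (\<forall>i\<ge>R. k i = 0)}"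

definition reduce :: "nat \<Rightarrow> nat \<Rightarrow> (nat \<Rightarrow> int) \<Rightarrow> nat \<Rightarrow> int" where
  "reduce R E k = (\<lambda>i. if i < R then k i mod int E else 0)"

lemma reduce_box: "E > 0 \<Longrightarrow> reduce R E k \<in> box R E" by (auto simp: reduce_def box_def)

lemma reduce_id: "k \<in> box R E \<Longrightarrow> reduce R E k = k" by (auto simp: reduce_def box_def fun_eq_iff)

lemma reduce_lattice: "k - reduce R E k \<in> period_lattice R E" by (auto simp: period_lattice_def reduce_def minus_apply)

lemma reduce_eq: "reduce R E k = reduce R E l \<longleftrightarrow> k - l \<in> period_lattice R E"
  by (auto simp: reduce_def period_lattice_def fun_eq_iff minus_apply mod_eq_dvd_iff split: if_splits)

lemma bij_box: "bij_betw (\<lambda>k. restrict k {..<R}) (box R E) ({..<R} \<rightarrow>\<^sub>E {0..<int E})"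
  by (rule bij_betwI[where g = "\<lambda>k i. if i < R then k i else 0"])
     (auto simp: box_def fun_eq_iff PiE_def extensional_def)

lemma finite_box: "finite (box R E)"
  using bij_betw_finite[OF bij_box[of R E]] by (simp add: finite_PiE)

lemma periods_lattice: "E > 0 \<Longrightarrow> periods (period_lattice R E) (box R E)"
proof
  show "\<exists>b\<in>box R E. k - b \<in> period_lattice R E" if "E > 0" for k using reduce_box[OF that] reduce_lattice by blast
qed (auto simp: finite_box period_lattice_def zero_fun_apply)

text \<open>As \<open>E\<close> is prime to the characteristic, the algebraic closure has
  \<open>E\<close> distinct \<open>E\<close>-th roots of unity and \<open>E\<close> is invertible in
  it; Fourier inversion rests on both.\<close>

locale torus = quadratic_field q ty for q and ty :: "'a::{field,finite} itself" +
  fixes R E :: nat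
  assumes not_dvd_E: "\<not> CHAR('a) dvd E"
begin

lemma E_nz: "of_nat E \<noteq> (0 :: 'a alg_closure)" and E_pos: "E > 0"
  using not_dvd_E of_nat_eq_0_iff_char_dvd[where ?'a = "'a alg_closure", of E] by (auto intro: Nat.gr0I)

lemma prime_char': "Factorial_Ring.prime CHAR('a alg_closure)" using prime_char by simp

lemma pfrob_add: "(x + y :: 'a alg_closure) ^ (q ^ j) = x ^ (q ^ j) + y ^ (q ^ j)"
proof -
  obtain e where "q = CHAR('a) ^ e" using q_char by blast
  then have "q ^ j = CHAR('a alg_closure) ^ (e * j)" by (simp add: power_mult)
  then show ?thesis by (rule freshmans_dream'[OF prime_char'])
qed

lemma pfrob_sum: "(\<Sum>i\<in>I. f i :: 'a alg_closure) ^ (q ^ j) = (\<Sum>i\<in>I. f i ^ (q ^ j))"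
proof -
  obtain e where "q = CHAR('a) ^ e" using q_char by blast
  then have "q ^ j = CHAR('a alg_closure) ^ (e * j)" by (simp add: power_mult)
  then show ?thesis by (rule freshmans_dream_sum'[OF prime_char'])
qed

lemma pfrob_of_nat: "(of_nat m :: 'a alg_closure) ^ (q ^ j) = of_nat m"
proof (induction m)
  case 0 then show ?case using q_ge_2 by (simp add: power_0_left)
next
  case (Suc m) then show ?case by (simp add: pfrob_add)
qed

lemma of_nat_q: "of_nat q = (0 :: 'a alg_closure)"
  using q_char of_nat_eq_0_iff_char_dvd[where ?'a = "'a alg_closure", of q] by (auto simp: dvd_power)

text \<open>Both sides have \<open>q\<^sup>2\<close> elements. This is the descent criterion that
  brings values computed in the closure back to the field.\<close>

lemma range_to_ac: "range (to_ac :: 'a \<Rightarrow> _) = {z. z ^ (q ^ 2) = z}"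
proof (rule card_subset_eq)
  have "of_nat (q ^ 2) = (0 :: 'a alg_closure)" by (simp add: of_nat_q)
  moreover have "2 \<le> q ^ 2" using q_ge_2 self_le_power[of q 2] by simp
  ultimately have c: "card {z :: 'a alg_closure. z ^ (q ^ 2) = z} = q ^ 2" by (rule card_frobenius_fixed)
  then show "finite {z :: 'a alg_closure. z ^ (q ^ 2) = z}" using q_ge_2 by (intro card_ge_0_finite) simp
  show "range (to_ac :: 'a \<Rightarrow> _) \<subseteq> {z. z ^ (q ^ 2) = z}" using power_card by (auto simp flip: to_ac_power)
  show "card (range (to_ac :: 'a \<Rightarrow> _)) = card {z :: 'a alg_closure. z ^ (q ^ 2) = z}"
    using c card_field by (simp add: card_image inj_to_ac)
qed

lemma to_ac_of_ac': "z ^ (q ^ 2) = (z :: 'a alg_closure) \<Longrightarrow> to_ac (of_ac z) = z"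
  using range_to_ac by (intro to_ac_of_ac) auto

abbreviation "Per \<equiv> period_lattice R E"
abbreviation "Box \<equiv> box R E"
abbreviation "red \<equiv> reduce R E"

text \<open>The dual group of \<open>(\<int>/E)\<^sup>R\<close>: a character is given by its values
  on the generators, padded with 1, and \<open>ev\<close> evaluates it.\<close>

definition Ch :: "(nat \<Rightarrow> 'a alg_closure) set" where
  "Ch = {z. (\<forall>i<R. z i ^ E = 1) \<and> (\<forall>i\<ge>R. z i = 1)}"

definition ev :: "(nat \<Rightarrow> 'a alg_closure) \<Rightarrow> (nat \<Rightarrow> int) \<Rightarrow> 'a alg_closure" where
  "ev z k = (\<Prod>i<R. z i powi k i)"

lemma bij_Ch: "bij_betw (\<lambda>z. restrict z {..<R}) Ch ({..<R} \<rightarrow>\<^sub>E {w. w ^ E = 1})"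
  by (rule bij_betwI[where g = "\<lambda>z i. if i < R then z i else 1"])
     (auto simp: Ch_def fun_eq_iff PiE_def extensional_def)

lemma finite_Ch: "finite Ch"
  using bij_betw_finite[OF bij_Ch] card_roots_unity_le(1)[OF E_pos, where ?'b = "'a alg_closure"] by (simp add: finite_PiE)

lemma Ch_nz: "z \<in> Ch \<Longrightarrow> z i \<noteq> 0"
  using E_pos by (cases "i < R") (auto simp: Ch_def power_0_left)

lemma ev_add: "z \<in> Ch \<Longrightarrow> ev z (k + l) = ev z k * ev z l"
  by (simp add: ev_def plus_fun_apply power_int_add Ch_nz prod.distrib)

lemma ev_0: "ev z 0 = 1" by (simp add: ev_def zero_fun_apply)

lemma powi_period: "w ^ E = (1 :: 'a alg_closure) \<Longrightarrow> int E dvd n \<Longrightarrow> w powi n = 1"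
  by (auto simp: power_int_mult elim!: dvdE)

lemma ev_Per: "z \<in> Ch \<Longrightarrow> k \<in> Per \<Longrightarrow> ev z k = 1"
  by (auto simp: ev_def Ch_def period_lattice_def powi_period)

lemma sum_roots_powi: "w ^ E = (1 :: 'a alg_closure) \<Longrightarrow> (\<Sum>j\<in>{0..<int E}. w powi j) = (if w = 1 then of_nat E else 0)"
proof -
  assume w: "w ^ E = 1"
  have "bij_betw int {..<E} {0..<int E}"
    by (rule bij_betwI[where g = nat]) auto
  then have "(\<Sum>j\<in>{0..<int E}. w powi j) = (\<Sum>j<E. w powi int j)" by (rule sum.reindex_bij_betw[symmetric])
  also have "\<dots> = (\<Sum>j<E. w ^ j)" by simp
  also have "\<dots> = (if w = 1 then of_nat E else 0)"
  proof (cases "w = 1")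
    case False
    have "(w - 1) * (\<Sum>j<E. w ^ j) = w ^ E - 1" by (rule power_diff_1_eq[symmetric])
    then show ?thesis using w False by simp
  qed simp
  finally show ?thesis .
qed

lemma sum_ev_Box: "z \<in> Ch \<Longrightarrow> (\<Sum>k\<in>Box. ev z k) = (if z = (\<lambda>_. 1) then of_nat (E ^ R) else 0)"
proof -
  assume z: "z \<in> Ch"
  have "(\<Sum>k\<in>Box. ev z k) = (\<Sum>k\<in>Box. \<Prod>i<R. z i powi (restrict k {..<R}) i)"
    unfolding ev_def by (intro sum.cong prod.cong) auto
  also have "\<dots> = (\<Sum>k\<in>{..<R} \<rightarrow>\<^sub>E {0..<int E}. \<Prod>i<R. z i powi k i)"
    by (rule sum.reindex_bij_betw[OF bij_box])
  also have "\<dots> = (\<Prod>i<R. \<Sum>j\<in>{0..<int E}. z i powi j)"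
    by (rule prod_sum_PiE[symmetric]) auto
  also have "\<dots> = (\<Prod>i<R. if z i = 1 then of_nat E else 0)"
    by (rule prod.cong) (use z in \<open>auto simp: Ch_def sum_roots_powi\<close>)
  also have "\<dots> = (if z = (\<lambda>_. 1) then of_nat (E ^ R) else 0)"
  proof (cases "z = (\<lambda>_. 1)")
    case False
    then obtain i where "z i \<noteq> 1" by auto
    moreover have "i < R" using z \<open>z i \<noteq> 1\<close> by (auto simp: Ch_def intro: leI)
    ultimately show ?thesis using False by auto
  qed simp
  finally show ?thesis .
qed

lemma sum_powi_roots: "(\<Sum>w\<in>{w :: 'a alg_closure. w ^ E = 1}. w powi n) = (if int E dvd n then of_nat E else 0)"
proof (cases "int E dvd n")
  case True
  then have "(\<Sum>w\<in>{w :: 'a alg_closure. w ^ E = 1}. w powi n) = (\<Sum>w\<in>{w :: 'a alg_closure. w ^ E = 1}. 1)"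
    by (intro sum.cong) (auto simp: powi_period)
  then show ?thesis using True card_nth_roots_unity[OF E_nz] by simp
next
  case False
  define d where "d = nat (n mod int E)"
  have "0 \<le> n mod int E" "n mod int E < int E" "n mod int E \<noteq> 0" using False E_pos by (auto simp: dvd_eq_mod_eq_0)
  then have d: "0 < d" "d < E" "int d = n mod int E" unfolding d_def by linarith+
  have powd: "w powi n = w ^ d" if w: "w ^ E = 1" for w :: "'a alg_closure"
  proof -
    have "w \<noteq> 0" using w E_pos by (auto simp: power_0_left)
    have "n = int E * (n div int E) + int d" using d(3) by simp
    then have "w powi n = w powi (int E * (n div int E)) * w powi int d" using power_int_add[of w] \<open>w \<noteq> 0\<close> by metis
    then show ?thesis using powi_period[OF w, of "int E * (n div int E)"] by simp
  qed
  \<comment> \<open>There are \<open>E\<close> solutions of \<open>w\<^sup>E = 1\<close> but at most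
    \<open>d < E\<close> of \<open>w\<^sup>d = 1\<close>. Multiplication by \<open>\<zeta>\<close>
    permutes the former and multiplies the sum of their \<open>d\<close>-th powers by a factor other
    than 1.\<close>
  have "\<exists>\<zeta>::'a alg_closure. \<zeta> ^ E = 1 \<and> \<zeta> ^ d \<noteq> 1"
  proof (rule ccontr)
    assume "\<not> ?thesis"
    then have "{w :: 'a alg_closure. w ^ E = 1} \<subseteq> {w. w ^ d = 1}" by auto
    then have "card {w :: 'a alg_closure. w ^ E = 1} \<le> card {w :: 'a alg_closure. w ^ d = 1}"
      by (rule card_mono[OF card_roots_unity_le(1)[OF d(1)]])
    also have "\<dots> \<le> d" by (rule card_roots_unity_le(2)[OF d(1)])
    finally show False using d card_nth_roots_unity[OF E_nz] by simp
  qed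
  then obtain \<zeta> :: "'a alg_closure" where \<zeta>: "\<zeta> ^ E = 1" "\<zeta> ^ d \<noteq> 1" by blast
  have \<zeta>0: "\<zeta> \<noteq> 0" using \<zeta>(1) E_pos by (auto simp: power_0_left)
  have "bij_betw (\<lambda>w. \<zeta> * w) {w. w ^ E = 1} {w. w ^ E = 1}"
    by (rule bij_betwI[where g = "\<lambda>w. w / \<zeta>"]) (use \<zeta> \<zeta>0 in \<open>auto simp: power_mult_distrib power_divide\<close>)
  from sum.reindex_bij_betw[OF this, of "\<lambda>w. w ^ d"]
  have "(\<Sum>w\<in>{w. w ^ E = 1}. w ^ d) = \<zeta> ^ d * (\<Sum>w\<in>{w. w ^ E = 1}. w ^ d)"
    by (simp add: power_mult_distrib sum_distrib_left)
  then have "(\<Sum>w\<in>{w :: 'a alg_closure. w ^ E = 1}. w ^ d) = 0" using \<zeta>(2) by auto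
  moreover have "(\<Sum>w\<in>{w :: 'a alg_closure. w ^ E = 1}. w powi n) = (\<Sum>w\<in>{w :: 'a alg_closure. w ^ E = 1}. w ^ d)"
    by (rule sum.cong) (auto simp: powd)
  ultimately show ?thesis using False by simp
qed

lemma sum_ev_Ch: "(\<Sum>z\<in>Ch. ev z k) = (if k \<in> Per then of_nat (E ^ R) else 0)"
proof -
  have "(\<Sum>z\<in>Ch. ev z k) = (\<Sum>z\<in>Ch. \<Prod>i<R. (restrict z {..<R}) i powi k i)"
    unfolding ev_def by (intro sum.cong prod.cong) auto
  also have "\<dots> = (\<Sum>z\<in>{..<R} \<rightarrow>\<^sub>E {w. w ^ E = 1}. \<Prod>i<R. z i powi k i)"
    by (rule sum.reindex_bij_betw[OF bij_Ch])
  also have "\<dots> = (\<Prod>i<R. \<Sum>w\<in>{w. w ^ E = 1}. w powi k i)"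
    by (rule prod_sum_PiE[symmetric]) (use card_roots_unity_le(1)[OF E_pos] in auto)
  also have "\<dots> = (\<Prod>i<R. if int E dvd k i then of_nat E else 0)" by (simp add: sum_powi_roots)
  also have "\<dots> = (if k \<in> Per then of_nat (E ^ R) else 0)"
  proof (cases "k \<in> Per")
    case True then show ?thesis by (simp add: period_lattice_def)
  next
    case False
    then show ?thesis by (auto simp: period_lattice_def)
  qed
  finally show ?thesis .
qed

text \<open>The power map with exponent Q = -q; it permutes \<open>Ch\<close> because the Frobenius
  map is injective.\<close>

definition \<phi> :: "(nat \<Rightarrow> 'a alg_closure) \<Rightarrow> nat \<Rightarrow> 'a alg_closure" where
  "\<phi> z = (\<lambda>i. inverse (z i ^ q))"

lemma \<phi>_Ch: "z \<in> Ch \<Longrightarrow> \<phi> z \<in> Ch"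
  by (auto simp: \<phi>_def Ch_def power_inverse power_mult[symmetric] mult.commute[of q]) (simp add: power_mult)

lemma ev_\<phi>: "ev (\<phi> z) k = ev z (- k) ^ q"
proof -
  have "inverse (x ^ q) powi n = (x powi (- n)) ^ q" for x :: "'a alg_closure" and n
    using power_int_mult[of x n "int q"]
    by (simp add: power_int_inverse power_int_minus power_inverse power_int_power mult.commute)
  then show ?thesis by (simp add: ev_def \<phi>_def prod_power_distrib)
qed

lemma pfrob_inj: "x ^ q = y ^ q \<longleftrightarrow> x = (y :: 'a alg_closure)"
proof
  assume "x ^ q = y ^ q"
  then have "(x - y) ^ q + y ^ q = y ^ q" using pfrob_add[of "x - y" y 1] by simp
  then show "x = y" by simp
qed simp

lemma bij_\<phi>: "bij_betw \<phi> Ch Ch"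
proof -
  have "inj_on \<phi> Ch" by (rule inj_onI) (auto simp: \<phi>_def fun_eq_iff pfrob_inj)
  then show ?thesis using endo_inj_surj[OF finite_Ch] \<phi>_Ch by (auto simp: bij_betw_def)
qed

text \<open>The value 0 off \<open>Ch\<close> makes equality of transforms an equality of
  functions.\<close>

definition hat :: "((nat \<Rightarrow> int) \<Rightarrow> 'a) \<Rightarrow> (nat \<Rightarrow> 'a alg_closure) \<Rightarrow> 'a alg_closure" where
  "hat f z = (if z \<in> Ch then (\<Sum>k\<in>Box. ev z (- k) * to_ac (f k)) / of_nat (E ^ R) else 0)"

definition periodic :: "((nat \<Rightarrow> int) \<Rightarrow> 'a) set" where
  "periodic = {f. \<forall>k. \<forall>p\<in>Per. f (k + p) = f k}"

lemma ER_nz: "of_nat (E ^ R) \<noteq> (0 :: 'a alg_closure)" using E_nz by simp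

lemma periodic_red: "f \<in> periodic \<Longrightarrow> f (red k) = f k"
proof -
  assume "f \<in> periodic"
  then have "f (red k + (k - red k)) = f (red k)" using reduce_lattice unfolding periodic_def by blast
  then show ?thesis by simp
qed

lemma hat_inversion: "f \<in> periodic \<Longrightarrow> (\<Sum>z\<in>Ch. hat f z * ev z k) = to_ac (f k)"
proof -
  assume f: "f \<in> periodic"
  have "(\<Sum>z\<in>Ch. hat f z * ev z k) = (\<Sum>z\<in>Ch. \<Sum>l\<in>Box. ev z (k - l) * to_ac (f l)) / of_nat (E ^ R)"
    unfolding sum_divide_distrib[of _ Ch]
  proof (rule sum.cong[OF refl])
    fix z assume z: "z \<in> Ch"
    have "ev z (k - l) = ev z (- l) * ev z k" for l using ev_add[OF z, of "- l" k] by simp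
    then show "hat f z * ev z k = (\<Sum>l\<in>Box. ev z (k - l) * to_ac (f l)) / of_nat (E ^ R)"
      using z by (simp add: hat_def sum_distrib_right sum_distrib_left mult_ac del: of_nat_power)
  qed
  also have "\<dots> = (\<Sum>l\<in>Box. (\<Sum>z\<in>Ch. ev z (k - l)) * to_ac (f l)) / of_nat (E ^ R)"
    by (subst sum.swap) (simp add: sum_distrib_right)
  also have "(\<Sum>l\<in>Box. (\<Sum>z\<in>Ch. ev z (k - l)) * to_ac (f l)) = (\<Sum>l\<in>Box. if l = red k then of_nat (E ^ R) * to_ac (f l) else 0)"
  proof (rule sum.cong[OF refl])
    fix l assume l: "l \<in> Box"
    have "k - l \<in> Per \<longleftrightarrow> l = red k" using reduce_eq[of R E k l] reduce_id[OF l] by auto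
    then show "(\<Sum>z\<in>Ch. ev z (k - l)) * to_ac (f l) = (if l = red k then of_nat (E ^ R) * to_ac (f l) else 0)"
      by (simp add: sum_ev_Ch)
  qed
  also have "\<dots> = of_nat (E ^ R) * to_ac (f k)" using finite_box reduce_box[OF E_pos] periodic_red[OF f] by simp
  finally show ?thesis using ER_nz by (simp del: of_nat_power)
qed

text \<open>Expansions in characters are unique. Transforms are computed below by proposing
  \<open>t\<close> and checking its expansion.\<close>

lemma hat_unique:
  assumes t: "\<And>z. z \<notin> Ch \<Longrightarrow> t z = 0" and f: "\<And>k. to_ac (f k) = (\<Sum>z\<in>Ch. t z * ev z k)"
  shows "hat f = t"
proof
  fix z show "hat f z = t z"
  proof (cases "z \<in> Ch")
    case True
    have "(\<Sum>k\<in>Box. ev z (- k) * to_ac (f k)) = (\<Sum>k\<in>Box. \<Sum>w\<in>Ch. t w * ev (\<lambda>i. w i / z i) k)"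
      unfolding f sum_distrib_left
      by (intro sum.cong refl) (simp add: ev_def power_int_minus power_int_divide_distrib prod_dividef prod_inversef field_simps)
    also have "\<dots> = (\<Sum>w\<in>Ch. t w * (\<Sum>k\<in>Box. ev (\<lambda>i. w i / z i) k))"
      by (subst sum.swap) (simp add: sum_distrib_left)
    also have "\<dots> = (\<Sum>w\<in>Ch. if w = z then t w * of_nat (E ^ R) else 0)"
    proof (rule sum.cong[OF refl])
      fix w assume w: "w \<in> Ch"
      have "(\<lambda>i. w i / z i) \<in> Ch" using w True by (auto simp: Ch_def power_divide)
      moreover have "(\<lambda>i. w i / z i) = (\<lambda>_. 1) \<longleftrightarrow> w = z" using Ch_nz[OF True] by (auto simp: fun_eq_iff)
      ultimately show "t w * (\<Sum>k\<in>Box. ev (\<lambda>i. w i / z i) k) = (if w = z then t w * of_nat (E ^ R) else 0)"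
        using sum_ev_Box by simp
    qed
    also have "\<dots> = t z * of_nat (E ^ R)" using True finite_Ch by simp
    finally show ?thesis using True ER_nz by (simp add: hat_def del: of_nat_power)
  qed (simp add: hat_def t)
qed

end

section \<open>Equivariant functions on the dual torus\<close>

context torus
begin

text \<open>Contracting a point \<open>\<pi> z\<close> into \<open>z\<close> multiplies the exponents, so the number of solutions is
  the product of all the exponents.\<close>

lemma card_twisted_functions:
  fixes D :: "'z set"
  assumes "finite D" "bij_betw \<pi> D D" "\<And>z. z \<in> D \<Longrightarrow> a z > 0"
  shows "card {f :: 'z \<Rightarrow> 'a alg_closure. (\<forall>z. z \<notin> D \<longrightarrow> f z = 0) \<and> (\<forall>z\<in>D. f (\<pi> z) = f z ^ (q ^ a z))}
    = q ^ (\<Sum>z\<in>D. a z)"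
  using assms
proof (induction "card D" arbitrary: D \<pi> a)
  case 0
  then have "D = {}" by simp
  moreover have "{f :: 'z \<Rightarrow> 'a alg_closure. \<forall>z. f z = 0} = {\<lambda>_. 0}" by auto
  ultimately show ?case by simp
next
  case (Suc n)
  define Sol where "Sol = (\<lambda>D \<pi> a. {f :: 'z \<Rightarrow> 'a alg_closure. (\<forall>z. z \<notin> D \<longrightarrow> f z = 0) \<and> (\<forall>z\<in>D. f (\<pi> z) = f z ^ (q ^ a z))})"
  obtain z0 where z0: "z0 \<in> D" using Suc.hyps(2) by fastforce
  have \<pi>D: "\<pi> z \<in> D" if "z \<in> D" for z using Suc.prems(2) that by (auto simp: bij_betw_def)
  have inj: "\<pi> z = \<pi> w \<longleftrightarrow> z = w" if "z \<in> D" "w \<in> D" for z w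
    using Suc.prems(2) that by (auto simp: bij_betw_def inj_on_def)
  show ?case
  proof (cases "\<pi> z0 = z0")
    \<comment> \<open>At a fixed point the value is any of the \<open>q ^ a z0\<close> elements
      fixed by the corresponding power map, independently of the other values.\<close>
    case True
    define D' where "D' = D - {z0}"
    have bij': "bij_betw \<pi> D' D'" unfolding D'_def using bij_betw_DiffI[OF Suc.prems(2), of "{z0}" "{z0}"] True z0 by simp
    have card': "card D' = n" "finite D'" using Suc.hyps(2) Suc.prems(1) z0 by (auto simp: D'_def)
    have IH: "card (Sol D' \<pi> a) = q ^ (\<Sum>z\<in>D'. a z)"
      unfolding Sol_def using Suc.hyps(1)[OF card'(1)[symmetric] card'(2) bij'] Suc.prems(3) by (simp add: D'_def)
    have "bij_betw (\<lambda>f. (f z0, f(z0 := 0))) (Sol D \<pi> a) ({w :: 'a alg_closure. w ^ (q ^ a z0) = w} \<times> Sol D' \<pi> a)"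
    proof (rule bij_betwI[where g = "\<lambda>(w, f). f(z0 := w)"])
      show "(\<lambda>f. (f z0, f(z0 := 0))) \<in> Sol D \<pi> a \<rightarrow> {w :: 'a alg_closure. w ^ (q ^ a z0) = w} \<times> Sol D' \<pi> a"
      proof
        fix f assume f: "f \<in> Sol D \<pi> a"
        have "f z0 ^ (q ^ a z0) = f z0" using f z0 True by (auto simp: Sol_def)
        moreover have "\<pi> z \<noteq> z0" if "z \<in> D'" for z using inj[of z z0] that z0 True by (auto simp: D'_def)
        ultimately show "(f z0, f(z0 := 0)) \<in> {w. w ^ (q ^ a z0) = w} \<times> Sol D' \<pi> a"
          using f by (auto simp: Sol_def D'_def)
      qed
      show "(\<lambda>(w, f). f(z0 := w)) \<in> {w :: 'a alg_closure. w ^ (q ^ a z0) = w} \<times> Sol D' \<pi> a \<rightarrow> Sol D \<pi> a"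
      proof clarsimp
        fix w :: "'a alg_closure" and f assume w: "w ^ (q ^ a z0) = w" and f: "f \<in> Sol D' \<pi> a"
        have "(f(z0 := w)) (\<pi> z) = (f(z0 := w)) z ^ (q ^ a z)" if z: "z \<in> D" for z
        proof (cases "z = z0")
          case False
          then have "\<pi> z \<noteq> z0" using inj[of z z0] z z0 True by auto
          moreover have "f (\<pi> z) = f z ^ (q ^ a z)" using f z False by (simp add: Sol_def D'_def)
          ultimately show ?thesis using False by simp
        qed (simp add: True w)
        moreover have "(f(z0 := w)) z = 0" if "z \<notin> D" for z using f that z0 by (auto simp: Sol_def D'_def)
        ultimately show "f(z0 := w) \<in> Sol D \<pi> a" by (simp add: Sol_def)
      qed
      show "(\<lambda>(w, f). f(z0 := w)) (f z0, f(z0 := 0)) = f" for f by simp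
      show "(\<lambda>f. (f z0, f(z0 := 0))) ((\<lambda>(w, f). f(z0 := w)) y) = y"
        if yy: "y \<in> {w :: 'a alg_closure. w ^ (q ^ a z0) = w} \<times> Sol D' \<pi> a" for y
      proof -
        obtain w f where y: "y = (w, f)" "f \<in> Sol D' \<pi> a" using yy by auto
        then have "f z0 = 0" by (simp add: Sol_def D'_def)
        then show ?thesis using y(1) by (simp add: fun_upd_idem)
      qed
    qed
    from bij_betw_same_card[OF this]
    have "card (Sol D \<pi> a) = card {w :: 'a alg_closure. w ^ (q ^ a z0) = w} * card (Sol D' \<pi> a)"
      by (simp only: card_cartesian_product)
    also have "card {w :: 'a alg_closure. w ^ (q ^ a z0) = w} = q ^ a z0"
    proof (rule card_frobenius_fixed)
      show "of_nat (q ^ a z0) = (0 :: 'a alg_closure)" using of_nat_q Suc.prems(3)[OF z0] by simp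
      show "2 \<le> q ^ a z0" using q_ge_2 self_le_power[of q "a z0"] Suc.prems(3)[OF z0] by simp
    qed
    also have "q ^ a z0 * card (Sol D' \<pi> a) = q ^ (\<Sum>z\<in>D. a z)"
      using IH Suc.prems(1) z0 by (simp add: D'_def power_add[symmetric] sum.remove)
    finally show ?thesis by (simp add: Sol_def)
  next
    \<comment> \<open>The value at \<open>y\<close> is determined by the value at \<open>z0\<close>.
      After deleting \<open>y\<close>, the point \<open>z0\<close> is sent to \<open>\<pi> y\<close>
      and the two exponents are added, which keeps the total.\<close>
    case False
    define y where "y = \<pi> z0"
    have y: "y \<in> D" "y \<noteq> z0" using z0 \<pi>D False by (auto simp: y_def)
    define D' where "D' = D - {y}"
    define \<pi>' where "\<pi>' = \<pi>(z0 := \<pi> y)"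
    define a' where "a' = a(z0 := a z0 + a y)"
    have z0': "z0 \<in> D'" using z0 y by (simp add: D'_def)
    have card': "card D' = n" "finite D'" using Suc.hyps(2) Suc.prems(1) y by (auto simp: D'_def)
    have \<pi>y: "\<pi> y \<noteq> y" using inj[of y z0] y z0 by (auto simp: y_def)
    have not_y: "\<pi> z \<noteq> y" if "z \<in> D" "z \<noteq> z0" for z using inj[of z z0] that z0 by (auto simp: y_def)
    have into: "\<pi>' z \<in> D'" if "z \<in> D'" for z
      using that \<pi>D y \<pi>y not_y by (auto simp: \<pi>'_def D'_def)
    have "inj_on \<pi>' D'"
      using inj y z0 by (intro inj_onI) (auto simp: \<pi>'_def D'_def split: if_splits)
    then have bij': "bij_betw \<pi>' D' D'" using endo_inj_surj[OF card'(2)] into by (auto simp: bij_betw_def)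
    have IH: "card (Sol D' \<pi>' a') = q ^ (\<Sum>z\<in>D'. a' z)"
      unfolding Sol_def by (rule Suc.hyps(1)[OF card'(1)[symmetric] card'(2) bij'])
        (use Suc.prems(3) y in \<open>auto simp: D'_def a'_def\<close>)
    have "bij_betw (\<lambda>f. f(y := 0)) (Sol D \<pi> a) (Sol D' \<pi>' a')"
    proof (rule bij_betwI[where g = "\<lambda>f. f(y := f z0 ^ (q ^ a z0))"])
      show "(\<lambda>f. f(y := 0)) \<in> Sol D \<pi> a \<rightarrow> Sol D' \<pi>' a'"
      proof
        fix f assume f: "f \<in> Sol D \<pi> a"
        have fy: "f y = f z0 ^ (q ^ a z0)" using f z0 by (auto simp: Sol_def y_def)
        have "f (\<pi> y) = f y ^ (q ^ a y)" using f y by (auto simp: Sol_def)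
        then have "f (\<pi> y) = f z0 ^ (q ^ (a z0 + a y))" by (simp add: fy power_mult[symmetric] power_add)
        then show "f(y := 0) \<in> Sol D' \<pi>' a'"
          using f y \<pi>y not_y by (auto simp: Sol_def D'_def \<pi>'_def a'_def)
      qed
      show "(\<lambda>f. f(y := f z0 ^ (q ^ a z0))) \<in> Sol D' \<pi>' a' \<rightarrow> Sol D \<pi> a"
      proof
        fix f assume f: "f \<in> Sol D' \<pi>' a'"
        have "f (\<pi> y) = f z0 ^ (q ^ (a z0 + a y))" using f z0' by (auto simp: Sol_def \<pi>'_def a'_def)
        then have "f (\<pi> y) = (f z0 ^ (q ^ a z0)) ^ (q ^ a y)" by (simp add: power_mult[symmetric] power_add)
        moreover have "f (\<pi> z) = f z ^ (q ^ a z)" if "z \<in> D'" "z \<noteq> z0" for z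
          using f that by (auto simp: Sol_def \<pi>'_def a'_def)
        moreover have "\<pi> z0 = y" by (simp add: y_def)
        ultimately show "f(y := f z0 ^ (q ^ a z0)) \<in> Sol D \<pi> a"
          using f y \<pi>y not_y z0 by (auto simp: Sol_def D'_def)
      qed
      show "(f(y := 0))(y := (f(y := 0)) z0 ^ (q ^ a z0)) = f" if "f \<in> Sol D \<pi> a" for f
        using that z0 y by (auto simp: Sol_def y_def fun_eq_iff)
      show "(f(y := f z0 ^ (q ^ a z0)))(y := 0) = f" if "f \<in> Sol D' \<pi>' a'" for f
        using that by (auto simp: Sol_def D'_def fun_eq_iff)
    qed
    from bij_betw_same_card[OF this] have "card (Sol D \<pi> a) = q ^ (\<Sum>z\<in>D'. a' z)" using IH by simp
    also have "(\<Sum>z\<in>D'. a' z) = (a z0 + a y) + (\<Sum>z\<in>D' - {z0}. a z)"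
      using card'(2) z0' by (simp add: sum.remove a'_def)
    also have "\<dots> = (\<Sum>z\<in>D. a z)"
    proof -
      have "(\<Sum>z\<in>D. a z) = a y + (\<Sum>z\<in>D'. a z)" unfolding D'_def using Suc.prems(1) y by (simp add: sum.remove)
      also have "(\<Sum>z\<in>D'. a z) = a z0 + (\<Sum>z\<in>D' - {z0}. a z)" using card'(2) z0' by (simp add: sum.remove)
      finally show ?thesis by simp
    qed
    finally show ?thesis by (simp add: Sol_def)
  qed
qed

text \<open>\<open>\<phi>\<close> is extended by the identity because permutations and their orbits
  refer to bijections of the whole type.\<close>

definition fr :: "(nat \<Rightarrow> 'a alg_closure) \<Rightarrow> nat \<Rightarrow> 'a alg_closure" where
  "fr z = (if z \<in> Ch then \<phi> z else z)"

lemma fr_Ch: "z \<in> Ch \<Longrightarrow> fr z = \<phi> z" "z \<in> Ch \<Longrightarrow> fr z \<in> Ch"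
  by (auto simp: fr_def \<phi>_Ch)

lemma fr_permutes: "fr permutes Ch"
proof (rule bij_imp_permutes)
  show "bij_betw fr Ch Ch" using bij_\<phi> by (rule bij_betw_cong[THEN iffD1, rotated]) (simp add: fr_def)
qed (simp add: fr_def)

lemma fr_permutation: "permutation fr"
  using fr_permutes finite_Ch by (auto simp: permutation_permutes)

text \<open>These are the transforms of \<open>Lam Per\<close>: the symmetry
  \<open>lam (- k) = lam k ^ q\<close> becomes equivariance under the Frobenius map.\<close>

definition Tset :: "((nat \<Rightarrow> 'a alg_closure) \<Rightarrow> 'a alg_closure) set" where
  "Tset = {t. (\<forall>z. z \<notin> Ch \<longrightarrow> t z = 0) \<and> (\<forall>z\<in>Ch. t (fr z) = t z ^ q)}"

lemma sum_fr: "(\<Sum>z\<in>Ch. g (fr z)) = (\<Sum>z\<in>Ch. g z)"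
  by (rule sum.reindex_bij_betw[OF permutes_imp_bij[OF fr_permutes]])

lemma pfrob_sum1: "(\<Sum>i\<in>I. f i :: 'a alg_closure) ^ q = (\<Sum>i\<in>I. f i ^ q)"
  using pfrob_sum[of f I 1] by simp

lemma ev_fr: "z \<in> Ch \<Longrightarrow> ev (fr z) k = ev z (- k) ^ q"
  by (simp add: fr_Ch ev_\<phi>)

lemma Lam_periodic: "lam \<in> Lam Per \<Longrightarrow> lam \<in> periodic"
  by (auto simp: Lam_def periodic_def)

lemma hat_Tset: "lam \<in> Lam Per \<Longrightarrow> hat lam \<in> Tset"
proof -
  assume lam: "lam \<in> Lam Per"
  define g where "g = inv_into Ch fr"
  have bij: "bij_betw fr Ch Ch" by (rule permutes_imp_bij[OF fr_permutes])
  have gf: "g (fr z) = z" if "z \<in> Ch" for z using bij that by (simp add: g_def bij_betw_def inv_into_f_f)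
  \<comment> \<open>Raising the expansion of \<open>lam (- k)\<close> to the power \<open>q\<close>
    gives an expansion of \<open>lam k\<close> with coefficient \<open>hat lam z ^ q\<close> at
    \<open>fr z\<close>; uniqueness identifies it with \<open>hat lam\<close>.\<close>
  have "hat lam = (\<lambda>z. if z \<in> Ch then hat lam (g z) ^ q else 0)"
  proof (rule hat_unique)
    fix k
    have "(\<Sum>z\<in>Ch. (if z \<in> Ch then hat lam (g z) ^ q else 0) * ev z k)
      = (\<Sum>z\<in>Ch. hat lam (g (fr z)) ^ q * ev (fr z) k)"
      by (subst sum_fr[symmetric], rule sum.cong) (simp_all add: fr_Ch(2))
    also have "\<dots> = (\<Sum>z\<in>Ch. (hat lam z * ev z (- k)) ^ q)"
      by (rule sum.cong) (auto simp: gf ev_fr power_mult_distrib)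
    also have "\<dots> = (to_ac (lam (- k))) ^ q" by (simp add: pfrob_sum1[symmetric] hat_inversion Lam_periodic lam)
    also have "\<dots> = to_ac (lam k)" using lam frob_frob[of "lam k"] by (simp add: Lam_def flip: to_ac_power)
    finally show "to_ac (lam k) = (\<Sum>z\<in>Ch. (if z \<in> Ch then hat lam (g z) ^ q else 0) * ev z k)" by simp
  qed simp
  then have "hat lam (fr z) = hat lam z ^ q" if "z \<in> Ch" for z
    using fun_cong[of _ _ "fr z"] gf[OF that] fr_Ch(2)[OF that] by (metis (no_types, lifting))
  then show ?thesis by (simp add: Tset_def hat_def)
qed

definition unhat :: "((nat \<Rightarrow> 'a alg_closure) \<Rightarrow> 'a alg_closure) \<Rightarrow> (nat \<Rightarrow> int) \<Rightarrow> 'a" where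
  "unhat t k = of_ac (\<Sum>z\<in>Ch. t z * ev z k)"

lemma Tset_sum_frob:
  assumes t: "t \<in> Tset"
  shows "(\<Sum>z\<in>Ch. t z * ev z k) ^ q = (\<Sum>z\<in>Ch. t z * ev z (- k))"
proof -
  have "(\<Sum>z\<in>Ch. t z * ev z k) ^ q = (\<Sum>z\<in>Ch. t (fr z) * ev (fr z) (- k))"
    unfolding pfrob_sum1 by (rule sum.cong) (use t in \<open>auto simp: power_mult_distrib ev_fr Tset_def\<close>)
  then show ?thesis by (simp add: sum_fr[of "\<lambda>z. t z * ev z (- k)"])
qed

text \<open>Two applications of \<open>Tset_sum_frob\<close> show that the sum is fixed by the
  \<open>q ^ 2\<close>-power map, so it comes from the field.\<close>

lemma unhat: "t \<in> Tset \<Longrightarrow> to_ac (unhat t k) = (\<Sum>z\<in>Ch. t z * ev z k)"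
  unfolding unhat_def by (rule to_ac_of_ac') (simp add: power2_eq_square power_mult Tset_sum_frob)

lemma unhat_Lam: "t \<in> Tset \<Longrightarrow> unhat t \<in> Lam Per"
proof -
  assume t: "t \<in> Tset"
  have "unhat t (- k) = unhat t k ^ q" for k
  proof -
    have "to_ac (unhat t (- k)) = to_ac (unhat t k ^ q)" by (simp add: unhat[OF t] Tset_sum_frob[OF t])
    then show ?thesis by (simp only: to_ac_eq_iff)
  qed
  moreover have "unhat t (k + p) = unhat t k" if "p \<in> Per" for k p
    unfolding unhat_def by (intro arg_cong[where f = of_ac] sum.cong) (auto simp: ev_add ev_Per that)
  ultimately show ?thesis by (simp add: Lam_def)
qed

lemma hat_unhat: "t \<in> Tset \<Longrightarrow> hat (unhat t) = t"
  by (rule hat_unique) (auto simp: Tset_def unhat)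

lemma unhat_hat: "lam \<in> Lam Per \<Longrightarrow> unhat (hat lam) = lam"
  by (simp add: unhat_def fun_eq_iff hat_inversion Lam_periodic)

lemma bij_unhat: "bij_betw unhat Tset (Lam Per)"
  by (rule bij_betwI[where g = hat]) (auto simp: unhat_Lam hat_Tset hat_unhat unhat_hat)

section \<open>The rank as the size of the support of the transform\<close>

definition supp :: "((nat \<Rightarrow> 'a alg_closure) \<Rightarrow> 'a alg_closure) \<Rightarrow> (nat \<Rightarrow> 'a alg_closure) set" where
  "supp t = {z. t z \<noteq> 0}"

lemma supp_Ch: "t \<in> Tset \<Longrightarrow> supp t \<subseteq> Ch" by (auto simp: supp_def Tset_def)

lemma q_pos: "q > 0" using q_ge_2 by simp

lemma supp_fr: "t \<in> Tset \<Longrightarrow> z \<in> Ch \<Longrightarrow> fr z \<in> supp t \<longleftrightarrow> z \<in> supp t"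
  using q_pos by (auto simp: supp_def Tset_def)

text \<open>The transform turns translation into multiplication by \<open>ev\<close>. Hence
  \<open>V\<close> becomes the space of functions on the support of \<open>t\<close> that are
  equivariant for \<open>fr \<circ> fr\<close> and the \<open>q ^ 2\<close>-power map, and
  \<open>card_twisted_functions\<close> counts these.\<close>

lemma rank_unhat:
  assumes t: "t \<in> Tset"
  shows "rank Box (unhat t) = card (supp t)"
proof -
  define lam where "lam = unhat t"
  have lam: "lam \<in> Lam Per" unfolding lam_def by (rule unhat_Lam[OF t])
  interpret H: hermitian_function q Per Box lam by (rule Lam_hermitian_function[OF periods_lattice[OF E_pos] lam])
  have hl: "hat lam = t" unfolding lam_def by (rule hat_unhat[OF t])
  define D where "D = supp t"
  have D: "D \<subseteq> Ch" "finite D" using supp_Ch[OF t] finite_subset[OF _ finite_Ch] by (auto simp: D_def)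
  have frD: "fr z \<in> D" if "z \<in> D" for z using supp_fr[OF t] that D(1) by (auto simp: D_def)
  define W where "W = {s :: (nat \<Rightarrow> 'a alg_closure) \<Rightarrow> 'a alg_closure.
      (\<forall>z. z \<notin> D \<longrightarrow> s z = 0) \<and> (\<forall>z\<in>D. s ((fr \<circ> fr) z) = s z ^ (q ^ 2))}"
  have bijD: "bij_betw fr D D"
    using endo_inj_surj[OF D(2)] frD permutes_inj_on[OF fr_permutes, of D] by (auto simp: bij_betw_def)
  have cW: "card W = q ^ (2 * card D)"
    unfolding W_def by (subst card_twisted_functions[OF D(2) bij_betw_trans[OF bijD bijD]]) (auto simp: mult.commute)
  have lp: "lam \<in> periodic" by (rule Lam_periodic[OF lam])
  have evff: "ev (fr (fr z)) k = ev z k ^ (q ^ 2)" if "z \<in> Ch" for z k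
    using that by (simp add: ev_fr fr_Ch(2) power2_eq_square power_mult)
  have tff: "t (fr (fr z)) = t z ^ (q ^ 2)" if "z \<in> Ch" for z
    using that t fr_Ch(2)[OF that] by (simp add: Tset_def power2_eq_square power_mult)
  have pq: "(to_ac (x :: 'a)) ^ (q ^ 2) = to_ac x" for x using power_card[of x] by (simp flip: to_ac_power)
  have hat_comb: "hat (H.comb b) = (\<lambda>z. (\<Sum>l\<in>Box. to_ac (b l) * ev z l) * t z)" for b
  proof (rule hat_unique)
    fix k
    have "(\<Sum>z\<in>Ch. (\<Sum>l\<in>Box. to_ac (b l) * ev z l) * t z * ev z k) = (\<Sum>z\<in>Ch. \<Sum>l\<in>Box. to_ac (b l) * (hat lam z * ev z (k + l)))"
      by (rule sum.cong) (auto simp: sum_distrib_right sum_distrib_left ev_add hl mult_ac)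
    also have "\<dots> = (\<Sum>l\<in>Box. to_ac (b l) * (\<Sum>z\<in>Ch. hat lam z * ev z (k + l)))"
      by (subst sum.swap) (simp add: sum_distrib_left)
    also have "\<dots> = to_ac (H.comb b k)" by (simp add: hat_inversion[OF lp] H.comb_apply to_ac_sum)
    finally show "to_ac (H.comb b k) = (\<Sum>z\<in>Ch. (\<Sum>l\<in>Box. to_ac (b l) * ev z l) * t z * ev z k)" by simp
  qed (use t in \<open>auto simp: Tset_def\<close>)
  have "bij_betw hat H.V W"
  proof (rule bij_betw_imageI)
    show "inj_on hat H.V"
    proof (rule inj_onI)
      fix x y assume xy: "x \<in> H.V" "y \<in> H.V" "hat x = hat y"
      then have p: "x \<in> periodic" "y \<in> periodic" using H.V_period by (auto simp: periodic_def)
      have "to_ac (x k) = to_ac (y k)" for k using hat_inversion[OF p(1), of k] hat_inversion[OF p(2), of k] xy(3) by simp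
      then show "x = y" by (simp add: fun_eq_iff)
    qed
    show "hat ` H.V = W"
    proof (intro equalityI subsetI)
      fix s assume "s \<in> hat ` H.V"
      then obtain b where s: "s = (\<lambda>z. (\<Sum>l\<in>Box. to_ac (b l) * ev z l) * t z)" by (auto simp: H.V_def hat_comb)
      have "s (fr (fr z)) = s z ^ (q ^ 2)" if "z \<in> D" for z
      proof -
        have z: "z \<in> Ch" using that D by blast
        show ?thesis by (simp add: s tff[OF z] evff[OF z] power_mult_distrib pfrob_sum pq)
      qed
      then show "s \<in> W" by (auto simp: W_def s D_def supp_def)
    next
      fix s assume s: "s \<in> W"
      \<comment> \<open>To reach \<open>s\<close>, the quotient \<open>s / t\<close> is expanded in
        the functions \<open>ev z l\<close> of \<open>z\<close>; equivariance under
        \<open>fr \<circ> fr\<close> puts the coefficients \<open>b\<close> into the field.\<close>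
      define c where "c = (\<lambda>z. if z \<in> D then s z / t z else 0)"
      have cff: "c (fr (fr z)) = c z ^ (q ^ 2)" if z: "z \<in> Ch" for z
      proof (cases "z \<in> D")
        case True
        then show ?thesis using s frD[OF frD[OF True]] tff[OF z] by (simp add: c_def W_def power_divide)
      next
        case False
        then have "fr (fr z) \<notin> D" using supp_fr[OF t] fr_Ch(2)[OF z] z by (simp add: D_def)
        then show ?thesis using False q_pos by (simp add: c_def power_0_left)
      qed
      define b where "b = (\<lambda>l. of_ac ((\<Sum>w\<in>Ch. c w * ev w (- l)) / of_nat (E ^ R)))"
      have b: "to_ac (b l) = (\<Sum>w\<in>Ch. c w * ev w (- l)) / of_nat (E ^ R)" for l
        unfolding b_def
      proof (rule to_ac_of_ac')
        have "(\<Sum>w\<in>Ch. c w * ev w (- l)) ^ (q ^ 2) = (\<Sum>w\<in>Ch. c (fr (fr w)) * ev (fr (fr w)) (- l))"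
          unfolding pfrob_sum by (rule sum.cong) (auto simp: power_mult_distrib cff evff)
        also have "\<dots> = (\<Sum>w\<in>Ch. c w * ev w (- l))"
          using sum_fr[of "\<lambda>w. c (fr w) * ev (fr w) (- l)"] sum_fr[of "\<lambda>w. c w * ev w (- l)"] by simp
        finally show "((\<Sum>w\<in>Ch. c w * ev w (- l)) / of_nat (E ^ R)) ^ (q ^ 2) = (\<Sum>w\<in>Ch. c w * ev w (- l)) / of_nat (E ^ R)"
          by (simp add: power_divide pfrob_of_nat del: of_nat_power)
      qed
      have "(\<Sum>l\<in>Box. to_ac (b l) * ev z l) = c z" if z: "z \<in> Ch" for z
      proof -
        have "(\<Sum>l\<in>Box. to_ac (b l) * ev z l) = (\<Sum>l\<in>Box. \<Sum>w\<in>Ch. c w * ev (\<lambda>i. z i / w i) l) / of_nat (E ^ R)"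
          unfolding b sum_divide_distrib[of _ Box]
        proof (rule sum.cong[OF refl])
          fix l
          have "ev w (- l) * ev z l = ev (\<lambda>i. z i / w i) l" for w
            by (simp add: ev_def power_int_minus power_int_divide_distrib prod_dividef prod_inversef field_simps)
          then show "(\<Sum>w\<in>Ch. c w * ev w (- l)) / of_nat (E ^ R) * ev z l = (\<Sum>w\<in>Ch. c w * ev (\<lambda>i. z i / w i) l) / of_nat (E ^ R)"
            by (simp add: sum_distrib_right mult.assoc del: of_nat_power)
        qed
        also have "(\<Sum>l\<in>Box. \<Sum>w\<in>Ch. c w * ev (\<lambda>i. z i / w i) l) = (\<Sum>w\<in>Ch. c w * (\<Sum>l\<in>Box. ev (\<lambda>i. z i / w i) l))"
          by (subst sum.swap) (simp add: sum_distrib_left)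
        also have "\<dots> = (\<Sum>w\<in>Ch. if w = z then c w * of_nat (E ^ R) else 0)"
        proof (rule sum.cong[OF refl])
          fix w assume w: "w \<in> Ch"
          have "(\<lambda>i. z i / w i) \<in> Ch" using w z by (auto simp: Ch_def power_divide)
          moreover have "(\<lambda>i. z i / w i) = (\<lambda>_. 1) \<longleftrightarrow> w = z" using Ch_nz[OF w] by (auto simp: fun_eq_iff)
          ultimately show "c w * (\<Sum>l\<in>Box. ev (\<lambda>i. z i / w i) l) = (if w = z then c w * of_nat (E ^ R) else 0)"
            using sum_ev_Box by simp
        qed
        also have "\<dots> = c z * of_nat (E ^ R)" using z finite_Ch by simp
        finally show ?thesis using ER_nz by (simp del: of_nat_power)
      qed
      then have "(\<Sum>l\<in>Box. to_ac (b l) * ev z l) * t z = s z" for z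
        using s D(1) by (cases "t z = 0") (auto simp: c_def W_def D_def supp_def)
      then have "hat (H.comb b) = s" by (simp add: hat_comb)
      then show "s \<in> hat ` H.V" by (auto simp: H.V_def)
    qed
  qed
  then have "card H.V = (q\<^sup>2) ^ card D" using cW bij_betw_same_card by (metis power_mult)
  then show ?thesis unfolding lam_def[symmetric] D_def[symmetric] by (rule rank_eqI)
qed

section \<open>Weighted counts of equivariant functions by support\<close>

definition wsum :: "((nat \<Rightarrow> 'a alg_closure) \<Rightarrow> 'a alg_closure) \<Rightarrow> rat" where
  "wsum t = wt (unhat t 0)"

lemma to_ac_unhat_0: "t \<in> Tset \<Longrightarrow> to_ac (unhat t 0) = (\<Sum>z\<in>Ch. t z)"
  by (simp add: unhat ev_0)

lemma finite_Tset: "finite Tset"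
  using bij_betw_finite[OF bij_unhat] finite_Lam[OF periods_lattice[OF E_pos]] by simp

text \<open>The indicator function of \<open>D\<close> is equivariant and its inverse transform is
  nonzero at some \<open>k\<close>. Multiplication by \<open>ev z k\<close> moves this value to 0,
  and symmetrizing restores equivariance at the price of turning the value into a trace.\<close>

lemma exists_equivariant_nonzero_sum:
  assumes D: "D \<subseteq> Ch" "D \<noteq> {}" "\<And>z. z \<in> Ch \<Longrightarrow> fr z \<in> D \<longleftrightarrow> z \<in> D"
  shows "\<exists>t\<in>Tset. supp t \<subseteq> D \<and> unhat t 0 \<noteq> 0"
proof -
  define d where "d = (\<lambda>z. if z \<in> D then 1 else (0 :: 'a alg_closure))"
  have dT: "d \<in> Tset" using D q_pos by (auto simp: d_def Tset_def power_0_left)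
  have "\<exists>k. unhat d k \<noteq> 0"
  proof (rule ccontr)
    assume "\<not> ?thesis"
    then have "hat (unhat d) = (\<lambda>_. 0)" by (simp add: hat_def fun_eq_iff)
    then have "d = (\<lambda>_. 0)" using hat_unhat[OF dT] by simp
    then show False using D(2) by (metis d_def all_not_in_conv zero_neq_one)
  qed
  then obtain k where k: "unhat d k \<noteq> 0" by blast
  obtain b where b: "b + b ^ q \<noteq> (0::'a)" using trace_nonzero by blast
  \<comment> \<open>This scaling makes the value at 0 equal to \<open>b + b ^ q\<close>, which is
    nonzero.\<close>
  define a where "a = b / unhat d k"
  define t where "t = (\<lambda>z. d z * (to_ac a * ev z k + to_ac a ^ q * ev z (- k)))"
  have aq: "(to_ac a ^ q) ^ q = to_ac a" using frob_frob[of a] by (simp flip: to_ac_power)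
  have tT: "t \<in> Tset"
  proof -
    have "t (fr z) = t z ^ q" if z: "z \<in> Ch" for z
    proof -
      have "t z ^ q = d z ^ q * ((to_ac a * ev z k) ^ q + (to_ac a ^ q * ev z (- k)) ^ q)"
        using pfrob_add[of "to_ac a * ev z k" "to_ac a ^ q * ev z (- k)" 1] by (simp add: t_def power_mult_distrib)
      also have "\<dots> = d (fr z) * (to_ac a ^ q * ev (fr z) (- k) + to_ac a * ev (fr z) k)"
        using dT z by (simp add: power_mult_distrib aq ev_fr Tset_def)
      finally show ?thesis by (simp add: t_def add.commute)
    qed
    moreover have "t z = 0" if "z \<notin> Ch" for z using that D(1) by (auto simp: t_def d_def)
    ultimately show ?thesis by (simp add: Tset_def)
  qed
  have "to_ac (unhat t 0) = to_ac a * (\<Sum>z\<in>Ch. d z * ev z k) + to_ac a ^ q * (\<Sum>z\<in>Ch. d z * ev z (- k))"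
    unfolding to_ac_unhat_0[OF tT] by (simp add: t_def distrib_left sum.distrib sum_distrib_left mult_ac)
  also have "\<dots> = to_ac (a * unhat d k + a ^ q * unhat d (- k))" by (simp add: unhat[OF dT])
  also have "unhat d (- k) = unhat d k ^ q" using unhat_Lam[OF dT] by (simp add: Lam_def)
  also have "a * unhat d k + a ^ q * unhat d k ^ q = b + b ^ q" using k by (simp add: a_def power_mult_distrib[symmetric])
  finally have "unhat t 0 = b + b ^ q" by (simp only: to_ac_eq_iff)
  moreover have "supp t \<subseteq> D" by (auto simp: supp_def t_def d_def)
  ultimately show ?thesis using tT b by metis
qed

text \<open>Adding multiples of a function \<open>t0\<close> with
  \<open>unhat t0 0 \<noteq> 0\<close> moves \<open>unhat t 0\<close> through the whole subfield,
  over which \<open>wt\<close> sums to zero.\<close>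

lemma sum_wsum_stable:
  assumes D: "D \<subseteq> Ch" "D \<noteq> {}" "\<And>z. z \<in> Ch \<Longrightarrow> fr z \<in> D \<longleftrightarrow> z \<in> D"
  shows "(\<Sum>t | t \<in> Tset \<and> supp t \<subseteq> D. wsum t) = 0"
proof -
  obtain t0 where t0: "t0 \<in> Tset" "supp t0 \<subseteq> D" "unhat t0 0 \<noteq> 0" using exists_equivariant_nonzero_sum[OF D] by blast
  define c where "c = unhat t0 0"
  have unFq: "unhat t 0 \<in> Fq" if "t \<in> Tset" for t
  proof -
    have "unhat t (- 0) = unhat t 0 ^ q" using unhat_Lam[OF that] unfolding Lam_def by blast
    then show ?thesis by simp
  qed
  have cF: "c \<in> Fq" unfolding c_def by (rule unFq[OF t0(1)])
  define TD where "TD = {t. t \<in> Tset \<and> supp t \<subseteq> D}"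
  have trans: "(\<lambda>z. t z + to_ac b * t0 z) \<in> TD" if "t \<in> TD" "b \<in> Fq" for t and b :: 'a
  proof -
    have bq: "to_ac b ^ q = to_ac b" using that(2) by (simp flip: to_ac_power)
    have "(t z + to_ac b * t0 z) ^ q = t z ^ q + to_ac b * t0 z ^ q" for z
      using pfrob_add[of "t z" "to_ac b * t0 z" 1] bq by (simp add: power_mult_distrib)
    then have "(\<lambda>z. t z + to_ac b * t0 z) \<in> Tset" using that t0 by (auto simp: TD_def Tset_def)
    moreover have "supp (\<lambda>z. t z + to_ac b * t0 z) \<subseteq> supp t \<union> supp t0" by (auto simp: supp_def)
    then have "supp (\<lambda>z. t z + to_ac b * t0 z) \<subseteq> D" using that t0 by (auto simp: TD_def)
    ultimately show ?thesis by (simp add: TD_def)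
  qed
  have wtr: "wsum (\<lambda>z. t z + to_ac b * t0 z) = wt (unhat t 0 + b * c)" if "t \<in> TD" "b \<in> Fq" for t and b :: 'a
  proof -
    have "to_ac (unhat (\<lambda>z. t z + to_ac b * t0 z) 0) = to_ac (unhat t 0 + b * c)"
      using trans[OF that] that t0 by (simp add: TD_def to_ac_unhat_0 c_def sum.distrib sum_distrib_left)
    then show ?thesis by (simp only: wsum_def to_ac_eq_iff)
  qed
  have inv: "(\<Sum>t\<in>TD. wsum t) = (\<Sum>t\<in>TD. wt (unhat t 0 + b * c))" if b: "b \<in> Fq" for b
  proof -
    have "bij_betw (\<lambda>t z. t z + to_ac b * t0 z) TD TD"
    proof (rule bij_betwI[where g = "\<lambda>t z. t z + to_ac (- b) * t0 z"])
      have "- b \<in> Fq" using b frob_minus[of b] by simp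
      then show "(\<lambda>t z. t z + to_ac (- b) * t0 z) \<in> TD \<rightarrow> TD" using trans by blast
    qed (use trans[OF _ b] in auto)
    from sum.reindex_bij_betw[OF this, of wsum] show ?thesis using wtr[OF _ b] by simp
  qed
  have "(\<Sum>b\<in>Fq. \<Sum>t\<in>TD. wsum t) = (\<Sum>b\<in>Fq. \<Sum>t\<in>TD. wt (unhat t 0 + b * c))"
    by (rule sum.cong[OF refl inv])
  then have "of_nat q * (\<Sum>t\<in>TD. wsum t) = (\<Sum>b\<in>Fq. \<Sum>t\<in>TD. wt (unhat t 0 + b * c))"
    using card_trace_fibers(1) by simp
  also have "\<dots> = (\<Sum>t\<in>TD. \<Sum>b\<in>Fq. wt (unhat t 0 + b * c))" by (rule sum.swap)
  also have "\<dots> = (\<Sum>t\<in>TD. 0)"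
  proof (rule sum.cong[OF refl])
    fix t assume t: "t \<in> TD"
    have "bij_betw (\<lambda>b. b * c) Fq Fq"
      by (rule bij_betwI[where g = "\<lambda>b. b / c"]) (use cF t0 in \<open>auto simp: c_def power_mult_distrib power_divide\<close>)
    from sum.reindex_bij_betw[OF this, of "\<lambda>b. wt (unhat t 0 + b)"]
    show "(\<Sum>b\<in>Fq. wt (unhat t 0 + b * c)) = 0" using sum_wt_Fq[OF unFq, of t] t by (simp add: TD_def)
  qed
  finally show ?thesis using q_pos by (simp add: TD_def)
qed

section \<open>The product over Frobenius orbits\<close>

definition Orb :: "(nat \<Rightarrow> 'a alg_closure) set set" where
  "Orb = orbit fr ` Ch"

lemma Orb_subset: "Y \<in> Orb \<Longrightarrow> Y \<subseteq> Ch"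
  using permutes_orbit_subset[OF fr_permutes] by (auto simp: Orb_def)

lemma orbit_eq: "x \<in> orbit fr y \<Longrightarrow> orbit fr x = orbit fr y"
  by (rule orbit_cyclic_eq3[OF cyclic_on_orbit'[OF fr_permutation]])

lemma Orb_eq: "Y \<in> Orb \<Longrightarrow> z \<in> Y \<Longrightarrow> Y = orbit fr z"
  using orbit_eq by (auto simp: Orb_def)

lemma Orb_disjoint: "Y \<in> Orb \<Longrightarrow> Y' \<in> Orb \<Longrightarrow> Y \<noteq> Y' \<Longrightarrow> Y \<inter> Y' = {}"
  using Orb_eq by (metis disjoint_iff)

lemma finite_Orb: "finite Orb" "Y \<in> Orb \<Longrightarrow> finite Y"
  using finite_Ch finite_subset[OF Orb_subset finite_Ch] by (auto simp: Orb_def)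

lemma mem_orbit: "z \<in> orbit fr z" by (rule permutation_self_in_orbit[OF fr_permutation])

lemma Orb_fr: "Y \<in> Orb \<Longrightarrow> fr z \<in> Y \<longleftrightarrow> z \<in> Y"
  using Orb_eq mem_orbit permutation_orbit_step[OF fr_permutation, of z] by metis

lemma card_Union_Orb: "\<A> \<subseteq> Orb \<Longrightarrow> card (\<Union>\<A>) = (\<Sum>Y\<in>\<A>. card Y)"
  by (rule card_Union_disjoint) (auto simp: pairwise_def disjnt_def dest: Orb_disjoint finite_Orb(2))

lemma Union_Orb_inj: "\<A> \<subseteq> Orb \<Longrightarrow> \<B> \<subseteq> Orb \<Longrightarrow> \<Union>\<A> \<subseteq> \<Union>\<B> \<longleftrightarrow> \<A> \<subseteq> \<B>"
proof
  assume A: "\<A> \<subseteq> Orb" "\<B> \<subseteq> Orb" "\<Union>\<A> \<subseteq> \<Union>\<B>"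
  show "\<A> \<subseteq> \<B>"
  proof
    fix Y assume Y: "Y \<in> \<A>"
    then obtain z where z: "z \<in> Y" using A by (auto simp: Orb_def intro: mem_orbit)
    then obtain Y' where "Y' \<in> \<B>" "z \<in> Y'" using A Y by blast
    then have "Y' = Y" using Orb_eq A Y z by (metis subsetD)
    then show "Y \<in> \<B>" using \<open>Y' \<in> \<B>\<close> by simp
  qed
qed blast

lemma supp_Orb: "t \<in> Tset \<Longrightarrow> supp t = \<Union>{Y \<in> Orb. Y \<subseteq> supp t}"
proof
  assume t: "t \<in> Tset"
  show "supp t \<subseteq> \<Union>{Y \<in> Orb. Y \<subseteq> supp t}"
  proof
    fix z assume z: "z \<in> supp t"
    then have zC: "z \<in> Ch" using supp_Ch[OF t] by blast
    have "y \<in> supp t" if "y \<in> orbit fr z" for y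
      using that
    proof induction
      case base then show ?case using supp_fr[OF t zC] z by simp
    next
      case (step y) then show ?case using supp_fr[OF t, of y] supp_Ch[OF t] by blast
    qed
    then show "z \<in> \<Union>{Y \<in> Orb. Y \<subseteq> supp t}" using zC mem_orbit[of z] by (auto simp: Orb_def)
  qed
qed blast

lemma fps_const_sum: "fps_const (\<Sum>i\<in>I. f i :: 'b::comm_ring_1) = (\<Sum>i\<in>I. fps_const (f i))"
  by (induction I rule: infinite_finite_induct) (simp_all flip: fps_const_add)

lemma sum_minus_one_Pow: "finite A \<Longrightarrow> (\<Sum>B\<in>Pow A. (-1 :: rat) ^ card B) = (if A = {} then 1 else 0)"
  using prod_add[of A "\<lambda>_. -1 :: rat" "\<lambda>_. 1"] by (auto simp: power_0_left)

text \<open>Moebius inversion over sets of orbits: the sums of both sides over the subsets of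
  \<open>\<A>\<close> agree, being 1 for empty \<open>\<A>\<close> and 0 otherwise, on the left by
  \<open>sum_wsum_stable\<close>.\<close>

lemma sum_wsum_supp:
  assumes "\<A> \<subseteq> Orb"
  shows "(\<Sum>t | t \<in> Tset \<and> supp t = \<Union>\<A>. wsum t) = (-1) ^ card \<A>"
  using assms
proof (induction "card \<A>" arbitrary: \<A> rule: less_induct)
  case less
  define g where "g = (\<lambda>\<A>. \<Sum>t | t \<in> Tset \<and> supp t = \<Union>\<A>. wsum t)"
  have fA: "finite \<A>" using less.prems finite_Orb finite_subset by blast
  have "(\<Sum>\<B>\<in>Pow \<A>. g \<B>) = (\<Sum>t | t \<in> Tset \<and> supp t \<subseteq> \<Union>\<A>. wsum t)"
  proof -
    define T where "T = {t. t \<in> Tset \<and> supp t \<subseteq> \<Union>\<A>}"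
    have "(\<Sum>t\<in>T. wsum t) = (\<Sum>\<B>\<in>Pow \<A>. \<Sum>t | t \<in> T \<and> {Y \<in> Orb. Y \<subseteq> supp t} = \<B>. wsum t)"
    proof (rule sum.group[symmetric])
      show "finite T" using finite_Tset by (simp add: T_def)
      show "(\<lambda>t. {Y \<in> Orb. Y \<subseteq> supp t}) ` T \<subseteq> Pow \<A>"
      proof
        fix \<B> assume "\<B> \<in> (\<lambda>t. {Y \<in> Orb. Y \<subseteq> supp t}) ` T"
        then obtain t where t: "t \<in> T" "\<B> = {Y \<in> Orb. Y \<subseteq> supp t}" by blast
        then have "\<Union>\<B> \<subseteq> \<Union>\<A>" by (auto simp: T_def)
        then show "\<B> \<in> Pow \<A>" using Union_Orb_inj[of \<B> \<A>] less.prems t by auto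
      qed
    qed (use fA in simp)
    also have "\<dots> = (\<Sum>\<B>\<in>Pow \<A>. g \<B>)"
    proof (rule sum.cong[OF refl])
      fix \<B> assume B: "\<B> \<in> Pow \<A>"
      have "{t. t \<in> T \<and> {Y \<in> Orb. Y \<subseteq> supp t} = \<B>} = {t. t \<in> Tset \<and> supp t = \<Union>\<B>}"
      proof (intro equalityI subsetI)
        fix t assume "t \<in> {t. t \<in> T \<and> {Y \<in> Orb. Y \<subseteq> supp t} = \<B>}"
        then show "t \<in> {t. t \<in> Tset \<and> supp t = \<Union>\<B>}" using supp_Orb[of t] by (auto simp: T_def)
      next
        fix t assume t: "t \<in> {t. t \<in> Tset \<and> supp t = \<Union>\<B>}"
        have "{Y \<in> Orb. Y \<subseteq> supp t} = \<B>"
        proof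
          have "\<Union>{Y \<in> Orb. Y \<subseteq> supp t} \<subseteq> \<Union>\<B>" using t by auto
          then show "{Y \<in> Orb. Y \<subseteq> supp t} \<subseteq> \<B>" using Union_Orb_inj[of "{Y \<in> Orb. Y \<subseteq> supp t}" \<B>] B less.prems by auto
          show "\<B> \<subseteq> {Y \<in> Orb. Y \<subseteq> supp t}" using t B less.prems by auto
        qed
        then show "t \<in> {t. t \<in> T \<and> {Y \<in> Orb. Y \<subseteq> supp t} = \<B>}" using t B by (auto simp: T_def)
      qed
      then show "(\<Sum>t | t \<in> T \<and> {Y \<in> Orb. Y \<subseteq> supp t} = \<B>. wsum t) = g \<B>" by (simp add: g_def)
    qed
    finally show ?thesis by (simp add: T_def)
  qed
  also have "\<dots> = (if \<A> = {} then 1 else 0)"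
  proof (cases "\<A> = {}")
    case True
    have zT: "(\<lambda>_. 0) \<in> Tset" using q_pos by (simp add: Tset_def)
    have "{t. t \<in> Tset \<and> supp t \<subseteq> \<Union>\<A>} = {\<lambda>_. 0}" using True zT by (auto simp: supp_def)
    moreover have "unhat (\<lambda>_. 0) 0 = 0" using to_ac_unhat_0[OF zT] by simp
    ultimately show ?thesis using True by (simp add: wsum_def wt_def)
  next
    case False
    have "(\<Sum>t | t \<in> Tset \<and> supp t \<subseteq> \<Union>\<A>. wsum t) = 0"
    proof (rule sum_wsum_stable)
      show "\<Union>\<A> \<subseteq> Ch" using less.prems Orb_subset by blast
      show "\<Union>\<A> \<noteq> {}" using False less.prems mem_orbit by (fastforce simp: Orb_def)
      show "fr z \<in> \<Union>\<A> \<longleftrightarrow> z \<in> \<Union>\<A>" for z using less.prems Orb_fr by blast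
    qed
    then show ?thesis using False by simp
  qed
  also have "\<dots> = (\<Sum>\<B>\<in>Pow \<A>. (-1) ^ card \<B>)" by (rule sum_minus_one_Pow[OF fA, symmetric])
  finally have eq: "(\<Sum>\<B>\<in>Pow \<A>. g \<B>) = (\<Sum>\<B>\<in>Pow \<A>. (-1) ^ card \<B>)" .
  have "(\<Sum>\<B>\<in>Pow \<A> - {\<A>}. g \<B>) = (\<Sum>\<B>\<in>Pow \<A> - {\<A>}. (-1) ^ card \<B>)"
  proof (rule sum.cong[OF refl])
    fix \<B> assume "\<B> \<in> Pow \<A> - {\<A>}"
    then have "\<B> \<subset> \<A>" by auto
    then show "g \<B> = (-1) ^ card \<B>"
      unfolding g_def using less.hyps[OF psubset_card_mono[OF fA]] less.prems by blast
  qed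
  then show ?case using eq fA by (simp add: sum.remove[of "Pow \<A>" \<A>] g_def)
qed

text \<open>Supports of equivariant functions are unions of orbits, and the functions supported
  exactly on the union of \<open>\<A>\<close> contribute the term of \<open>\<A>\<close> in the
  expanded product.\<close>

theorem rank_generating_function:
  "(\<Sum>lam\<in>Lam Per. fps_const (wt (lam 0)) * fps_X ^ rank Box lam) = (\<Prod>Y\<in>Orb. 1 - fps_X ^ card Y)"
proof -
  have "(\<Sum>lam\<in>Lam Per. fps_const (wt (lam 0)) * fps_X ^ rank Box lam)
      = (\<Sum>t\<in>Tset. fps_const (wsum t) * fps_X ^ card (supp t))"
    by (subst sum.reindex_bij_betw[OF bij_unhat, symmetric]) (simp add: wsum_def rank_unhat)
  also have "\<dots> = (\<Sum>\<A>\<in>Pow Orb. \<Sum>t | t \<in> Tset \<and> {Y \<in> Orb. Y \<subseteq> supp t} = \<A>. fps_const (wsum t) * fps_X ^ card (supp t))"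
    by (rule sum.group[symmetric]) (use finite_Tset finite_Orb in auto)
  also have "\<dots> = (\<Sum>\<A>\<in>Pow Orb. (\<Prod>Y\<in>\<A>. - (fps_X ^ card Y)) * (\<Prod>Y\<in>Orb - \<A>. 1))"
  proof (rule sum.cong[OF refl])
    fix \<A> assume A: "\<A> \<in> Pow Orb"
    have eq: "{t. t \<in> Tset \<and> {Y \<in> Orb. Y \<subseteq> supp t} = \<A>} = {t. t \<in> Tset \<and> supp t = \<Union>\<A>}"
    proof (intro equalityI subsetI)
      fix t assume "t \<in> {t. t \<in> Tset \<and> {Y \<in> Orb. Y \<subseteq> supp t} = \<A>}"
      then show "t \<in> {t. t \<in> Tset \<and> supp t = \<Union>\<A>}" using supp_Orb[of t] by auto
    next
      fix t assume t: "t \<in> {t. t \<in> Tset \<and> supp t = \<Union>\<A>}"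
      have "\<Union>{Y \<in> Orb. Y \<subseteq> supp t} \<subseteq> \<Union>\<A>" using t by auto
      then have "{Y \<in> Orb. Y \<subseteq> supp t} \<subseteq> \<A>" using Union_Orb_inj[of "{Y \<in> Orb. Y \<subseteq> supp t}" \<A>] A by auto
      moreover have "\<A> \<subseteq> {Y \<in> Orb. Y \<subseteq> supp t}" using t A by auto
      ultimately show "t \<in> {t. t \<in> Tset \<and> {Y \<in> Orb. Y \<subseteq> supp t} = \<A>}" using t by auto
    qed
    have "(\<Sum>t | t \<in> Tset \<and> {Y \<in> Orb. Y \<subseteq> supp t} = \<A>. fps_const (wsum t) * fps_X ^ card (supp t))
      = fps_const (\<Sum>t | t \<in> Tset \<and> supp t = \<Union>\<A>. wsum t) * fps_X ^ card (\<Union>\<A>)"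
      unfolding eq by (simp add: fps_const_sum sum_distrib_right)
    also have "\<dots> = fps_const ((-1) ^ card \<A>) * (\<Prod>Y\<in>\<A>. fps_X ^ card Y)"
      using A by (simp add: sum_wsum_supp card_Union_Orb power_sum)
    also have "fps_const ((-1) ^ card \<A>) = (-1 :: rat fps) ^ card \<A>"
      by (metis fps_const_1_eq_1 fps_const_neg fps_const_power)
    finally show "(\<Sum>t | t \<in> Tset \<and> {Y \<in> Orb. Y \<subseteq> supp t} = \<A>. fps_const (wsum t) * fps_X ^ card (supp t))
      = (\<Prod>Y\<in>\<A>. - (fps_X ^ card Y)) * (\<Prod>Y\<in>Orb - \<A>. 1)"
      by (simp add: prod_uminus)
  qed
  also have "\<dots> = (\<Prod>Y\<in>Orb. - (fps_X ^ card Y) + 1)"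
    by (rule prod_add[OF finite_Orb(1), symmetric])
  finally show ?thesis by simp
qed

lemma orbit_period: "(fr ^^ d) z = z \<longleftrightarrow> card (orbit fr z) dvd d"
proof -
  define c where "c = funpow_dist1 fr z z"
  have z: "z \<in> orbit fr z" by (rule mem_orbit)
  have c: "card (orbit fr z) = c"
    unfolding c_def by (subst orbit_conv_funpow_dist1[OF z]) (simp only: card_image[OF inj_on_funpow_dist1[OF z]] card_atLeastLessThan diff_zero)
  have cz: "(fr ^^ c) z = z" unfolding c_def by (rule funpow_dist1_prop[OF z])
  have "(fr ^^ d) z = (fr ^^ (d mod c)) z" using funpow_mod_eq[OF cz] by simp
  moreover have "(fr ^^ (d mod c)) z = z \<longleftrightarrow> d mod c = 0"
    using funpow_dist1_least[of "d mod c" fr z z] by (auto simp: c_def simp del: funpow.simps)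
  ultimately show ?thesis using c by (simp add: dvd_eq_mod_eq_0)
qed

lemma funpow_fr: "z \<in> Ch \<Longrightarrow> (fr ^^ d) z \<in> Ch \<and> (fr ^^ d) z = (\<lambda>i. if even d then z i ^ (q ^ d) else inverse (z i ^ (q ^ d)))"
proof (induction d)
  case (Suc d)
  then have *: "(fr ^^ d) z \<in> Ch" "(fr ^^ d) z = (\<lambda>i. if even d then z i ^ (q ^ d) else inverse (z i ^ (q ^ d)))" by auto
  have "(fr ^^ Suc d) z = \<phi> ((fr ^^ d) z)" using fr_Ch(1)[OF *(1)] by simp
  also have "\<dots> = (\<lambda>i. if even (Suc d) then z i ^ (q ^ Suc d) else inverse (z i ^ (q ^ Suc d)))"
    by (auto simp: *(2) \<phi>_def power_inverse power_mult[symmetric] mult.commute)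
  finally show ?case using fr_Ch(2)[OF *(1)] by simp
qed simp

text \<open>The left side counts the fixed points of \<open>fr ^^ d\<close>, the points whose first
  \<open>R\<close> components are roots of unity of order dividing |Q^d - 1|. As this number divides
  \<open>E\<close>, all such roots occur in \<open>Ch\<close>, and it is prime to the
  characteristic, so they are as many as expected.\<close>

theorem sum_orbit_lengths:
  assumes d: "d > 0" and E: "(if even d then q ^ d - 1 else q ^ d + 1) dvd E"
  shows "(\<Sum>Y | Y \<in> Orb \<and> card Y dvd d. card Y) = (if even d then q ^ d - 1 else q ^ d + 1) ^ R"
proof -
  define m where "m = (if even d then q ^ d - 1 else q ^ d + 1)"
  have qd: "q ^ d > 1" using q_ge_2 d by (intro one_less_power) auto
  have "(\<Sum>Y | Y \<in> Orb \<and> card Y dvd d. card Y) = card (\<Union>{Y. Y \<in> Orb \<and> card Y dvd d})"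
    by (rule card_Union_Orb[symmetric]) auto
  also have "\<Union>{Y. Y \<in> Orb \<and> card Y dvd d} = {z\<in>Ch. (fr ^^ d) z = z}"
  proof (intro equalityI subsetI)
    fix z assume "z \<in> \<Union>{Y. Y \<in> Orb \<and> card Y dvd d}"
    then obtain Y where Y: "Y \<in> Orb" "card Y dvd d" "z \<in> Y" by blast
    then show "z \<in> {z\<in>Ch. (fr ^^ d) z = z}" using Orb_eq[OF Y(1,3)] Orb_subset[OF Y(1)] orbit_period by auto
  next
    fix z assume "z \<in> {z\<in>Ch. (fr ^^ d) z = z}"
    then show "z \<in> \<Union>{Y. Y \<in> Orb \<and> card Y dvd d}" using orbit_period mem_orbit by (auto simp: Orb_def)
  qed
  also have "\<dots> = {z\<in>Ch. \<forall>i<R. z i ^ m = 1}"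
  proof (intro Collect_cong conj_cong refl)
    fix z assume z: "z \<in> Ch"
    have *: "(if even d then w ^ (q ^ d) else inverse (w ^ (q ^ d))) = w \<longleftrightarrow> w ^ m = 1" if "w \<noteq> 0" for w :: "'a alg_closure"
    proof (cases "even d")
      case True
      have "w ^ (q ^ d) = w * w ^ m" using qd q_pos by (subst power_eq_if) (simp add: m_def True)
      then show ?thesis using True that by simp
    next
      case False
      then show ?thesis using that by (auto simp: m_def field_simps inverse_eq_divide)
    qed
    have "(fr ^^ d) z = z \<longleftrightarrow> (\<forall>i. z i ^ m = 1)" using funpow_fr[OF z, of d] * Ch_nz[OF z] by (auto simp: fun_eq_iff)
    also have "\<dots> \<longleftrightarrow> (\<forall>i<R. z i ^ m = 1)" using z by (auto simp: Ch_def) (metis leI power_one)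
    finally show "(fr ^^ d) z = z \<longleftrightarrow> (\<forall>i<R. z i ^ m = 1)" .
  qed
  also have "card \<dots> = card ({..<R} \<rightarrow>\<^sub>E {w :: 'a alg_closure. w ^ m = 1})"
  proof (rule bij_betw_same_card[where f = "\<lambda>z. restrict z {..<R}"], rule bij_betwI[where g = "\<lambda>z i. if i < R then z i else 1"])
    have "w ^ E = 1" if "w ^ m = 1" for w :: "'a alg_closure" using E that by (auto simp: m_def[symmetric] power_mult elim!: dvdE)
    then show "(\<lambda>z i. if i < R then z i else 1) \<in> ({..<R} \<rightarrow>\<^sub>E {w :: 'a alg_closure. w ^ m = 1}) \<rightarrow> {z\<in>Ch. \<forall>i<R. z i ^ m = 1}"
      by (auto simp: Ch_def PiE_iff)
  qed (auto simp: Ch_def fun_eq_iff PiE_def extensional_def)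
  also have "\<dots> = m ^ R"
  proof -
    have m: "of_nat m \<noteq> (0 :: 'a alg_closure)"
    proof
      assume "of_nat m = (0 :: 'a alg_closure)"
      then have "of_nat E = (0 :: 'a alg_closure)" using E by (auto simp: m_def[symmetric] elim!: dvdE)
      then show False using E_nz by simp
    qed
    show ?thesis using card_nth_roots_unity[OF m] by (simp add: card_PiE)
  qed
  finally show ?thesis by (simp add: m_def)
qed

end

section \<open>Translation to matrices\<close>

lemma subspace_vec_iff:
  "VectorSpace.subspace class_ring U (module_vec TYPE('a::field) n) \<longleftrightarrow>
    U \<subseteq> carrier_vec n \<and> 0\<^sub>v n \<in> U \<and> (\<forall>u\<in>U. \<forall>v\<in>U. u + v \<in> U) \<and> (\<forall>a. \<forall>u\<in>U. a \<cdot>\<^sub>v u \<in> U)"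
proof -
  interpret vec_space "TYPE('a)" n .
  have "vectorspace class_ring (module_vec TYPE('a) n)" by (rule vec_vs)
  moreover have "Module.module class_ring (module_vec TYPE('a) n)" by (rule vec_module)
  ultimately show ?thesis
    unfolding VectorSpace.subspace_def LinearCombinations.submodule_def class_ring_simps module_vec_simps by auto
qed

section \<open>Vectors and matrices as functions and operators\<close>

definition of_vec :: "'a vec \<Rightarrow> nat \<Rightarrow> 'a::field" where
  "of_vec v = (\<lambda>i. if i < dim_vec v then v $ i else 0)"

lemma of_vec_std: "v \<in> carrier_vec n \<Longrightarrow> of_vec v \<in> std_space n"
  by (auto simp: of_vec_def std_space_def)

lemma vec_of_vec: "v \<in> carrier_vec n \<Longrightarrow> vec n (of_vec v) = v"
  by (auto simp: of_vec_def)

lemma of_vec_vec: "x \<in> std_space n \<Longrightarrow> of_vec (vec n x) = x"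
  by (auto simp: of_vec_def std_space_def fun_eq_iff)

lemma bij_of_vec: "bij_betw of_vec (carrier_vec n) (std_space n)"
  by (rule bij_betwI[where g = "vec n"]) (auto simp: of_vec_std vec_of_vec of_vec_vec)

lemma of_vec_add: "u \<in> carrier_vec n \<Longrightarrow> v \<in> carrier_vec n \<Longrightarrow> of_vec (u + v) = of_vec u + of_vec v"
  by (auto simp: of_vec_def fun_eq_iff plus_fun_apply)

lemma of_vec_smult: "of_vec (a \<cdot>\<^sub>v u) = smul a (of_vec u)"
  by (auto simp: of_vec_def fun_eq_iff smul_apply)

lemma of_vec_zero: "of_vec (0\<^sub>v n) = 0"
  by (auto simp: of_vec_def fun_eq_iff zero_fun_apply)

definition gu_form :: "nat \<Rightarrow> 'a::field \<Rightarrow> nat \<Rightarrow> (nat \<Rightarrow> 'a) \<Rightarrow> (nat \<Rightarrow> 'a) \<Rightarrow> 'a" where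
  "gu_form q c n x y = c * (\<Sum>i<n. (-1) ^ i * x i * (y (n - 1 - i)) ^ q)"

lemma herm_form_of_vec:
  "u \<in> carrier_vec n \<Longrightarrow> v \<in> carrier_vec n \<Longrightarrow> gu_form q c n (of_vec u) (of_vec v) = herm_form q c n u v"
  by (auto simp: gu_form_def herm_form_def of_vec_def intro!: sum.cong)

definition op_mat :: "nat \<Rightarrow> 'a mat \<Rightarrow> (nat \<Rightarrow> 'a) \<Rightarrow> (nat \<Rightarrow> 'a::field)" where
  "op_mat n A = (\<lambda>x\<in>std_space n. of_vec (A *\<^sub>v vec n x))"

lemma op_mat_of_vec: "v \<in> carrier_vec n \<Longrightarrow> op_mat n A (of_vec v) = of_vec (A *\<^sub>v v)"
  by (simp add: op_mat_def of_vec_std vec_of_vec)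

lemma op_mat_std: "A \<in> carrier_mat n n \<Longrightarrow> x \<in> std_space n \<Longrightarrow> op_mat n A x \<in> std_space n"
  by (simp add: op_mat_def of_vec_std)

lemma op_mat_add: "A \<in> carrier_mat n n \<Longrightarrow> x \<in> std_space n \<Longrightarrow> y \<in> std_space n \<Longrightarrow>
    op_mat n A (x + y) = op_mat n A x + op_mat n A y"
proof -
  assume A: "A \<in> carrier_mat n n" and x: "x \<in> std_space n" and y: "y \<in> std_space n"
  have "x + y = of_vec (vec n x + vec n y)" using x y by (simp add: of_vec_add[of _ n] of_vec_vec)
  then have "op_mat n A (x + y) = of_vec (A *\<^sub>v (vec n x + vec n y))" by (simp add: op_mat_of_vec)
  also have "\<dots> = of_vec (A *\<^sub>v vec n x) + of_vec (A *\<^sub>v vec n y)"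
    using A by (simp add: mult_add_distrib_mat_vec[of A n n] of_vec_add[of _ n])
  finally show ?thesis using x y by (simp add: op_mat_def)
qed

lemma op_mat_smul: "A \<in> carrier_mat n n \<Longrightarrow> x \<in> std_space n \<Longrightarrow> op_mat n A (smul a x) = smul a (op_mat n A x)"
proof -
  assume A: "A \<in> carrier_mat n n" and x: "x \<in> std_space n"
  have "smul a x = of_vec (a \<cdot>\<^sub>v vec n x)" using x by (simp add: of_vec_smult of_vec_vec)
  then have "op_mat n A (smul a x) = of_vec (A *\<^sub>v (a \<cdot>\<^sub>v vec n x))" by (simp add: op_mat_of_vec)
  also have "\<dots> = smul a (of_vec (A *\<^sub>v vec n x))"
    using A by (simp add: mult_mat_vec[of A n n] of_vec_smult)
  finally show ?thesis using x by (simp add: op_mat_def)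
qed

lemma op_mat_mult: "A \<in> carrier_mat n n \<Longrightarrow> B \<in> carrier_mat n n \<Longrightarrow> x \<in> std_space n \<Longrightarrow>
    op_mat n (A * B) x = op_mat n A (op_mat n B x)"
  by (simp add: op_mat_def of_vec_std vec_of_vec assoc_mult_mat_vec[of A n n B n])

lemma op_mat_one: "x \<in> std_space n \<Longrightarrow> op_mat n (1\<^sub>m n) x = x"
  by (simp add: op_mat_def of_vec_vec)

lemma op_mat_inj:
  assumes A: "A \<in> carrier_mat n n" and B: "B \<in> carrier_mat n n" and eq: "\<And>x. x \<in> std_space n \<Longrightarrow> op_mat n A x = op_mat n B x"
  shows "A = B"
proof (rule eq_matI)
  fix i j assume ij: "i < dim_row B" "j < dim_col B"
  then have ij: "i < n" "j < n" using B by auto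
  have "of_vec (A *\<^sub>v unit_vec n j) = of_vec (B *\<^sub>v unit_vec n j)"
    using eq[OF of_vec_std[of "unit_vec n j" n]] by (simp add: op_mat_of_vec)
  then have "(A *\<^sub>v unit_vec n j) $ i = (B *\<^sub>v unit_vec n j) $ i"
    using A B ij by (auto simp: of_vec_def dest!: fun_cong[of _ _ i])
  then show "A $$ (i, j) = B $$ (i, j)" using A B ij by simp
qed (use A B in auto)

definition mat_op :: "nat \<Rightarrow> ((nat \<Rightarrow> 'a) \<Rightarrow> (nat \<Rightarrow> 'a::field)) \<Rightarrow> 'a mat" where
  "mat_op n f = mat n n (\<lambda>(i, j). f (\<lambda>k. if k = j then 1 else 0) i)"

lemma std_space_expand: "x \<in> std_space n \<Longrightarrow> x = (\<Sum>j<n. smul (x j) (\<lambda>k. if k = j then 1 else 0))"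
  by (auto simp: std_space_def fun_eq_iff sum_fun_apply smul_apply if_distrib cong: if_cong)

lemma op_mat_mat_op:
  fixes f :: "(nat \<Rightarrow> 'a::field) \<Rightarrow> nat \<Rightarrow> 'a"
  assumes f: "f \<in> isoms (std_space n) h (std_space n) h"
  shows "op_mat n (mat_op n f) = f"
proof (rule extensionalityI[where A = "std_space n"])
  show "f \<in> extensional (std_space n)" by (rule isomsD(5)[OF f])
  fix x :: "nat \<Rightarrow> 'a" assume x: "x \<in> std_space n"
  have unit: "(\<lambda>k. if k = j then 1 else 0 :: 'a) \<in> std_space n" if "j < n" for j using that by (auto simp: std_space_def)
  have "f x = f (\<Sum>j<n. smul (x j) (\<lambda>k. if k = j then 1 else 0))" using std_space_expand[OF x] by simp
  also have "\<dots> = (\<Sum>j<n. f (smul (x j) (\<lambda>k. if k = j then 1 else 0)))"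
    by (rule isoms_sum[OF f subsp_std_space]) (auto intro: subsp_smul[OF subsp_std_space] unit)
  also have "\<dots> = (\<Sum>j<n. smul (x j) (f (\<lambda>k. if k = j then 1 else 0)))"
    by (rule sum.cong) (auto simp: isomsD(3)[OF f] unit)
  finally have fx: "f x = (\<Sum>j<n. smul (x j) (f (\<lambda>k. if k = j then 1 else 0)))" .
  have "op_mat n (mat_op n f) x i = f x i" for i
  proof (cases "i < n")
    case True
    then have "op_mat n (mat_op n f) x i = (\<Sum>j<n. f (\<lambda>k. if k = j then 1 else 0) i * x j)"
      using x by (simp add: op_mat_def of_vec_def mat_op_def scalar_prod_def atLeast0LessThan)
    then show ?thesis by (simp add: fx sum_fun_apply smul_apply mult.commute)
  next
    case False
    then show ?thesis using x isomsD(1)[OF f x] by (simp add: op_mat_def of_vec_def mat_op_def std_space_def)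
  qed
  then show "op_mat n (mat_op n f) x = f x" by (simp add: fun_eq_iff)
qed (simp add: op_mat_def)

section \<open>The unitary group, its homomorphisms and its posets in terms of
  representations\<close>

context quadratic_field
begin

text \<open>Reversing the summation exchanges the arguments at the cost of the sign (-1)^(n + 1),
  which the condition on \<open>c\<close> compensates. For nondegeneracy, pairing with the unit
  vector at \<open>n - 1 - j\<close> isolates coordinate \<open>j\<close>.\<close>

lemma gu_hermitian:
  fixes c :: 'a
  assumes c: "c \<noteq> 0" "c ^ (q - 1) = (-1) ^ (n + 1)" and n: "n \<ge> 1"
  shows "hermitian_space q (std_space n) (gu_form q c n)"
proof unfold_locales
  show "finite (std_space n :: (nat \<Rightarrow> 'a) set)" "subsp (std_space n :: (nat \<Rightarrow> 'a) set)"
    by (rule finite_std_space subsp_std_space)+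
  fix x y z :: "nat \<Rightarrow> 'a" and a
  show "gu_form q c n (x + y) z = gu_form q c n x z + gu_form q c n y z"
    by (simp add: gu_form_def plus_fun_apply algebra_simps sum.distrib)
  show "gu_form q c n (smul a x) z = a * gu_form q c n x z"
    by (simp add: gu_form_def smul_apply sum_distrib_left mult_ac)
  have m1: "((-1) ^ i :: 'a) ^ q = (-1) ^ i" for i
    by (induction i) (simp_all add: power_mult_distrib frob_minus)
  have "gu_form q c n x y ^ q = c ^ q * (\<Sum>i<n. (-1) ^ i * x i ^ q * y (n - 1 - i))"
    by (simp add: gu_form_def power_mult_distrib frob_sum m1 frob_frob)
  also have "(\<Sum>i<n. (-1) ^ i * x i ^ q * y (n - 1 - i)) = (\<Sum>i<n. (-1) ^ (n - 1 - i) * x (n - 1 - i) ^ q * y i)"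
    by (rule sum.reindex_bij_witness[of _ "\<lambda>i. n - 1 - i" "\<lambda>i. n - 1 - i"]) auto
  also have "\<dots> = (\<Sum>i<n. (-1) ^ (n + 1) * ((-1) ^ i * y i * x (n - 1 - i) ^ q))"
  proof (rule sum.cong[OF refl])
    fix i assume "i \<in> {..<n}"
    then have "(-1) ^ (n - 1 - i) = ((-1) ^ (n + 1 + i) :: 'a)" by (auto simp: minus_one_power_iff)
    then show "(-1) ^ (n - 1 - i) * x (n - 1 - i) ^ q * y i = (-1) ^ (n + 1) * ((-1) ^ i * y i * x (n - 1 - i) ^ q)"
      by (simp add: power_add mult_ac)
  qed
  also have "\<dots> = (-1) ^ (n + 1) * (\<Sum>i<n. (-1) ^ i * y i * x (n - 1 - i) ^ q)"
    by (rule sum_distrib_left[symmetric])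
  also have "c ^ q = c * c ^ (q - 1)" using q_ge_2 by (simp add: power_eq_if[of c q])
  also have "c * c ^ (q - 1) * ((-1) ^ (n + 1) * (\<Sum>i<n. (-1) ^ i * y i * x (n - 1 - i) ^ q))
      = (c ^ (q - 1) * (-1) ^ (n + 1)) * gu_form q c n y x"
    unfolding gu_form_def by (simp only: mult_ac)
  also have "c ^ (q - 1) * (-1) ^ (n + 1) = 1" unfolding c(2) by (simp add: power_add[symmetric])
  finally show "gu_form q c n y x = gu_form q c n x y ^ q" by simp
next
  fix x :: "nat \<Rightarrow> 'a" assume x: "x \<in> std_space n" "\<And>y. y \<in> std_space n \<Longrightarrow> gu_form q c n x y = 0"
  have "x j = 0" for j
  proof (cases "j < n")
    case True
    define y :: "nat \<Rightarrow> 'a" where "y = (\<lambda>k. if k = n - 1 - j then 1 else 0)"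
    have "y \<in> std_space n" using True by (auto simp: std_space_def y_def)
    from x(2)[OF this] have "(\<Sum>i<n. (-1) ^ i * x i * (y (n - 1 - i)) ^ q) = 0" using c(1) by (simp add: gu_form_def)
    also have "(\<Sum>i<n. (-1) ^ i * x i * (y (n - 1 - i)) ^ q) = (\<Sum>i<n. if i = j then (-1) ^ i * x i else 0)"
    proof (rule sum.cong[OF refl])
      fix i assume "i \<in> {..<n}"
      then have "n - 1 - i = n - 1 - j \<longleftrightarrow> i = j" using True by auto
      then show "(-1) ^ i * x i * (y (n - 1 - i)) ^ q = (if i = j then (-1) ^ i * x i else 0)"
        using frob_0 by (simp add: y_def)
    qed
    finally show ?thesis using True by simp
  qed (use x in \<open>auto simp: std_space_def\<close>)
  then show "x = 0" by (simp add: fun_eq_iff zero_fun_apply)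
qed

lemma bij_op_mat:
  fixes c :: 'a
  assumes c: "c \<noteq> 0" "c ^ (q - 1) = (-1) ^ (n + 1)" and n: "n \<ge> 1"
  defines "S \<equiv> std_space n" and "h \<equiv> gu_form q c n"
  shows "bij_betw (op_mat n) (carrier (GU q c n)) (isoms S h S h)"
proof (rule bij_betwI[where g = "mat_op n"])
  interpret H: hermitian_space q S h unfolding S_def h_def by (rule gu_hermitian[OF c n])
  show op: "op_mat n \<in> carrier (GU q c n) \<rightarrow> isoms S h S h"
  proof
    fix A assume "A \<in> carrier (GU q c n)"
    then have A: "A \<in> carrier_mat n n" and f: "\<And>u v. u \<in> carrier_vec n \<Longrightarrow> v \<in> carrier_vec n \<Longrightarrow>
        herm_form q c n (A *\<^sub>v u) (A *\<^sub>v v) = herm_form q c n u v"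
      by (auto simp: GU_def)
    show "op_mat n A \<in> isoms S h S h"
    proof (rule isomsI)
      show "op_mat n A \<in> S \<rightarrow>\<^sub>E S" using A by (auto simp: S_def op_mat_std) (simp add: op_mat_def)
      fix x y assume x: "x \<in> S" and y: "y \<in> S"
      show "op_mat n A (x + y) = op_mat n A x + op_mat n A y" using op_mat_add[OF A] x y by (simp add: S_def)
      have "h (op_mat n A x) (op_mat n A y) = herm_form q c n (A *\<^sub>v vec n x) (A *\<^sub>v vec n y)"
        using A x y by (simp add: h_def S_def op_mat_def herm_form_of_vec)
      also have "\<dots> = h (of_vec (vec n x)) (of_vec (vec n y))" by (simp add: f h_def herm_form_of_vec)
      finally show "h (op_mat n A x) (op_mat n A y) = h x y" using x y by (simp add: S_def of_vec_vec)
    qed (use op_mat_smul[OF A] in \<open>simp add: S_def\<close>)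
  qed
  show "mat_op n \<in> isoms S h S h \<rightarrow> carrier (GU q c n)"
  proof
    fix f assume f: "f \<in> isoms S h S h"
    define g where "g = restrict (inv_into S f) S"
    have bij: "bij_betw f S S" by (rule isoms_bij[OF H.hermitian_space_axioms H.hermitian_space_axioms f refl])
    have g: "g \<in> isoms S h S h" unfolding g_def by (rule isoms_inv[OF f bij H.subS H.subS])
    have gf: "g (f x) = x" "f (g x) = x" if "x \<in> S" for x
      using that bij isomsD(1)[OF f that] by (auto simp: g_def bij_betw_def inv_into_f_f f_inv_into_f)
    have of: "op_mat n (mat_op n f) = f" and og: "op_mat n (mat_op n g) = g"
      using op_mat_mat_op f g by (auto simp: S_def)
    have carr: "mat_op n f \<in> carrier_mat n n" "mat_op n g \<in> carrier_mat n n" by (auto simp: mat_op_def)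
    have "mat_op n f * mat_op n g = 1\<^sub>m n"
      by (rule op_mat_inj[where n = n])
         (use carr gf isomsD(1)[OF g] in \<open>auto simp: op_mat_mult of og op_mat_one S_def\<close>)
    moreover have "mat_op n g * mat_op n f = 1\<^sub>m n"
      by (rule op_mat_inj[where n = n])
         (use carr gf isomsD(1)[OF f] in \<open>auto simp: op_mat_mult of og op_mat_one S_def\<close>)
    ultimately have "invertible_mat (mat_op n f)"
      using carr unfolding invertible_mat_def inverts_mat_def by auto
    moreover have "herm_form q c n (mat_op n f *\<^sub>v u) (mat_op n f *\<^sub>v v) = herm_form q c n u v"
      if u: "u \<in> carrier_vec n" "v \<in> carrier_vec n" for u v
    proof -
      have "herm_form q c n (mat_op n f *\<^sub>v u) (mat_op n f *\<^sub>v v) = h (of_vec (mat_op n f *\<^sub>v u)) (of_vec (mat_op n f *\<^sub>v v))"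
        using carr u by (simp add: h_def herm_form_of_vec)
      also have "\<dots> = h (f (of_vec u)) (f (of_vec v))" using op_mat_of_vec[of _ n "mat_op n f"] u of by simp
      also have "\<dots> = h (of_vec u) (of_vec v)" by (rule isomsD(4)[OF f]) (use u of_vec_std in \<open>auto simp: S_def\<close>)
      finally show ?thesis using u by (simp add: h_def herm_form_of_vec)
    qed
    ultimately show "mat_op n f \<in> carrier (GU q c n)" using carr by (simp add: GU_def)
  qed
  show "op_mat n (mat_op n f) = f" if "f \<in> isoms S h S h" for f using op_mat_mat_op that by (simp add: S_def)
  show "mat_op n (op_mat n A) = A" if A: "A \<in> carrier (GU q c n)" for A
  proof (rule op_mat_inj[where n = n])
    show "A \<in> carrier_mat n n" using A by (simp add: GU_def)
    show "mat_op n (op_mat n A) \<in> carrier_mat n n" by (simp add: mat_op_def)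
    show "op_mat n (mat_op n (op_mat n A)) x = op_mat n A x" for x
      using op_mat_mat_op[of "op_mat n A" n h] op A by (simp add: S_def Pi_iff)
  qed
qed

lemma order_GU:
  fixes c :: 'a
  assumes c: "c \<noteq> 0" "c ^ (q - 1) = (-1) ^ (n + 1)" and n: "n \<ge> 1"
  shows "Coset.order (GU q c n) = order_U n"
proof -
  have "Coset.order (GU q c n) = card (isoms (std_space n) (gu_form q c n) (std_space n) (gu_form q c n))"
    unfolding Coset.order_def by (rule bij_betw_same_card[OF bij_op_mat[OF assms]])
  also have "\<dots> = order_U n"
    by (rule order_U_eq[OF gu_hermitian[OF assms] gu_hermitian[OF assms]]) (simp_all add: card_std_space card_field)
  finally show ?thesis .
qed

text \<open>A homomorphism out of \<open>Zpow R\<close> is read as a representation of all integer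
  sequences that ignores the entries from \<open>R\<close> on; the period lattice with
  \<open>E = 0\<close> says just this.\<close>

lemma bij_Homs:
  fixes c :: 'a
  assumes c: "c \<noteq> 0" "c ^ (q - 1) = (-1) ^ (n + 1)" and n: "n \<ge> 1"
  shows "bij_betw (\<lambda>Y k. op_mat n (Y (restrict k {..<R}))) (Homs (Zpow R) (GU q c n))
    (Reps (period_lattice R 0) (std_space n) (gu_form q c n))"
proof -
  define S where "S = (std_space n :: (nat \<Rightarrow> 'a) set)"
  define h where "h = gu_form q c n"
  define op where "op = (op_mat n :: 'a mat \<Rightarrow> _)"
  define G where "G = carrier (GU q c n)"
  define inv_op where "inv_op = inv_into G op"
  interpret H: hermitian_space q S h unfolding S_def h_def by (rule gu_hermitian[OF assms])
  have bij: "bij_betw op G (isoms S h S h)" unfolding op_def G_def S_def h_def by (rule bij_op_mat[OF assms])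
  have GM: "A \<in> carrier_mat n n" if "A \<in> G" for A using that by (simp add: G_def GU_def)
  have opG: "op A \<in> isoms S h S h" if "A \<in> G" for A using bij that by (auto simp: bij_betw_def)
  have io: "inv_op (op A) = A" if "A \<in> G" for A using bij that by (simp add: inv_op_def bij_betw_def inv_into_f_f)
  have oi: "op (inv_op f) = f" "inv_op f \<in> G" if "f \<in> isoms S h S h" for f
    using bij that by (auto simp: inv_op_def bij_betw_def f_inv_into_f inv_into_into)
  have Z: "carrier (Zpow R) = {..<R} \<rightarrow>\<^sub>E UNIV" "x \<otimes>\<^bsub>Zpow R\<^esub> y = (\<lambda>i\<in>{..<R}. x i + y i)" for x y
    by (auto simp: Zpow_def integer_group_def)
  have mulG: "A \<otimes>\<^bsub>GU q c n\<^esub> B = A * B" for A B by (simp add: GU_def)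
  have res: "restrict (k + l) {..<R} = restrict k {..<R} \<otimes>\<^bsub>Zpow R\<^esub> restrict l {..<R}" for k l :: "nat \<Rightarrow> int"
    by (auto simp: Z fun_eq_iff plus_fun_apply)
  define \<Phi> where "\<Phi> = (\<lambda>Y (k :: nat \<Rightarrow> int). op (Y (restrict k {..<R})))"
  define ext0 where "ext0 = (\<lambda>(k :: nat \<Rightarrow> int) i. if i < R then k i else 0)"
  define \<Psi> where "\<Psi> = (\<lambda>\<rho> :: (nat \<Rightarrow> int) \<Rightarrow> _. \<lambda>k\<in>carrier (Zpow R). inv_op (\<rho> (ext0 k)))"
  have HomsD: "Y k \<in> G" "Y (k \<otimes>\<^bsub>Zpow R\<^esub> l) = Y k * Y l"
    if "Y \<in> Homs (Zpow R) (GU q c n)" "k \<in> carrier (Zpow R)" "l \<in> carrier (Zpow R)" for Y k l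
    using that by (auto simp: Homs_def hom_def G_def mulG Pi_iff)
  have rc: "restrict k {..<R} \<in> carrier (Zpow R)" for k :: "nat \<Rightarrow> int" by (simp add: Z)
  have "bij_betw \<Phi> (Homs (Zpow R) (GU q c n)) (Reps (period_lattice R 0) S h)"
  proof (rule bij_betwI[where g = \<Psi>])
    show "\<Phi> \<in> Homs (Zpow R) (GU q c n) \<rightarrow> Reps (period_lattice R 0) S h"
    proof
      fix Y assume Y: "Y \<in> Homs (Zpow R) (GU q c n)"
      have iso: "\<Phi> Y k \<in> isoms S h S h" for k unfolding \<Phi>_def by (rule opG[OF HomsD(1)[OF Y rc rc]])
      have hom: "\<Phi> Y (k + l) x = \<Phi> Y k (\<Phi> Y l x)" if "x \<in> S" for k l x
        using that GM[OF HomsD(1)[OF Y rc rc]]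
        by (simp add: \<Phi>_def res HomsD(2)[OF Y rc rc] op_def op_mat_mult S_def)
      show "\<Phi> Y \<in> Reps (period_lattice R 0) S h"
      proof (rule RepsI)
        show "\<Phi> Y k \<in> isoms S h S h" for k by (rule iso)
        show "\<Phi> Y (k + l) x = \<Phi> Y k (\<Phi> Y l x)" if "x \<in> S" for k l x by (rule hom[OF that])
      next
        fix k x assume k: "k \<in> period_lattice R 0" and x: "x \<in> S"
        have inj: "inj_on (\<Phi> Y k) S" by (rule isoms_inj[OF H.hermitian_space_axioms H.hermitian_space_axioms iso])
        \<comment> \<open>This makes \<open>\<Phi> Y k\<close> idempotent; being injective as well,
          it is the identity on \<open>S\<close>.\<close>
        have "restrict (k + k) {..<R} = restrict k {..<R}" using k by (auto simp: period_lattice_def fun_eq_iff plus_fun_apply)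
        then have "\<Phi> Y (k + k) = \<Phi> Y k" by (simp add: \<Phi>_def)
        then have "\<Phi> Y k (\<Phi> Y k x) = \<Phi> Y k x" using hom[OF x, of k k] by simp
        then show "\<Phi> Y k x = x" using inj_onD[OF inj] isomsD(1)[OF iso x, of k] x by blast
      qed
    qed
    show "\<Psi> \<in> Reps (period_lattice R 0) S h \<rightarrow> Homs (Zpow R) (GU q c n)"
    proof
      fix \<rho> assume r: "\<rho> \<in> Reps (period_lattice R 0) S h"
      have "\<Psi> \<rho> (k \<otimes>\<^bsub>Zpow R\<^esub> l) = \<Psi> \<rho> k * \<Psi> \<rho> l" if k: "k \<in> carrier (Zpow R)" "l \<in> carrier (Zpow R)" for k l
      proof (rule op_mat_inj[where n = n])
        have kl: "k \<otimes>\<^bsub>Zpow R\<^esub> l \<in> carrier (Zpow R)" by (simp add: Z)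
        have e: "ext0 (k \<otimes>\<^bsub>Zpow R\<^esub> l) = ext0 k + ext0 l" by (auto simp: ext0_def Z fun_eq_iff plus_fun_apply)
        have m: "\<Psi> \<rho> k \<in> carrier_mat n n" if "k \<in> carrier (Zpow R)" for k
          using that GM[OF oi(2)[OF RepsD(1)[OF r]]] by (simp add: \<Psi>_def)
        show "\<Psi> \<rho> (k \<otimes>\<^bsub>Zpow R\<^esub> l) \<in> carrier_mat n n" by (rule m[OF kl])
        show "\<Psi> \<rho> k * \<Psi> \<rho> l \<in> carrier_mat n n" by (rule mult_carrier_mat[OF m[OF k(1)] m[OF k(2)]])
        have o: "op_mat n (\<Psi> \<rho> k) = \<rho> (ext0 k)" if "k \<in> carrier (Zpow R)" for k
          using that oi(1)[OF RepsD(1)[OF r]] by (simp add: \<Psi>_def op_def)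
        fix x :: "nat \<Rightarrow> 'a" assume x: "x \<in> std_space n"
        have "op_mat n (\<Psi> \<rho> (k \<otimes>\<^bsub>Zpow R\<^esub> l)) x = \<rho> (ext0 k + ext0 l) x" by (simp add: o[OF kl] e)
        also have "\<dots> = \<rho> (ext0 k) (\<rho> (ext0 l) x)" using RepsD(2)[OF r] x by (simp add: S_def)
        also have "\<dots> = op_mat n (\<Psi> \<rho> k * \<Psi> \<rho> l) x"
          using x by (simp add: op_mat_mult[OF m[OF k(1)] m[OF k(2)]] o k)
        finally show "op_mat n (\<Psi> \<rho> (k \<otimes>\<^bsub>Zpow R\<^esub> l)) x = op_mat n (\<Psi> \<rho> k * \<Psi> \<rho> l) x" .
      qed
      moreover have "\<Psi> \<rho> k \<in> G" if "k \<in> carrier (Zpow R)" for k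
        using that oi(2)[OF RepsD(1)[OF r]] by (simp add: \<Psi>_def)
      ultimately show "\<Psi> \<rho> \<in> Homs (Zpow R) (GU q c n)"
        by (auto simp: Homs_def hom_def G_def mulG) (simp add: \<Psi>_def)
    qed
    show "\<Psi> (\<Phi> Y) = Y" if Y: "Y \<in> Homs (Zpow R) (GU q c n)" for Y
    proof (rule extensionalityI[where A = "carrier (Zpow R)"])
      show "Y \<in> extensional (carrier (Zpow R))" using Y by (simp add: Homs_def)
      fix k assume k: "k \<in> carrier (Zpow R)"
      have "restrict (ext0 k) {..<R} = k" using k by (auto simp: ext0_def Z fun_eq_iff PiE_def extensional_def)
      then show "\<Psi> (\<Phi> Y) k = Y k" using k io[OF HomsD(1)[OF Y k k]] by (simp add: \<Psi>_def \<Phi>_def)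
    qed (simp add: \<Psi>_def)
    show "\<Phi> (\<Psi> \<rho>) = \<rho>" if r: "\<rho> \<in> Reps (period_lattice R 0) S h" for \<rho>
    proof
      fix k
      have "\<rho> (ext0 (restrict k {..<R})) = \<rho> k"
        by (rule Reps_period[OF r]) (auto simp: period_lattice_def ext0_def minus_apply)
      then show "\<Phi> (\<Psi> \<rho>) k = \<rho> k" using rc oi(1)[OF RepsD(1)[OF r]] by (simp add: \<Psi>_def \<Phi>_def)
    qed
  qed
  then show ?thesis by (simp add: \<Phi>_def S_def h_def op_def)
qed

lemma reduced_euler_char_chi:
  fixes c :: 'a
  assumes c: "c \<noteq> 0" "c ^ (q - 1) = (-1) ^ (n + 1)" and n: "n \<ge> 1" and Y: "Y \<in> Homs (Zpow R) (GU q c n)"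
  shows "reduced_euler_char (invariant_subspaces (Y ` carrier (Zpow R)) (isotropic_subspaces q c n))
    = - chi (gu_form q c n) (range (\<lambda>k. op_mat n (Y (restrict k {..<R})))) (std_space n)"
proof -
  define S where "S = (std_space n :: (nat \<Rightarrow> 'a) set)"
  define h where "h = gu_form q c n"
  define \<rho> where "\<rho> = (\<lambda>k. op_mat n (Y (restrict k {..<R})))"
  interpret H: hermitian_space q S h unfolding S_def h_def by (rule gu_hermitian[OF c n])
  have r: "\<rho> \<in> Reps (period_lattice R 0) S h" unfolding \<rho>_def S_def h_def using bij_Homs[OF c n] Y by (auto simp: bij_betw_def)
  interpret A: hermitian_action q S h "range \<rho>" by (rule Reps_action[OF H.hermitian_space_axioms r])
  define P where "P = invariant_subspaces (Y ` carrier (Zpow R)) (isotropic_subspaces q c n)"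
  define P' where "P' = {U \<in> Sub (range \<rho>) S. isotropic h U \<and> U \<noteq> {0}}"
  have P_vec: "U \<subseteq> carrier_vec n" if "U \<in> P" for U
    using that by (auto simp: P_def invariant_subspaces_def isotropic_subspaces_def subspace_vec_iff)
  have finV: "finite (carrier_vec n :: 'a vec set)"
    using bij_betw_finite[OF bij_of_vec[where ?'a = 'a, of n]] finite_std_space by blast
  have finP: "finite P" by (rule finite_subset[of _ "Pow (carrier_vec n)"]) (use P_vec finV in auto)
  have injv: "inj_on of_vec (carrier_vec n :: 'a vec set)" using bij_of_vec[where ?'a = 'a, of n] by (simp add: bij_betw_def)
  have imv: "of_vec ` carrier_vec n = S" using bij_of_vec[where ?'a = 'a, of n] by (simp add: bij_betw_def S_def)
  have ran: "range \<rho> = op_mat n ` (Y ` carrier (Zpow R))"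
  proof -
    have "(\<lambda>k. restrict k {..<R}) ` UNIV = carrier (Zpow R)"
    proof (intro equalityI subsetI)
      fix k :: "nat \<Rightarrow> int" assume "k \<in> carrier (Zpow R)"
      then have "k = restrict k {..<R}" by (auto simp: Zpow_def fun_eq_iff PiE_def extensional_def)
      then show "k \<in> (\<lambda>k. restrict k {..<R}) ` UNIV" by (metis rangeI)
    qed (auto simp: Zpow_def integer_group_def split: if_splits)
    moreover have "range \<rho> = op_mat n ` Y ` (\<lambda>k. restrict k {..<R}) ` UNIV"
      by (simp only: \<rho>_def image_image)
    ultimately show ?thesis by (simp only:)
  qed
  have key: "of_vec ` U \<in> P' \<longleftrightarrow> U \<in> P" if U: "U \<subseteq> carrier_vec n" for U
  proof -
    have UC: "u \<in> carrier_vec n" if "u \<in> U" for u using that U by blast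
    have mem: "of_vec v \<in> of_vec ` U \<longleftrightarrow> v \<in> U" if "v \<in> carrier_vec n" for v
      using inj_on_image_mem_iff[OF injv that U] .
    have "0 \<in> of_vec ` U \<longleftrightarrow> 0\<^sub>v n \<in> U" using mem[of "0\<^sub>v n"] by (simp add: of_vec_zero)
    moreover have "(\<forall>x\<in>of_vec ` U. \<forall>y\<in>of_vec ` U. x + y \<in> of_vec ` U) \<longleftrightarrow> (\<forall>u\<in>U. \<forall>v\<in>U. u + v \<in> U)"
    proof -
      have "of_vec u + of_vec v \<in> of_vec ` U \<longleftrightarrow> u + v \<in> U" if "u \<in> U" "v \<in> U" for u v
        using mem[of "u + v"] of_vec_add[OF UC[OF that(1)] UC[OF that(2)]] UC that by simp
      then show ?thesis by blast
    qed
    moreover have "(\<forall>a. \<forall>x\<in>of_vec ` U. smul a x \<in> of_vec ` U) \<longleftrightarrow> (\<forall>a. \<forall>u\<in>U. a \<cdot>\<^sub>v u \<in> U)"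
    proof -
      have "smul a (of_vec u) \<in> of_vec ` U \<longleftrightarrow> a \<cdot>\<^sub>v u \<in> U" if "u \<in> U" for a u
        using mem[of "a \<cdot>\<^sub>v u"] UC[OF that] by (simp add: of_vec_smult)
      then show ?thesis by blast
    qed
    ultimately have sub: "subsp (of_vec ` U) \<longleftrightarrow> VectorSpace.subspace class_ring U (module_vec TYPE('a) n)"
      unfolding subsp_def subspace_vec_iff using U by blast
    have iso: "isotropic h (of_vec ` U) \<longleftrightarrow> U \<subseteq> perp q c n U"
    proof -
      have "h (of_vec u) (of_vec v) = herm_form q c n u v" if "u \<in> U" "v \<in> U" for u v
        using UC that by (simp add: h_def herm_form_of_vec)
      then show ?thesis using U by (auto simp: isotropic_def perp_def)
    qed
    have z: "of_vec ` U = {0} \<longleftrightarrow> U = {0\<^sub>v n}"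
      using inj_on_image_eq_iff[OF injv U, of "{0\<^sub>v n}"] by (simp add: of_vec_zero)
    have inv: "(\<forall>f\<in>range \<rho>. f ` of_vec ` U \<subseteq> of_vec ` U) \<longleftrightarrow> (\<forall>B\<in>Y ` carrier (Zpow R). (\<lambda>v. B *\<^sub>v v) ` U = U)"
    proof -
      have "op_mat n B ` of_vec ` U \<subseteq> of_vec ` U \<longleftrightarrow> (\<lambda>v. B *\<^sub>v v) ` U = U" if B: "B \<in> Y ` carrier (Zpow R)" for B
      proof -
        have "B \<in> carrier (GU q c n)" using B Y by (auto simp: Homs_def hom_def)
        then have BM: "B \<in> carrier_mat n n" by (simp add: GU_def)
        have opB: "op_mat n B \<in> range \<rho>" using ran B by blast
        have BU: "B *\<^sub>v u \<in> carrier_vec n" if "u \<in> U" for u using BM UC[OF that] by simp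
        have "op_mat n B ` of_vec ` U = of_vec ` ((\<lambda>v. B *\<^sub>v v) ` U)"
          using op_mat_of_vec[OF UC] by (simp add: image_image cong: image_cong)
        moreover have "of_vec ` ((\<lambda>v. B *\<^sub>v v) ` U) \<subseteq> of_vec ` U \<longleftrightarrow> (\<lambda>v. B *\<^sub>v v) ` U \<subseteq> U"
          using mem BU by blast
        \<comment> \<open>\<open>invariant_subspaces\<close> asks for equality and
          \<open>Sub\<close> for inclusion; injectivity on a finite set reconciles them.\<close>
        moreover have "(\<lambda>v. B *\<^sub>v v) ` U \<subseteq> U \<longleftrightarrow> (\<lambda>v. B *\<^sub>v v) ` U = U"
        proof
          assume s: "(\<lambda>v. B *\<^sub>v v) ` U \<subseteq> U"
          have "inj_on (\<lambda>v. B *\<^sub>v v) U"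
          proof (rule inj_onI)
            fix u v assume uv: "u \<in> U" "v \<in> U" "B *\<^sub>v u = B *\<^sub>v v"
            then have "op_mat n B (of_vec u) = op_mat n B (of_vec v)" using op_mat_of_vec UC by metis
            then have "of_vec u = of_vec v"
              by (rule inj_onD[OF A.act_inj[OF opB]]) (simp_all add: S_def of_vec_std UC uv(1,2))
            then show "u = v" using inj_onD[OF injv] UC uv by blast
          qed
          then show "(\<lambda>v. B *\<^sub>v v) ` U = U" using s endo_inj_surj[OF finite_subset[OF U finV]] by blast
        qed simp
        ultimately show ?thesis by simp
      qed
      then have "(\<forall>B\<in>D. op_mat n B ` of_vec ` U \<subseteq> of_vec ` U) \<longleftrightarrow> (\<forall>B\<in>D. (\<lambda>v. B *\<^sub>v v) ` U = U)"
        if "D = Y ` carrier (Zpow R)" for D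
        unfolding that by (rule ball_cong[OF refl])
      then show ?thesis by (simp only: ran ball_simps)
    qed
    have US: "of_vec ` U \<subseteq> S" using U imv by blast
    have "of_vec ` U \<in> P' \<longleftrightarrow> subsp (of_vec ` U) \<and> (\<forall>f\<in>range \<rho>. f ` of_vec ` U \<subseteq> of_vec ` U) \<and>
        isotropic h (of_vec ` U) \<and> of_vec ` U \<noteq> {0}"
      by (simp only: P'_def Sub_def mem_Collect_eq US simp_thms conj_assoc)
    also have "\<dots> \<longleftrightarrow> U \<in> P"
      by (simp only: sub iso z inv P_def invariant_subspaces_def isotropic_subspaces_def mem_Collect_eq conj_ac)
    finally show ?thesis .
  qed
  have "echar P' = echar P"
  proof (rule echar_iso[where f = "image of_vec"])
    show "bij_betw (image of_vec) P P'"
    proof (rule bij_betw_imageI)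
      show "inj_on (image of_vec) P" using inj_on_image_eq_iff[OF injv] P_vec by (auto simp: inj_on_def)
      show "image of_vec ` P = P'"
      proof (intro equalityI subsetI)
        fix W assume W: "W \<in> P'"
        then have "W \<subseteq> of_vec ` carrier_vec n" using imv by (auto simp: P'_def dest: SubD(2))
        then obtain U where U: "U \<subseteq> carrier_vec n" "W = of_vec ` U" by (auto simp: subset_image_iff)
        then show "W \<in> image of_vec ` P" using key[OF U(1)] W by blast
      qed (use key P_vec in blast)
    qed
    show "of_vec ` U \<le> of_vec ` W \<longleftrightarrow> U \<le> W" if UW: "U \<in> P" "W \<in> P" for U W
      using inj_on_image_mem_iff[OF injv _ P_vec[OF UW(2)]] P_vec[OF UW(1)] by blast
  qed
  then have "reduced_euler_char P = - echar P'" using reduced_euler_char_eq[OF finP] by simp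
  then show ?thesis using A.chi_echar[OF A.S_Sub] by (simp add: P_def P'_def S_def h_def \<rho>_def)
qed

text \<open>Only representations of exponent \<open>E\<close>, the prime-to-\<open>p\<close> part of the exponent of the group,
  contribute.\<close>

lemma chi_sum_semisimple_part:
  fixes S :: "('i \<Rightarrow> 'a) set"
  assumes S: "hermitian_space q S h" and E: "E > 0"
    and dvd: "fact (card (isoms S h S h)) dvd CHAR('a) ^ a * E"
  shows "(\<Sum>\<rho>\<in>Reps (period_lattice R 0) S h. chi h (range \<rho>) S) = chi_sum (period_lattice R E) S h"
proof -
  interpret H: hermitian_space q S h by fact
  define F where "F = CHAR('a) ^ a * E"
  have F: "F > 0" using E prime_gt_0_nat[OF prime_char] by (simp add: F_def)
  define scale where "scale = (\<lambda>m (k :: nat \<Rightarrow> int) i. int m * k i)"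
  have pow: "\<rho> (scale m k) x = (\<rho> k ^^ m) x" if r: "\<rho> \<in> Reps (period_lattice R 0) S h" and x: "x \<in> S" for \<rho> m k x
  proof (induction m)
    case 0
    have "scale 0 k \<in> period_lattice R 0" by (simp add: scale_def period_lattice_def)
    then show ?case using RepsD(3)[OF r _ x] by simp
  next
    case (Suc m)
    have "scale (Suc m) k = k + scale m k" by (auto simp: scale_def fun_eq_iff plus_fun_apply algebra_simps)
    then show ?case using Suc RepsD(2)[OF r x] by simp
  qed
  have finI: "finite (isoms S h S h)" by (rule finite_isoms[OF H.finS H.finS])
  have exponent: "(f ^^ F) x = x" if f: "f \<in> isoms S h S h" and x: "x \<in> S" for f x
  proof -
    define N where "N = card (isoms S h S h)"
    define g where "g = (\<lambda>i. restrict (f ^^ i) S)"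
    have fS: "(f ^^ i) y \<in> S" if "y \<in> S" for i y by (induction i) (auto simp: that isomsD(1)[OF f])
    have g: "g i \<in> isoms S h S h" for i
    proof (induction i)
      case 0 show ?case by (rule isomsI) (auto simp: g_def)
    next
      case (Suc i)
      have "g (Suc i) = compose S f (g i)" by (auto simp: g_def compose_def fun_eq_iff)
      then show ?case using isoms_compose[OF Suc f H.subS] by simp
    qed
    \<comment> \<open>Two of the powers with exponents 0 to \<open>N\<close> agree, so
      \<open>f\<close> has a period of at most \<open>N\<close>; it divides \<open>fact N\<close>
      and therefore \<open>F\<close>.\<close>
    have "card (g ` {..N}) \<le> N" unfolding N_def using g finI by (intro card_mono) auto
    then have "\<not> inj_on g {..N}" using card_image[of g "{..N}"] by auto
    then obtain i j where ij: "i < j" "j \<le> N" "g i = g j"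
      unfolding inj_on_def by (metis atMost_iff linorder_neqE_nat)
    have d: "(f ^^ (j - i)) y = y" if y: "y \<in> S" for y
    proof -
      have "(f ^^ i) ((f ^^ (j - i)) y) = (f ^^ j) y" using ij by (simp flip: funpow_add[THEN fun_cong, unfolded o_def])
      also have "\<dots> = (f ^^ i) y" using fun_cong[OF ij(3), of y] y by (simp add: g_def)
      finally have "g i ((f ^^ (j - i)) y) = g i y" using fS y by (simp add: g_def)
      then show ?thesis
        using inj_onD[OF isoms_inj[OF S S g]] fS[OF y] y by blast
    qed
    have "j - i dvd fact N" using ij by (intro dvd_fact) auto
    then have "j - i dvd F" using dvd by (auto simp: F_def N_def)
    then obtain t where t: "F = (j - i) * t" by (rule dvdE)
    have "((f ^^ (j - i)) ^^ t) x = x" by (induction t) (simp_all add: d x)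
    then show ?thesis by (simp add: t funpow_mult mult.commute)
  qed
  have sub: "Reps (period_lattice R E) S h \<subseteq> Reps (period_lattice R 0) S h"
    by (auto simp: Reps_def period_lattice_def)
  have toF: "Reps (period_lattice R 0) S h \<subseteq> Reps (period_lattice R F) S h"
  proof
    fix \<rho> assume r: "\<rho> \<in> Reps (period_lattice R 0) S h"
    have "\<rho> k x = x" if k: "k \<in> period_lattice R F" and x: "x \<in> S" for k x
    proof -
      have "\<rho> k = \<rho> (scale F (\<lambda>i. k i div int F))"
        by (rule Reps_period[OF r]) (use k in \<open>auto simp: period_lattice_def scale_def minus_apply\<close>)
      then show ?thesis using pow[OF r x] exponent[OF RepsD(1)[OF r] x] by simp
    qed
    then show "\<rho> \<in> Reps (period_lattice R F) S h" using RepsD(1,2)[OF r] by (intro RepsI) auto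
  qed
  have "finite (Reps (period_lattice R F) S h)"
    by (rule periods.finite_Reps[OF periods_lattice[OF F] H.finS])
  then have fin: "finite (Reps (period_lattice R 0) S h)" using toF finite_subset by blast
  have "(\<Sum>\<rho>\<in>Reps (period_lattice R E) S h. chi h (range \<rho>) S) = (\<Sum>\<rho>\<in>Reps (period_lattice R 0) S h. chi h (range \<rho>) S)"
  proof (rule sum.mono_neutral_left[OF fin sub], rule ballI)
    fix \<rho> assume "\<rho> \<in> Reps (period_lattice R 0) S h - Reps (period_lattice R E) S h"
    then have r: "\<rho> \<in> Reps (period_lattice R 0) S h" and n: "\<rho> \<notin> Reps (period_lattice R E) S h" by auto
    \<comment> \<open>Some \<open>k\<close> divisible by \<open>E\<close> acts nontrivially, yet its
      multiple by the power of the characteristic lies in the lattice of \<open>F\<close> and acts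
      trivially: \<open>k\<close> acts unipotently.\<close>
    have "\<exists>k\<in>period_lattice R E. \<exists>x\<in>S. \<rho> k x \<noteq> x"
    proof (rule ccontr)
      assume "\<not> ?thesis"
      then have "\<rho> \<in> Reps (period_lattice R E) S h" using RepsD(1,2)[OF r] by (intro RepsI) auto
      then show False using n by simp
    qed
    then obtain k x where k: "k \<in> period_lattice R E" "x \<in> S" "\<rho> k x \<noteq> x" by blast
    show "chi h (range \<rho>) S = 0"
    proof (rule chi_eq_0_of_unipotent[OF S r, where k = k and a = a])
      fix y assume y: "y \<in> S"
      have "scale (CHAR('a) ^ a) k \<in> period_lattice R F" using k(1) by (auto simp: period_lattice_def scale_def F_def mult_dvd_mono)
      then show "(\<rho> k ^^ (CHAR('a) ^ a)) y = y"
        using RepsD(3)[OF subsetD[OF toF r] _ y] pow[OF r y, of "CHAR('a) ^ a" k] by simp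
    qed (use k in blast)
  qed
  then show ?thesis by (simp add: chi_sum_def)
qed

theorem equiv_reduced_euler_char_eq_mass:
  fixes c :: 'a
  assumes c: "c \<noteq> 0" "c ^ (q - 1) = (-1) ^ (n + 1)" and n: "n \<ge> 1" and E: "E > 0"
    and dvd: "fact (order_U n) dvd CHAR('a) ^ a * E"
  shows "equiv_reduced_euler_char R q c n = - mass (period_lattice R E) n"
proof -
  define S where "S = (std_space n :: (nat \<Rightarrow> 'a) set)"
  define h where "h = gu_form q c n"
  have H: "hermitian_space q S h" unfolding S_def h_def by (rule gu_hermitian[OF c n])
  have cS: "card S = (q\<^sup>2) ^ n" by (simp add: S_def card_std_space card_field)
  have "(\<Sum>Y\<in>Homs (Zpow R) (GU q c n). reduced_euler_char (invariant_subspaces (Y ` carrier (Zpow R)) (isotropic_subspaces q c n)))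
    = (\<Sum>Y\<in>Homs (Zpow R) (GU q c n). - chi h (range (\<lambda>k. op_mat n (Y (restrict k {..<R})))) S)"
    by (rule sum.cong[OF refl]) (simp add: reduced_euler_char_chi[OF c n] S_def h_def)
  also have "\<dots> = (\<Sum>\<rho>\<in>Reps (period_lattice R 0) S h. - chi h (range \<rho>) S)"
    unfolding S_def h_def by (rule sum.reindex_bij_betw[OF bij_Homs[OF c n]])
  also have "\<dots> = - chi_sum (period_lattice R E) S h"
    using chi_sum_semisimple_part[OF H E, of a R] dvd order_U_eq[OF H H cS cS] by (simp add: sum_negf)
  also have "chi_sum (period_lattice R E) S h = chi_sum (period_lattice R E) (std_space n :: (nat \<Rightarrow> 'a) set) (std_form q n)"
    by (rule chi_sum_cong[OF H std_hermitian]) (simp add: S_def)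
  finally have "(\<Sum>Y\<in>Homs (Zpow R) (GU q c n). reduced_euler_char (invariant_subspaces (Y ` carrier (Zpow R)) (isotropic_subspaces q c n)))
    = - chi_sum (period_lattice R E) (std_space n :: (nat \<Rightarrow> 'a) set) (std_form q n)" .
  then show ?thesis
    unfolding equiv_reduced_euler_char_def mass_def of_int_sum[symmetric] by (simp add: order_GU[OF c n])
qed

end

section \<open>Logarithmic derivatives of power series\<close>

no_notation vec_index (infixl \<open>$\<close> 100)

text \<open>The factor \<open>fps_X\<close> preserves degrees, so that coefficients are compared
  without an index shift.\<close>

definition log_deriv :: "'b::field_char_0 fps \<Rightarrow> 'b fps" where
  "log_deriv F = fps_X * fps_deriv F * inverse F"

lemma log_deriv_iff: "F $ 0 \<noteq> 0 \<Longrightarrow> log_deriv F = L \<longleftrightarrow> fps_X * fps_deriv F = F * L"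
  using inverse_mult_eq_1'[of F] inverse_mult_eq_1[of F] by (auto simp: log_deriv_def mult.left_commute)

lemma log_deriv_mult: "F $ 0 \<noteq> 0 \<Longrightarrow> G $ 0 \<noteq> 0 \<Longrightarrow> log_deriv (F * G) = log_deriv F + log_deriv G"
  using log_deriv_iff[of F "log_deriv F"] log_deriv_iff[of G "log_deriv G"] by (simp add: log_deriv_iff algebra_simps)

lemma log_deriv_1: "log_deriv 1 = 0"
  by (simp add: log_deriv_def)

lemma log_deriv_inverse: "F $ 0 \<noteq> 0 \<Longrightarrow> log_deriv (inverse F) = - log_deriv F"
  using log_deriv_mult[of F "inverse F"] by (simp add: inverse_mult_eq_1' log_deriv_1 eq_neg_iff_add_eq_0 add.commute)

lemma log_deriv_power: "F $ 0 \<noteq> 0 \<Longrightarrow> log_deriv (F ^ k) = of_nat k * log_deriv F"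
  by (induction k) (simp_all add: log_deriv_1 log_deriv_mult fps_nth_power_0 algebra_simps)

lemma log_deriv_power_int: "F $ 0 \<noteq> 0 \<Longrightarrow> log_deriv (F powi k) = of_int k * log_deriv F"
  by (auto simp: power_int_def log_deriv_power log_deriv_inverse)

lemma fps_prod_nth_0: "(\<Prod>i\<in>I. F i) $ 0 = (\<Prod>i\<in>I. F i $ 0 :: 'b::comm_ring_1)"
  by (induction I rule: infinite_finite_induct) auto

lemma log_deriv_prod:
  "(\<And>i. i \<in> I \<Longrightarrow> F i $ 0 \<noteq> 0) \<Longrightarrow> log_deriv (\<Prod>i\<in>I. F i) = (\<Sum>i\<in>I. log_deriv (F i))"
  by (induction I rule: infinite_finite_induct) (auto simp: log_deriv_1 log_deriv_mult fps_prod_nth_0)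

lemma log_deriv_linear:
  "log_deriv (1 + fps_const (a :: 'b::field_char_0) * fps_X) = Abs_fps (\<lambda>n. if n = 0 then 0 else - ((- a) ^ n))"
proof (subst log_deriv_iff)
  show "fps_X * fps_deriv (1 + fps_const a * fps_X)
    = (1 + fps_const a * fps_X) * Abs_fps (\<lambda>n. if n = 0 then 0 else - ((- a) ^ n))"
    (is "?l = ?r")
  proof (rule fps_ext)
    fix n show "?l $ n = ?r $ n"
      by (cases n) (auto simp: ring_distribs mult.assoc)
  qed
qed simp

lemma log_deriv_one_minus_power:
  assumes "k > 0"
  shows "log_deriv (1 - fps_X ^ k :: 'b::field_char_0 fps) = Abs_fps (\<lambda>n. if n > 0 \<and> k dvd n then - of_nat k else 0)"
proof (subst log_deriv_iff)
  show "fps_X * fps_deriv (1 - fps_X ^ k :: 'b fps) = (1 - fps_X ^ k) * Abs_fps (\<lambda>n. if n > 0 \<and> k dvd n then - of_nat k else 0)"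
    (is "?l = ?r")
  proof (rule fps_ext)
    fix n
    have l: "?l $ n = (if n = k then - of_nat k else 0)"
      using assms by (cases n) (auto simp: algebra_simps)
    have "k dvd n - k \<longleftrightarrow> k dvd n" if "n \<ge> k" using that by (simp add: dvd_minus_self)
    then show "?l $ n = ?r $ n"
      unfolding l using assms by (auto simp: left_diff_distrib fps_X_power_mult_nth dest: dvd_imp_le)
  qed
qed (use assms in simp)

lemma log_deriv_nth_0: "log_deriv F $ 0 = 0"
  by (simp add: log_deriv_def mult.assoc)

lemma log_deriv_recursion:
  assumes "F $ 0 \<noteq> 0"
  shows "of_nat n * F $ n = (\<Sum>i<n. F $ i * log_deriv F $ (n - i))"
proof -
  have "(fps_X * fps_deriv F) $ n = (\<Sum>i=0..n. F $ i * log_deriv F $ (n - i))"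
    using log_deriv_iff[OF assms, of "log_deriv F"] by (simp add: fps_mult_nth)
  also have "\<dots> = (\<Sum>i<n. F $ i * log_deriv F $ (n - i))"
    by (rule sum.mono_neutral_right) (auto simp: not_less log_deriv_nth_0)
  finally show ?thesis by (cases n) auto
qed

text \<open>By \<open>log_deriv_recursion\<close> the coefficients up to \<open>N\<close> depend
  only on the constant term and on the logarithmic derivative up to \<open>N\<close>. The comparison
  is truncated because a fixed \<open>E\<close> covers finitely many degrees only.\<close>

lemma fps_nth_eqI_log_deriv:
  assumes "F $ 0 = G $ 0" "F $ 0 \<noteq> 0" and L: "\<And>m. m \<le> N \<Longrightarrow> log_deriv F $ m = log_deriv G $ m"
  shows "n \<le> N \<Longrightarrow> F $ n = G $ n"
proof (induction n rule: less_induct)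
  case (less n)
  show ?case
  proof (cases "n = 0")
    case False
    have "of_nat n * F $ n = of_nat n * G $ n"
      using assms less by (simp add: log_deriv_recursion)
    then show ?thesis using False by simp
  qed (simp add: assms)
qed

text \<open>Substituting \<open>a\<close> times the variable commutes with the degree-preserving
  derivation.\<close>

lemma log_deriv_scale:
  assumes "F $ 0 \<noteq> 0"
  shows "log_deriv (Abs_fps (\<lambda>n. a ^ n * F $ n)) = Abs_fps (\<lambda>n. a ^ n * log_deriv F $ n)"
proof (subst log_deriv_iff)
  show "fps_X * fps_deriv (Abs_fps (\<lambda>n. a ^ n * F $ n))
    = Abs_fps (\<lambda>n. a ^ n * F $ n) * Abs_fps (\<lambda>n. a ^ n * log_deriv F $ n)" (is "?l = ?r")
  proof (rule fps_ext)
    fix n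
    have "?r $ n = a ^ n * (\<Sum>i=0..n. F $ i * log_deriv F $ (n - i))"
      by (auto simp: fps_mult_nth sum_distrib_left power_add[symmetric] mult_ac intro!: sum.cong)
    also have "(\<Sum>i=0..n. F $ i * log_deriv F $ (n - i)) = (fps_X * fps_deriv F) $ n"
      using log_deriv_iff[OF assms, of "log_deriv F"] by (simp add: fps_mult_nth)
    also have "a ^ n * \<dots> = ?l $ n" by (cases n) auto
    finally show "?l $ n = ?r $ n" ..
  qed
qed (use assms in simp)

text \<open>The factor at \<open>j\<close> contributes its exponent times a geometric sequence. The
  sum over \<open>j\<close> is the binomial expansion of one power, whose base
  \<open>q ^ n + (-1) ^ (n + 1)\<close> is |Q^n - 1|.\<close>

lemma log_deriv_signed_product:
  fixes q r :: nat
  defines "W \<equiv> (\<Prod>j\<in>{0..r}. (1 + fps_const ((-1) ^ (r - j) * of_nat q ^ j) * fps_X)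
      powi ((-1) ^ (r - j) * int (r choose j))) :: 'b::field_char_0 fps"
  shows "W $ 0 = 1" "n > 0 \<Longrightarrow> log_deriv W $ n = - ((- 1) ^ n * (of_nat q ^ n + (- 1) ^ (n + 1)) ^ r)"
proof -
  define F where "F j = (1 + fps_const ((-1) ^ (r - j) * of_nat q ^ j) * fps_X :: 'b fps)" for j
  have W: "W = (\<Prod>j\<in>{0..r}. F j powi ((-1) ^ (r - j) * int (r choose j)))" by (simp add: W_def F_def)
  have F0: "F j $ 0 = 1" for j by (simp add: F_def)
  have F0': "(F j powi k) $ 0 = 1" for j k by (auto simp: power_int_def F0 fps_nth_power_0)
  show "W $ 0 = 1" by (simp add: W fps_prod_nth_0 F0')
  assume n: "n > 0"
  have "log_deriv W $ n = (\<Sum>j=0..r. of_int ((-1) ^ (r - j) * int (r choose j)) * log_deriv (F j) $ n)"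
    by (simp add: W log_deriv_prod F0' log_deriv_power_int F0 fps_sum_nth fps_of_int[symmetric] del: of_int_mult of_int_power)
  also have "\<dots> = (\<Sum>j=0..r. - ((-1) ^ n * (of_nat (r choose j) * (of_nat q ^ n) ^ j * ((-1) ^ (n + 1)) ^ (r - j))))"
  proof (rule sum.cong[OF refl])
    fix j
    have e: "(- ((-1) ^ (r - j) * of_nat q ^ j :: 'b)) ^ n = (-1) ^ n * ((-1) ^ (r - j)) ^ n * (of_nat q ^ n) ^ j"
      by (simp add: power_minus[of "_ * _"] power_mult_distrib power_mult[symmetric] mult.commute)
    have "(-1 :: 'b) ^ (r - j) * ((-1) ^ (r - j)) ^ n = ((-1) ^ (n + 1)) ^ (r - j)"
      by (metis Suc_eq_plus1 mult.commute power_Suc power_mult)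
    then show "of_int ((-1) ^ (r - j) * int (r choose j)) * log_deriv (F j) $ n
      = - ((-1) ^ n * (of_nat (r choose j) * (of_nat q ^ n) ^ j * ((-1) ^ (n + 1)) ^ (r - j)))"
      using n by (simp add: F_def log_deriv_linear e del: power_Suc)
  qed
  also have "\<dots> = - ((-1) ^ n * (of_nat q ^ n + (-1) ^ (n + 1)) ^ r)"
    by (simp only: binomial_ring sum_negf sum_distrib_left[symmetric] atMost_atLeast0)
  finally show "log_deriv W $ n = - ((- 1) ^ n * (of_nat q ^ n + (- 1) ^ (n + 1)) ^ r)" .
qed

section \<open>The generating function\<close>

lemma (in torus) orbit_product_nth:
  fixes W :: "rat fps"
  assumes W0: "W $ 0 = 1"
    and W: "\<And>n. n > 0 \<Longrightarrow> log_deriv W $ n = - ((- 1) ^ n * (of_nat q ^ n + (- 1) ^ (n + 1)) ^ r)"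
    and R: "R = r + 1"
    and E: "\<And>d. 0 < d \<Longrightarrow> d \<le> N \<Longrightarrow> (if even d then q ^ d - 1 else q ^ d + 1) dvd E"
    and n: "n \<le> N"
  shows "(\<Prod>Y\<in>Orb. 1 - fps_X ^ card Y) $ n = (Abs_fps (\<lambda>n. (- of_nat q) ^ n * W $ n) * inverse W) $ n"
proof (rule fps_nth_eqI_log_deriv[OF _ _ _ n])
  have pos: "card Y > 0" if "Y \<in> Orb" for Y
    using that finite_Orb(2)[OF that] mem_orbit by (auto simp: card_gt_0_iff Orb_def)
  have nz: "(1 - fps_X ^ card Y :: rat fps) $ 0 = 1" if "Y \<in> Orb" for Y using pos[OF that] by simp
  show "(\<Prod>Y\<in>Orb. 1 - fps_X ^ card Y) $ 0 = (Abs_fps (\<lambda>n. (- rat_of_nat q) ^ n * W $ n) * inverse W) $ 0"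
    using W0 by (simp add: fps_prod_nth_0 pos)
  show "(\<Prod>Y\<in>Orb. 1 - fps_X ^ card Y :: rat fps) $ 0 \<noteq> 0" by (simp add: fps_prod_nth_0 pos)
  fix d assume d: "d \<le> N"
  show "log_deriv (\<Prod>Y\<in>Orb. 1 - fps_X ^ card Y) $ d
    = log_deriv (Abs_fps (\<lambda>n. (- rat_of_nat q) ^ n * W $ n) * inverse W) $ d"
  proof (cases "d = 0")
    case False
    define u where "u = (if even d then q ^ d - 1 else q ^ d + 1)"
    have q1: "q ^ d \<ge> 1" using q_ge_2 by simp
    have "log_deriv (\<Prod>Y\<in>Orb. 1 - fps_X ^ card Y :: rat fps) $ d = (\<Sum>Y\<in>Orb. if card Y dvd d then - of_nat (card Y) else 0)"
      using False by (subst log_deriv_prod) (auto simp: pos fps_sum_nth log_deriv_one_minus_power intro!: sum.cong)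
    also have "\<dots> = - of_nat (\<Sum>Y | Y \<in> Orb \<and> card Y dvd d. card Y)"
      using finite_Orb by (simp add: sum.inter_filter sum_negf[symmetric] if_distrib cong: if_cong)
    also have "\<dots> = - (of_nat u ^ (r + 1))"
      using sum_orbit_lengths[OF _ E] False d by (simp add: R u_def)
    also have "of_nat u = (of_nat q ^ d + (- 1) ^ (d + 1) :: rat)"
      using q1 by (simp add: u_def of_nat_diff)
    \<comment> \<open>The factor Q^d - 1 supplies one more copy of the base, up to the sign (-1)^d
      that the logarithmic derivative of \<open>W\<close> carries.\<close>
    also have "- ((of_nat q ^ d + (- 1) ^ (d + 1)) ^ (r + 1)) = (- of_nat q) ^ d * log_deriv W $ d - log_deriv W $ d"
      using False by (cases "even d") (simp_all add: W power_minus_odd algebra_simps)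
    also have "\<dots> = log_deriv (Abs_fps (\<lambda>n. (- of_nat q) ^ n * W $ n) * inverse W) $ d"
      using W0 by (simp add: log_deriv_mult log_deriv_inverse log_deriv_scale)
    finally show ?thesis .
  qed (simp add: log_deriv_nth_0)
qed

context quadratic_field
begin

text \<open>\<open>E\<close> is the part prime to the characteristic of one common multiple. The
  numbers \<open>q ^ d - 1\<close> and \<open>q ^ d + 1\<close> are prime to the characteristic and
  hence divide this part.\<close>

lemma exists_prime_to_char_exponent:
  obtains a E where "\<not> CHAR('a) dvd E" "\<And>m. m \<le> n \<Longrightarrow> fact (order_U m) dvd CHAR('a) ^ a * E"
    "\<And>d. 0 < d \<Longrightarrow> d \<le> n \<Longrightarrow> (if even d then q ^ d - 1 else q ^ d + 1) dvd E"
proof -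
  define u where "u d = (if even d then q ^ d - 1 else q ^ d + 1)" for d
  define H where "H = (\<Prod>m\<le>n. fact (order_U m)) * (\<Prod>d=1..n. u d)"
  have upos: "u d > 0" if "d > 0" for d
    using that q_ge_2 one_less_power[of q d] by (auto simp: u_def)
  have "H > 0" using upos by (auto simp: H_def intro!: prod_pos)
  then obtain E where E: "H = CHAR('a) ^ multiplicity CHAR('a) H * E" "\<not> CHAR('a) dvd E"
    using multiplicity_decompose'[of H "CHAR('a)"] prime_char by (metis not_prime_unit not_less_zero)
  show thesis
  proof (rule that[of E "multiplicity CHAR('a) H"])
    show "\<not> CHAR('a) dvd E" by fact
    show "fact (order_U m) dvd CHAR('a) ^ multiplicity CHAR('a) H * E" if "m \<le> n" for m
      using that dvd_prodI[of "{..n}" m "\<lambda>m. fact (order_U m) :: nat"]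
      unfolding E(1)[symmetric] by (simp add: H_def)
    show "(if even d then q ^ d - 1 else q ^ d + 1) dvd E" if d: "0 < d" "d \<le> n" for d
    proof -
      have "u d dvd CHAR('a) ^ multiplicity CHAR('a) H * E"
        using d dvd_prodI[of "{1..n}" d u] unfolding E(1)[symmetric] by (simp add: H_def)
      moreover have "coprime (u d) CHAR('a)"
      proof -
        obtain e where e: "e > 0" "q = CHAR('a) ^ e" using q_char by blast
        have "CHAR('a) dvd q ^ d" using e d by (metis dvd_power dvd_trans prime_char power_mult nat_0_less_mult_iff)
        moreover have "q ^ d > 0" using q_ge_2 by simp
        then have "q ^ d = u d + 1 \<or> u d = q ^ d + 1" by (auto simp: u_def)
        ultimately have "CHAR('a) dvd 1" if "CHAR('a) dvd u d"
          using that dvd_add_right_iff[of "CHAR('a)" "u d" 1] dvd_add_right_iff[of "CHAR('a)" "q ^ d" 1] by auto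
        then have "\<not> CHAR('a) dvd u d" using prime_char not_prime_unit by blast
        then show ?thesis using prime_imp_coprime[OF prime_char] by (metis coprime_commute)
      qed
      ultimately show ?thesis by (simp add: u_def coprime_dvd_mult_right_iff)
    qed
  qed
qed

lemma std_space_0: "std_space 0 = ({0} :: (nat \<Rightarrow> 'a) set)"
  by (auto simp: std_space_def fun_eq_iff zero_fun_apply)

lemma mass_0: "mass P 0 = 1"
proof -
  define \<iota> :: "(nat \<Rightarrow> 'a) \<Rightarrow> (nat \<Rightarrow> 'a)" where "\<iota> = restrict (\<lambda>_. 0) {0}"
  have i0: "\<iota> 0 = 0" by (simp add: \<iota>_def)
  have s0: "smul a (0 :: nat \<Rightarrow> 'a) = 0" for a by (simp add: smul_apply fun_eq_iff zero_fun_apply)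
  have isom0: "isoms {0} (std_form q 0) {0} (std_form q 0) = {\<iota>}"
  proof (intro equalityI subsetI)
    fix f assume "f \<in> isoms {0::nat \<Rightarrow> 'a} (std_form q 0) {0::nat \<Rightarrow> 'a} (std_form q 0)"
    then have "f \<in> {0} \<rightarrow>\<^sub>E {0}" by (rule isomsD(6))
    then show "f \<in> {\<iota>}" by (auto simp: \<iota>_def fun_eq_iff PiE_def extensional_def)
  next
    fix f assume "f \<in> {\<iota>}"
    then show "f \<in> isoms {0} (std_form q 0) {0} (std_form q 0)"
      by (intro isomsI) (auto simp: i0 s0 std_form_def \<iota>_def)
  qed
  have "Reps P {0} (std_form q 0) = {\<lambda>_. \<iota>}"
    unfolding Reps_def isom0 by (auto simp: i0)
  moreover have "{U \<in> Sub (range (\<lambda>_::'b. \<iota>)) {0}. isotropic (std_form q 0) U} = {{0}}"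
    by (auto simp: i0 s0 Sub_def isotropic_def std_form_def subsp_def)
  ultimately have "chi_sum P ({0} :: (nat \<Rightarrow> 'a) set) (std_form q 0) = 1"
    by (simp add: chi_sum_def chi_def)
  then show ?thesis by (simp add: mass_def order_U_def std_space_0 isom0)
qed

text \<open>The exponent \<open>E\<close> depends on the degree, so each degree has its recursion
  from a different finite group. The series \<open>T\<close> is independent of \<open>E\<close>, and
  strong induction links the degrees.\<close>

theorem FGL_product:
  fixes c :: "nat \<Rightarrow> 'a"
  assumes c: "\<And>n. n \<ge> 1 \<Longrightarrow> c n \<noteq> 0 \<and> c n ^ (q - 1) = (-1) ^ (n + 1)"
  shows "FGL (r + 1) q c = (\<Prod>j\<in>{0..r}. (1 + fps_const ((-1) ^ (r - j) * of_nat q ^ j) * fps_X)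
       powi ((-1) ^ (r - j) * int (r choose j)))"
    (is "_ = ?W")
proof (rule fps_ext)
  define W where "W = ?W"
  have W0: "W $ 0 = 1" and WL: "\<And>n. n > 0 \<Longrightarrow> log_deriv W $ n = - ((- 1) ^ n * (of_nat q ^ n + (- 1) ^ (n + 1)) ^ r)"
    unfolding W_def by (rule log_deriv_signed_product)+
  define T where "T = Abs_fps (\<lambda>n. (- of_nat q) ^ n * W $ n) * inverse W"
  have T0: "T $ 0 = 1" using W0 by (simp add: T_def)
  have TW: "(- of_nat q) ^ n * W $ n = (\<Sum>m=0..n. T $ m * W $ (n - m))" for n
  proof -
    have "T * W = Abs_fps (\<lambda>n. (- of_nat q) ^ n * W $ n)"
      using W0 inverse_mult_eq_1[of W] by (simp add: T_def mult.assoc)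
    then show ?thesis by (metis fps_mult_nth fps_nth_Abs_fps)
  qed
  fix n show "FGL (r + 1) q c $ n = ?W $ n" unfolding W_def[symmetric]
  proof (induction n rule: less_induct)
    case (less n)
    obtain a E where aE: "\<not> CHAR('a) dvd E" "\<And>m. m \<le> n \<Longrightarrow> fact (order_U m) dvd CHAR('a) ^ a * E"
      "\<And>d. 0 < d \<Longrightarrow> d \<le> n \<Longrightarrow> (if even d then q ^ d - 1 else q ^ d + 1) dvd E"
      using exists_prime_to_char_exponent[of n] by metis
    interpret torus q ty "r + 1" E by unfold_locales (rule aE)
    define b where "b = mass (period_lattice (r + 1) E)"
    \<comment> \<open>The same \<open>E\<close> serves all dimensions up to \<open>n\<close>, so in
      these degrees its masses are the coefficients sought.\<close>
    have b: "FGL (r + 1) q c $ m = b m" if "m \<le> n" for m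
    proof (cases "m = 0")
      case False
      then show ?thesis
        using equiv_reduced_euler_char_eq_mass[OF _ _ _ E_pos aE(2)[OF that], of "c m" "r + 1"] c[of m]
        by (simp add: FGL_def b_def)
    qed (simp add: FGL_def b_def mass_0)
    define L where "L = Lam (period_lattice (r + 1) E)"
    define rk where "rk = rank (box (r + 1) E)"
    have fin: "finite L" unfolding L_def by (rule finite_Lam[OF periods_lattice[OF E_pos]])
    have "(- of_nat q) ^ n * b n = (\<Sum>lam | lam \<in> L \<and> rk lam \<le> n. wt (lam 0) * b (n - rk lam))"
      unfolding b_def L_def rk_def by (rule mass_recursion[OF periods_lattice[OF E_pos]])
    also have "\<dots> = (\<Sum>lam\<in>L. \<Sum>m=0..n. (if m = rk lam then wt (lam 0) * b (n - m) else 0))"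
      using fin by (simp add: sum.delta sum.inter_filter)
    also have "\<dots> = (\<Sum>m=0..n. (\<Sum>lam\<in>L. if m = rk lam then wt (lam 0) else 0) * b (n - m))"
      by (subst sum.swap) (auto simp: sum_distrib_right intro!: sum.cong)
    also have "\<dots> = (\<Sum>m=0..n. T $ m * b (n - m))"
    proof (rule sum.cong[OF refl])
      fix m assume "m \<in> {0..n}"
      then have "T $ m = (\<Prod>Y\<in>Orb. 1 - fps_X ^ card Y) $ m"
        unfolding T_def using orbit_product_nth[OF W0 WL refl aE(3), of n m] by simp
      also have "\<dots> = (\<Sum>lam\<in>L. if m = rk lam then wt (lam 0) else 0)"
        unfolding rank_generating_function[symmetric]
        by (simp add: fps_sum_nth L_def rk_def if_distrib cong: if_cong)
      finally show "(\<Sum>lam\<in>L. if m = rk lam then wt (lam 0) else 0) * b (n - m) = T $ m * b (n - m)" by simp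
    qed
    finally have bT: "(- of_nat q) ^ n * b n = (\<Sum>m=0..n. T $ m * b (n - m))" .
    show ?case
    proof (cases "n = 0")
      case False
      \<comment> \<open>The two recursions are subtracted. By induction only the term of
        \<open>T $ 0 = 1\<close> remains, which leaves the factor Q^n - 1.\<close>
      have "(- of_nat q) ^ n * (b n - W $ n) = (\<Sum>m=0..n. T $ m * (b (n - m) - W $ (n - m)))"
        using bT TW[of n] by (simp add: right_diff_distrib sum_subtractf)
      also have "\<dots> = (\<Sum>m\<in>{0}. T $ m * (b (n - m) - W $ (n - m)))"
      proof (rule sum.mono_neutral_right)
        show "\<forall>m\<in>{0..n} - {0}. T $ m * (b (n - m) - W $ (n - m)) = 0"
        proof
          fix m assume "m \<in> {0..n} - {0}"
          then have "n - m < n" using False by auto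
          then show "T $ m * (b (n - m) - W $ (n - m)) = 0" using less.IH[of "n - m"] b[of "n - m"] by simp
        qed
      qed auto
      finally have "((- of_nat q) ^ n - 1) * (b n - W $ n) = 0" by (simp add: T0 algebra_simps)
      moreover have "(- of_nat q :: rat) ^ n \<noteq> 1"
      proof
        assume "(- of_nat q :: rat) ^ n = 1"
        then have "\<bar>- of_nat q :: rat\<bar> ^ n = 1" by (metis abs_one power_abs)
        then have "q ^ n = 1" by (simp flip: of_nat_power)
        then show False using q_ge_2 False by simp
      qed
      ultimately show ?thesis using b[of n] by simp
    qed (simp add: W0 FGL_def)
  qed
qed

end

theorem theorem1p4:
  fixes q r :: nat and c :: "nat \<Rightarrow> 'a::{field,finite}"
  assumes "primepow q"
    and "CARD('a) = q\<^sup>2"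
    and "\<And>n. n \<ge> 1 \<Longrightarrow> c n \<noteq> 0 \<and> c n ^ (q - 1) = (-1) ^ (n + 1)"
  shows "FGL (r + 1) q c =
    (\<Prod>j\<in>{0..r}. (1 + fps_const ((-1) ^ (r - j) * of_nat q ^ j) * fps_X)
       powi ((-1) ^ (r - j) * int (r choose j)))"
proof -
  interpret quadratic_field q "TYPE('a)" by unfold_locales (fact assms(1,2))+
  show ?thesis by (rule FGL_product[OF assms(3)])
qed

end
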